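(* Let $F$ be a field of characteristic not $2$ or $3$, let $\phi\colon A\to A'$ be a $3$-isogeny of abelian varieties over $F$, and let $\hat D\in F^*$ be such that $K=F[t]/(t^2-\hat D)$ is the mirror algebra of $A[\phi]$. Then there is a natural bijection between $H^1(G_F,A[\phi])$ and the set of $\mathrm{SL}_2(F)$-orbits on $V(F)_{4\hat D}$ (the bijection described in the context). Moreover, the stabilizer in $\mathrm{SL}_2(F)$ of any $f\in V(F)_{4\hat D}$ is isomorphic to $A[\phi](F)$.
   Context: $G_F$ is the absolute Galois group of $F$; a $3$-isogeny is an isogeny of degree $3$; $A[\phi]=\ker\phi$. Binary cubic forms: $V(F)$ is the space of forms $f(x,y)=ax^3+3bx^2y+3cxy^2+dy^3$ with $a,b,c,d\in F$, with $\mathrm{SL}_2(F)$ acting by linear change of variables; $\mathrm{Disc}(f)=a^2d^2-3b^2c^2+4ac^3+4b^3d-6abcd$, and $V(F)_\Delta=\{f\in V(F):\mathrm{Disc}(f)=\Delta\}$. Mirror algebra: the $G_F$-action on $A[\phi](\bar F)$ (a group of order $3$) is through a quadratic character; let $K_0=F[t]/(t^2-D)$ be the corresponding étale quadratic $F$-algebra ($K_0=F\times F$ if the action is trivial). The mirror algebra of $A[\phi]$ is $F[t]/(t^2-\hat D)$ with $\hat D=-3D$, where $\hat D$ is determined up to squares in $F^*$. The bijection: there is an isomorphism $A[\phi]\simeq\ker(\mathrm{Nm}\colon\mathrm{Res}^K_F\mu_3\to\mu_3)$ of group schemes, inducing $H^1(G_F,A[\phi])\simeq(K^*/K^{*3})_{N=1}:=\ker(N\colon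 K^*/K^{*3}\to F^*/F^{*3})$. Every class in $(K^*/K^{*3})_{N=1}$ has a representative $\delta\in K^*$ with $N(\delta)=1$, and the class is sent to the $\mathrm{SL}_2(F)$-orbit of $f(x,y)=\frac1{2\hat D}\mathrm{Tr}_{K/F}\left(\delta\tau(x+\tau y)^3\right)\in V(F)_{4\hat D}$, where $\tau$ is the image of $t$ in $K$. *)

theory Defs
  imports
    "HOL-Analysis.Analysis"
    "HOL-Algebra.Group_Action"
    "HOL-Algebra.Algebraic_Closure_Type"
begin

no_notation fps_nth (infixl \<open>$\<close> 75)

section \<open>The absolute Galois group and its continuous cohomology\<close>

definition base_field :: "'a::field alg_closure set" where
  "base_field = range to_ac"

text \<open>Restriction identifies the automorphism group of an algebraic closure with that of the
  separable closure, so the following is the absolute Galois group also for imperfect fields.\<close>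

definition abs_gal :: "('a::field alg_closure \<Rightarrow> 'a alg_closure) set" where
  "abs_gal = {\<sigma>. bij \<sigma> \<and> (\<forall>x y. \<sigma> (x + y) = \<sigma> x + \<sigma> y) \<and> (\<forall>x y. \<sigma> (x * y) = \<sigma> x * \<sigma> y)
     \<and> (\<forall>a. \<sigma> (to_ac a) = to_ac a)}"

definition krull_topology :: "('a::field alg_closure \<Rightarrow> 'a alg_closure) topology" where
  "krull_topology = subtopology (product_topology (\<lambda>_. discrete_topology UNIV) UNIV) abs_gal"

text \<open>In the next three definitions \<open>M\<close> is a discrete Galois module, written
  multiplicatively, and \<open>act\<close> is the action of the Galois group on it.\<close>

definition cocycles ::
  "'m monoid \<Rightarrow> (('a::field alg_closure \<Rightarrow> 'a alg_closure) \<Rightarrow> 'm \<Rightarrow> 'm)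
    \<Rightarrow> (('a alg_closure \<Rightarrow> 'a alg_closure) \<Rightarrow> 'm) monoid" where
  "cocycles M act =
    \<lparr>carrier = {c \<in> abs_gal \<rightarrow>\<^sub>E carrier M.
        continuous_map krull_topology (discrete_topology (carrier M)) c \<and>
        (\<forall>\<sigma>\<in>abs_gal. \<forall>\<tau>\<in>abs_gal. c (\<sigma> \<circ> \<tau>) = c \<sigma> \<otimes>\<^bsub>M\<^esub> act \<sigma> (c \<tau>))},
     mult = (\<lambda>c c'. \<lambda>\<sigma>\<in>abs_gal. c \<sigma> \<otimes>\<^bsub>M\<^esub> c' \<sigma>),
     one = (\<lambda>\<sigma>\<in>abs_gal. \<one>\<^bsub>M\<^esub>)\<rparr>"

definition coboundaries ::
  "'m monoid \<Rightarrow> (('a::field alg_closure \<Rightarrow> 'a alg_closure) \<Rightarrow> 'm \<Rightarrow> 'm)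
    \<Rightarrow> (('a alg_closure \<Rightarrow> 'a alg_closure) \<Rightarrow> 'm) set" where
  "coboundaries M act = {(\<lambda>\<sigma>\<in>abs_gal. act \<sigma> m \<otimes>\<^bsub>M\<^esub> inv\<^bsub>M\<^esub> m) | m. m \<in> carrier M}"

definition H1 ::
  "'m monoid \<Rightarrow> (('a::field alg_closure \<Rightarrow> 'a alg_closure) \<Rightarrow> 'm \<Rightarrow> 'm)
    \<Rightarrow> (('a alg_closure \<Rightarrow> 'a alg_closure) \<Rightarrow> 'm) set monoid" where
  "H1 M act = cocycles M act Mod coboundaries M act"


section \<open>Projective varieties\<close>

text \<open>A point of projective space over \<open>'k\<close> is a line without its origin, and a variety is its
  set of points over an algebraically closed field.\<close>

type_synonym ('k, 'n) point = "('k ^ 'n) set"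

definition proj :: "'k::field ^ 'n::finite \<Rightarrow> ('k, 'n) point" where
  "proj x = {c *s x | c. c \<noteq> 0}"

text \<open>Homogeneous polynomials of degree \<open>d\<close> with coefficients in \<open>R\<close>, as functions. Over an
  infinite field a polynomial is determined by its function.\<close>

definition forms :: "'k::field set \<Rightarrow> nat \<Rightarrow> ('k ^ 'n::finite \<Rightarrow> 'k) set" where
  "forms R d = {(\<lambda>x. \<Sum>m | sum m UNIV = d. c m * (\<Prod>i\<in>UNIV. (x $ i) ^ m i)) | c :: ('n \<Rightarrow> nat) \<Rightarrow> 'k.
     range c \<subseteq> R}"

definition vanishes_on :: "('k::field ^ 'n::finite \<Rightarrow> 'k) \<Rightarrow> ('k, 'n) point set \<Rightarrow> bool" where
  "vanishes_on g V \<longleftrightarrow> (\<forall>x. x \<noteq> 0 \<and> proj x \<in> V \<longrightarrow> g x = 0)"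

definition zariski_closed :: "('k::field, 'n::finite) point set \<Rightarrow> bool" where
  "zariski_closed V \<longleftrightarrow>
     (\<exists>S \<subseteq> (\<Union>d. forms UNIV d). V = {proj x | x. x \<noteq> 0 \<and> (\<forall>g\<in>S. g x = 0)})"

definition zariski_irreducible :: "('k::field, 'n::finite) point set \<Rightarrow> bool" where
  "zariski_irreducible V \<longleftrightarrow> V \<noteq> {} \<and>
     (\<forall>W Z. zariski_closed W \<and> zariski_closed Z \<and> V \<subseteq> W \<union> Z \<longrightarrow> V \<subseteq> W \<or> V \<subseteq> Z)"

text \<open>Geometrically integral projective varieties over a subfield \<open>R\<close>: the homogeneous ideal of
  \<open>V\<close> has to be generated by forms over \<open>R\<close>. For imperfect \<open>R\<close> this is stronger than asking \<open>V\<close>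
  to be the zero locus of such forms.\<close>

definition projective_variety :: "'k::field set \<Rightarrow> ('k, 'n::finite) point set \<Rightarrow> bool" where
  "projective_variety R V \<longleftrightarrow> zariski_closed V \<and> zariski_irreducible V \<and>
     (\<forall>d. \<forall>g \<in> forms UNIV d. vanishes_on g V \<longrightarrow>
        (\<exists>T c. finite T \<and> T \<subseteq> {h \<in> forms R d. vanishes_on h V} \<and> g = (\<lambda>x. \<Sum>h\<in>T. c h * h x)))"

text \<open>Morphisms are given near every point by forms of equal degree over \<open>R\<close>. Shrinking the domain
  of such a local presentation to the nonvanishing locus of a form \<open>h\<close> amounts to multiplying all
  the \<open>G j\<close> by \<open>h\<close>.\<close>

definition morphism_over ::
  "'k::field set \<Rightarrow> ('k, 'n::finite) point set \<Rightarrow> ('k, 'm::finite) point set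
    \<Rightarrow> (('k, 'n) point \<Rightarrow> ('k, 'm) point) \<Rightarrow> bool" where
  "morphism_over R V W f \<longleftrightarrow> f \<in> V \<rightarrow> W \<and>
     (\<forall>P\<in>V. \<exists>d. \<exists>G :: 'm \<Rightarrow> 'k ^ 'n \<Rightarrow> 'k. (\<forall>j. G j \<in> forms R d) \<and>
        (\<exists>x. x \<noteq> 0 \<and> proj x = P \<and> (\<exists>j. G j x \<noteq> 0)) \<and>
        (\<forall>x. x \<noteq> 0 \<and> proj x \<in> V \<and> (\<exists>j. G j x \<noteq> 0) \<longrightarrow> f (proj x) = proj (\<chi> j. G j x)))"

definition rational_point :: "'k::field set \<Rightarrow> ('k, 'n::finite) point \<Rightarrow> bool" where
  "rational_point R P \<longleftrightarrow> (\<exists>x. x \<noteq> 0 \<and> (\<forall>i. x $ i \<in> R) \<and> P = proj x)"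

definition segre :: "'k::field ^ 'n::finite \<Rightarrow> 'k ^ 'm::finite \<Rightarrow> 'k ^ ('n \<times> 'm)" where
  "segre x y = (\<chi> i. x $ fst i * y $ snd i)"

definition product_variety ::
  "('k::field, 'n::finite) point set \<Rightarrow> ('k, 'm::finite) point set \<Rightarrow> ('k, 'n \<times> 'm) point set" where
  "product_variety V W =
     {proj (segre x y) | x y. x \<noteq> 0 \<and> y \<noteq> 0 \<and> proj x \<in> V \<and> proj y \<in> W}"


section \<open>Function fields\<close>

text \<open>A rational function on \<open>V\<close> is the class of a function that is a quotient of two forms of
  equal degree on a nonempty open subset, modulo functions vanishing on a nonempty open subset.
  The values of a representative elsewhere are irrelevant.\<close>

definition rational_representatives ::
  "('k::field, 'n::finite) point set \<Rightarrow> (('k, 'n) point \<Rightarrow> 'k) ring" where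
  "rational_representatives V =
    \<lparr>carrier = {f. \<exists>d. \<exists>g \<in> forms UNIV d. \<exists>h \<in> forms UNIV d. \<not> vanishes_on h V \<and>
        (\<forall>x. x \<noteq> 0 \<and> proj x \<in> V \<and> h x \<noteq> 0 \<longrightarrow> f (proj x) = g x / h x)},
     mult = (\<lambda>f f' P. f P * f' P), one = (\<lambda>P. 1), zero = (\<lambda>P. 0), add = (\<lambda>f f' P. f P + f' P)\<rparr>"

definition generically_zero ::
  "('k::field, 'n::finite) point set \<Rightarrow> (('k, 'n) point \<Rightarrow> 'k) set" where
  "generically_zero V = {f \<in> carrier (rational_representatives V).
     \<exists>d. \<exists>h \<in> forms UNIV d. \<not> vanishes_on h V \<and>
       (\<forall>x. x \<noteq> 0 \<and> proj x \<in> V \<and> h x \<noteq> 0 \<longrightarrow> f (proj x) = 0)}"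

definition function_field ::
  "('k::field, 'n::finite) point set \<Rightarrow> (('k, 'n) point \<Rightarrow> 'k) set ring" where
  "function_field V = rational_representatives V Quot generically_zero V"

definition pullback_field ::
  "('k::field, 'n::finite) point set \<Rightarrow> ('k, 'm::finite) point set
    \<Rightarrow> (('k, 'n) point \<Rightarrow> ('k, 'm) point) \<Rightarrow> (('k, 'n) point \<Rightarrow> 'k) set set" where
  "pullback_field V W \<phi> =
     {generically_zero V +>\<^bsub>rational_representatives V\<^esub> (\<lambda>P. f (\<phi> P)) | f.
        f \<in> carrier (rational_representatives W)}"


section \<open>Abelian varieties and isogenies\<close>

text \<open>Abelian varieties over \<open>'a\<close> with a projective embedding, as the group of points over the
  algebraic closure.\<close>

definition abelian_variety :: "('a::field alg_closure, 'n::finite) point monoid \<Rightarrow> bool" where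
  "abelian_variety A \<longleftrightarrow> comm_group A \<and> projective_variety base_field (carrier A) \<and>
     rational_point base_field \<one>\<^bsub>A\<^esub> \<and>
     morphism_over base_field (carrier A) (carrier A) (\<lambda>P. inv\<^bsub>A\<^esub> P) \<and>
     (\<exists>\<mu>. morphism_over base_field (product_variety (carrier A) (carrier A)) (carrier A) \<mu> \<and>
        (\<forall>x y. x \<noteq> 0 \<and> y \<noteq> 0 \<and> proj x \<in> carrier A \<and> proj y \<in> carrier A \<longrightarrow>
           \<mu> (proj (segre x y)) = proj x \<otimes>\<^bsub>A\<^esub> proj y))"

definition isogeny ::
  "('a::field alg_closure, 'n::finite) point monoid \<Rightarrow> ('a alg_closure, 'm::finite) point monoid
    \<Rightarrow> (('a alg_closure, 'n) point \<Rightarrow> ('a alg_closure, 'm) point) \<Rightarrow> bool" where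
  "isogeny A A' \<phi> \<longleftrightarrow> abelian_variety A \<and> abelian_variety A' \<and>
     morphism_over base_field (carrier A) (carrier A') \<phi> \<and> \<phi> \<in> hom A A' \<and>
     \<phi> ` carrier A = carrier A' \<and> finite (kernel A A' \<phi>)"

text \<open>The degree is that of the extension of function fields. It is computed over the algebraic
  closure, which does not change it because the varieties are geometrically integral.\<close>

definition isogeny_of_degree ::
  "nat \<Rightarrow> ('a::field alg_closure, 'n::finite) point monoid
    \<Rightarrow> ('a alg_closure, 'm::finite) point monoid
    \<Rightarrow> (('a alg_closure, 'n) point \<Rightarrow> ('a alg_closure, 'm) point) \<Rightarrow> bool" where
  "isogeny_of_degree n A A' \<phi> \<longleftrightarrow> isogeny A A' \<phi> \<and>
     ring.dimension (function_field (carrier A)) n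
       (pullback_field (carrier A) (carrier A') \<phi>) (carrier (function_field (carrier A)))"

definition kernel_group ::
  "('p, 'e) monoid_scheme \<Rightarrow> ('q, 'f) monoid_scheme \<Rightarrow> ('p \<Rightarrow> 'q) \<Rightarrow> ('p, 'e) monoid_scheme" where
  "kernel_group A A' \<phi> = A\<lparr>carrier := kernel A A' \<phi>\<rparr>"

definition gal_point ::
  "('k::field \<Rightarrow> 'k) \<Rightarrow> ('k, 'n::finite) point \<Rightarrow> ('k, 'n) point" where
  "gal_point \<sigma> P = (\<lambda>x. \<chi> i. \<sigma> (x $ i)) ` P"

text \<open>The rational points of the finite etale group scheme with Galois module \<open>M\<close>.\<close>

definition gal_invariants ::
  "('a::field alg_closure, 'n::finite) point monoid \<Rightarrow> ('a alg_closure, 'n) point monoid" where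
  "gal_invariants M = M\<lparr>carrier := {P \<in> carrier M. \<forall>\<sigma>\<in>abs_gal. gal_point \<sigma> P = P}\<rparr>"


section \<open>Quadratic algebras\<close>

text \<open>\<open>quad_alg D\<close> is the algebra \<open>k[t]/(t\<^sup>2 - D)\<close> in the basis \<open>1, \<tau>\<close>, where \<open>\<tau>\<close> is the image of
  \<open>t\<close>: the pair \<open>(u, v)\<close> stands for \<open>u + v \<tau>\<close>.\<close>

definition quad_alg :: "'k::field \<Rightarrow> ('k \<times> 'k) ring" where
  "quad_alg D =
    \<lparr>carrier = UNIV,
     mult = (\<lambda>z w. (fst z * fst w + D * snd z * snd w, fst z * snd w + snd z * fst w)),
     one = (1, 0), zero = (0, 0), add = (\<lambda>z w. (fst z + fst w, snd z + snd w))\<rparr>"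

abbreviation quad_tau :: "'k::field \<times> 'k" where
  "quad_tau \<equiv> (0, 1)"

definition quad_norm :: "'k::field \<Rightarrow> 'k \<times> 'k \<Rightarrow> 'k" where
  "quad_norm D z = (fst z)\<^sup>2 - D * (snd z)\<^sup>2"

definition quad_trace :: "'k::field \<times> 'k \<Rightarrow> 'k" where
  "quad_trace z = 2 * fst z"

lemma quad_alg_cring: "cring (quad_alg D)"
proof (rule cringI)
  show "abelian_group (quad_alg D)"
    by (rule abelian_groupI)
      (auto simp: quad_alg_def algebra_simps prod_eq_iff intro!: exI[of _ "- _"])
  show "comm_monoid (quad_alg D)"
    by (rule comm_monoidI) (auto simp: quad_alg_def algebra_simps)
qed (auto simp: quad_alg_def algebra_simps)

lemma quad_tau_square: "quad_tau \<otimes>\<^bsub>quad_alg D\<^esub> quad_tau = (D, 0)"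
  by (simp add: quad_alg_def)

text \<open>\<open>cube_classes D\<close> is \<open>K\<^sup>*/K\<^sup>*\<^sup>3\<close> for \<open>K = k[t]/(t\<^sup>2 - D)\<close>, and \<open>norm_one_classes D\<close> is the kernel of
  the norm from it to the cube classes of the base field.\<close>

definition cube_classes :: "'k::field \<Rightarrow> ('k \<times> 'k) set monoid" where
  "cube_classes D = units_of (quad_alg D) Mod
     {z [^]\<^bsub>quad_alg D\<^esub> (3::nat) | z. z \<in> Units (quad_alg D)}"

definition norm_one_classes :: "'k::field \<Rightarrow> ('k \<times> 'k) set monoid" where
  "norm_one_classes D = (cube_classes D)\<lparr>carrier :=
     {C \<in> carrier (cube_classes D). \<forall>z\<in>C. \<exists>u. u \<noteq> 0 \<and> quad_norm D z = u ^ 3}\<rparr>"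

text \<open>The kernel of the norm from the restriction of scalars of \<open>\<mu>\<^sub>3\<close> to \<open>\<mu>\<^sub>3\<close>, as the Galois module
  of its points over the algebraic closure; these lie in \<open>K \<otimes> 'a alg_closure\<close>, which is
  \<open>quad_alg (to_ac D)\<close>, and the Galois group acts on the second factor.\<close>

definition norm_one_mu3 :: "'a::field \<Rightarrow> ('a alg_closure \<times> 'a alg_closure) monoid" where
  "norm_one_mu3 D = (units_of (quad_alg (to_ac D)))\<lparr>carrier :=
     {z \<in> Units (quad_alg (to_ac D)).
        z [^]\<^bsub>quad_alg (to_ac D)\<^esub> (3::nat) = \<one>\<^bsub>quad_alg (to_ac D)\<^esub> \<and>
        quad_norm (to_ac D) z = 1}\<rparr>"

definition gal_quad :: "('k \<Rightarrow> 'k) \<Rightarrow> 'k \<times> 'k \<Rightarrow> 'k \<times> 'k" where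
  "gal_quad \<sigma> z = (\<sigma> (fst z), \<sigma> (snd z))"


section \<open>The mirror algebra\<close>

text \<open>The Galois action on \<open>M\<close> is through \<open>\<plusminus>1\<close>, by the quadratic character of
  \<open>F[t]/(t\<^sup>2 - D)\<close>; the action is trivial iff \<open>D\<close> is a square.\<close>

definition quadratic_action_by ::
  "('a::field alg_closure, 'n::finite) point monoid \<Rightarrow> 'a \<Rightarrow> bool" where
  "quadratic_action_by M D \<longleftrightarrow> D \<noteq> 0 \<and>
     (\<forall>\<sigma>\<in>abs_gal. \<forall>P\<in>carrier M. \<forall>d. d\<^sup>2 = to_ac D \<longrightarrow>
        gal_point \<sigma> P = (if \<sigma> d = d then P else inv\<^bsub>M\<^esub> P))"

definition mirror_algebra ::
  "('a::field alg_closure, 'n::finite) point monoid \<Rightarrow> 'a \<Rightarrow> bool" where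
  "mirror_algebra M Dhat \<longleftrightarrow>
     (\<exists>D s. quadratic_action_by M D \<and> s \<noteq> 0 \<and> Dhat = - 3 * D * s\<^sup>2)"

text \<open>Isomorphisms of Galois modules, that is, of finite etale group schemes.\<close>

definition mu3_isos ::
  "('a::field alg_closure, 'n::finite) point monoid \<Rightarrow> 'a
    \<Rightarrow> (('a alg_closure, 'n) point \<Rightarrow> 'a alg_closure \<times> 'a alg_closure) set" where
  "mu3_isos M D = {\<iota> \<in> iso M (norm_one_mu3 D).
     \<forall>\<sigma>\<in>abs_gal. \<forall>P\<in>carrier M. \<iota> (gal_point \<sigma> P) = gal_quad \<sigma> (\<iota> P)}"

text \<open>The map induced on cohomology by \<open>\<iota>\<close> and Kummer theory: the class of a cocycle \<open>c\<close> is sent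
  to the class of \<open>\<delta>\<close> when \<open>\<iota> \<circ> c\<close> is the Kummer cocycle \<open>\<sigma> \<mapsto> \<sigma>(\<beta>)/\<beta>\<close> of some cube root \<open>\<beta>\<close>
  of \<open>\<delta>\<close>. The value below is the set of all such \<open>\<delta>\<close>.\<close>

definition kummer_class ::
  "(('a::field alg_closure, 'n::finite) point \<Rightarrow> 'a alg_closure \<times> 'a alg_closure) \<Rightarrow> 'a
    \<Rightarrow> (('a alg_closure \<Rightarrow> 'a alg_closure) \<Rightarrow> ('a alg_closure, 'n) point) set \<Rightarrow> ('a \<times> 'a) set" where
  "kummer_class \<iota> D C = {\<delta> \<in> Units (quad_alg D).
     \<exists>c\<in>C. \<exists>\<beta>\<in>Units (quad_alg (to_ac D)).
       \<beta> [^]\<^bsub>quad_alg (to_ac D)\<^esub> (3::nat) = (to_ac (fst \<delta>), to_ac (snd \<delta>)) \<and>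
       (\<forall>\<sigma>\<in>abs_gal. gal_quad \<sigma> \<beta> = \<iota> (c \<sigma>) \<otimes>\<^bsub>quad_alg (to_ac D)\<^esub> \<beta>)}"


section \<open>Binary cubic forms\<close>

text \<open>\<open>Cubic a b c d\<close> is the form \<open>a x\<^sup>3 + 3 b x\<^sup>2 y + 3 c x y\<^sup>2 + d y\<^sup>3\<close>.\<close>

datatype 'a cubic = Cubic 'a 'a 'a 'a

fun cubic_eval :: "'a::comm_ring_1 cubic \<Rightarrow> 'a \<Rightarrow> 'a \<Rightarrow> 'a" where
  "cubic_eval (Cubic a b c d) x y = a * x^3 + 3 * b * x^2 * y + 3 * c * x * y^2 + d * y^3"

fun cubic_disc :: "'a::comm_ring_1 cubic \<Rightarrow> 'a" where
  "cubic_disc (Cubic a b c d) =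
     a^2 * d^2 - 3 * b^2 * c^2 + 4 * a * c^3 + 4 * b^3 * d - 6 * a * b * c * d"

definition SL2 :: "('a::field ^ 2 ^ 2) monoid" where
  "SL2 = \<lparr>carrier = {g. det g = 1}, mult = (**), one = mat 1\<rparr>"

text \<open>The left action \<open>(g \<cdot> f)(x, y) = f((x, y) g)\<close>, in coefficients.\<close>

fun cubic_act :: "'a::comm_ring_1 ^ 2 ^ 2 \<Rightarrow> 'a cubic \<Rightarrow> 'a cubic" where
  "cubic_act g (Cubic a b c d) =
    (let p = g $ 1 $ 1; q = g $ 1 $ 2; r = g $ 2 $ 1; s = g $ 2 $ 2 in
     Cubic (a * p^3 + 3 * b * p^2 * q + 3 * c * p * q^2 + d * q^3)
       (a * p^2 * r + b * (p^2 * s + 2 * p * q * r) + c * (2 * p * q * s + q^2 * r) + d * q^2 * s)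
       (a * p * r^2 + b * (2 * p * r * s + q * r^2) + c * (p * s^2 + 2 * q * r * s) + d * q * s^2)
       (a * r^3 + 3 * b * r^2 * s + 3 * c * r * s^2 + d * s^3))"

lemma cubic_eval_act:
  "cubic_eval (cubic_act g f) x y =
     cubic_eval f (x * g $ 1 $ 1 + y * g $ 2 $ 1) (x * g $ 1 $ 2 + y * g $ 2 $ 2)"
  by (cases f) (simp add: Let_def power2_eq_square power3_eq_cube algebra_simps)

text \<open>The form \<open>1/(2 D) Tr (\<delta> \<tau> (x + \<tau> y)\<^sup>3)\<close>: expanding the cube, the coefficients in the
  normalisation of \<open>Cubic\<close> are \<open>1/(2 D) Tr (\<delta> \<tau>\<^sup>i)\<close> for \<open>i = 1, 2, 3, 4\<close>.\<close>

definition trace_form :: "'a::field \<Rightarrow> 'a \<times> 'a \<Rightarrow> 'a cubic" where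
  "trace_form D \<delta> =
    (let t = (\<lambda>i::nat. quad_trace (\<delta> \<otimes>\<^bsub>quad_alg D\<^esub> quad_tau [^]\<^bsub>quad_alg D\<^esub> i) / (2 * D))
     in Cubic (t 1) (t 2) (t 3) (t 4))"

lemma cubic_eval_trace_form:
  "cubic_eval (trace_form D \<delta>) x y =
     quad_trace (\<delta> \<otimes>\<^bsub>quad_alg D\<^esub> quad_tau \<otimes>\<^bsub>quad_alg D\<^esub> (x, y) [^]\<^bsub>quad_alg D\<^esub> (3::nat)) / (2 * D)"
proof (cases "2 * D = 0")
  case False
  then show ?thesis
    by (simp add: trace_form_def quad_trace_def quad_alg_def nat_pow_def numeral_eq_Suc
        nonzero_eq_divide_eq field_simps)
qed (auto simp: trace_form_def)

end

theory Submission
  imports Defs "HOL-Algebra.Exponent"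
begin

text \<open>The kernel of \<open>\<phi>\<close> has order three. At least three points lie in some fibre: a generator
  \<open>\<theta>\<close> of the function field with \<open>\<theta>\<^sup>3 = p \<theta> + q\<close> expresses the coordinates of a point
  through its image and \<open>\<theta>\<close>, and substituting the three roots of the cubic at a generic point of the
  target for \<open>\<theta>\<close> yields three preimages. At most three: translates of a point by the kernel have
  the same image, so a function separating them takes values that are roots of one polynomial of
  degree three.

  The kernel acquires its points over \<open>F(d)\<close>, where \<open>D = -3 s\<^sup>2 d\<^sup>2\<close>. Over the closure the
  cube roots of unity of norm one in the mirror algebra are \<open>1\<close> and \<open>-1/2 \<plusminus> \<tau>/(2 s d)\<close>, so Galois
  acts on them through the sign of \<open>d\<close>, as on the kernel. Hilbert 90 and Kummer theory then identify the
  cohomology with classes of cubes. Over an imperfect field the elements fixed by Galois are only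
  purely inseparable over the base; raising to a power of the characteristic that is \<open>1\<close> modulo
  three repairs this.

  On the side of cubic forms, the Hessian of a form of discriminant \<open>4 D\<close> represents \<open>1\<close>, by the
  syzygy between the covariants, and is therefore equivalent to the norm form \<open>x\<^sup>2 - D y\<^sup>2\<close>. The
  forms with this Hessian are the trace forms of the elements of norm one, and
  they are permuted by the norm one group, an element \<open>\<kappa>\<close> acting as multiplication by \<open>\<kappa>\<^sup>3\<close>.\<close>

section \<open>Extending embeddings to automorphisms of the algebraic closure\<close>

text \<open>The elements of \<open>abs_gal\<close> are concrete maps of the closure, so the
  existence of enough of them has to be proved. It enters only through
  \<open>fixed_field_abs_gal\<close>: a fixed element is radical over the base. Such an element is
  rational once its cube is, because powers of the characteristic exponent are coprime to three;
  hence the rational cube asked for in \<open>quad_fixed_rational\<close>.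

  The classes allow cubes of all units of K, whereas mu3 and the transporters in SL2 only know norm
  one. The gap is a scalar: if w has norm \<omega> with \<open>\<omega>^3 = 1\<close>, then \<omega>
  w has norm \<open>\<omega>^2 * \<omega> = 1\<close> and the same cube. This correction is made
  once for cocycles and once for orbits.

  The degree is a dimension of function fields, the kernel a set of points. Elements of a function
  field are functions up to generic equality and have no value at a prescribed point. Substituting a
  root for \<open>\<theta>\<close> is therefore done with expressions whose coefficients are regular
  off one hypersurface, and inequalities are turned into identities first.\<close>

text \<open>A homomorphism over the base field from a subring of the closure, given by its graph.
  The domain is never named, and the union of a chain of such maps is literally the union of the
  sets. Single-valuedness follows from the trivial kernel by subtraction.\<close>

definition partial_embedding :: "('a::field alg_closure \<times> 'a alg_closure) set \<Rightarrow> bool" where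
  "partial_embedding S \<longleftrightarrow> (\<forall>a. (to_ac a, to_ac a) \<in> S) \<and>
     (\<forall>x y x' y'. (x, y) \<in> S \<and> (x', y') \<in> S \<longrightarrow> (x + x', y + y') \<in> S \<and> (x * x', y * y') \<in> S) \<and>
     (\<forall>y. (0, y) \<in> S \<longrightarrow> y = 0)"

text \<open>The graph of the induced map on polynomials.\<close>

definition poly_pair :: "('k::field \<times> 'k) set \<Rightarrow> 'k poly \<Rightarrow> 'k poly \<Rightarrow> bool" where
  "poly_pair S p q \<longleftrightarrow> (\<forall>i. (Polynomial.coeff p i, Polynomial.coeff q i) \<in> S)"

text \<open>The extension of the embedding that sends \<open>z\<close> to \<open>w\<close>. It is
  single-valued only for suitable \<open>w\<close> and is therefore kept as a relation.\<close>

definition adjoin_root :: "('k::field \<times> 'k) set \<Rightarrow> 'k \<Rightarrow> 'k \<Rightarrow> ('k \<times> 'k) set" where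
  "adjoin_root S z w = {(poly p z, poly q w) | p q. poly_pair S p q}"

lemma partial_embeddingD:
  assumes "partial_embedding S"
  shows "(to_ac a, to_ac a) \<in> S"
    and "(x, y) \<in> S \<Longrightarrow> (x', y') \<in> S \<Longrightarrow> (x + x', y + y') \<in> S"
    and "(x, y) \<in> S \<Longrightarrow> (x', y') \<in> S \<Longrightarrow> (x * x', y * y') \<in> S"
    and "(0, y) \<in> S \<Longrightarrow> y = 0"
  using assms by (simp_all add: partial_embedding_def)

context
  fixes S :: "('a::field alg_closure \<times> 'a alg_closure) set"
  assumes S: "partial_embedding S"
begin

lemma embedding_01: "(0, 0) \<in> S" "(1, 1) \<in> S" "(- 1, - 1) \<in> S"
  using partial_embeddingD(1)[OF S, of 0] partial_embeddingD(1)[OF S, of 1]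
    partial_embeddingD(1)[OF S, of "- 1"] by auto

lemma embedding_uminus: "(x, y) \<in> S \<Longrightarrow> (- x, - y) \<in> S"
  using partial_embeddingD(3)[OF S embedding_01(3), of x y] by simp

lemma embedding_diff: "(x, y) \<in> S \<Longrightarrow> (x', y') \<in> S \<Longrightarrow> (x - x', y - y') \<in> S"
  using partial_embeddingD(2)[OF S _ embedding_uminus, of x y x' y'] by simp

lemma embedding_unique: "(x, y) \<in> S \<Longrightarrow> (x, y') \<in> S \<Longrightarrow> y = y'"
  using partial_embeddingD(4)[OF S, of "y - y'"] embedding_diff[of x y x y'] by simp

lemma embedding_sum: "(\<And>i. i \<in> I \<Longrightarrow> (f i, g i) \<in> S) \<Longrightarrow> (sum f I, sum g I) \<in> S"
  by (induction I rule: infinite_finite_induct) (auto simp: embedding_01 partial_embeddingD(2)[OF S])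

lemma poly_pair_0: "poly_pair S 0 q \<Longrightarrow> q = 0"
  unfolding poly_pair_def by (rule poly_eqI) (simp add: partial_embeddingD(4)[OF S])

lemma poly_pair_const: "(x, y) \<in> S \<Longrightarrow> poly_pair S [:x:] [:y:]"
  unfolding poly_pair_def by (auto simp: coeff_pCons embedding_01 split: nat.split)

lemma poly_pair_X: "poly_pair S [:0, 1:] [:0, 1:]"
  unfolding poly_pair_def by (auto simp: coeff_pCons embedding_01 split: nat.split)

lemma poly_pair_monom: "(x, y) \<in> S \<Longrightarrow> poly_pair S (Polynomial.monom x n) (Polynomial.monom y n)"
  unfolding poly_pair_def by (auto simp: embedding_01)

lemma poly_pair_add: "poly_pair S p q \<Longrightarrow> poly_pair S p' q' \<Longrightarrow> poly_pair S (p + p') (q + q')"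
  unfolding poly_pair_def by (auto simp: partial_embeddingD(2)[OF S])

lemma poly_pair_diff: "poly_pair S p q \<Longrightarrow> poly_pair S p' q' \<Longrightarrow> poly_pair S (p - p') (q - q')"
  unfolding poly_pair_def by (auto simp: embedding_diff)

lemma poly_pair_mult: "poly_pair S p q \<Longrightarrow> poly_pair S p' q' \<Longrightarrow> poly_pair S (p * p') (q * q')"
  unfolding poly_pair_def
  by (auto simp: Polynomial.coeff_mult intro!: embedding_sum partial_embeddingD(3)[OF S])

lemma poly_pair_base: "poly_pair S (map_poly to_ac p) (map_poly to_ac p)"
  unfolding poly_pair_def by (auto simp: coeff_map_poly partial_embeddingD(1)[OF S])

lemma poly_pair_eval: "poly_pair S p q \<Longrightarrow> (x, y) \<in> S \<Longrightarrow> (poly p x, poly q y) \<in> S"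
proof (induction p arbitrary: q)
  case 0
  then show ?case using poly_pair_0 embedding_01 by fastforce
next
  case (pCons a p)
  obtain b q' where q: "q = pCons b q'" by (cases q)
  have "(a, b) \<in> S" "poly_pair S p q'"
    using pCons.prems(1) unfolding q poly_pair_def
    by (metis coeff_pCons_0, metis coeff_pCons_Suc)
  then show ?case
    using pCons.IH[OF _ pCons.prems(2)] pCons.prems(2) unfolding q
    by (simp add: partial_embeddingD[OF S])
qed

text \<open>The domain is a field because the closure is algebraic: a relation
  \<open>a + x * Q(x) = 0\<close> over the base with \<open>a \<noteq> 0\<close> exhibits the
  inverse of \<open>x\<close> as a polynomial in \<open>x\<close>.\<close>

lemma embedding_inverse:
  assumes "(x, y) \<in> S" "x \<noteq> 0"
  shows "\<exists>z. (inverse x, z) \<in> S"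
proof -
  obtain P :: "'a poly" where "P \<noteq> 0" "poly (map_poly to_ac P) x = 0"
    using alg_closure_algebraic by blast
  \<comment> \<open>Factors of the variable are cancelled from a relation for
    \<open>x \<noteq> 0\<close> until its constant coefficient is nonzero.\<close>
  then have "\<exists>Q :: 'a poly. Polynomial.coeff Q 0 \<noteq> 0 \<and> poly (map_poly to_ac Q) x = 0"
  proof (induction P)
    case (pCons a P)
    show ?case
    proof (cases "a = 0")
      case True
      then show ?thesis using pCons \<open>x \<noteq> 0\<close> by (simp add: map_poly_pCons)
    next
      case False
      then show ?thesis using pCons.prems by (intro exI[of _ "pCons a P"]) simp
    qed
  qed simp
  then obtain a Q where Q: "a \<noteq> 0" "poly (map_poly to_ac (pCons a Q)) x = 0"
    by (metis coeff_pCons_0 pCons_cases)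
  have "inverse x = to_ac (- inverse a) * poly (map_poly to_ac Q) x"
  proof -
    have "to_ac a + x * poly (map_poly to_ac Q) x = 0" using Q(2) by (simp add: map_poly_pCons)
    then have "x * poly (map_poly to_ac Q) x = - to_ac a" by (simp add: add_eq_0_iff)
    then show ?thesis using Q(1) assms(2) by (simp add: field_simps)
  qed
  moreover have "(poly (map_poly to_ac Q) x, poly (map_poly to_ac Q) y) \<in> S"
    using poly_pair_eval[OF poly_pair_base assms(1)] .
  ultimately show ?thesis
    using partial_embeddingD(3)[OF S partial_embeddingD(1)[OF S]] by metis
qed

lemma embedding_inj: "(x, 0) \<in> S \<Longrightarrow> x = 0"
proof (rule ccontr)
  assume x: "(x, 0) \<in> S" "x \<noteq> 0"
  then obtain z where "(inverse x, z) \<in> S" using embedding_inverse by blast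
  then have "(1, 0) \<in> S" using partial_embeddingD(3)[OF S x(1)] x(2) by fastforce
  then show False using embedding_unique embedding_01(2) by fastforce
qed

text \<open>The point is that \<open>p(z) = 0\<close> forces \<open>q(w) = 0\<close>. Long division
  by the monic relation \<open>m\<close> of least degree is carried out in parallel on
  \<open>p\<close> and on its image \<open>q\<close>; each step lowers the degree of
  \<open>p\<close> and keeps the root \<open>z\<close>.\<close>

lemma adjoin_root_embedding:
  assumes m: "poly_pair S m m'" "Polynomial.lead_coeff m = 1"
    and root: "poly m' w = 0"
    and min: "\<And>p q. poly_pair S p q \<Longrightarrow> p \<noteq> 0 \<Longrightarrow> poly p z = 0 \<Longrightarrow>
      Polynomial.degree m \<le> Polynomial.degree p"
    and root0: "poly m z = 0"
  shows "partial_embedding (adjoin_root S z w)"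
proof -
  have zero: "poly q w = 0" if "poly_pair S p q" "poly p z = 0" for p q
    using that
  proof (induction "Polynomial.degree p" arbitrary: p q rule: less_induct)
    case less
    show ?case
    proof (cases "p = 0")
      case True
      then show ?thesis using less.prems poly_pair_0 by fastforce
    next
      case False
      let ?d = "Polynomial.degree p" and ?n = "Polynomial.degree m"
      have dn: "?n \<le> ?d" using min less.prems False by blast
      \<comment> \<open>One division step: \<open>r\<close> cancels the leading term of
        \<open>p\<close> against the monic \<open>m\<close>, and \<open>s\<close> is the image of
        \<open>r\<close>.\<close>
      define r where "r = Polynomial.monom (Polynomial.coeff p ?d) (?d - ?n)"
      define s where "s = Polynomial.monom (Polynomial.coeff q ?d) (?d - ?n)"
      have rs: "poly_pair S r s"
        unfolding r_def s_def using less.prems(1) by (intro poly_pair_monom) (simp add: poly_pair_def)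
      have pp: "poly_pair S (p - r * m) (q - s * m')"
        using less.prems(1) rs m(1) by (intro poly_pair_diff poly_pair_mult)
      have pz: "poly (p - r * m) z = 0" using less.prems(2) root0 by simp
      have "poly (q - s * m') w = 0"
      proof (cases "p - r * m = 0")
        case True
        then show ?thesis using pp poly_pair_0 by fastforce
      next
        case F: False
        have deg: "Polynomial.degree (r * m) \<le> ?d"
          using dn degree_mult_le[of r m] Polynomial.degree_monom_le[of "Polynomial.coeff p ?d" "?d - ?n"]
          unfolding r_def by linarith
        have "Polynomial.coeff (r * m) ?d = Polynomial.coeff p ?d"
          unfolding r_def using dn m(2) by (simp add: coeff_monom_mult)
        then have "Polynomial.coeff (p - r * m) ?d = 0" by simp
        moreover have "Polynomial.degree (p - r * m) \<le> ?d"
          using deg by (simp add: Polynomial.degree_diff_le)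
        ultimately have "Polynomial.degree (p - r * m) < ?d"
          using F by (metis le_neq_implies_less leading_coeff_0_iff)
        then show ?thesis using less.hyps pp pz by blast
      qed
      then show ?thesis using root by simp
    qed
  qed
  show ?thesis
    unfolding partial_embedding_def
  proof (intro conjI allI impI)
    fix a
    show "(to_ac a, to_ac a) \<in> adjoin_root S z w"
      using poly_pair_const[OF partial_embeddingD(1)[OF S, of a]] unfolding adjoin_root_def by force
  next
    fix x y x' y' assume "(x, y) \<in> adjoin_root S z w \<and> (x', y') \<in> adjoin_root S z w"
    then obtain p q p' q' where *: "poly_pair S p q" "poly_pair S p' q'"
      "x = poly p z" "y = poly q w" "x' = poly p' z" "y' = poly q' w"
      unfolding adjoin_root_def by blast
    show "(x + x', y + y') \<in> adjoin_root S z w" "(x * x', y * y') \<in> adjoin_root S z w"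
      using poly_pair_add[OF *(1,2)] poly_pair_mult[OF *(1,2)] *(3-)
      unfolding adjoin_root_def by (force simp flip: poly_add poly_mult)+
  next
    fix y assume "(0, y) \<in> adjoin_root S z w"
    then show "y = 0" unfolding adjoin_root_def using zero by force
  qed
qed

lemma adjoin_root_incl: "S \<subseteq> adjoin_root S z w" "(z, w) \<in> adjoin_root S z w"
proof -
  show "S \<subseteq> adjoin_root S z w"
  proof
    fix t assume "t \<in> S"
    then show "t \<in> adjoin_root S z w"
      using poly_pair_const[of "fst t" "snd t"] unfolding adjoin_root_def
      by (cases t) force
  qed
  show "(z, w) \<in> adjoin_root S z w"
    using poly_pair_X unfolding adjoin_root_def by force
qed

text \<open>The relation of least degree is made monic. Its image has coefficient \<open>1\<close>
  at the same positive degree, so it is not constant and has a root \<open>w\<close> to which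
  \<open>z\<close> can be sent.\<close>

lemma adjoin_root_exists: "\<exists>w. partial_embedding (adjoin_root S z w)"
proof -
  define Q where "Q n \<longleftrightarrow> (\<exists>p q. poly_pair S p q \<and> p \<noteq> 0 \<and> poly p z = 0 \<and> Polynomial.degree p = n)" for n
  obtain P :: "'a poly" where P: "P \<noteq> 0" "poly (map_poly to_ac P) z = 0"
    using alg_closure_algebraic by blast
  have "map_poly to_ac P \<noteq> 0" using P(1) by (simp add: map_poly_eq_0_iff)
  then have "Q (Polynomial.degree (map_poly to_ac P))"
    unfolding Q_def using P(2) poly_pair_base by blast
  then have Q: "Q (LEAST n. Q n)" "\<And>n. Q n \<Longrightarrow> (LEAST n. Q n) \<le> n"
    by (auto intro: LeastI Least_le)
  then obtain p q where p: "poly_pair S p q" "p \<noteq> 0" "poly p z = 0" "Polynomial.degree p = (LEAST n. Q n)"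
    unfolding Q_def by blast
  let ?n = "Polynomial.degree p"
  have "(Polynomial.coeff p ?n, Polynomial.coeff q ?n) \<in> S" using p(1) unfolding poly_pair_def by blast
  then obtain e where e: "(inverse (Polynomial.lead_coeff p), e) \<in> S"
    using embedding_inverse p(2) by fastforce
  define m where "m = [:inverse (Polynomial.lead_coeff p):] * p"
  define m' where "m' = [:e:] * q"
  have m: "poly_pair S m m'" unfolding m_def m'_def
    by (intro poly_pair_mult poly_pair_const e p)
  have degm: "Polynomial.degree m = ?n" unfolding m_def using p(2) by simp
  have lm: "Polynomial.lead_coeff m = 1" unfolding m_def using p(2) by simp
  have mz: "poly m z = 0" unfolding m_def using p(3) by simp
  have pos: "?n > 0"
  proof (rule ccontr)
    assume "\<not> ?n > 0"
    then obtain c where "p = [:c:]" by (metis degree_eq_zeroE gr_zeroI)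
    then show False using p(2,3) by simp
  qed
  have "Polynomial.coeff m' ?n = 1"
  proof -
    have "(Polynomial.coeff m ?n, Polynomial.coeff m' ?n) \<in> S"
      using m unfolding poly_pair_def by blast
    then show ?thesis using lm degm embedding_unique embedding_01(2) by fastforce
  qed
  then have "Polynomial.degree m' > 0"
    using pos le_degree[of m' ?n] by simp
  then obtain w where "poly m' w = 0" using alg_closed_imp_poly_has_root by blast
  then have "partial_embedding (adjoin_root S z w)"
  proof (intro adjoin_root_embedding[OF m lm _ _ mz])
    fix p' q' assume "poly_pair S p' q'" "p' \<noteq> 0" "poly p' z = 0"
    then have "Q (Polynomial.degree p')" unfolding Q_def by blast
    then show "Polynomial.degree m \<le> Polynomial.degree p'" using Q(2) degm p(4) by simp
  qed
  then show ?thesis by blast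
qed

end

lemma maximal_extension:
  fixes P :: "('a \<times> 'a) set \<Rightarrow> bool"
  assumes "P S" "\<And>C. C \<noteq> {} \<Longrightarrow> \<forall>T\<in>C. P T \<and> S \<subseteq> T \<Longrightarrow> \<forall>T\<in>C. \<forall>U\<in>C. T \<subseteq> U \<or> U \<subseteq> T \<Longrightarrow> P (\<Union>C)"
  shows "\<exists>M. P M \<and> S \<subseteq> M \<and> (\<forall>U. P U \<longrightarrow> S \<subseteq> U \<longrightarrow> M \<subseteq> U \<longrightarrow> U = M)"
proof -
  define A where "A = {T. P T \<and> S \<subseteq> T}"
  have "\<exists>M\<in>A. \<forall>U\<in>A. M \<subseteq> U \<longrightarrow> U = M"
  proof (rule subset_Zorn_nonempty)
    show "A \<noteq> {}" using assms(1) unfolding A_def by auto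
  next
    fix C assume C: "C \<noteq> {}" "subset.chain A C"
    then have "C \<subseteq> A" and ch: "\<forall>T\<in>C. \<forall>U\<in>C. T \<subseteq> U \<or> U \<subseteq> T"
      by (simp_all add: subset_chain_def)
    then have "P (\<Union>C)" using C(1) by (intro assms(2)) (auto simp: A_def)
    moreover have "S \<subseteq> \<Union>C" using C(1) \<open>C \<subseteq> A\<close> by (auto simp: A_def)
    ultimately show "\<Union>C \<in> A" by (simp add: A_def)
  qed
  then show ?thesis unfolding A_def by auto
qed

lemma partial_embedding_Union:
  assumes "C \<noteq> {}" and pe: "\<And>T. T \<in> C \<Longrightarrow> partial_embedding T"
    and ch: "\<And>T U. T \<in> C \<Longrightarrow> U \<in> C \<Longrightarrow> T \<subseteq> U \<or> U \<subseteq> T"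
  shows "partial_embedding (\<Union>C)"
  unfolding partial_embedding_def
proof (intro conjI allI impI)
  fix a
  obtain T where "T \<in> C" using assms(1) by auto
  then show "(to_ac a, to_ac a) \<in> \<Union>C"
    using partial_embeddingD(1)[OF pe] by auto
next
  fix x y x' y' assume a: "(x, y) \<in> \<Union>C \<and> (x', y') \<in> \<Union>C"
  then obtain T where T: "T \<in> C" "(x, y) \<in> T" by auto
  from a obtain U where U: "U \<in> C" "(x', y') \<in> U" by auto
  obtain V where V: "V \<in> C" "(x, y) \<in> V" "(x', y') \<in> V"
    using ch[OF T(1) U(1)] T U by (elim disjE) auto
  show "(x + x', y + y') \<in> \<Union>C" "(x * x', y * y') \<in> \<Union>C"
    using partial_embeddingD(2)[OF pe V(2,3)] partial_embeddingD(3)[OF pe V(2,3)] V(1) by auto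
next
  fix y assume "(0, y) \<in> \<Union>C"
  then obtain T where T: "T \<in> C" "(0, y) \<in> T" by auto
  show "y = 0" using partial_embeddingD(4)[OF pe[OF T(1)] T(2)] .
qed

text \<open>A maximal partial embedding is total, since any missing element could be adjoined. It is
  onto because it maps the finite root set of each polynomial over the base injectively into
  itself.\<close>

lemma extend_to_automorphism:
  fixes S :: "('a::field alg_closure \<times> 'a alg_closure) set"
  assumes S: "partial_embedding S"
  shows "\<exists>\<sigma>\<in>abs_gal. \<forall>(x, y)\<in>S. \<sigma> x = y"
proof -
  have "\<exists>M. partial_embedding M \<and> S \<subseteq> M \<and>
      (\<forall>U. partial_embedding U \<longrightarrow> S \<subseteq> U \<longrightarrow> M \<subseteq> U \<longrightarrow> U = M)"
    using S by (rule maximal_extension) (rule partial_embedding_Union, simp_all)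
  then obtain M where M: "partial_embedding M" "S \<subseteq> M"
    and max: "\<And>U. partial_embedding U \<Longrightarrow> S \<subseteq> U \<Longrightarrow> M \<subseteq> U \<Longrightarrow> U = M"
    by (elim exE conjE) simp
  have total: "\<exists>w. (z, w) \<in> M" for z
  proof -
    obtain w where "partial_embedding (adjoin_root M z w)" using adjoin_root_exists[OF M(1)] by blast
    then have "adjoin_root M z w = M"
      using max[of "adjoin_root M z w"] M(2) adjoin_root_incl(1)[OF M(1), of z w] by simp
    then show ?thesis using adjoin_root_incl(2)[OF M(1), of z w] by metis
  qed
  define \<sigma> where "\<sigma> z = (SOME w. (z, w) \<in> M)" for z
  have \<sigma>: "(z, \<sigma> z) \<in> M" for z unfolding \<sigma>_def using total by (rule someI_ex)
  have \<sigma>_eq: "\<sigma> z = w" if "(z, w) \<in> M" for z w using embedding_unique[OF M(1) \<sigma> that] .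
  have add: "\<sigma> (x + y) = \<sigma> x + \<sigma> y" and mult: "\<sigma> (x * y) = \<sigma> x * \<sigma> y" for x y
    using \<sigma>_eq[OF partial_embeddingD(2)[OF M(1) \<sigma> \<sigma>]] \<sigma>_eq[OF partial_embeddingD(3)[OF M(1) \<sigma> \<sigma>]] by auto
  have fixb: "\<sigma> (to_ac a) = to_ac a" for a using \<sigma>_eq[OF partial_embeddingD(1)[OF M(1)]] .
  have inj: "inj \<sigma>"
  proof (rule injI)
    fix x y assume "\<sigma> x = \<sigma> y"
    then have "(x - y, 0) \<in> M" using embedding_diff[OF M(1) \<sigma>[of x] \<sigma>[of y]] by simp
    then show "x = y" using embedding_inj[OF M(1), of "x - y"] by simp
  qed
  have surj: "\<exists>x. \<sigma> x = y" for y
  proof -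
    obtain P :: "'a poly" where P: "P \<noteq> 0" "poly (map_poly to_ac P) y = 0"
      using alg_closure_algebraic by blast
    let ?R = "{x. poly (map_poly to_ac P) x = 0}"
    have fin: "finite ?R" using P(1) by (intro poly_roots_finite) (simp add: map_poly_eq_0_iff)
    have "\<sigma> ` ?R \<subseteq> ?R"
    proof
      fix t assume "t \<in> \<sigma> ` ?R"
      then obtain x where x: "poly (map_poly to_ac P) x = 0" "t = \<sigma> x" by blast
      have "(0, poly (map_poly to_ac P) (\<sigma> x)) \<in> M"
        using poly_pair_eval[OF M(1) poly_pair_base[OF M(1)] \<sigma>[of x], of P] x(1) by simp
      then show "t \<in> ?R" using partial_embeddingD(4)[OF M(1)] x(2) by simp
    qed
    then have "\<sigma> ` ?R = ?R" using fin inj by (intro endo_inj_surj) (auto intro: inj_on_subset)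
    moreover have "y \<in> ?R" using P(2) by simp
    ultimately have "y \<in> \<sigma> ` ?R" by simp
    then show ?thesis by auto
  qed
  have surj': "surj \<sigma>"
    by (rule surjI[of \<sigma> "\<lambda>y. SOME x. \<sigma> x = y"]) (rule someI_ex[OF surj])
  have "\<sigma> \<in> abs_gal"
    unfolding abs_gal_def bij_def mem_Collect_eq
    using inj surj' add mult fixb by simp
  moreover have "\<sigma> x = y" if "(x, y) \<in> S" for x y using \<sigma>_eq M(2) that by auto
  ultimately show ?thesis by auto
qed


section \<open>Elements fixed by the absolute Galois group\<close>

definition base_poly :: "'a::field alg_closure poly \<Rightarrow> bool" where
  "base_poly p \<longleftrightarrow> (\<forall>i. Polynomial.coeff p i \<in> base_field)"

lemma minimal_polynomial:
  fixes x :: "'a::field alg_closure"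
  obtains m where "base_poly m" "Polynomial.lead_coeff m = 1" "poly m x = 0"
    and "\<And>p. base_poly p \<Longrightarrow> p \<noteq> 0 \<Longrightarrow> poly p x = 0 \<Longrightarrow> Polynomial.degree m \<le> Polynomial.degree p"
proof -
  define Q where "Q n \<longleftrightarrow> (\<exists>p. base_poly p \<and> p \<noteq> 0 \<and> poly p x = 0 \<and> Polynomial.degree p = n)" for n
  obtain P :: "'a poly" where P: "P \<noteq> 0" "poly (map_poly to_ac P) x = 0"
    using alg_closure_algebraic by blast
  have "map_poly to_ac P \<noteq> 0" using P(1) by (simp add: map_poly_eq_0_iff)
  moreover have "base_poly (map_poly to_ac P)"
    unfolding base_poly_def base_field_def by (auto simp: coeff_map_poly)
  ultimately have "Q (Polynomial.degree (map_poly to_ac P))"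
    unfolding Q_def using P(2) by blast
  then have Q: "Q (LEAST n. Q n)" "\<And>n. Q n \<Longrightarrow> (LEAST n. Q n) \<le> n"
    by (auto intro: LeastI Least_le)
  then obtain p where p: "base_poly p" "p \<noteq> 0" "poly p x = 0" "Polynomial.degree p = (LEAST n. Q n)"
    unfolding Q_def by blast
  define m where "m = Polynomial.smult (inverse (Polynomial.lead_coeff p)) p"
  show thesis
  proof (rule that[of m])
    show "base_poly m"
      unfolding base_poly_def
    proof
      fix i
      obtain a b where "Polynomial.lead_coeff p = to_ac a" "Polynomial.coeff p i = to_ac b"
        using p(1) unfolding base_poly_def base_field_def by blast
      then have "Polynomial.coeff m i = to_ac (inverse a * b)" unfolding m_def by simp
      then show "Polynomial.coeff m i \<in> base_field" unfolding base_field_def by (metis rangeI)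
    qed
    show "Polynomial.lead_coeff m = 1" "poly m x = 0" unfolding m_def using p(2,3) by simp_all
    fix q assume "base_poly q" "q \<noteq> 0" "poly q x = 0"
    then have "Q (Polynomial.degree q)" unfolding Q_def by blast
    then show "Polynomial.degree m \<le> Polynomial.degree q" using Q(2) p(2,4) unfolding m_def by simp
  qed
qed

lemma partial_embedding_base: "partial_embedding (range (\<lambda>a. (to_ac a, to_ac a)))"
  unfolding partial_embedding_def
proof (intro conjI allI impI)
  fix x y x' y' :: "'a alg_closure"
  assume "(x, y) \<in> range (\<lambda>a. (to_ac a, to_ac a)) \<and> (x', y') \<in> range (\<lambda>a. (to_ac a, to_ac a))"
  then obtain a b where "x = to_ac a" "y = to_ac a" "x' = to_ac b" "y' = to_ac b" by auto
  then show "(x + x', y + y') \<in> range (\<lambda>a. (to_ac a, to_ac a))"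
    "(x * x', y * y') \<in> range (\<lambda>a. (to_ac a, to_ac a))"
    by (auto simp flip: to_ac_add to_ac_mult)
qed auto

lemma poly_pair_base_iff:
  "poly_pair (range (\<lambda>a. (to_ac a, to_ac a))) p q \<longleftrightarrow> q = p \<and> base_poly p"
  unfolding poly_pair_def base_poly_def base_field_def poly_eq_iff by (auto simp: image_iff) metis+

text \<open>The identity of the base field extends by \<open>x \<mapsto> y\<close>, because both are
  roots of the minimal polynomial of \<open>x\<close>, and then to the whole closure.\<close>

lemma galois_conjugate:
  fixes x y :: "'a::field alg_closure"
  assumes "base_poly m" "Polynomial.lead_coeff m = 1" "poly m x = 0" "poly m y = 0"
    and "\<And>p. base_poly p \<Longrightarrow> p \<noteq> 0 \<Longrightarrow> poly p x = 0 \<Longrightarrow> Polynomial.degree m \<le> Polynomial.degree p"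
  shows "\<exists>\<sigma>\<in>abs_gal. \<sigma> x = y"
proof -
  let ?S = "range (\<lambda>a. (to_ac a, to_ac a))"
  have "partial_embedding (adjoin_root ?S x y)"
    by (rule adjoin_root_embedding[OF partial_embedding_base, of m m])
      (use assms in \<open>simp_all add: poly_pair_base_iff\<close>)
  from extend_to_automorphism[OF this] show ?thesis
    using adjoin_root_incl(2)[OF partial_embedding_base, of x y] by fastforce
qed

lemma single_root_poly:
  fixes m :: "'k::alg_closed_field poly"
  assumes "Polynomial.lead_coeff m = 1" "\<And>y. poly m y = 0 \<Longrightarrow> y = x"
  shows "m = [:- x, 1:] ^ Polynomial.degree m"
  using assms
proof (induction "Polynomial.degree m" arbitrary: m)
  case 0
  then show ?case by (metis degree_eq_zeroE lead_coeff_pCons(2) one_pCons power_0)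
next
  case (Suc n)
  then obtain y where "poly m y = 0" using alg_closed_imp_poly_has_root by (metis zero_less_Suc)
  then have "[:- x, 1:] dvd m" using Suc.prems(2) poly_eq_0_iff_dvd by metis
  then obtain k where k: "m = [:- x, 1:] * k" by blast
  have "k \<noteq> 0" using k Suc.prems(1) by auto
  then have dk: "Polynomial.degree m = Suc (Polynomial.degree k)"
    unfolding k by (subst degree_mult_eq) auto
  have "Polynomial.lead_coeff k = 1" using Suc.prems(1) unfolding k lead_coeff_mult by simp
  then have "k = [:- x, 1:] ^ Polynomial.degree k"
    using Suc.hyps dk Suc.prems(2) unfolding k by (metis Suc_inject mult_zero_right poly_mult)
  then show ?case using dk k by (metis power_Suc)
qed

text \<open>The value \<open>1\<close> in characteristic zero lets radical elements be treated
  uniformly: there the powers below are the element itself.\<close>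

definition char_exponent :: "'a::field itself \<Rightarrow> nat" where
  "char_exponent _ = (if CHAR('a) = 0 then 1 else CHAR('a))"

text \<open>The minimal polynomial of a fixed \<open>x\<close> has no other root, so it is
  \<open>(X - x)^n\<close> and has the coefficients \<open>(n choose k) * (- x)^k\<close>. Whenever
  \<open>n choose k\<close> is nonzero in the field, \<open>x^k\<close> is rational;
  \<open>k\<close> is \<open>1\<close> in characteristic zero and otherwise the exact power of the
  characteristic dividing \<open>n\<close>.\<close>

theorem fixed_field_abs_gal:
  fixes x :: "'a::field alg_closure"
  assumes fixed: "\<And>\<sigma>. \<sigma> \<in> abs_gal \<Longrightarrow> \<sigma> x = x"
  shows "\<exists>e. x ^ (char_exponent TYPE('a) ^ e) \<in> base_field"
proof -
  obtain m where m: "base_poly m" "Polynomial.lead_coeff m = 1" "poly m x = 0"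
    "\<And>p. base_poly p \<Longrightarrow> p \<noteq> 0 \<Longrightarrow> poly p x = 0 \<Longrightarrow> Polynomial.degree m \<le> Polynomial.degree p"
    using minimal_polynomial by blast
  let ?n = "Polynomial.degree m"
  have "y = x" if "poly m y = 0" for y
    using galois_conjugate[OF m(1,2,3) that m(4)] fixed by blast
  then have mx: "m = [:- x, 1:] ^ ?n" using single_root_poly m(2) by blast
  have n: "?n > 0" using m(3) mx by (metis gr_zeroI poly_1 power_0 zero_neq_one)
  have *: "x ^ k \<in> base_field" if k: "k \<le> ?n" "of_nat (?n choose k) \<noteq> (0::'a)" for k
  proof -
    have "Polynomial.coeff m (?n - k) = of_nat (?n choose k) * (- x) ^ k"
      using k(1) by (subst mx, subst coeff_linear_poly_power)
        (auto simp: binomial_symmetric[of k ?n])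
    moreover obtain a where "Polynomial.coeff m (?n - k) = to_ac a"
      using m(1) unfolding base_poly_def base_field_def by (meson rangeE)
    moreover have "(of_nat (?n choose k) :: 'a alg_closure) = to_ac (of_nat (?n choose k))" by simp
    ultimately have "to_ac a = to_ac (of_nat (?n choose k)) * ((- 1) ^ k * x ^ k)"
      by (metis power_minus)
    then have "x ^ k = (- 1) ^ k * (to_ac a / to_ac (of_nat (?n choose k)))"
      using k(2) by (auto simp del: to_ac_of_nat simp flip: mult.assoc power_add power_mult_distrib)
    also have "\<dots> = to_ac ((- 1) ^ k * (a / of_nat (?n choose k)))" by simp
    finally show ?thesis unfolding base_field_def by blast
  qed
  show ?thesis
  proof (cases "CHAR('a) = 0")
    case True
    have "of_nat (?n choose 1) \<noteq> (0::'a)" using n True by (simp add: of_nat_eq_0_iff_char_dvd)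
    then show ?thesis using *[of 1] n True by (auto simp: char_exponent_def)
  next
    case False
    then have p: "Factorial_Ring.prime CHAR('a)" by (simp add: prime_CHAR_semidom)
    let ?p = "CHAR('a)"
    obtain k where k: "?n = ?p ^ multiplicity ?p ?n * k" "\<not> ?p dvd k"
    proof
      show "?n = ?p ^ multiplicity ?p ?n * (?n div ?p ^ multiplicity ?p ?n)"
        using multiplicity_dvd[of ?p ?n] by simp
      show "\<not> ?p dvd (?n div ?p ^ multiplicity ?p ?n)"
        using n p by (intro multiplicity_decompose) (auto simp: not_prime_unit)
    qed
    let ?e = "multiplicity ?p ?n"
    have "k > 0" using k(2) by (intro Nat.gr0I) simp
    \<comment> \<open>The binomial coefficient from the combinatorial proof of Sylow's theorem: it
      is divisible by \<open>p\<close> exactly as often as \<open>k\<close>.\<close>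
    have "multiplicity ?p (?p ^ ?e * k choose ?p ^ ?e) = multiplicity ?p k"
      using const_p_fac[OF \<open>k > 0\<close> p] .
    also have "\<dots> = 0" using k(2) by (simp add: not_dvd_imp_multiplicity_0)
    finally have "multiplicity ?p (?n choose ?p ^ ?e) = 0" using k(1) by simp
    moreover have le: "?p ^ ?e \<le> ?n" using k(1) n by (metis dvdI dvd_imp_le)
    moreover have "?n choose ?p ^ ?e \<noteq> 0" using le by simp
    ultimately have "\<not> ?p dvd (?n choose ?p ^ ?e)"
      using multiplicity_eq_zero_iff[of "?n choose ?p ^ ?e" ?p] not_prime_unit p by blast
    then show ?thesis using *[of "?p ^ ?e"] le False
      by (auto simp: char_exponent_def of_nat_eq_0_iff_char_dvd)
  qed
qed

section \<open>Binary cubic forms and their Hessians\<close>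

lemma quad_mult: "z \<otimes>\<^bsub>quad_alg D\<^esub> w = (fst z * fst w + D * snd z * snd w, fst z * snd w + snd z * fst w)"
  by (simp add: quad_alg_def)

lemma quad_one: "\<one>\<^bsub>quad_alg D\<^esub> = (1, 0)"
  by (simp add: quad_alg_def)

lemma quad_cube:
  "z [^]\<^bsub>quad_alg D\<^esub> (3::nat) =
    ((fst z)^3 + 3 * D * fst z * (snd z)\<^sup>2, 3 * (fst z)\<^sup>2 * snd z + D * (snd z)^3)"
  by (simp add: quad_alg_def nat_pow_def numeral_eq_Suc) (simp add: algebra_simps)

lemma quad_norm_mult: "quad_norm D (z \<otimes>\<^bsub>quad_alg D\<^esub> w) = quad_norm D z * quad_norm D w"
  unfolding quad_norm_def quad_mult fst_conv snd_conv by Groebner_Basis.algebra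

lemma quad_norm_cube: "quad_norm D (z [^]\<^bsub>quad_alg D\<^esub> (3::nat)) = quad_norm D z ^ 3"
  unfolding quad_norm_def quad_cube fst_conv snd_conv by Groebner_Basis.algebra

definition mat2 :: "'a \<Rightarrow> 'a \<Rightarrow> 'a \<Rightarrow> 'a \<Rightarrow> 'a::field ^ 2 ^ 2" where
  "mat2 p q r s = vector [vector [p, q], vector [r, s]]"

lemma mat2_nth [simp]:
  "mat2 p q r s $ 1 $ 1 = p" "mat2 p q r s $ 1 $ 2 = q" "mat2 p q r s $ 2 $ 1 = r" "mat2 p q r s $ 2 $ 2 = s"
  by (simp_all add: mat2_def)

lemma mat2_eta: "g = mat2 (g $ 1 $ 1) (g $ 1 $ 2) (g $ 2 $ 1) (g $ 2 $ 2)"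
  by (simp add: vec_eq_iff forall_2)

lemma mat2_eq_iff: "mat2 p q r s = mat2 p' q' r' s' \<longleftrightarrow> p = p' \<and> q = q' \<and> r = r' \<and> s = s'"
  by (metis mat2_nth)

lemma mat2_cases:
  fixes g :: "'a::field ^ 2 ^ 2"
  obtains p q r s where "g = mat2 p q r s"
  using mat2_eta by blast

lemma mat2_mult: "mat2 p q r s ** mat2 p' q' r' s' =
  mat2 (p * p' + q * r') (p * q' + q * s') (r * p' + s * r') (r * q' + s * s')"
  by (simp add: vec_eq_iff forall_2 matrix_matrix_mult_def sum_2)

lemma mat2_one: "mat 1 = mat2 1 0 0 1"
  by (simp add: vec_eq_iff forall_2 mat_def)

lemma det_mat2: "det (mat2 p q r s) = p * s - q * r"
  by (simp add: det_2)

lemma cubic_act_mat2: "cubic_act (mat2 p q r s) (Cubic a b c d) =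
  Cubic (a * p^3 + 3 * b * p\<^sup>2 * q + 3 * c * p * q\<^sup>2 + d * q^3)
    (a * p\<^sup>2 * r + b * (p\<^sup>2 * s + 2 * p * q * r) + c * (2 * p * q * s + q\<^sup>2 * r) + d * q\<^sup>2 * s)
    (a * p * r\<^sup>2 + b * (2 * p * r * s + q * r\<^sup>2) + c * (p * s\<^sup>2 + 2 * q * r * s) + d * q * s\<^sup>2)
    (a * r^3 + 3 * b * r\<^sup>2 * s + 3 * c * r * s\<^sup>2 + d * s^3)"
  by (simp add: Let_def)

lemma cubic_act_mult:
  fixes g h :: "'a::field ^ 2 ^ 2"
  shows "cubic_act (g ** h) f = cubic_act g (cubic_act h f)"
proof -
  obtain p q r s p' q' r' s' a b c d where
    "g = mat2 p q r s" "h = mat2 p' q' r' s'" "f = Cubic a b c d"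
    by (metis mat2_eta cubic.exhaust)
  note e = this
  show ?thesis
    unfolding e mat2_mult cubic_act_mat2 cubic.inject by (intro conjI; Groebner_Basis.algebra)
qed

lemma cubic_act_one: "cubic_act (mat 1) f = (f :: 'a::field cubic)"
  unfolding mat2_one by (cases f) (simp only: cubic_act_mat2, simp)

lemma SL2_carrier: "g \<in> carrier SL2 \<longleftrightarrow> det g = 1"
  and SL2_mult: "g \<otimes>\<^bsub>SL2\<^esub> h = g ** h"
  and SL2_one: "\<one>\<^bsub>SL2\<^esub> = mat 1"
  by (simp_all add: SL2_def)

lemma SL2_group: "group (SL2 :: ('a::field ^ 2 ^ 2) monoid)"
proof (rule groupI)
  fix g :: "'a ^ 2 ^ 2" assume g: "g \<in> carrier SL2"
  obtain p q r s where g': "g = mat2 p q r s" by (rule mat2_cases)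
  have 1: "p * s - q * r = 1" using g unfolding SL2_carrier g' det_mat2 .
  have "mat2 s (- q) (- r) p \<otimes>\<^bsub>SL2\<^esub> g = \<one>\<^bsub>SL2\<^esub>"
    unfolding g' SL2_mult SL2_one mat2_mult mat2_one mat2_eq_iff using 1 by (simp add: algebra_simps)
  moreover have "mat2 s (- q) (- r) p \<in> carrier SL2"
    using 1 by (simp add: SL2_carrier det_mat2 algebra_simps)
  ultimately show "\<exists>h\<in>carrier SL2. h \<otimes>\<^bsub>SL2\<^esub> g = \<one>\<^bsub>SL2\<^esub>" by blast
qed (auto simp: SL2_carrier SL2_mult SL2_one det_mul matrix_mul_assoc)

lemma cubic_disc_act:
  fixes g :: "'a::field ^ 2 ^ 2"
  assumes "det g = 1"
  shows "cubic_disc (cubic_act g f) = cubic_disc f"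
proof -
  obtain p q r s a b c d where gf: "g = mat2 p q r s" "f = Cubic a b c d"
    by (metis mat2_eta cubic.exhaust)
  have "cubic_disc (cubic_act (mat2 p q r s) (Cubic a b c d)) = (p * s - q * r) ^ 6 * cubic_disc (Cubic a b c d)"
    unfolding cubic_act_mat2 cubic_disc.simps by Groebner_Basis.algebra
  then show ?thesis using assms unfolding gf det_mat2 by simp
qed

lemma orbit_eqI:
  fixes f :: "'a::field cubic"
  assumes "g \<in> carrier SL2" "cubic_act g f = f'"
  shows "orbit SL2 cubic_act f = orbit SL2 cubic_act f'"
proof -
  interpret group "SL2 :: ('a ^ 2 ^ 2) monoid" by (rule SL2_group)
  have "f = cubic_act (inv\<^bsub>SL2\<^esub> g) f'"
    unfolding assms(2)[symmetric] cubic_act_mult[symmetric]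
    using l_inv[OF assms(1)] by (simp add: SL2_mult SL2_one cubic_act_one)
  then have f: "f = cubic_act (inv\<^bsub>SL2\<^esub> g) f'" .
  show ?thesis
  proof
    show "orbit SL2 cubic_act f \<subseteq> orbit SL2 cubic_act f'"
    proof
      fix k assume "k \<in> orbit SL2 cubic_act f"
      then obtain h where h: "h \<in> carrier SL2" "k = cubic_act h f" unfolding orbit_def by blast
      then have "k = cubic_act (h \<otimes>\<^bsub>SL2\<^esub> inv\<^bsub>SL2\<^esub> g) f'"
        using f by (simp add: SL2_mult cubic_act_mult)
      then show "k \<in> orbit SL2 cubic_act f'"
        unfolding orbit_def using m_closed[OF h(1) inv_closed[OF assms(1)]] by blast
    qed
    show "orbit SL2 cubic_act f' \<subseteq> orbit SL2 cubic_act f"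
    proof
      fix k assume "k \<in> orbit SL2 cubic_act f'"
      then obtain h where h: "h \<in> carrier SL2" "k = cubic_act h f'" unfolding orbit_def by blast
      then have "k = cubic_act (h \<otimes>\<^bsub>SL2\<^esub> g) f"
        using assms(2) by (simp add: SL2_mult cubic_act_mult)
      then show "k \<in> orbit SL2 cubic_act f"
        unfolding orbit_def using m_closed[OF h(1) assms(1)] by blast
    qed
  qed
qed

text \<open>The coefficients of \<open>x^2\<close>, \<open>x y\<close>, \<open>y^2\<close> in the
  Hessian covariant, with the sign and scaling for which its discriminant is that of the
  cubic.\<close>

fun hessian :: "'a::field cubic \<Rightarrow> 'a \<times> 'a \<times> 'a" where
  "hessian (Cubic a b c d) = (b\<^sup>2 - a * c, b * c - a * d, c\<^sup>2 - b * d)"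

text \<open>Covariance of weight two: the general identity carries the factor
  \<open>(p * s - q * r)^2\<close>, which is one here.\<close>

lemma hessian_act:
  fixes p q r s :: "'a::field"
  assumes det: "p * s - q * r = 1" and H: "hessian f = (A, B, C)"
  shows "hessian (cubic_act (mat2 p q r s) f) =
    (A * p\<^sup>2 + B * p * q + C * q\<^sup>2, 2 * A * p * r + B * (p * s + q * r) + 2 * C * q * s,
     A * r\<^sup>2 + B * r * s + C * s\<^sup>2)"
proof -
  obtain a b c d where f: "f = Cubic a b c d" by (cases f)
  have ABC: "A = b\<^sup>2 - a * c" "B = b * c - a * d" "C = c\<^sup>2 - b * d" using H unfolding f by auto
  have 1: "hessian (cubic_act (mat2 p q r s) f) =
    ((p * s - q * r)\<^sup>2 * (A * p\<^sup>2 + B * p * q + C * q\<^sup>2),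
     (p * s - q * r)\<^sup>2 * (2 * A * p * r + B * (p * s + q * r) + 2 * C * q * s),
     (p * s - q * r)\<^sup>2 * (A * r\<^sup>2 + B * r * s + C * s\<^sup>2))"
    unfolding f cubic_act_mat2 hessian.simps ABC prod.inject by (intro conjI; Groebner_Basis.algebra)
  then show ?thesis unfolding det by simp
qed

text \<open>Explains the constant \<open>4 * D\<close>: it is the discriminant of the quadratic form
  \<open>x^2 - D * y^2\<close>, the intended Hessian.\<close>

lemma hessian_disc:
  assumes "hessian f = (A, B, C)"
  shows "B\<^sup>2 - 4 * A * C = cubic_disc f"
proof -
  obtain a b c d where f: "f = Cubic a b c d" by (cases f)
  have ABC: "A = b\<^sup>2 - a * c" "B = b * c - a * d" "C = c\<^sup>2 - b * d" using assms unfolding f by auto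
  show ?thesis unfolding ABC f cubic_disc.simps by Groebner_Basis.algebra
qed

text \<open>The trace form of \<delta> with the division by \<open>2 * D\<close> carried out, so
  that polynomial identities apply to it directly.\<close>

definition norm_form :: "'a::field \<Rightarrow> 'a \<times> 'a \<Rightarrow> 'a cubic" where
  "norm_form D \<delta> = Cubic (snd \<delta>) (fst \<delta>) (snd \<delta> * D) (fst \<delta> * D)"

lemma norm_form_inject: "norm_form D \<delta> = norm_form D \<delta>' \<longleftrightarrow> \<delta> = \<delta>'"
  by (auto simp: norm_form_def prod_eq_iff)

lemma trace_form_eq:
  fixes D :: "'a::field"
  assumes "(2::'a) \<noteq> 0" "D \<noteq> 0"
  shows "trace_form D \<delta> = norm_form D \<delta>"
  using assms unfolding norm_form_def trace_form_def Let_def quad_trace_def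
  by (simp add: quad_alg_def nat_pow_def numeral_eq_Suc)

lemma disc_norm_form: "quad_norm D \<delta> = 1 \<Longrightarrow> cubic_disc (norm_form D \<delta>) = 4 * D"
proof -
  obtain u v where d: "\<delta> = (u, v)" by (cases \<delta>)
  have "cubic_disc (norm_form D \<delta>) = 4 * D * (quad_norm D \<delta>)\<^sup>2"
    unfolding d norm_form_def quad_norm_def fst_conv snd_conv cubic_disc.simps by Groebner_Basis.algebra
  then show "quad_norm D \<delta> = 1 \<Longrightarrow> cubic_disc (norm_form D \<delta>) = 4 * D" by simp
qed

text \<open>In general the Hessian is the norm of \<delta> times
  \<open>x^2 - D * y^2\<close>.\<close>

lemma hessian_norm_form: "quad_norm D \<delta> = 1 \<Longrightarrow> hessian (norm_form D \<delta>) = (1, 0, - D)"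
proof -
  obtain u v where d: "\<delta> = (u, v)" by (cases \<delta>)
  assume "quad_norm D \<delta> = 1"
  then have h: "u\<^sup>2 - D * v\<^sup>2 = 1" unfolding d quad_norm_def by simp
  have "u\<^sup>2 - v * (v * D) = 1" "u * (v * D) - v * (u * D) = 0"
    using h by (simp_all add: power2_eq_square mult_ac)
  moreover have "(v * D)\<^sup>2 - u * (u * D) = - D * (u\<^sup>2 - D * v\<^sup>2)"
    by (simp add: power2_eq_square algebra_simps)
  ultimately show ?thesis
    unfolding d norm_form_def fst_conv snd_conv hessian.simps prod.inject h by simp
qed

text \<open>Multiplying \<open>c\<close> by \<open>1 = b^2 - a * c\<close> and using
  \<open>b * c = a * d\<close> gives \<open>c = a * (b * d - c^2) = a * D\<close>; in the same way
  \<open>d = b * D\<close>.\<close>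

lemma cubic_of_hessian:
  assumes "hessian f = (1, 0, - D)"
  shows "\<exists>\<delta>. quad_norm D \<delta> = 1 \<and> f = norm_form D \<delta>"
proof -
  obtain a b c d where f: "f = Cubic a b c d" by (cases f)
  have h: "b\<^sup>2 - a * c = 1" "b * c - a * d = 0" "c\<^sup>2 - b * d = - D" using assms unfolding f by auto
  have c: "c = a * D" and d: "d = b * D" using h by Groebner_Basis.algebra+
  have "b\<^sup>2 - D * a\<^sup>2 = 1" using h(1) unfolding c by Groebner_Basis.algebra
  then show ?thesis unfolding f c d
    by (intro exI[of _ "(b, a)"]) (simp add: quad_norm_def norm_form_def)
qed

text \<open>The matrix of multiplication by \<kappa> on \<open>x + y \<tau>\<close>, acting on row
  vectors \<open>(x, y)\<close> from the right.\<close>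

definition quad_mat :: "'a::field \<Rightarrow> 'a \<times> 'a \<Rightarrow> 'a ^ 2 ^ 2" where
  "quad_mat D \<kappa> = mat2 (fst \<kappa>) (snd \<kappa>) (D * snd \<kappa>) (fst \<kappa>)"

lemma det_quad_mat: "det (quad_mat D \<kappa>) = quad_norm D \<kappa>"
  unfolding quad_mat_def det_mat2 quad_norm_def by (simp add: power2_eq_square)

lemma quad_mat_mult: "quad_mat D \<kappa> ** quad_mat D \<kappa>' = quad_mat D (\<kappa> \<otimes>\<^bsub>quad_alg D\<^esub> \<kappa>')"
  unfolding quad_mat_def mat2_mult quad_mult mat2_eq_iff by (simp add: algebra_simps)

lemma quad_mat_inject: "quad_mat D \<kappa> = quad_mat D \<kappa>' \<longleftrightarrow> \<kappa> = \<kappa>'"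
  unfolding quad_mat_def mat2_eq_iff by (auto simp: prod_eq_iff)

text \<open>Replacing \<open>x + \<tau> y\<close> by its multiple by \<kappa> inside the cube of the
  trace form moves \<open>\<kappa>^3\<close> next to \<delta>.\<close>

lemma quad_mat_act:
  "cubic_act (quad_mat D \<kappa>) (norm_form D \<delta>) = norm_form D (\<delta> \<otimes>\<^bsub>quad_alg D\<^esub> \<kappa> [^]\<^bsub>quad_alg D\<^esub> (3::nat))"
proof -
  obtain u v p q where e: "\<delta> = (u, v)" "\<kappa> = (p, q)" by (cases \<delta>; cases \<kappa>)
  show ?thesis
    unfolding e quad_mat_def norm_form_def quad_cube quad_mult fst_conv snd_conv cubic_act_mat2 cubic.inject
    by (intro conjI; Groebner_Basis.algebra)
qed

text \<open>Elements of \<open>SL\<^sub>2\<close> relating two forms with Hessian \<open>x\<^sup>2 - D y\<^sup>2\<close> preserve this norm form, so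
  they are multiplications by elements of norm one.\<close>

lemma norm_form_transporter:
  fixes D :: "'a::field"
  assumes g: "g \<in> carrier SL2" and act: "cubic_act g (norm_form D \<delta>) = norm_form D \<delta>'"
    and N: "quad_norm D \<delta> = 1" "quad_norm D \<delta>' = 1" and "(2::'a) \<noteq> 0"
  shows "\<exists>\<kappa>. quad_norm D \<kappa> = 1 \<and> g = quad_mat D \<kappa>"
proof -
  obtain p q r s where g': "g = mat2 p q r s" by (rule mat2_cases)
  have det: "p * s - q * r = 1" using g unfolding g' SL2_carrier det_mat2 .
  have "hessian (norm_form D \<delta>') = (1 * p\<^sup>2 + 0 * p * q + - D * q\<^sup>2, 2 * 1 * p * r + 0 * (p * s + q * r) + 2 * - D * q * s,
     1 * r\<^sup>2 + 0 * r * s + - D * s\<^sup>2)"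
    unfolding act[symmetric] g' by (rule hessian_act[OF det hessian_norm_form[OF N(1)]])
  then have h: "p\<^sup>2 - D * q\<^sup>2 = 1" "2 * (p * r - D * q * s) = 0"
    unfolding hessian_norm_form[OF N(2)] by (auto simp: algebra_simps)
  have h2: "p * r - D * q * s = 0" using h(2) assms(5) by (metis mult_eq_0_iff)
  have "r = D * q" "s = p" using h(1) h2 det by Groebner_Basis.algebra+
  then show ?thesis using h(1) unfolding g'
    by (intro exI[of _ "(p, q)"]) (simp add: quad_norm_def quad_mat_def)
qed

text \<open>A nondegenerate quadratic form represents a nonzero value at \<open>(1, 0)\<close>,
  \<open>(0, 1)\<close> or \<open>(1, 1)\<close>; the matrices move that vector into first
  position.\<close>

lemma leading_hessian_nonzero:
  fixes f :: "'a::field cubic"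
  assumes "cubic_disc f \<noteq> 0"
  shows "\<exists>g\<in>carrier SL2. fst (hessian (cubic_act g f)) \<noteq> 0"
proof -
  obtain A B C where H: "hessian f = (A, B, C)" by (cases "hessian f")
  have d: "B\<^sup>2 - 4 * A * C \<noteq> 0" using hessian_disc[OF H] assms by simp
  note act = hessian_act[OF _ H]
  consider "A \<noteq> 0" | "A = 0" "C \<noteq> 0" | "A = 0" "C = 0" "B \<noteq> 0" using d by fastforce
  then show ?thesis
  proof cases
    case 1
    then show ?thesis using act[of 1 1 0 0]
      by (intro bexI[of _ "mat2 1 0 0 1"]) (simp_all add: SL2_carrier det_mat2)
  next
    case 2
    then show ?thesis using act[of 0 0 1 "- 1"]
      by (intro bexI[of _ "mat2 0 1 (- 1) 0"]) (simp_all add: SL2_carrier det_mat2)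
  next
    case 3
    then show ?thesis using act[of 1 1 1 0]
      by (intro bexI[of _ "mat2 1 1 0 1"]) (simp_all add: SL2_carrier det_mat2)
  qed
qed

text \<open>The syzygy \<open>4 H\<^sup>3 = T\<^sup>2 - disc f\<^sup>2\<close>, evaluated at \<open>(1, 0)\<close>, exhibits \<open>A\<close> as a norm \<open>m\<^sup>2 - D n\<^sup>2\<close>,
  and then the Hessian represents \<open>1\<close>.\<close>

lemma reduce_hessian:
  fixes a b c d D :: "'a::field"
  assumes disc: "cubic_disc (Cubic a b c d) = 4 * D" and A: "b\<^sup>2 - a * c \<noteq> 0" and 2: "(2::'a) \<noteq> 0"
  shows "\<exists>g\<in>carrier SL2. hessian (cubic_act g (Cubic a b c d)) = (1, 0, - D)"
proof -
  have cancel: "x = 0" if "k * x = 0" "k \<noteq> 0" for k x :: 'a using that by simp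
  define A B C where "A = b\<^sup>2 - a * c" and "B = b * c - a * d" and "C = c\<^sup>2 - b * d"
  \<comment> \<open>The numerator is the cubic covariant T at \<open>(1, 0)\<close>. With this
    scaling the syzygy becomes \<open>m^2 - D * n^2 = A\<close>.\<close>
  define m where "m = (a\<^sup>2 * d - 3 * a * b * c + 2 * b ^ 3) / (2 * A)"
  define n where "n = a / A"
  \<comment> \<open>Completes the square: the Hessian is
    \<open>A * (x + e * y)^2 - (D / A) * y^2\<close>.\<close>
  define e where "e = B / (2 * A)"
  have A0: "A \<noteq> 0" "2 * A \<noteq> 0" using A 2 unfolding A_def by auto
  have m: "2 * A * m = a\<^sup>2 * d - 3 * a * b * c + 2 * b ^ 3" and n: "A * n = a" and e: "2 * A * e = B"
    unfolding m_def n_def e_def using A0 by simp_all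
  have dABC: "B\<^sup>2 - 4 * A * C = 4 * D"
    using hessian_disc[of "Cubic a b c d"] disc unfolding A_def B_def C_def by simp
  have four: "(4::'a) \<noteq> 0" using 2 by (metis mult_eq_0_iff numeral_Bit0_eq_double)
  have eC: "A\<^sup>2 * e\<^sup>2 = A * C + D"
  proof -
    have "4 * (A\<^sup>2 * e\<^sup>2 - (A * C + D)) = 0" using dABC e by Groebner_Basis.algebra
    from cancel[OF this four] show ?thesis by simp
  qed
  have syz: "(a\<^sup>2 * d - 3 * a * b * c + 2 * b ^ 3)\<^sup>2 - 4 * D * a\<^sup>2 = 4 * A ^ 3"
    unfolding disc[symmetric] A_def cubic_disc.simps by Groebner_Basis.algebra
  have N: "m\<^sup>2 - D * n\<^sup>2 = A"
  proof -
    have "4 * A\<^sup>2 * (m\<^sup>2 - D * n\<^sup>2 - A) = 0" using syz m n by Groebner_Basis.algebra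
    moreover have "4 * A\<^sup>2 \<noteq> 0" using four A0 by simp
    ultimately have "m\<^sup>2 - D * n\<^sup>2 - A = 0" by (rule cancel)
    then show ?thesis by simp
  qed
  \<comment> \<open>The rows \<open>(x1, n)\<close> and \<open>(x2, m)\<close> are chosen so that
    the completed variable \<open>x + e * y\<close> takes the values \<open>m / A\<close> and
    \<open>n * D / A\<close>. They are then orthogonal for the Hessian, with values \<open>1\<close>
    and \<open>- D\<close>, because \<open>m^2 - D * n^2 = A\<close>.\<close>
  define x1 where "x1 = m / A - e * n"
  define x2 where "x2 = n * D / A - e * m"
  have x1: "A * x1 = m - A * e * n" and x2: "A * x2 = n * D - A * e * m"
    unfolding x1_def x2_def using A0 by (simp_all add: right_diff_distrib)
  have det: "x1 * m - n * x2 = 1"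
  proof -
    have "A * (x1 * m - n * x2 - 1) = 0" using x1 x2 N by Groebner_Basis.algebra
    from cancel[OF this A0(1)] show ?thesis by simp
  qed
  have H: "hessian (Cubic a b c d) = (A, B, C)" unfolding A_def B_def C_def by simp
  have AC: "A * C = A\<^sup>2 * e\<^sup>2 - D" using eC by simp
  have h1: "A * x1\<^sup>2 + B * x1 * n + C * n\<^sup>2 = 1"
  proof -
    have "A * (A * x1\<^sup>2 + B * x1 * n + C * n\<^sup>2 - 1) = (A * x1)\<^sup>2 + B * n * (A * x1) + A * C * n\<^sup>2 - A"
      by Groebner_Basis.algebra
    also have "\<dots> = m\<^sup>2 - D * n\<^sup>2 - A"
      unfolding x1 AC e[symmetric] by Groebner_Basis.algebra
    finally have "A * (A * x1\<^sup>2 + B * x1 * n + C * n\<^sup>2 - 1) = 0" unfolding N by simp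
    from cancel[OF this A0(1)] show ?thesis by simp
  qed
  have h2: "2 * A * x1 * x2 + B * (x1 * m + n * x2) + 2 * C * n * m = 0"
  proof -
    have "A * (2 * A * x1 * x2 + B * (x1 * m + n * x2) + 2 * C * n * m) =
        2 * (A * x1) * (A * x2) + B * (m * (A * x1) + n * (A * x2)) + 2 * (A * C) * n * m"
      by Groebner_Basis.algebra
    also have "\<dots> = 0" unfolding x1 x2 AC e[symmetric] by Groebner_Basis.algebra
    finally have "A * (2 * A * x1 * x2 + B * (x1 * m + n * x2) + 2 * C * n * m) = 0" .
    from cancel[OF this A0(1)] show ?thesis by simp
  qed
  have h3: "A * x2\<^sup>2 + B * x2 * m + C * m\<^sup>2 = - D"
  proof -
    have "A * (A * x2\<^sup>2 + B * x2 * m + C * m\<^sup>2 + D) = (A * x2)\<^sup>2 + B * m * (A * x2) + A * C * m\<^sup>2 + A * D"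
      by Groebner_Basis.algebra
    also have "\<dots> = D * (A - (m\<^sup>2 - D * n\<^sup>2))"
      unfolding x2 AC e[symmetric] by Groebner_Basis.algebra
    finally have "A * (A * x2\<^sup>2 + B * x2 * m + C * m\<^sup>2 + D) = 0" unfolding N by simp
    from cancel[OF this A0(1)] show ?thesis by (simp add: eq_neg_iff_add_eq_0)
  qed
  have "hessian (cubic_act (mat2 x1 n x2 m) (Cubic a b c d)) = (1, 0, - D)"
    unfolding hessian_act[OF det H] h1 h2 h3 ..
  then show ?thesis using det by (intro bexI[of _ "mat2 x1 n x2 m"]) (simp_all add: SL2_carrier det_mat2)
qed

lemma cubic_reduction:
  fixes f :: "'a::field cubic"
  assumes disc: "cubic_disc f = 4 * D" and "D \<noteq> 0" and 2: "(2::'a) \<noteq> 0"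
  shows "\<exists>g\<in>carrier SL2. \<exists>\<delta>. quad_norm D \<delta> = 1 \<and> cubic_act g f = norm_form D \<delta>"
proof -
  have "(4::'a) \<noteq> 0" using 2 by (metis mult_eq_0_iff numeral_Bit0_eq_double)
  then obtain g where g: "g \<in> carrier SL2" "fst (hessian (cubic_act g f)) \<noteq> 0"
    using leading_hessian_nonzero[of f] assms by auto
  obtain a b c d where f': "cubic_act g f = Cubic a b c d" by (cases "cubic_act g f")
  have "cubic_disc (Cubic a b c d) = 4 * D"
    using cubic_disc_act[of g f] g(1) disc unfolding f' SL2_carrier by simp
  then obtain h where h: "h \<in> carrier SL2" "hessian (cubic_act h (Cubic a b c d)) = (1, 0, - D)"
    using reduce_hessian[OF _ _ 2] g(2) unfolding f' by fastforce
  have "h ** g \<in> carrier SL2" using g(1) h(1) by (simp add: SL2_carrier det_mul)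
  moreover obtain \<delta> where "quad_norm D \<delta> = 1" "cubic_act h (Cubic a b c d) = norm_form D \<delta>"
    using cubic_of_hessian[OF h(2)] by blast
  ultimately show ?thesis using f' by (metis cubic_act_mult)
qed

section \<open>Descent for quadratic algebras\<close>

lemma sqrt_exists: "\<exists>d :: 'k::alg_closed_field. d\<^sup>2 = D"
proof -
  have "\<exists>d. poly [:- D, 0, 1:] d = 0" by (rule alg_closed_imp_poly_has_root) simp
  then show ?thesis by (auto simp: power2_eq_square)
qed

lemma cube_root_exists: "\<exists>d :: 'k::alg_closed_field. d ^ 3 = D"
proof -
  have "\<exists>d. poly [:- D, 0, 0, 1:] d = 0" by (rule alg_closed_imp_poly_has_root) simp
  then obtain d where "poly [:- D, 0, 0, 1:] d = 0" by blast
  then have "d ^ 3 = D" by (simp add: power3_eq_cube mult.assoc)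
  then show ?thesis ..
qed

lemma of_nat_neq_0_alg_closure:
  assumes "Factorial_Ring.prime n" "CHAR('a::field) \<noteq> n"
  shows "(of_nat n :: 'a alg_closure) \<noteq> 0"
proof
  assume "(of_nat n :: 'a alg_closure) = 0"
  then have "CHAR('a) dvd n" by (simp add: of_nat_eq_0_iff_char_dvd)
  then have "CHAR('a) = 1" using assms by (auto simp: prime_nat_iff)
  then show False using CHAR_not_1[where ?'a = 'a] by simp
qed

section \<open>Automorphisms of the closure\<close>

lemma abs_galD:
  assumes "\<sigma> \<in> abs_gal"
  shows gal_bij: "bij \<sigma>" and gal_add: "\<sigma> (x + y) = \<sigma> x + \<sigma> y" and gal_mult: "\<sigma> (x * y) = \<sigma> x * \<sigma> y"
    and gal_base: "\<sigma> (to_ac a) = to_ac a"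
  using assms unfolding abs_gal_def by auto

lemma gal_simps:
  assumes "\<sigma> \<in> abs_gal"
  shows gal_0: "\<sigma> 0 = 0" and gal_1: "\<sigma> 1 = 1" and gal_numeral: "\<sigma> (numeral n) = numeral n"
    and gal_uminus: "\<sigma> (- x) = - \<sigma> x" and gal_diff: "\<sigma> (x - y) = \<sigma> x - \<sigma> y"
    and gal_power: "\<sigma> (x ^ k) = \<sigma> x ^ k" and gal_inverse: "\<sigma> (inverse x) = inverse (\<sigma> x)"
    and gal_divide: "\<sigma> (x / y) = \<sigma> x / \<sigma> y" and gal_eq_iff: "\<sigma> x = \<sigma> y \<longleftrightarrow> x = y"
proof -
  show 0: "\<sigma> 0 = 0" and 1: "\<sigma> 1 = 1" "\<sigma> (numeral n) = numeral n"
    using gal_base[OF assms, of 0] gal_base[OF assms, of 1] gal_base[OF assms, of "numeral n"] by simp_all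
  show um: "\<sigma> (- x) = - \<sigma> x" for x
    using gal_add[OF assms, of x "- x"] 0 by (simp add: eq_neg_iff_add_eq_0 add.commute)
  show "\<sigma> (x - y) = \<sigma> x - \<sigma> y" using gal_add[OF assms, of x "- y"] um by simp
  show "\<sigma> (x ^ k) = \<sigma> x ^ k" by (induction k) (simp_all add: 1 gal_mult[OF assms])
  show inv: "\<sigma> (inverse x) = inverse (\<sigma> x)" for x
  proof (cases "x = 0")
    case False
    then have "\<sigma> x * \<sigma> (inverse x) = 1" using gal_mult[OF assms, of x "inverse x"] 1 by simp
    then show ?thesis by (metis inverse_unique)
  qed (simp add: 0)
  show "\<sigma> (x / y) = \<sigma> x / \<sigma> y" using gal_mult[OF assms, of x "inverse y"] inv by (simp add: divide_inverse)
  show "\<sigma> x = \<sigma> y \<longleftrightarrow> x = y" using gal_bij[OF assms] by (metis bij_def inj_eq)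
qed

lemma abs_gal_id: "id \<in> abs_gal"
  unfolding abs_gal_def by simp

lemma abs_gal_comp: "\<sigma> \<in> abs_gal \<Longrightarrow> \<tau> \<in> abs_gal \<Longrightarrow> \<sigma> \<circ> \<tau> \<in> abs_gal"
  unfolding abs_gal_def by (auto intro: bij_comp)

lemma abs_gal_inv:
  assumes "\<sigma> \<in> abs_gal"
  shows "inv_into UNIV \<sigma> \<in> abs_gal"
proof -
  have b: "bij \<sigma>" by (rule gal_bij[OF assms])
  have s: "\<sigma> (inv_into UNIV \<sigma> x) = x" for x using b by (simp add: bij_is_surj surj_f_inv_f)
  have e: "inv_into UNIV \<sigma> (\<sigma> x) = x" for x using b by (simp add: bij_is_inj)
  have "inv_into UNIV \<sigma> (x + y) = inv_into UNIV \<sigma> x + inv_into UNIV \<sigma> y" for x y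
    using gal_add[OF assms, of "inv_into UNIV \<sigma> x" "inv_into UNIV \<sigma> y"] e[of "inv_into UNIV \<sigma> x + inv_into UNIV \<sigma> y"] by (simp add: s)
  moreover have "inv_into UNIV \<sigma> (x * y) = inv_into UNIV \<sigma> x * inv_into UNIV \<sigma> y" for x y
    using gal_mult[OF assms, of "inv_into UNIV \<sigma> x" "inv_into UNIV \<sigma> y"] e[of "inv_into UNIV \<sigma> x * inv_into UNIV \<sigma> y"] by (simp add: s)
  moreover have "inv_into UNIV \<sigma> (to_ac a) = to_ac a" for a using e[of "to_ac a"] gal_base[OF assms] by simp
  ultimately show ?thesis unfolding abs_gal_def using b by (simp add: bij_imp_bij_inv)
qed

lemma gal_sum: "\<sigma> \<in> abs_gal \<Longrightarrow> \<sigma> (sum f I) = (\<Sum>i\<in>I. \<sigma> (f i))"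
  by (induction I rule: infinite_finite_induct) (auto simp: gal_0 gal_add)

lemma gal_sqrt:
  assumes "\<sigma> \<in> abs_gal" "d\<^sup>2 = to_ac D"
  shows "\<sigma> d = d \<or> \<sigma> d = - d"
proof -
  have "(\<sigma> d)\<^sup>2 = d\<^sup>2" using gal_power[OF assms(1), of d 2] assms(2) gal_base[OF assms(1)] by simp
  then show ?thesis by (simp add: power2_eq_iff)
qed

text \<open>All conjugates are roots of one polynomial over the base. This makes the sums in Hilbert
  90 finite.\<close>

lemma gal_conjugates_finite: "finite {\<sigma> x | \<sigma>. \<sigma> \<in> abs_gal}"
proof -
  obtain P :: "'a poly" where P: "P \<noteq> 0" "poly (map_poly to_ac P) x = 0"
    using alg_closure_algebraic by blast
  have "\<sigma> x \<in> {y. poly (map_poly to_ac P) y = 0}" if \<sigma>: "\<sigma> \<in> abs_gal" for \<sigma>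
  proof -
    have "poly (map_poly to_ac P) (\<sigma> x) = \<sigma> (poly (map_poly to_ac P) x)"
      unfolding poly_altdef gal_sum[OF \<sigma>] gal_mult[OF \<sigma>] gal_power[OF \<sigma>]
      by (simp add: coeff_map_poly gal_base[OF \<sigma>])
    then show ?thesis using P(2) gal_0[OF \<sigma>] by simp
  qed
  then have "{\<sigma> x | \<sigma>. \<sigma> \<in> abs_gal} \<subseteq> {y. poly (map_poly to_ac P) y = 0}" by blast
  moreover have "finite {y. poly (map_poly to_ac P) y = 0}"
    using P(1) by (intro poly_roots_finite) (simp add: map_poly_eq_0_iff)
  ultimately show ?thesis by (rule finite_subset)
qed

lemma base_field_closed:
  assumes "x \<in> base_field" "y \<in> base_field"
  shows "x * y \<in> base_field" "x / y \<in> base_field" "x ^ n \<in> base_field"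
proof -
  obtain a b where "x = to_ac a" "y = to_ac b" using assms unfolding base_field_def by blast
  then have "x * y = to_ac (a * b)" "x / y = to_ac (a / b)" "x ^ n = to_ac (a ^ n)" by simp_all
  then show "x * y \<in> base_field" "x / y \<in> base_field" "x ^ n \<in> base_field"
    unfolding base_field_def by (metis rangeI)+
qed

section \<open>Units, splittings and extension of scalars for quadratic algebras\<close>

lemma quad_norm_conj: "z \<otimes>\<^bsub>quad_alg D\<^esub> (fst z, - snd z) = (quad_norm D z, 0)"
  by (simp add: quad_mult quad_norm_def power2_eq_square)

lemma quad_units_iff: "z \<in> Units (quad_alg D) \<longleftrightarrow> quad_norm D z \<noteq> 0"
proof
  assume "z \<in> Units (quad_alg D)"
  then obtain w where "w \<otimes>\<^bsub>quad_alg D\<^esub> z = \<one>\<^bsub>quad_alg D\<^esub>" unfolding Units_def by blast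
  then have "quad_norm D w * quad_norm D z = 1"
    by (simp add: quad_norm_mult[symmetric]) (simp add: quad_norm_def quad_one)
  then show "quad_norm D z \<noteq> 0" by auto
next
  assume N: "quad_norm D z \<noteq> 0"
  define w where "w = (fst z / quad_norm D z, - snd z / quad_norm D z)"
  have "z \<otimes>\<^bsub>quad_alg D\<^esub> w = \<one>\<^bsub>quad_alg D\<^esub>" "w \<otimes>\<^bsub>quad_alg D\<^esub> z = \<one>\<^bsub>quad_alg D\<^esub>"
    unfolding w_def quad_mult quad_one using N
    by (simp_all add: field_simps power2_eq_square) (simp_all add: quad_norm_def power2_eq_square algebra_simps)
  then show "z \<in> Units (quad_alg D)" unfolding Units_def by (auto simp: quad_alg_def)
qed

lemma quad_units_group: "comm_group (units_of (quad_alg D))"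
proof -
  interpret cring "quad_alg D" by (rule quad_alg_cring)
  show ?thesis by (rule units_comm_group)
qed

lemma quad_units_simps:
  "carrier (units_of (quad_alg D)) = Units (quad_alg D)"
  "mult (units_of (quad_alg D)) = mult (quad_alg D)" "one (units_of (quad_alg D)) = one (quad_alg D)"
  by (simp_all add: units_of_def)

lemma quad_units_pow: "z [^]\<^bsub>units_of (quad_alg D)\<^esub> (n::nat) = z [^]\<^bsub>quad_alg D\<^esub> n"
  by (simp add: nat_pow_def quad_units_simps)

text \<open>Evaluation of \<tau> at a square root \<open>d\<close> of \<open>D\<close>. The
  evaluations at \<open>d\<close> and \<open>- d\<close> together identify the algebra with two
  copies of the field when \<open>2 * d\<close> is nonzero.\<close>

definition split_at :: "'k::field \<Rightarrow> 'k \<times> 'k \<Rightarrow> 'k" where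
  "split_at d z = fst z + d * snd z"

lemma split_mult: "d\<^sup>2 = D \<Longrightarrow> split_at d (z \<otimes>\<^bsub>quad_alg D\<^esub> w) = split_at d z * split_at d w"
  unfolding split_at_def quad_mult by (auto simp: power2_eq_square algebra_simps)

lemma split_one: "split_at d \<one>\<^bsub>quad_alg D\<^esub> = 1"
  by (simp add: split_at_def quad_one)

lemma split_pow: "d\<^sup>2 = D \<Longrightarrow> split_at d (z [^]\<^bsub>quad_alg D\<^esub> (n::nat)) = split_at d z ^ n"
  by (induction n) (simp_all add: nat_pow_def split_one split_mult mult.commute)

lemma split_norm: "d\<^sup>2 = D \<Longrightarrow> quad_norm D z = split_at d z * split_at (- d) z"
  unfolding split_at_def quad_norm_def by (auto simp: power2_eq_square algebra_simps)

lemma split_eqI: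
  fixes d :: "'k::field"
  assumes "(2::'k) \<noteq> 0" "d \<noteq> 0" "split_at d z = split_at d w" "split_at (- d) z = split_at (- d) w"
  shows "z = w"
proof -
  have "split_at d z + split_at (- d) z = 2 * fst z" "split_at d z - split_at (- d) z = 2 * (d * snd z)"
    "split_at d w + split_at (- d) w = 2 * fst w" "split_at d w - split_at (- d) w = 2 * (d * snd w)"
    by (simp_all add: split_at_def)
  then have "2 * fst z = 2 * fst w" "2 * (d * snd z) = 2 * (d * snd w)" using assms(3,4) by metis+
  then show ?thesis using assms(1,2) by (simp add: prod_eq_iff)
qed

lemma split_surj:
  fixes d :: "'k::field"
  assumes "(2::'k) \<noteq> 0" "d \<noteq> 0"
  shows "\<exists>z. split_at d z = a \<and> split_at (- d) z = b"
proof -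
  define z where "z = ((a + b) / 2, (a - b) / (2 * d))"
  have "split_at d z = (a + b) / 2 + (a - b) / 2" "split_at (- d) z = (a + b) / 2 - (a - b) / 2"
    unfolding z_def split_at_def using assms by simp_all
  moreover have "(a + b) / 2 + (a - b) / 2 = (2 * a) / 2" "(a + b) / 2 - (a - b) / 2 = (2 * b) / 2"
    by (simp_all only: add_divide_distrib[symmetric] diff_divide_distrib[symmetric]) (simp_all add: algebra_simps)
  moreover have "(2 * a) / 2 = a" "(2 * b) / 2 = b" using assms(1) by simp_all
  ultimately show ?thesis by (intro exI[of _ z]) simp
qed

text \<open>The map from K into its scalar extension to the algebraic closure; its image consists of
  the rational elements.\<close>

definition quad_embed :: "'a::field \<times> 'a \<Rightarrow> 'a alg_closure \<times> 'a alg_closure" where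
  "quad_embed z = (to_ac (fst z), to_ac (snd z))"

lemma quad_embed_mult:
  "quad_embed (z \<otimes>\<^bsub>quad_alg D\<^esub> w) = quad_embed z \<otimes>\<^bsub>quad_alg (to_ac D)\<^esub> quad_embed w"
  by (simp add: quad_embed_def quad_mult)

lemma quad_embed_one: "quad_embed \<one>\<^bsub>quad_alg D\<^esub> = \<one>\<^bsub>quad_alg (to_ac D)\<^esub>"
  by (simp add: quad_embed_def quad_one)

lemma quad_embed_pow:
  "quad_embed (z [^]\<^bsub>quad_alg D\<^esub> (n::nat)) = quad_embed z [^]\<^bsub>quad_alg (to_ac D)\<^esub> n"
  by (induction n) (simp_all add: nat_pow_def quad_embed_one quad_embed_mult)

lemma quad_embed_norm: "quad_norm (to_ac D) (quad_embed z) = to_ac (quad_norm D z)"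
  by (simp add: quad_norm_def quad_embed_def)

lemma quad_embed_inject: "quad_embed z = quad_embed w \<longleftrightarrow> z = w"
  by (simp add: quad_embed_def prod_eq_iff)

lemma quad_embed_units: "quad_embed z \<in> Units (quad_alg (to_ac D)) \<longleftrightarrow> z \<in> Units (quad_alg D)"
  by (simp add: quad_units_iff quad_embed_norm)

lemma gal_quad_hom:
  assumes "\<sigma> \<in> abs_gal"
  shows gal_quad_mult: "gal_quad \<sigma> (z \<otimes>\<^bsub>quad_alg (to_ac D)\<^esub> w) =
      gal_quad \<sigma> z \<otimes>\<^bsub>quad_alg (to_ac D)\<^esub> gal_quad \<sigma> w"
    and gal_quad_one: "gal_quad \<sigma> \<one>\<^bsub>quad_alg (to_ac D)\<^esub> = \<one>\<^bsub>quad_alg (to_ac D)\<^esub>"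
    and gal_quad_norm: "quad_norm (to_ac D) (gal_quad \<sigma> z) = \<sigma> (quad_norm (to_ac D) z)"
    and gal_quad_embed: "gal_quad \<sigma> (quad_embed a) = quad_embed a"
  using assms
  by (simp_all add: gal_quad_def quad_mult quad_one quad_norm_def quad_embed_def gal_add gal_mult gal_base
      gal_0 gal_1 gal_diff gal_power)

lemma gal_quad_pow: "\<sigma> \<in> abs_gal \<Longrightarrow> gal_quad \<sigma> (z [^]\<^bsub>quad_alg (to_ac D)\<^esub> (n::nat)) =
    gal_quad \<sigma> z [^]\<^bsub>quad_alg (to_ac D)\<^esub> n"
  by (induction n) (simp_all add: nat_pow_def gal_quad_one gal_quad_mult)

lemma gal_quad_comp: "gal_quad (\<sigma> \<circ> \<tau>) z = gal_quad \<sigma> (gal_quad \<tau> z)"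
  by (simp add: gal_quad_def)

lemma gal_quad_units:
  "\<sigma> \<in> abs_gal \<Longrightarrow> z \<in> Units (quad_alg (to_ac D)) \<Longrightarrow> gal_quad \<sigma> z \<in> Units (quad_alg (to_ac D))"
  unfolding quad_units_iff gal_quad_norm using gal_eq_iff[of \<sigma> _ 0] gal_0[of \<sigma>] by metis

text \<open>Over an imperfect field the fixed elements are only radical over the base, but in the
  situations below some power prime to the characteristic is rational as well.\<close>

lemma (in group) subgroup_coprime_powers:
  assumes "subgroup H G" "x \<in> carrier G" "x [^] (a::nat) \<in> H" "x [^] (b::nat) \<in> H" "coprime a b" "a \<noteq> 0"
  shows "x \<in> H"
proof -
  obtain u v where uv: "a * u = b * v + 1" using bezout_nat[OF assms(6), of b] assms(5) by auto
  have p: "x [^] (n * k) \<in> H" if "x [^] n \<in> H" for n k :: nat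
  proof -
    interpret H: group "G\<lparr>carrier := H\<rparr>" using assms(1) by (rule subgroup_imp_group)
    have "(x [^] n) [^]\<^bsub>G\<lparr>carrier := H\<rparr>\<^esub> k \<in> H" using H.nat_pow_closed[of "x [^] n" k] that by simp
    then show ?thesis using assms(2) by (simp add: nat_pow_pow nat_pow_consistent[symmetric])
  qed
  have "x [^] (b * v) \<otimes> x \<in> H" using p[OF assms(3), of u] uv by simp
  moreover have "inv (x [^] (b * v)) \<in> H" using p[OF assms(4)] assms(1) by (rule subgroup.m_inv_closed[rotated])
  ultimately have "inv (x [^] (b * v)) \<otimes> (x [^] (b * v) \<otimes> x) \<in> H" using assms(1) by (metis subgroup.m_closed)
  then show ?thesis using assms(2) by (simp flip: m_assoc)
qed

lemma char_exponent_power: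
  "CHAR('a::field) \<noteq> 2 \<Longrightarrow> odd (char_exponent TYPE('a) ^ e)"
  "CHAR('a) \<noteq> 3 \<Longrightarrow> coprime (char_exponent TYPE('a) ^ e) 3"
  "char_exponent TYPE('a) ^ e \<noteq> 0"
proof -
  have p: "Factorial_Ring.prime CHAR('a)" if "CHAR('a) \<noteq> 0" using that by (simp add: prime_CHAR_semidom)
  show "odd (char_exponent TYPE('a) ^ e)" if "CHAR('a) \<noteq> 2"
    using p that prime_odd_nat[of "CHAR('a)"] prime_ge_2_nat[of "CHAR('a)"]
    by (cases "CHAR('a) = 0") (auto simp: char_exponent_def)
  show "coprime (char_exponent TYPE('a) ^ e) 3" if "CHAR('a) \<noteq> 3"
  proof (cases "CHAR('a) = 0")
    case False
    have "Factorial_Ring.prime (3::nat)" by simp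
    then have "coprime CHAR('a) 3" using p[OF False] that primes_coprime by blast
    then show ?thesis using False by (simp add: char_exponent_def)
  qed (simp add: char_exponent_def)
  show "char_exponent TYPE('a) ^ e \<noteq> 0" by (simp add: char_exponent_def)
qed

lemma frobenius_add:
  fixes x y :: "'a::field alg_closure"
  shows "(x + y) ^ (char_exponent TYPE('a) ^ e) = x ^ (char_exponent TYPE('a) ^ e) + y ^ (char_exponent TYPE('a) ^ e)"
proof (cases "CHAR('a) = 0")
  case False
  then have "Factorial_Ring.prime CHAR('a alg_closure)" by (simp add: prime_CHAR_semidom)
  then show ?thesis using False freshmans_dream'[where ?'a = "'a alg_closure"] by (simp add: char_exponent_def)
qed (simp add: char_exponent_def)

text \<open>Both coordinates are fixed, hence radical. A power of the characteristic exponent is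
  additive, so it acts on \<open>u + v \<tau>\<close> termwise; being odd, it turns \<tau> into a
  rational multiple of \<tau>. The computation is done in the two splittings.\<close>

lemma quad_fixed_descent:
  fixes D :: "'a::field"
  assumes "CHAR('a) \<noteq> 2" "D \<noteq> 0" and fixed: "\<And>\<sigma>. \<sigma> \<in> abs_gal \<Longrightarrow> gal_quad \<sigma> z = z"
  shows "\<exists>e. z [^]\<^bsub>quad_alg (to_ac D)\<^esub> (char_exponent TYPE('a) ^ e) \<in> range quad_embed"
proof -
  let ?q = "char_exponent TYPE('a)"
  obtain e1 where e1: "fst z ^ (?q ^ e1) \<in> base_field"
    using fixed_field_abs_gal[of "fst z"] fixed unfolding gal_quad_def by (metis fst_conv)
  obtain e2 where e2: "snd z ^ (?q ^ e2) \<in> base_field"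
    using fixed_field_abs_gal[of "snd z"] fixed unfolding gal_quad_def by (metis snd_conv)
  define N where "N = ?q ^ (e1 + e2)"
  have N1: "fst z ^ N \<in> base_field" "snd z ^ N \<in> base_field"
    using base_field_closed(3)[OF e1 e1, of "?q ^ e2"] base_field_closed(3)[OF e2 e2, of "?q ^ e1"]
    unfolding N_def by (simp_all add: power_add flip: power_mult) (simp add: mult.commute)
  have "odd N" unfolding N_def by (rule char_exponent_power(1)[OF assms(1)])
  \<comment> \<open>For a square root \<open>c\<close> of \<open>D\<close> this gives
    \<open>c^N = c * D^k\<close>.\<close>
  then obtain k where k: "N = 2 * k + 1" by (rule oddE)
  obtain a b where ab: "fst z ^ N = to_ac a" "snd z ^ N = to_ac b"
    using N1 unfolding base_field_def by blast
  obtain d :: "'a alg_closure" where d: "d\<^sup>2 = to_ac D" using sqrt_exists by blast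
  have d0: "d \<noteq> 0" using d assms(2) by auto
  have two: "(2::'a alg_closure) \<noteq> 0"
    using of_nat_neq_0_alg_closure[of 2, where ?'a = 'a] assms(1) by simp
  have sp: "split_at c (z [^]\<^bsub>quad_alg (to_ac D)\<^esub> N) = split_at c (to_ac a, to_ac D ^ k * to_ac b)"
    if c: "c\<^sup>2 = to_ac D" for c
  proof -
    have "split_at c (z [^]\<^bsub>quad_alg (to_ac D)\<^esub> N) = (fst z + c * snd z) ^ N"
      using split_pow[OF c] by (simp add: split_at_def)
    also have "\<dots> = fst z ^ N + c ^ N * snd z ^ N"
      unfolding N_def frobenius_add by (simp add: power_mult_distrib)
    also have "c ^ N = c * to_ac D ^ k" unfolding k c[symmetric] by (simp add: power_mult)
    finally show ?thesis unfolding ab split_at_def by simp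
  qed
  have "z [^]\<^bsub>quad_alg (to_ac D)\<^esub> N = (to_ac a, to_ac D ^ k * to_ac b)"
    by (rule split_eqI[OF two d0]) (simp_all add: sp d)
  also have "\<dots> = quad_embed (a, D ^ k * b)" by (simp add: quad_embed_def)
  finally show ?thesis unfolding N_def by blast
qed

lemma quad_embed_subgroup:
  "subgroup (quad_embed ` Units (quad_alg D)) (units_of (quad_alg (to_ac D)))"
proof -
  interpret U: comm_group "units_of (quad_alg (to_ac D))" by (rule quad_units_group)
  interpret K: comm_group "units_of (quad_alg D)" by (rule quad_units_group)
  interpret h: group_hom "units_of (quad_alg D)" "units_of (quad_alg (to_ac D))" quad_embed
    by unfold_locales (auto simp: hom_def quad_units_simps quad_embed_units quad_embed_mult)
  show ?thesis using h.img_is_subgroup by (simp add: quad_units_simps)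
qed

text \<open>A power of the characteristic exponent and the cube both carry \<open>z\<close> into the
  group of rational units, and the two exponents are coprime.\<close>

lemma quad_fixed_rational:
  fixes D :: "'a::field"
  assumes char: "CHAR('a) \<noteq> 2" "CHAR('a) \<noteq> 3" and "D \<noteq> 0" and z: "z \<in> Units (quad_alg (to_ac D))"
    and fixed: "\<And>\<sigma>. \<sigma> \<in> abs_gal \<Longrightarrow> gal_quad \<sigma> z = z"
    and cube: "z [^]\<^bsub>quad_alg (to_ac D)\<^esub> (3::nat) \<in> range quad_embed"
  shows "z \<in> quad_embed ` Units (quad_alg D)"
proof -
  interpret U: comm_group "units_of (quad_alg (to_ac D))" by (rule quad_units_group)
  obtain e where e: "z [^]\<^bsub>quad_alg (to_ac D)\<^esub> (char_exponent TYPE('a) ^ e) \<in> range quad_embed"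
    using quad_fixed_descent[OF char(1) assms(3) fixed] by blast
  have unit: "z [^]\<^bsub>quad_alg (to_ac D)\<^esub> (n::nat) \<in> quad_embed ` Units (quad_alg D)"
    if zn: "z [^]\<^bsub>quad_alg (to_ac D)\<^esub> n \<in> range quad_embed" for n
  proof -
    have "z [^]\<^bsub>quad_alg (to_ac D)\<^esub> n \<in> Units (quad_alg (to_ac D))"
      using U.nat_pow_closed[of z n] z by (simp add: quad_units_simps quad_units_pow)
    moreover obtain w where w: "z [^]\<^bsub>quad_alg (to_ac D)\<^esub> n = quad_embed w" using zn by (elim imageE)
    ultimately have "quad_embed w \<in> Units (quad_alg (to_ac D))" by simp
    then have "w \<in> Units (quad_alg D)" by (rule quad_embed_units[THEN iffD1])
    then show ?thesis unfolding w by (rule imageI)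
  qed
  show ?thesis
    by (rule U.subgroup_coprime_powers[OF quad_embed_subgroup, of z "char_exponent TYPE('a) ^ e" 3])
      (use z unit[OF e] unit[OF cube] char_exponent_power[where ?'a = 'a, of e] char in
        \<open>simp_all add: quad_units_simps quad_units_pow\<close>)
qed

text \<open>The scalar version, for norms: a Bezout relation writes \<open>x\<close> as a quotient
  of rational elements, with zero treated apart.\<close>

lemma fixed_rational:
  fixes x :: "'a::field alg_closure"
  assumes fixed: "\<And>\<sigma>. \<sigma> \<in> abs_gal \<Longrightarrow> \<sigma> x = x" and n: "x ^ n \<in> base_field" "n \<noteq> 0"
    and "\<And>e. coprime (char_exponent TYPE('a) ^ e) n"
  shows "x \<in> base_field"
proof (cases "x = 0")
  case True
  then show ?thesis using to_ac_0 unfolding base_field_def by (metis rangeI)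
next
  case False
  obtain e where e: "x ^ (char_exponent TYPE('a) ^ e) \<in> base_field" using fixed_field_abs_gal fixed by blast
  let ?a = "char_exponent TYPE('a) ^ e"
  obtain u v where uv: "?a * u = n * v + 1"
    using bezout_nat[OF char_exponent_power(3)[where ?'a = 'a, of e], of n] assms(4)[of e] by auto
  have "x * x ^ (n * v) = x ^ (?a * u)" unfolding uv by simp
  then have "x * (x ^ n) ^ v = (x ^ ?a) ^ u" by (simp only: power_mult)
  moreover have "(x ^ n) ^ v \<noteq> 0" using False by simp
  ultimately have "x = (x ^ ?a) ^ u / (x ^ n) ^ v" by (metis nonzero_eq_divide_eq)
  then show ?thesis using base_field_closed e n(1) by metis
qed

section \<open>The kernel as a module of order three\<close>

lemma (in group) order_3_elements:
  assumes "card (carrier G) = 3" "x \<in> carrier G" "x \<noteq> \<one>"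
  shows "carrier G = {\<one>, x, x \<otimes> x}" "x \<otimes> (x \<otimes> x) = \<one>" "x \<otimes> x \<noteq> \<one>" "x \<otimes> x \<noteq> x"
proof -
  show 3: "x \<otimes> (x \<otimes> x) = \<one>"
    using pow_order_eq_1[OF assms(2)] assms(1,2) by (simp add: order_def numeral_3_eq_3 m_assoc)
  show 1: "x \<otimes> x \<noteq> \<one>" using 3 assms(2,3) by auto
  show 2: "x \<otimes> x \<noteq> x" using assms(2,3) by (metis l_cancel_one)
  have "card {\<one>, x, x \<otimes> x} = 3" using assms(3) 1 2 by auto
  then show "carrier G = {\<one>, x, x \<otimes> x}"
    using assms card_seteq[of "carrier G" "{\<one>, x, x \<otimes> x}"] card.infinite by fastforce
qed

lemma order_3_iso:
  assumes "group G" "group H" "card (carrier G) = 3" "card (carrier H) = 3"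
  shows "\<exists>h. h \<in> iso G H"
proof -
  interpret G: group G by fact
  interpret H: group H by fact
  have "\<exists>x\<in>carrier G. x \<noteq> \<one>\<^bsub>G\<^esub>" "\<exists>y\<in>carrier H. y \<noteq> \<one>\<^bsub>H\<^esub>"
  proof -
    have "carrier G \<noteq> {\<one>\<^bsub>G\<^esub>}" "carrier H \<noteq> {\<one>\<^bsub>H\<^esub>}" using assms(3,4) by auto
    then show "\<exists>x\<in>carrier G. x \<noteq> \<one>\<^bsub>G\<^esub>" "\<exists>y\<in>carrier H. y \<noteq> \<one>\<^bsub>H\<^esub>" using G.one_closed H.one_closed by blast+
  qed
  then obtain x y where x: "x \<in> carrier G" "x \<noteq> \<one>\<^bsub>G\<^esub>" and y: "y \<in> carrier H" "y \<noteq> \<one>\<^bsub>H\<^esub>" by blast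
  note X = G.order_3_elements[OF assms(3) x] and Y = H.order_3_elements[OF assms(4) y]
  define h where "h z = (if z = \<one>\<^bsub>G\<^esub> then \<one>\<^bsub>H\<^esub> else if z = x then y else y \<otimes>\<^bsub>H\<^esub> y)" for z
  have h: "h \<one>\<^bsub>G\<^esub> = \<one>\<^bsub>H\<^esub>" "h x = y" "h (x \<otimes>\<^bsub>G\<^esub> x) = y \<otimes>\<^bsub>H\<^esub> y"
    unfolding h_def using x(2) X(3,4) by auto
  have X4: "(x \<otimes>\<^bsub>G\<^esub> x) \<otimes>\<^bsub>G\<^esub> x = \<one>\<^bsub>G\<^esub>" "(x \<otimes>\<^bsub>G\<^esub> x) \<otimes>\<^bsub>G\<^esub> (x \<otimes>\<^bsub>G\<^esub> x) = x"
    using X(2) x by (simp_all add: G.m_assoc)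
  have Y4: "(y \<otimes>\<^bsub>H\<^esub> y) \<otimes>\<^bsub>H\<^esub> y = \<one>\<^bsub>H\<^esub>" "(y \<otimes>\<^bsub>H\<^esub> y) \<otimes>\<^bsub>H\<^esub> (y \<otimes>\<^bsub>H\<^esub> y) = y"
    using Y(2) y by (simp_all add: H.m_assoc)
  have "h \<in> hom G H"
  proof (rule homI)
    fix z assume "z \<in> carrier G"
    then show "h z \<in> carrier H" unfolding h_def using y by simp
  next
    fix z w assume "z \<in> carrier G" "w \<in> carrier G"
    then have "z = \<one>\<^bsub>G\<^esub> \<or> z = x \<or> z = x \<otimes>\<^bsub>G\<^esub> x" "w = \<one>\<^bsub>G\<^esub> \<or> w = x \<or> w = x \<otimes>\<^bsub>G\<^esub> x" using X(1) by auto
    then show "h (z \<otimes>\<^bsub>G\<^esub> w) = h z \<otimes>\<^bsub>H\<^esub> h w"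
      using x y by (elim disjE) (simp_all add: h X(2) X4 Y(2) Y4)
  qed
  moreover have "h ` carrier G = carrier H" unfolding X(1) Y(1) using h by simp
  moreover have "inj_on h (carrier G)" unfolding X(1) using h x y X(3,4) Y(3,4) by (auto simp: inj_on_def)
  ultimately show ?thesis unfolding iso_def bij_betw_def by blast
qed

text \<open>A basic open set of the product topology prescribes finitely many values, so continuity
  into a discrete set means being locally constant. All cocycles are handled in this form.\<close>

lemma krull_continuous_iff:
  fixes c :: "('b::field alg_closure \<Rightarrow> 'b alg_closure) \<Rightarrow> 'c"
  assumes "c \<in> abs_gal \<rightarrow> S"
  shows "continuous_map krull_topology (discrete_topology S) c \<longleftrightarrow>
    (\<forall>\<sigma>\<in>abs_gal. \<exists>T. finite T \<and> (\<forall>\<tau>\<in>abs_gal. (\<forall>x\<in>T. \<tau> x = \<sigma> x) \<longrightarrow> c \<tau> = c \<sigma>))"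
proof -
  let ?P = "product_topology (\<lambda>_ :: 'b alg_closure. discrete_topology (UNIV :: 'b alg_closure set)) UNIV"
  have top: "topspace krull_topology = abs_gal" unfolding krull_topology_def by simp
  show ?thesis
  proof
    assume cont: "continuous_map krull_topology (discrete_topology S) c"
    show "\<forall>\<sigma>\<in>abs_gal. \<exists>T. finite T \<and> (\<forall>\<tau>\<in>abs_gal. (\<forall>x\<in>T. \<tau> x = \<sigma> x) \<longrightarrow> c \<tau> = c \<sigma>)"
    proof
      fix \<sigma> :: "'b alg_closure \<Rightarrow> 'b alg_closure" assume \<sigma>: "\<sigma> \<in> abs_gal"
      have "openin krull_topology {\<tau> \<in> topspace krull_topology. c \<tau> \<in> {c \<sigma>}}"
        using cont assms \<sigma> by (intro openin_continuous_map_preimage) auto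
      then obtain U where U: "openin ?P U" "{\<tau> \<in> abs_gal. c \<tau> = c \<sigma>} = U \<inter> abs_gal"
        unfolding krull_topology_def openin_subtopology by auto
      then have "\<sigma> \<in> U" using \<sigma> by blast
      then obtain B where B: "finite {i \<in> UNIV. B i \<noteq> topspace (discrete_topology UNIV)}"
        "\<sigma> \<in> Pi\<^sub>E UNIV B" "Pi\<^sub>E UNIV B \<subseteq> U"
        using U(1) unfolding openin_product_topology_alt by blast
      \<comment> \<open>The finitely many coordinates that the basic box constrains.\<close>
      let ?T = "{i. B i \<noteq> UNIV}"
      have "c \<tau> = c \<sigma>" if \<tau>: "\<tau> \<in> abs_gal" "\<forall>x\<in>?T. \<tau> x = \<sigma> x" for \<tau>
      proof -
        have "\<tau> x \<in> B x" for x using \<tau>(2) B(2) by (cases "B x = UNIV") (auto simp: PiE_def Pi_def)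
        then have "\<tau> \<in> U" using B(3) by (auto simp: PiE_def)
        then show ?thesis using U(2) \<tau>(1) by blast
      qed
      then show "\<exists>T. finite T \<and> (\<forall>\<tau>\<in>abs_gal. (\<forall>x\<in>T. \<tau> x = \<sigma> x) \<longrightarrow> c \<tau> = c \<sigma>)"
        using B(1) by (intro exI[of _ ?T]) simp
    qed
  next
    assume loc: "\<forall>\<sigma>\<in>abs_gal. \<exists>T. finite T \<and> (\<forall>\<tau>\<in>abs_gal. (\<forall>x\<in>T. \<tau> x = \<sigma> x) \<longrightarrow> c \<tau> = c \<sigma>)"
    show "continuous_map krull_topology (discrete_topology S) c"
      unfolding continuous_map_def top
    proof (intro conjI allI impI)
      show "c \<in> abs_gal \<rightarrow> topspace (discrete_topology S)" using assms by simp
      fix U assume "openin (discrete_topology S) U"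
      show "openin krull_topology {\<sigma> \<in> abs_gal. c \<sigma> \<in> U}"
      proof (subst openin_subopen, intro ballI)
        fix \<sigma> assume \<sigma>: "\<sigma> \<in> {\<sigma> \<in> abs_gal. c \<sigma> \<in> U}"
        then obtain T where T: "finite T" "\<forall>\<tau>\<in>abs_gal. (\<forall>x\<in>T. \<tau> x = \<sigma> x) \<longrightarrow> c \<tau> = c \<sigma>" using loc by blast
        \<comment> \<open>The box of maps that agree with \<sigma> on \<open>T\<close>.\<close>
        define B where "B x = (if x \<in> T then {\<sigma> x} else UNIV)" for x
        have "{i \<in> UNIV. B i \<noteq> topspace (discrete_topology (UNIV :: 'b alg_closure set))} \<subseteq> T"
          unfolding B_def by auto
        then have "finite {i \<in> UNIV. B i \<noteq> topspace (discrete_topology (UNIV :: 'b alg_closure set))}"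
          using T(1) by (rule finite_subset)
        then have "openin ?P (Pi\<^sub>E UNIV B)"
          unfolding openin_PiE_gen by auto
        then have "openin krull_topology (Pi\<^sub>E UNIV B \<inter> abs_gal)"
          unfolding krull_topology_def openin_subtopology by blast
        moreover have "\<sigma> \<in> Pi\<^sub>E UNIV B \<inter> abs_gal" using \<sigma> unfolding B_def by auto
        moreover have "Pi\<^sub>E UNIV B \<inter> abs_gal \<subseteq> {\<sigma> \<in> abs_gal. c \<sigma> \<in> U}"
        proof
          fix \<tau> assume \<tau>: "\<tau> \<in> Pi\<^sub>E UNIV B \<inter> abs_gal"
          have "\<tau> x = \<sigma> x" if "x \<in> T" for x
          proof -
            have "\<tau> x \<in> B x" using \<tau> by (auto simp: PiE_def Pi_def)
            then show ?thesis using that unfolding B_def by simp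
          qed
          then have "\<forall>x\<in>T. \<tau> x = \<sigma> x" ..
          moreover have "\<tau> \<in> abs_gal" using \<tau> by (rule IntD2)
          ultimately have "c \<tau> = c \<sigma>" using T(2) by simp
          then show "\<tau> \<in> {\<sigma> \<in> abs_gal. c \<sigma> \<in> U}" using \<sigma> \<open>\<tau> \<in> abs_gal\<close> by simp
        qed
        ultimately show "\<exists>T. openin krull_topology T \<and> \<sigma> \<in> T \<and> T \<subseteq> {\<sigma> \<in> abs_gal. c \<sigma> \<in> U}" by blast
      qed
    qed
  qed
qed

section \<open>Norm-one cube roots of unity as a Galois module\<close>

lemma norm_one_mu3_simps:
  "mult (norm_one_mu3 D) = mult (quad_alg (to_ac D))" "one (norm_one_mu3 D) = one (quad_alg (to_ac D))"
  "z \<in> carrier (norm_one_mu3 D) \<longleftrightarrow> z [^]\<^bsub>quad_alg (to_ac D)\<^esub> (3::nat) = \<one>\<^bsub>quad_alg (to_ac D)\<^esub> \<and>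
    quad_norm (to_ac D) z = 1"
  by (auto simp: norm_one_mu3_def quad_units_simps quad_units_iff)

lemma norm_one_mu3_group: "group (norm_one_mu3 D)"
proof -
  interpret U: comm_group "units_of (quad_alg (to_ac D))" by (rule quad_units_group)
  let ?Q = "quad_alg (to_ac D)"
  let ?C = "{z \<in> Units ?Q. z [^]\<^bsub>?Q\<^esub> (3::nat) = \<one>\<^bsub>?Q\<^esub> \<and> quad_norm (to_ac D) z = 1}"
  have "subgroup ?C (units_of ?Q)"
  proof (rule U.subgroupI)
    show "?C \<subseteq> carrier (units_of ?Q)" by (auto simp: quad_units_simps)
    have "\<one>\<^bsub>?Q\<^esub> \<in> ?C" using U.one_closed U.nat_pow_one[of 3]
      by (simp add: quad_units_simps quad_units_pow) (simp add: quad_norm_def quad_one)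
    then show "?C \<noteq> {}" by blast
  next
    fix z assume z: "z \<in> ?C"
    then have zc: "z \<in> carrier (units_of ?Q)" by (simp add: quad_units_simps)
    have "inv\<^bsub>units_of ?Q\<^esub> z \<in> Units ?Q" using U.inv_closed[OF zc] by (simp add: quad_units_simps)
    moreover have "inv\<^bsub>units_of ?Q\<^esub> z [^]\<^bsub>?Q\<^esub> (3::nat) = \<one>\<^bsub>?Q\<^esub>"
      using U.nat_pow_inv[OF zc, of 3] z U.inv_one by (simp add: quad_units_simps quad_units_pow)
    moreover have "quad_norm (to_ac D) (inv\<^bsub>units_of ?Q\<^esub> z) = 1"
    proof -
      have "quad_norm (to_ac D) (z \<otimes>\<^bsub>?Q\<^esub> inv\<^bsub>units_of ?Q\<^esub> z) = 1"
        using U.r_inv[OF zc] by (simp add: quad_units_simps) (simp add: quad_norm_def quad_one)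
      then show ?thesis unfolding quad_norm_mult using z by simp
    qed
    ultimately show "inv\<^bsub>units_of ?Q\<^esub> z \<in> ?C" by blast
  next
    fix z w assume zw: "z \<in> ?C" "w \<in> ?C"
    then have c: "z \<in> carrier (units_of ?Q)" "w \<in> carrier (units_of ?Q)" by (simp_all add: quad_units_simps)
    show "z \<otimes>\<^bsub>units_of ?Q\<^esub> w \<in> ?C"
      using U.m_closed[OF c] U.nat_pow_distrib[OF c, of 3] zw U.r_one[OF U.one_closed]
      by (simp add: quad_units_simps quad_units_pow quad_norm_mult)
  qed
  then show ?thesis unfolding norm_one_mu3_def by (rule U.subgroup_imp_group)
qed

text \<open>What is kept of the kernel of the isogeny: three points with Galois acting through a
  quadratic character. \<open>D\<close> and \<open>s\<close> witness that \<open>Dhat\<close>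
  defines the mirror algebra.\<close>

locale mirror_module = comm_group M for M :: "('a::field alg_closure, 'n::finite) point monoid" (structure) +
  fixes D s Dhat :: 'a
  assumes char: "CHAR('a) \<noteq> 2" "CHAR('a) \<noteq> 3" and card_M: "card (carrier M) = 3"
    and action: "quadratic_action_by M D" and s: "s \<noteq> 0" and Dhat: "Dhat = - 3 * D * s\<^sup>2"
begin

lemma two: "(2::'a) \<noteq> 0" and three: "(3::'a) \<noteq> 0"
  and two': "(2::'a alg_closure) \<noteq> 0" and three': "(3::'a alg_closure) \<noteq> 0"
proof -
  show 2: "(2::'a alg_closure) \<noteq> 0" and 3: "(3::'a alg_closure) \<noteq> 0"
    using of_nat_neq_0_alg_closure[of 2, where ?'a = 'a] of_nat_neq_0_alg_closure[of 3, where ?'a = 'a] char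
    by simp_all
  show "(2::'a) \<noteq> 0" "(3::'a) \<noteq> 0"
    using 2 3 to_ac_numeral[of "Num.Bit0 Num.One", where ?'a = 'a] to_ac_numeral[of "Num.Bit1 Num.One", where ?'a = 'a]
    by (auto simp del: to_ac_numeral)
qed

lemma D0: "D \<noteq> 0" using action unfolding quadratic_action_by_def by simp

lemma Dhat0: "Dhat \<noteq> 0" unfolding Dhat using D0 s three by simp

text \<open>One fixed square root; the Galois action on the module is then read off from its
  sign.\<close>

definition d0 :: "'a alg_closure" where "d0 = (SOME d. d\<^sup>2 = to_ac D)"

lemma d0: "d0\<^sup>2 = to_ac D"
  unfolding d0_def by (rule someI_ex) (rule sqrt_exists)

lemma d0_nz: "d0 \<noteq> 0" using d0 D0 by auto

lemma gal_d0: "\<sigma> \<in> abs_gal \<Longrightarrow> \<sigma> d0 = d0 \<or> \<sigma> d0 = - d0"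
  using gal_sqrt d0 by blast

lemma gal_point_eq:
  "\<sigma> \<in> abs_gal \<Longrightarrow> P \<in> carrier M \<Longrightarrow> gal_point \<sigma> P = (if \<sigma> d0 = d0 then P else inv P)"
  using action d0 unfolding quadratic_action_by_def by blast

text \<open>The \<tau>-coordinate of a nontrivial element of mu3. It satisfies
  \<open>4 * Dhat * e0^2 = - 3\<close> because \<open>Dhat = - 3 * D * s^2\<close>, and its sign
  follows that of \<open>d0\<close>.\<close>

definition e0 :: "'a alg_closure" where "e0 = 1 / (2 * to_ac s * d0)"

lemma e0: "4 * (to_ac Dhat * e0\<^sup>2) = - 3" "e0 \<noteq> 0"
proof -
  have n: "2 * to_ac s * d0 \<noteq> 0" using two' s d0_nz by simp
  then have "e0 * (2 * to_ac s * d0) = 1" unfolding e0_def by simp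
  then have "e0\<^sup>2 * (2 * to_ac s * d0)\<^sup>2 = 1" by (metis power_mult_distrib one_power2)
  then have "4 * (e0\<^sup>2 * to_ac s ^ 2 * to_ac D) = 1" by (simp add: power_mult_distrib d0 mult_ac)
  note one = this
  have "to_ac Dhat = - 3 * to_ac D * (to_ac s)\<^sup>2" unfolding Dhat by simp
  then have "4 * (to_ac Dhat * e0\<^sup>2) = - 3 * (4 * (e0\<^sup>2 * to_ac s ^ 2 * to_ac D))" by Groebner_Basis.algebra
  then show "4 * (to_ac Dhat * e0\<^sup>2) = - 3" unfolding one by simp
  show "e0 \<noteq> 0" unfolding e0_def using n by simp
qed

text \<open>Eliminating \<open>v\<close> by the norm equation turns the first coordinate of the cube
  into \<open>4 * u^3 - 3 * u\<close>. Setting this equal to \<open>1\<close> leaves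
  \<open>u = 1\<close> or \<open>u = - 1 / 2\<close>.\<close>

lemma mu3_elements:
  "z \<in> carrier (norm_one_mu3 Dhat) \<longleftrightarrow> z = (1, 0) \<or> z = (- 1 / 2, e0) \<or> z = (- 1 / 2, - e0)"
proof
  assume "z = (1, 0) \<or> z = (- 1 / 2, e0) \<or> z = (- 1 / 2, - e0)"
  moreover have "(- 1 / 2, e) \<in> carrier (norm_one_mu3 Dhat)" if e: "4 * (to_ac Dhat * e\<^sup>2) = - 3" for e
  proof -
    define h :: "'a alg_closure" where "h = - 1 / 2"
    have h: "2 * h = - 1" unfolding h_def using two' by simp
    have c: "x = 0" if "4 * x = 0" for x :: "'a alg_closure"
    proof -
      have "2 * (2 * x) = 0" using that by simp
      then show ?thesis using two' by (metis mult_eq_0_iff)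
    qed
    have "4 * (h\<^sup>2 - to_ac Dhat * e\<^sup>2 - 1) = 0" using h e by Groebner_Basis.algebra
    from c[OF this] have "h\<^sup>2 - to_ac Dhat * e\<^sup>2 = 1" by simp
    moreover have "4 * (4 * (h ^ 3 + 3 * to_ac Dhat * h * e\<^sup>2 - 1)) = 0" using h e by Groebner_Basis.algebra
    from c[OF c[OF this]] have "h ^ 3 + 3 * to_ac Dhat * h * e\<^sup>2 = 1" by simp
    moreover have "4 * (3 * h\<^sup>2 * e + to_ac Dhat * e ^ 3) = 0" using h e by Groebner_Basis.algebra
    from c[OF this] have "3 * h\<^sup>2 * e + to_ac Dhat * e ^ 3 = 0" .
    ultimately show ?thesis
      unfolding norm_one_mu3_simps quad_cube quad_one h_def[symmetric] by (simp add: quad_norm_def)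
  qed
  moreover have "(1, 0) \<in> carrier (norm_one_mu3 Dhat)"
    unfolding norm_one_mu3_simps quad_cube quad_one by (simp add: quad_norm_def)
  ultimately show "z \<in> carrier (norm_one_mu3 Dhat)" using e0(1) by auto
next
  assume z: "z \<in> carrier (norm_one_mu3 Dhat)"
  obtain u v where uv: "z = (u, v)" by (cases z)
  have N: "u\<^sup>2 - to_ac Dhat * v\<^sup>2 = 1" and C: "u ^ 3 + 3 * to_ac Dhat * u * v\<^sup>2 = 1"
    using z unfolding uv norm_one_mu3_simps quad_cube quad_one by (simp_all add: quad_norm_def)
  \<comment> \<open>The factorization of \<open>4 * u^3 - 3 * u - 1\<close>.\<close>
  have "(u - 1) * (2 * u + 1)\<^sup>2 = 0" using N C by Groebner_Basis.algebra
  then consider "u = 1" | "2 * u + 1 = 0" by auto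
  then show "z = (1, 0) \<or> z = (- 1 / 2, e0) \<or> z = (- 1 / 2, - e0)"
  proof cases
    case 1
    then show ?thesis using N Dhat0 unfolding uv by simp
  next
    case 2
    then have "2 * u = - 1" by (simp add: eq_neg_iff_add_eq_0)
    then have u: "u = - 1 / 2" using two' by (simp add: field_simps)
    have "to_ac Dhat * (4 * (v\<^sup>2 - e0\<^sup>2)) = 0" using N 2 e0(1) by Groebner_Basis.algebra
    then have "4 * (v\<^sup>2 - e0\<^sup>2) = 0" using Dhat0 by (metis mult_eq_0_iff to_ac_eq_0_iff)
    then have "2 * (2 * (v\<^sup>2 - e0\<^sup>2)) = 0" by simp
    then have "v\<^sup>2 - e0\<^sup>2 = 0" using two' by (metis mult_eq_0_iff)
    then have "v = e0 \<or> v = - e0" by (simp add: power2_eq_iff)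
    then show ?thesis unfolding uv u by auto
  qed
qed

lemma e0_neg: "- e0 \<noteq> e0"
proof
  assume "- e0 = e0"
  then have "2 * e0 = 0" by (metis add_eq_0_iff mult_2)
  then show False using e0(2) two' by simp
qed

lemma card_mu3: "card (carrier (norm_one_mu3 Dhat)) = 3"
proof -
  have "carrier (norm_one_mu3 Dhat) = {(1, 0), (- 1 / 2, e0), (- 1 / 2, - e0)}" using mu3_elements by blast
  then show ?thesis using e0(2) e0_neg by (auto simp: card_insert_if)
qed

text \<open>Since \<open>s\<close> is rational, \<open>e0\<close> and \<open>d0\<close> change sign
  under the same automorphisms.\<close>

lemma gal_mu3:
  assumes "\<sigma> \<in> abs_gal" "z \<in> carrier (norm_one_mu3 Dhat)"
  shows "gal_quad \<sigma> z = (if \<sigma> d0 = d0 then z else (fst z, - snd z))"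
proof -
  have "\<sigma> e0 = (if \<sigma> d0 = d0 then e0 else - e0)"
    using gal_d0[OF assms(1)] unfolding e0_def
    by (auto simp: gal_divide[OF assms(1)] gal_mult[OF assms(1)] gal_numeral[OF assms(1)] gal_base[OF assms(1)] gal_1[OF assms(1)])
  then show ?thesis
    using assms(2) unfolding mu3_elements
    by (auto simp: gal_quad_def gal_0[OF assms(1)] gal_1[OF assms(1)] gal_divide[OF assms(1)]
        gal_uminus[OF assms(1)] gal_numeral[OF assms(1)])
qed

lemma mu3_inv:
  assumes "z \<in> carrier (norm_one_mu3 Dhat)"
  shows "inv\<^bsub>norm_one_mu3 Dhat\<^esub> z = (fst z, - snd z)"
proof -
  interpret G: group "norm_one_mu3 Dhat" by (rule norm_one_mu3_group)
  have "(fst z, - snd z) \<in> carrier (norm_one_mu3 Dhat)" using assms unfolding mu3_elements by auto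
  moreover have "z \<otimes>\<^bsub>norm_one_mu3 Dhat\<^esub> (fst z, - snd z) = \<one>\<^bsub>norm_one_mu3 Dhat\<^esub>"
    using assms by (simp add: norm_one_mu3_simps quad_norm_conj) (simp add: quad_one)
  ultimately show ?thesis using G.inv_equality G.inv_comm assms by metis
qed

text \<open>On both sides an automorphism acts as the identity or as inversion according to the sign
  of \<open>d0\<close>, and homomorphisms commute with inversion. Equivariance is thus
  automatic.\<close>

lemma mu3_isos_eq: "mu3_isos M Dhat = iso M (norm_one_mu3 Dhat)"
proof -
  interpret G: group "norm_one_mu3 Dhat" by (rule norm_one_mu3_group)
  have "\<iota> (gal_point \<sigma> P) = gal_quad \<sigma> (\<iota> P)"
    if \<iota>: "\<iota> \<in> iso M (norm_one_mu3 Dhat)" and \<sigma>: "\<sigma> \<in> abs_gal" and P: "P \<in> carrier M" for \<iota> \<sigma> P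
  proof -
    interpret h: group_hom M "norm_one_mu3 Dhat" \<iota> using \<iota> by unfold_locales (simp add: iso_def)
    show ?thesis
      using gal_mu3[OF \<sigma> h.hom_closed[OF P]] gal_point_eq[OF \<sigma> P] mu3_inv[OF h.hom_closed[OF P]] h.hom_inv[OF P]
      by simp
  qed
  then show ?thesis unfolding mu3_isos_def by blast
qed

lemma mu3_isos_nonempty: "mu3_isos M Dhat \<noteq> {}"
  unfolding mu3_isos_eq using order_3_iso[OF is_group norm_one_mu3_group card_M card_mu3] by blast

end

section \<open>Hilbert 90\<close>

text \<open>Artin's argument with the arguments confined to a multiplicative set \<open>E\<close>.
  In Hilbert 90 the maps are coset representatives, which are told apart by elements of the finite
  level \<open>E\<close>.\<close>

lemma independence_of_characters:
  fixes E :: "'k::field set" and R :: "('k \<Rightarrow> 'k) set"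
  assumes "finite R" and E: "1 \<in> E" "\<And>x y. x \<in> E \<Longrightarrow> y \<in> E \<Longrightarrow> x * y \<in> E"
    and R: "\<And>r. r \<in> R \<Longrightarrow> r 1 = 1" "\<And>r x y. r \<in> R \<Longrightarrow> r (x * y) = r x * r y"
    and sep: "\<And>r r'. r \<in> R \<Longrightarrow> r' \<in> R \<Longrightarrow> r \<noteq> r' \<Longrightarrow> \<exists>x\<in>E. r x \<noteq> r' x"
    and zero: "\<And>g. g \<in> E \<Longrightarrow> (\<Sum>r\<in>R. a r * r g) = 0"
  shows "\<forall>r\<in>R. a r = 0"
  using assms(1) R sep zero
proof (induction R arbitrary: a rule: finite_induct)
  case (insert \<rho> R)
  \<comment> \<open>The relation at \<open>h * g\<close> minus \<rho>(h) times the relation at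
    \<open>g\<close> no longer contains \<rho>.\<close>
  have IH: "\<forall>r\<in>R. a r * (r h - \<rho> h) = 0" if h: "h \<in> E" for h
  proof (rule insert.IH)
    fix g assume g: "g \<in> E"
    have "(\<Sum>r\<in>insert \<rho> R. a r * r (h * g)) - \<rho> h * (\<Sum>r\<in>insert \<rho> R. a r * r g) = 0"
      using insert.prems(4)[OF E(2)[OF h g]] insert.prems(4)[OF g] by simp
    moreover have "(\<Sum>r\<in>insert \<rho> R. a r * r (h * g)) = (\<Sum>r\<in>insert \<rho> R. a r * (r h * r g))"
      using insert.prems(2) by (intro sum.cong) auto
    ultimately have "(\<Sum>r\<in>R. a r * (r h * r g)) - (\<Sum>r\<in>R. \<rho> h * (a r * r g)) = 0"
      using insert.hyps by (simp add: sum_distrib_left algebra_simps)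
    then show "(\<Sum>r\<in>R. a r * (r h - \<rho> h) * r g) = 0"
      by (simp add: sum_subtractf[symmetric] algebra_simps)
  qed (use insert.prems in auto)
  have R0: "a r = 0" if r: "r \<in> R" for r
  proof -
    have "r \<noteq> \<rho>" using r insert.hyps by blast
    then obtain h where h: "h \<in> E" "r h \<noteq> \<rho> h" using insert.prems(3) r by blast
    then show ?thesis using IH[OF h(1)] r by auto
  qed
  moreover have "a \<rho> = 0"
  proof -
    have "(\<Sum>r\<in>insert \<rho> R. a r * r 1) = a \<rho> * \<rho> 1" using insert.hyps R0 by simp
    then show ?thesis using insert.prems(4)[OF E(1)] insert.prems(1)[of \<rho>] by simp
  qed
  ultimately show ?case by blast
qed simp

lemma quad_carrier: "carrier (quad_alg D) = UNIV"
  by (simp add: quad_alg_def)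

lemma quad_cancel:
  assumes "\<beta> \<in> Units (quad_alg D)" "z \<otimes>\<^bsub>quad_alg D\<^esub> \<beta> = w \<otimes>\<^bsub>quad_alg D\<^esub> \<beta>"
  shows "z = w"
proof -
  interpret Q: cring "quad_alg D" by (rule quad_alg_cring)
  show ?thesis using Q.Units_l_cancel[OF assms(1), of z w] assms(2) Q.m_comm[of \<beta>] by (simp add: quad_carrier)
qed

lemma quad_divide:
  assumes "\<beta> \<in> Units (quad_alg D)"
  shows "\<exists>z. z \<otimes>\<^bsub>quad_alg D\<^esub> \<beta> = w"
proof -
  interpret Q: cring "quad_alg D" by (rule quad_alg_cring)
  show ?thesis using assms Q.Units_l_inv[OF assms]
    by (intro exI[of _ "w \<otimes>\<^bsub>quad_alg D\<^esub> inv\<^bsub>quad_alg D\<^esub> \<beta>"]) (simp add: Q.m_assoc quad_carrier)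
qed

lemma quad_assoc: "(x \<otimes>\<^bsub>quad_alg D\<^esub> y) \<otimes>\<^bsub>quad_alg D\<^esub> z = x \<otimes>\<^bsub>quad_alg D\<^esub> (y \<otimes>\<^bsub>quad_alg D\<^esub> z)"
  and quad_comm: "x \<otimes>\<^bsub>quad_alg D\<^esub> y = y \<otimes>\<^bsub>quad_alg D\<^esub> x"
  and quad_left_comm: "x \<otimes>\<^bsub>quad_alg D\<^esub> (y \<otimes>\<^bsub>quad_alg D\<^esub> z) = y \<otimes>\<^bsub>quad_alg D\<^esub> (x \<otimes>\<^bsub>quad_alg D\<^esub> z)"
  and quad_mult_one: "\<one>\<^bsub>quad_alg D\<^esub> \<otimes>\<^bsub>quad_alg D\<^esub> x = x" "x \<otimes>\<^bsub>quad_alg D\<^esub> \<one>\<^bsub>quad_alg D\<^esub> = x"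
  by (simp_all add: quad_mult quad_one algebra_simps)

lemma quad_pow_mult:
  "(x \<otimes>\<^bsub>quad_alg D\<^esub> y) [^]\<^bsub>quad_alg D\<^esub> (n::nat) = x [^]\<^bsub>quad_alg D\<^esub> n \<otimes>\<^bsub>quad_alg D\<^esub> y [^]\<^bsub>quad_alg D\<^esub> n"
  and quad_pow_pow: "(x [^]\<^bsub>quad_alg D\<^esub> (n::nat)) [^]\<^bsub>quad_alg D\<^esub> (k::nat) = x [^]\<^bsub>quad_alg D\<^esub> (n * k)"
  and quad_pow_add: "x [^]\<^bsub>quad_alg D\<^esub> (n + k) = x [^]\<^bsub>quad_alg D\<^esub> n \<otimes>\<^bsub>quad_alg D\<^esub> x [^]\<^bsub>quad_alg D\<^esub> k"
  and quad_one_pow: "\<one>\<^bsub>quad_alg D\<^esub> [^]\<^bsub>quad_alg D\<^esub> n = \<one>\<^bsub>quad_alg D\<^esub>"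
proof -
  interpret Q: cring "quad_alg D" by (rule quad_alg_cring)
  show "(x \<otimes>\<^bsub>quad_alg D\<^esub> y) [^]\<^bsub>quad_alg D\<^esub> n = x [^]\<^bsub>quad_alg D\<^esub> n \<otimes>\<^bsub>quad_alg D\<^esub> y [^]\<^bsub>quad_alg D\<^esub> n"
    by (rule Q.nat_pow_distrib) (simp_all add: quad_carrier)
  show "(x [^]\<^bsub>quad_alg D\<^esub> n) [^]\<^bsub>quad_alg D\<^esub> k = x [^]\<^bsub>quad_alg D\<^esub> (n * k)"
    by (rule Q.nat_pow_pow) (simp add: quad_carrier)
  show "x [^]\<^bsub>quad_alg D\<^esub> (n + k) = x [^]\<^bsub>quad_alg D\<^esub> n \<otimes>\<^bsub>quad_alg D\<^esub> x [^]\<^bsub>quad_alg D\<^esub> k"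
    by (rule Q.nat_pow_mult[symmetric]) (simp add: quad_carrier)
  show "\<one>\<^bsub>quad_alg D\<^esub> [^]\<^bsub>quad_alg D\<^esub> n = \<one>\<^bsub>quad_alg D\<^esub>" by simp
qed

lemma quad_units_closed:
  "x \<in> Units (quad_alg D) \<Longrightarrow> y \<in> Units (quad_alg D) \<Longrightarrow> x \<otimes>\<^bsub>quad_alg D\<^esub> y \<in> Units (quad_alg D)"
  and quad_units_pow_closed: "x \<in> Units (quad_alg D) \<Longrightarrow> x [^]\<^bsub>quad_alg D\<^esub> (n::nat) \<in> Units (quad_alg D)"
proof -
  interpret Q: cring "quad_alg D" by (rule quad_alg_cring)
  show "x \<in> Units (quad_alg D) \<Longrightarrow> y \<in> Units (quad_alg D) \<Longrightarrow> x \<otimes>\<^bsub>quad_alg D\<^esub> y \<in> Units (quad_alg D)"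
    by (rule Q.Units_m_closed)
  show "x \<in> Units (quad_alg D) \<Longrightarrow> x [^]\<^bsub>quad_alg D\<^esub> n \<in> Units (quad_alg D)"
    by (rule Q.Units_pow_closed)
qed

text \<open>The resolvent \<open>\<beta> = \<Sum> r(g) z(r)^(-1)\<close> over representatives of a
  finite quotient satisfies the required equation. Inverses are conjugates because \<open>z\<close>
  has norm one. Independence of characters makes \<beta> nonzero in each of the two splittings for
  some \<open>g\<close>, and one \<open>g\<close> can be found for both.\<close>

lemma hilbert_90:
  fixes D :: "'a::field" and z :: "('a alg_closure \<Rightarrow> 'a alg_closure) \<Rightarrow> 'a alg_closure \<times> 'a alg_closure"
  assumes norm: "\<And>\<sigma>. \<sigma> \<in> abs_gal \<Longrightarrow> quad_norm (to_ac D) (z \<sigma>) = 1"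
    and cocycle: "\<And>\<sigma> \<tau>. \<sigma> \<in> abs_gal \<Longrightarrow> \<tau> \<in> abs_gal \<Longrightarrow>
      z (\<sigma> \<circ> \<tau>) = z \<sigma> \<otimes>\<^bsub>quad_alg (to_ac D)\<^esub> gal_quad \<sigma> (z \<tau>)"
    and T: "finite T" and loc: "\<And>\<sigma>. \<sigma> \<in> abs_gal \<Longrightarrow> (\<forall>x\<in>T. \<sigma> x = x) \<Longrightarrow> z \<sigma> = \<one>\<^bsub>quad_alg (to_ac D)\<^esub>"
  shows "\<exists>\<beta>\<in>Units (quad_alg (to_ac D)). \<forall>\<sigma>\<in>abs_gal. gal_quad \<sigma> \<beta> = z \<sigma> \<otimes>\<^bsub>quad_alg (to_ac D)\<^esub> \<beta>"
proof -
  let ?Q = "quad_alg (to_ac D)"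
  \<comment> \<open>The restriction to \<open>T\<close> names the left coset of \<sigma> modulo the
    subgroup fixing \<open>T\<close>.\<close>
  define cl where "cl \<sigma> = restrict \<sigma> T" for \<sigma> :: "'a alg_closure \<Rightarrow> 'a alg_closure"
  have cl_iff: "cl \<sigma> = cl \<tau> \<longleftrightarrow> (\<forall>x\<in>T. \<sigma> x = \<tau> x)" for \<sigma> \<tau> unfolding cl_def by (metis restrict_apply' restrict_ext)
  have "cl ` abs_gal \<subseteq> Pi\<^sub>E T (\<lambda>x. {\<sigma> x | \<sigma>. \<sigma> \<in> abs_gal})" unfolding cl_def by auto
  then have fincl: "finite (cl ` abs_gal)"
    by (rule finite_subset) (intro finite_PiE T gal_conjugates_finite)
  \<comment> \<open>A representative depending only on the coset.\<close>
  define \<rho> where "\<rho> \<sigma> = (SOME \<tau>. \<tau> \<in> abs_gal \<and> cl \<tau> = cl \<sigma>)" for \<sigma>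
  have \<rho>: "\<rho> \<sigma> \<in> abs_gal" "cl (\<rho> \<sigma>) = cl \<sigma>" if "\<sigma> \<in> abs_gal" for \<sigma>
    using someI_ex[of "\<lambda>\<tau>. \<tau> \<in> abs_gal \<and> cl \<tau> = cl \<sigma>"] that unfolding \<rho>_def by blast+
  have \<rho>_cong: "cl \<sigma> = cl \<tau> \<Longrightarrow> \<rho> \<sigma> = \<rho> \<tau>" for \<sigma> \<tau> unfolding \<rho>_def by simp
  define R where "R = \<rho> ` abs_gal"
  have Rg: "r \<in> abs_gal" and Rr: "\<rho> r = r" if rR: "r \<in> R" for r
  proof -
    obtain \<sigma> where \<sigma>: "\<sigma> \<in> abs_gal" "r = \<rho> \<sigma>" using rR unfolding R_def by blast
    show "r \<in> abs_gal" unfolding \<sigma>(2) by (rule \<rho>(1)[OF \<sigma>(1)])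
    show "\<rho> r = r" unfolding \<sigma>(2) by (rule \<rho>_cong[OF \<rho>(2)[OF \<sigma>(1)]])
  qed
  have finR: "finite R"
  proof -
    have "inj_on cl R" using Rr \<rho>_cong by (metis inj_onI)
    moreover have "cl ` R \<subseteq> cl ` abs_gal" using Rg by blast
    ultimately show ?thesis using fincl by (metis finite_imageD finite_subset)
  qed
  \<comment> \<open>The fixed field of that subgroup. It contains \<open>T\<close>, so its elements
    distinguish the representatives.\<close>
  define E where "E = {x. \<forall>h\<in>abs_gal. (\<forall>y\<in>T. h y = y) \<longrightarrow> h x = x}"
  have TE: "T \<subseteq> E" unfolding E_def by blast
  have E1: "1 \<in> E" unfolding E_def using gal_1 by blast
  have Em: "x * y \<in> E" "x + y \<in> E" if "x \<in> E" "y \<in> E" for x y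
    using that unfolding E_def by (auto simp: gal_mult gal_add)
  have quot: "\<exists>h\<in>abs_gal. (\<forall>y\<in>T. h y = y) \<and> \<tau> = \<sigma> \<circ> h"
    if st: "\<sigma> \<in> abs_gal" "\<tau> \<in> abs_gal" "cl \<sigma> = cl \<tau>" for \<sigma> \<tau>
  proof (intro bexI conjI)
    have b: "bij \<sigma>" by (rule gal_bij[OF st(1)])
    show "inv_into UNIV \<sigma> \<circ> \<tau> \<in> abs_gal" by (intro abs_gal_comp abs_gal_inv st)
    show "\<forall>y\<in>T. (inv_into UNIV \<sigma> \<circ> \<tau>) y = y"
    proof
      fix y assume "y \<in> T"
      then have "\<tau> y = \<sigma> y" using st(3) unfolding cl_iff by simp
      then show "(inv_into UNIV \<sigma> \<circ> \<tau>) y = y" using b by (simp add: bij_is_inj)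
    qed
    show "\<tau> = \<sigma> \<circ> (inv_into UNIV \<sigma> \<circ> \<tau>)" using b by (auto simp: bij_is_surj surj_f_inv_f)
  qed
  have same_z: "z \<sigma> = z \<tau>" if st: "\<sigma> \<in> abs_gal" "\<tau> \<in> abs_gal" "cl \<sigma> = cl \<tau>" for \<sigma> \<tau>
  proof -
    obtain h where h: "h \<in> abs_gal" "\<forall>y\<in>T. h y = y" "\<tau> = \<sigma> \<circ> h" using quot[OF st] by blast
    show ?thesis unfolding h(3) cocycle[OF st(1) h(1)] loc[OF h(1,2)] gal_quad_one[OF st(1)] quad_mult_one ..
  qed
  have same_E: "\<sigma> g = \<tau> g" if st: "\<sigma> \<in> abs_gal" "\<tau> \<in> abs_gal" "cl \<sigma> = cl \<tau>" and g: "g \<in> E" for \<sigma> \<tau> g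
  proof -
    obtain h where h: "h \<in> abs_gal" "\<forall>y\<in>T. h y = y" "\<tau> = \<sigma> \<circ> h" using quot[OF st] by blast
    have "h g = g" using g h(1,2) unfolding E_def by blast
    then show ?thesis unfolding h(3) by simp
  qed
  \<comment> \<open>Left multiplication by \<sigma> permutes the cosets. The product with a
    representative need not be a representative, hence the requirement that \<open>F\<close> depend
    on the coset only.\<close>
  have reindex: "(\<Sum>r\<in>R. F (\<sigma> \<circ> r)) = (\<Sum>r\<in>R. F r)"
    if \<sigma>: "\<sigma> \<in> abs_gal" and F: "\<And>\<tau> \<tau>'. \<tau> \<in> abs_gal \<Longrightarrow> \<tau>' \<in> abs_gal \<Longrightarrow> cl \<tau> = cl \<tau>' \<Longrightarrow> F \<tau> = F \<tau>'"
    for \<sigma> and F :: "('a alg_closure \<Rightarrow> 'a alg_closure) \<Rightarrow> 'a alg_closure"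
  proof -
    let ?f = "\<lambda>r. \<rho> (\<sigma> \<circ> r)"
    have sr: "\<sigma> \<circ> r \<in> abs_gal" if "r \<in> R" for r using abs_gal_comp[OF \<sigma> Rg[OF that]] .
    have inj: "inj_on ?f R"
    proof (rule inj_onI)
      fix r r' assume r: "r \<in> R" "r' \<in> R" and eq: "\<rho> (\<sigma> \<circ> r) = \<rho> (\<sigma> \<circ> r')"
      have "cl (\<sigma> \<circ> r) = cl (\<sigma> \<circ> r')" using \<rho>(2)[OF sr[OF r(1)]] \<rho>(2)[OF sr[OF r(2)]] eq by simp
      then have "cl r = cl r'" unfolding cl_iff using gal_eq_iff[OF \<sigma>] by simp
      then have "\<rho> r = \<rho> r'" by (rule \<rho>_cong)
      then show "r = r'" using Rr r by simp
    qed
    have "?f ` R \<subseteq> R" using sr unfolding R_def by blast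
    then have "bij_betw ?f R R" using inj finR by (simp add: bij_betw_def endo_inj_surj)
    then have "(\<Sum>r\<in>R. F r) = (\<Sum>r\<in>R. F (\<rho> (\<sigma> \<circ> r)))" by (rule sum.reindex_bij_betw[symmetric])
    also have "\<dots> = (\<Sum>r\<in>R. F (\<sigma> \<circ> r))" by (intro sum.cong F \<rho> sr refl)
    finally show ?thesis ..
  qed
  define S1 where "S1 g = (\<Sum>r\<in>R. r g * fst (z r))" for g
  define S2 where "S2 g = (\<Sum>r\<in>R. r g * snd (z r))" for g
  \<comment> \<open>The sign on the second coordinate is the conjugation that inverts
    \<open>z r\<close>.\<close>
  define \<beta> where "\<beta> g = (S1 g, - S2 g)" for g
  have gal: "gal_quad \<sigma> (\<beta> g) = z \<sigma> \<otimes>\<^bsub>?Q\<^esub> \<beta> g" if \<sigma>: "\<sigma> \<in> abs_gal" and g: "g \<in> E" for \<sigma> g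
  proof -
    let ?a = "fst (z \<sigma>)" and ?b = "snd (z \<sigma>)"
    have N: "?a\<^sup>2 - to_ac D * ?b\<^sup>2 = 1" using norm[OF \<sigma>] unfolding quad_norm_def .
    \<comment> \<open>The cocycle relation solved for the image of \<open>z r\<close>:
      multiplication by \<open>z \<sigma>\<close> is inverted by its conjugate, as the norm is
      one.\<close>
    have w: "\<sigma> (fst (z r)) = ?a * fst (z (\<sigma> \<circ> r)) - to_ac D * ?b * snd (z (\<sigma> \<circ> r))"
      "\<sigma> (snd (z r)) = ?a * snd (z (\<sigma> \<circ> r)) - ?b * fst (z (\<sigma> \<circ> r))" if "r \<in> R" for r
    proof -
      have v: "fst (z (\<sigma> \<circ> r)) = ?a * \<sigma> (fst (z r)) + to_ac D * ?b * \<sigma> (snd (z r))"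
        "snd (z (\<sigma> \<circ> r)) = ?a * \<sigma> (snd (z r)) + ?b * \<sigma> (fst (z r))"
        unfolding cocycle[OF \<sigma> Rg[OF that]] quad_mult gal_quad_def by simp_all
      show "\<sigma> (fst (z r)) = ?a * fst (z (\<sigma> \<circ> r)) - to_ac D * ?b * snd (z (\<sigma> \<circ> r))"
        "\<sigma> (snd (z r)) = ?a * snd (z (\<sigma> \<circ> r)) - ?b * fst (z (\<sigma> \<circ> r))"
        unfolding v using N by Groebner_Basis.algebra+
    qed
    have A1: "(\<Sum>r\<in>R. (\<sigma> \<circ> r) g * fst (z (\<sigma> \<circ> r))) = S1 g"
      unfolding S1_def by (rule reindex[OF \<sigma>]) (use same_z same_E[OF _ _ _ g] in metis)
    have A2: "(\<Sum>r\<in>R. (\<sigma> \<circ> r) g * snd (z (\<sigma> \<circ> r))) = S2 g"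
      unfolding S2_def by (rule reindex[OF \<sigma>]) (use same_z same_E[OF _ _ _ g] in metis)
    have "\<sigma> (S1 g) = (\<Sum>r\<in>R. ?a * ((\<sigma> \<circ> r) g * fst (z (\<sigma> \<circ> r))) - to_ac D * ?b * ((\<sigma> \<circ> r) g * snd (z (\<sigma> \<circ> r))))"
      unfolding S1_def gal_sum[OF \<sigma>] gal_mult[OF \<sigma>] by (intro sum.cong) (simp_all add: w(1) algebra_simps)
    also have "\<dots> = ?a * S1 g - to_ac D * ?b * S2 g"
      unfolding sum_subtractf sum_distrib_left[symmetric] A1 A2 ..
    finally have s1: "\<sigma> (S1 g) = ?a * S1 g - to_ac D * ?b * S2 g" .
    have "\<sigma> (S2 g) = (\<Sum>r\<in>R. ?a * ((\<sigma> \<circ> r) g * snd (z (\<sigma> \<circ> r))) - ?b * ((\<sigma> \<circ> r) g * fst (z (\<sigma> \<circ> r))))"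
      unfolding S2_def gal_sum[OF \<sigma>] gal_mult[OF \<sigma>] by (intro sum.cong) (simp_all add: w(2) algebra_simps)
    also have "\<dots> = ?a * S2 g - ?b * S1 g"
      unfolding sum_subtractf sum_distrib_left[symmetric] A1 A2 ..
    finally have s2: "\<sigma> (S2 g) = ?a * S2 g - ?b * S1 g" .
    show ?thesis
      unfolding \<beta>_def quad_mult gal_quad_def fst_conv snd_conv gal_uminus[OF \<sigma>] s1 s2 by (simp add: algebra_simps)
  qed
  have add: "S1 (g + h) = S1 g + S1 h" "S2 (g + h) = S2 g + S2 h" for g h
    unfolding S1_def S2_def sum.distrib[symmetric] by (auto intro!: sum.cong simp: gal_add[OF Rg] algebra_simps)
  obtain d where d: "d\<^sup>2 = to_ac D" using sqrt_exists by blast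
  have sp_nz: "\<exists>g\<in>E. split_at c (\<beta> g) \<noteq> 0" if c: "c\<^sup>2 = to_ac D" for c
  proof (rule ccontr)
    assume "\<not> (\<exists>g\<in>E. split_at c (\<beta> g) \<noteq> 0)"
    then have z0: "split_at c (\<beta> g) = 0" if "g \<in> E" for g using that by blast
    \<comment> \<open>In a splitting the resolvent is a combination of the characters
      \<open>r\<close>. A coefficient cannot vanish, because its product with the one from the other
      splitting is the norm, which is one.\<close>
    have sp: "split_at c (\<beta> g) = (\<Sum>r\<in>R. split_at (- c) (z r) * r g)" for g
      unfolding \<beta>_def split_at_def S1_def S2_def fst_conv snd_conv
      by (simp add: sum_distrib_left sum_negf[symmetric] sum.distrib[symmetric] algebra_simps)
    have "\<forall>r\<in>R. split_at (- c) (z r) = 0"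
    proof (rule independence_of_characters[OF finR E1 Em(1)])
      fix r r' assume r: "r \<in> R" "r' \<in> R" "r \<noteq> r'"
      then have "cl r \<noteq> cl r'" using Rr \<rho>_cong by metis
      then show "\<exists>x\<in>E. r x \<noteq> r' x" unfolding cl_iff using TE by blast
    next
      fix g assume "g \<in> E"
      then show "(\<Sum>r\<in>R. split_at (- c) (z r) * r g) = 0" using z0 sp by simp
    qed (use Rg gal_1 gal_mult in blast)+
    moreover have "\<rho> id \<in> R" unfolding R_def using abs_gal_id by blast
    ultimately have "split_at (- c) (z (\<rho> id)) = 0" by blast
    then have "quad_norm (to_ac D) (z (\<rho> id)) = 0" using split_norm[OF c] by simp
    then show False using norm[OF \<rho>(1)[OF abs_gal_id]] by simp
  qed
  obtain g1 where g1: "g1 \<in> E" "split_at d (\<beta> g1) \<noteq> 0" using sp_nz[OF d] by blast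
  obtain g2 where g2: "g2 \<in> E" "split_at (- d) (\<beta> g2) \<noteq> 0" using sp_nz[of "- d"] d by auto
  have sadd: "split_at c (\<beta> (g + h)) = split_at c (\<beta> g) + split_at c (\<beta> h)" for c g h
    unfolding \<beta>_def split_at_def add by (simp add: algebra_simps)
  \<comment> \<open>If \<open>g1\<close> fails at \<open>- d\<close> and \<open>g2\<close> fails at
    \<open>d\<close>, then \<open>g1 + g2\<close> works at both.\<close>
  have "\<exists>g\<in>E. split_at d (\<beta> g) \<noteq> 0 \<and> split_at (- d) (\<beta> g) \<noteq> 0"
  proof (cases "split_at (- d) (\<beta> g1) = 0")
    case True
    show ?thesis
    proof (cases "split_at d (\<beta> g2) = 0")
      case F: True
      show ?thesis using g1 g2 True F Em(2)[OF g1(1) g2(1)]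
        by (intro bexI[of _ "g1 + g2"]) (simp_all add: sadd)
    qed (use g2 in blast)
  qed (use g1 in blast)
  then obtain g where g: "g \<in> E" "split_at d (\<beta> g) \<noteq> 0" "split_at (- d) (\<beta> g) \<noteq> 0" by blast
  then have "\<beta> g \<in> Units ?Q" unfolding quad_units_iff split_norm[OF d] by simp
  then show ?thesis using gal g(1) by blast
qed

section \<open>The Kummer pairing of cocycles with elements\<close>

lemma (in mirror_module) gal_point_closed: "\<sigma> \<in> abs_gal \<Longrightarrow> P \<in> carrier M \<Longrightarrow> gal_point \<sigma> P \<in> carrier M"
  by (simp add: gal_point_eq)

lemma (in mirror_module) gal_point_mult:
  "\<sigma> \<in> abs_gal \<Longrightarrow> P \<in> carrier M \<Longrightarrow> P' \<in> carrier M \<Longrightarrow>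
    gal_point \<sigma> (P \<otimes> P') = gal_point \<sigma> P \<otimes> gal_point \<sigma> P'"
  by (simp add: gal_point_eq inv_mult)

lemma (in mirror_module) gal_point_comp:
  assumes "\<sigma> \<in> abs_gal" "\<tau> \<in> abs_gal" "P \<in> carrier M"
  shows "gal_point (\<sigma> \<circ> \<tau>) P = gal_point \<sigma> (gal_point \<tau> P)"
  unfolding gal_point_def image_image by simp

locale kummer = mirror_module +
  fixes \<iota>
  assumes \<iota>: "\<iota> \<in> mu3_isos M Dhat"
begin

abbreviation QQ where "QQ \<equiv> quad_alg (to_ac Dhat)"

abbreviation qmult (infixl "\<star>" 70) where "z \<star> w \<equiv> z \<otimes>\<^bsub>QQ\<^esub> w"

abbreviation ZZ where "ZZ \<equiv> cocycles M gal_point"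

lemma \<iota>_mu3: "P \<in> carrier M \<Longrightarrow> \<iota> P \<in> carrier (norm_one_mu3 Dhat)"
  and \<iota>_mult: "P \<in> carrier M \<Longrightarrow> P' \<in> carrier M \<Longrightarrow> \<iota> (P \<otimes> P') = \<iota> P \<star> \<iota> P'"
  and \<iota>_gal: "\<sigma> \<in> abs_gal \<Longrightarrow> P \<in> carrier M \<Longrightarrow> \<iota> (gal_point \<sigma> P) = gal_quad \<sigma> (\<iota> P)"
  and \<iota>_bij: "bij_betw \<iota> (carrier M) (carrier (norm_one_mu3 Dhat))"
  using \<iota> unfolding mu3_isos_def iso_def hom_def by (auto simp: norm_one_mu3_simps)

lemma \<iota>_norm: "P \<in> carrier M \<Longrightarrow> quad_norm (to_ac Dhat) (\<iota> P) = 1"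
  and \<iota>_cube: "P \<in> carrier M \<Longrightarrow> \<iota> P [^]\<^bsub>QQ\<^esub> (3::nat) = \<one>\<^bsub>QQ\<^esub>"
  using \<iota>_mu3 unfolding norm_one_mu3_simps by blast+

lemma \<iota>_one: "\<iota> \<one> = \<one>\<^bsub>QQ\<^esub>"
proof -
  have "\<iota> \<one> \<star> \<iota> \<one> = \<one>\<^bsub>QQ\<^esub> \<star> \<iota> \<one>" using \<iota>_mult[of \<one> \<one>] by (simp add: quad_mult_one)
  moreover have "\<iota> \<one> \<in> Units QQ" using \<iota>_norm[of \<one>] unfolding quad_units_iff by simp
  ultimately show ?thesis using quad_cancel by blast
qed

lemma \<iota>_inject: "P \<in> carrier M \<Longrightarrow> P' \<in> carrier M \<Longrightarrow> \<iota> P = \<iota> P' \<Longrightarrow> P = P'"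
  using \<iota>_bij unfolding bij_betw_def inj_on_def by blast

lemma \<iota>_surj: "z [^]\<^bsub>QQ\<^esub> (3::nat) = \<one>\<^bsub>QQ\<^esub> \<Longrightarrow> quad_norm (to_ac Dhat) z = 1 \<Longrightarrow> \<exists>P\<in>carrier M. \<iota> P = z"
proof -
  assume "z [^]\<^bsub>QQ\<^esub> (3::nat) = \<one>\<^bsub>QQ\<^esub>" "quad_norm (to_ac Dhat) z = 1"
  then have "z \<in> carrier (norm_one_mu3 Dhat)" by (simp add: norm_one_mu3_simps)
  then have "z \<in> \<iota> ` carrier M" using \<iota>_bij unfolding bij_betw_def by simp
  then show ?thesis by blast
qed

lemma cocycleD:
  assumes "c \<in> carrier ZZ"
  shows "\<sigma> \<in> abs_gal \<Longrightarrow> c \<sigma> \<in> carrier M"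
    and "\<sigma> \<in> abs_gal \<Longrightarrow> \<tau> \<in> abs_gal \<Longrightarrow> c (\<sigma> \<circ> \<tau>) = c \<sigma> \<otimes> gal_point \<sigma> (c \<tau>)"
    and "c \<in> extensional abs_gal"
    and "\<sigma> \<in> abs_gal \<Longrightarrow> \<exists>T. finite T \<and> (\<forall>\<tau>\<in>abs_gal. (\<forall>x\<in>T. \<tau> x = \<sigma> x) \<longrightarrow> c \<tau> = c \<sigma>)"
proof -
  have c: "c \<in> abs_gal \<rightarrow>\<^sub>E carrier M" "continuous_map krull_topology (discrete_topology (carrier M)) c"
    "\<forall>\<sigma>\<in>abs_gal. \<forall>\<tau>\<in>abs_gal. c (\<sigma> \<circ> \<tau>) = c \<sigma> \<otimes> gal_point \<sigma> (c \<tau>)"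
    using assms unfolding cocycles_def by simp_all
  show "\<sigma> \<in> abs_gal \<Longrightarrow> c \<sigma> \<in> carrier M" "c \<in> extensional abs_gal" using c(1) by (auto simp: PiE_def)
  show "\<sigma> \<in> abs_gal \<Longrightarrow> \<tau> \<in> abs_gal \<Longrightarrow> c (\<sigma> \<circ> \<tau>) = c \<sigma> \<otimes> gal_point \<sigma> (c \<tau>)" using c(3) by blast
  have "c \<in> abs_gal \<rightarrow> carrier M" using c(1) by (simp add: PiE_def)
  then show "\<sigma> \<in> abs_gal \<Longrightarrow> \<exists>T. finite T \<and> (\<forall>\<tau>\<in>abs_gal. (\<forall>x\<in>T. \<tau> x = \<sigma> x) \<longrightarrow> c \<tau> = c \<sigma>)"
    using c(2) krull_continuous_iff by blast
qed

lemma cocycleI: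
  assumes "\<And>\<sigma>. \<sigma> \<in> abs_gal \<Longrightarrow> c \<sigma> \<in> carrier M"
    and "\<And>\<sigma> \<tau>. \<sigma> \<in> abs_gal \<Longrightarrow> \<tau> \<in> abs_gal \<Longrightarrow> c (\<sigma> \<circ> \<tau>) = c \<sigma> \<otimes> gal_point \<sigma> (c \<tau>)"
    and "c \<in> extensional abs_gal"
    and "\<And>\<sigma>. \<sigma> \<in> abs_gal \<Longrightarrow> \<exists>T. finite T \<and> (\<forall>\<tau>\<in>abs_gal. (\<forall>x\<in>T. \<tau> x = \<sigma> x) \<longrightarrow> c \<tau> = c \<sigma>)"
  shows "c \<in> carrier ZZ"
proof -
  have c: "c \<in> abs_gal \<rightarrow> carrier M" using assms(1) by blast
  then have "continuous_map krull_topology (discrete_topology (carrier M)) c"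
    using krull_continuous_iff[OF c] assms(4) by blast
  then show ?thesis unfolding cocycles_def using assms(2,3) c by (simp add: PiE_def)
qed

lemma cocycles_simps: "mult ZZ = (\<lambda>c c'. \<lambda>\<sigma>\<in>abs_gal. c \<sigma> \<otimes> c' \<sigma>)" "one ZZ = (\<lambda>\<sigma>\<in>abs_gal. \<one>)"
  by (simp_all add: cocycles_def)

lemma cocycle_mult: "c \<in> carrier ZZ \<Longrightarrow> c' \<in> carrier ZZ \<Longrightarrow> (\<lambda>\<sigma>\<in>abs_gal. c \<sigma> \<otimes> c' \<sigma>) \<in> carrier ZZ"
proof (rule cocycleI)
  assume c: "c \<in> carrier ZZ" "c' \<in> carrier ZZ"
  note C = cocycleD[OF c(1)] and C' = cocycleD[OF c(2)]
  show "(\<lambda>\<sigma>\<in>abs_gal. c \<sigma> \<otimes> c' \<sigma>) \<in> extensional abs_gal" by simp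
  show "(\<lambda>\<sigma>\<in>abs_gal. c \<sigma> \<otimes> c' \<sigma>) \<sigma> \<in> carrier M" if "\<sigma> \<in> abs_gal" for \<sigma> using that C(1) C'(1) by simp
  show "(\<lambda>\<sigma>\<in>abs_gal. c \<sigma> \<otimes> c' \<sigma>) (\<sigma> \<circ> \<tau>) = (\<lambda>\<sigma>\<in>abs_gal. c \<sigma> \<otimes> c' \<sigma>) \<sigma> \<otimes> gal_point \<sigma> ((\<lambda>\<sigma>\<in>abs_gal. c \<sigma> \<otimes> c' \<sigma>) \<tau>)"
    if "\<sigma> \<in> abs_gal" "\<tau> \<in> abs_gal" for \<sigma> \<tau>
    using that C(1,2) C'(1,2) by (simp add: abs_gal_comp gal_point_mult gal_point_closed m_ac)
  show "\<exists>T. finite T \<and> (\<forall>\<tau>\<in>abs_gal. (\<forall>x\<in>T. \<tau> x = \<sigma> x) \<longrightarrow>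
      (\<lambda>\<sigma>\<in>abs_gal. c \<sigma> \<otimes> c' \<sigma>) \<tau> = (\<lambda>\<sigma>\<in>abs_gal. c \<sigma> \<otimes> c' \<sigma>) \<sigma>)" if \<sigma>: "\<sigma> \<in> abs_gal" for \<sigma>
  proof -
    obtain T where T: "finite T" "\<forall>\<tau>\<in>abs_gal. (\<forall>x\<in>T. \<tau> x = \<sigma> x) \<longrightarrow> c \<tau> = c \<sigma>" using C(4)[OF \<sigma>] by blast
    obtain T' where T': "finite T'" "\<forall>\<tau>\<in>abs_gal. (\<forall>x\<in>T'. \<tau> x = \<sigma> x) \<longrightarrow> c' \<tau> = c' \<sigma>" using C'(4)[OF \<sigma>] by blast
    show ?thesis
    proof (intro exI[of _ "T \<union> T'"] conjI ballI impI)
      fix \<tau> assume \<tau>: "\<tau> \<in> abs_gal" "\<forall>x\<in>T \<union> T'. \<tau> x = \<sigma> x"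
      have "c \<tau> = c \<sigma>" by (rule T(2)[rule_format, OF \<tau>(1)]) (use \<tau>(2) in blast)
      moreover have "c' \<tau> = c' \<sigma>" by (rule T'(2)[rule_format, OF \<tau>(1)]) (use \<tau>(2) in blast)
      ultimately show "(\<lambda>\<sigma>\<in>abs_gal. c \<sigma> \<otimes> c' \<sigma>) \<tau> = (\<lambda>\<sigma>\<in>abs_gal. c \<sigma> \<otimes> c' \<sigma>) \<sigma>" using \<sigma> \<tau>(1) by simp
    qed (use T T' in simp)
  qed
qed

lemma coboundary_cocycle:
  assumes m: "m \<in> carrier M"
  shows "(\<lambda>\<sigma>\<in>abs_gal. gal_point \<sigma> m \<otimes> inv m) \<in> carrier ZZ"
proof (rule cocycleI)
  show "(\<lambda>\<sigma>\<in>abs_gal. gal_point \<sigma> m \<otimes> inv m) \<in> extensional abs_gal" by simp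
  show "(\<lambda>\<sigma>\<in>abs_gal. gal_point \<sigma> m \<otimes> inv m) \<sigma> \<in> carrier M" if "\<sigma> \<in> abs_gal" for \<sigma>
    using that m by (simp add: gal_point_closed)
  have minv: "gal_point \<sigma> (inv m) = inv (gal_point \<sigma> m)" if "\<sigma> \<in> abs_gal" for \<sigma>
    using that m by (simp add: gal_point_eq)
  show "(\<lambda>\<sigma>\<in>abs_gal. gal_point \<sigma> m \<otimes> inv m) (\<sigma> \<circ> \<tau>) = (\<lambda>\<sigma>\<in>abs_gal. gal_point \<sigma> m \<otimes> inv m) \<sigma> \<otimes>
      gal_point \<sigma> ((\<lambda>\<sigma>\<in>abs_gal. gal_point \<sigma> m \<otimes> inv m) \<tau>)"
    if st: "\<sigma> \<in> abs_gal" "\<tau> \<in> abs_gal" for \<sigma> \<tau>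
  proof -
    define a where "a = gal_point \<sigma> m"
    define b where "b = gal_point \<sigma> (gal_point \<tau> m)"
    have ab: "a \<in> carrier M" "b \<in> carrier M" unfolding a_def b_def using st m gal_point_closed by simp_all
    have "b \<otimes> inv m = (a \<otimes> inv m) \<otimes> (b \<otimes> inv a)"
    proof -
      have "(a \<otimes> inv m) \<otimes> (b \<otimes> inv a) = (b \<otimes> inv a) \<otimes> (a \<otimes> inv m)" using ab m by (simp add: m_comm)
      also have "\<dots> = b \<otimes> ((inv a \<otimes> a) \<otimes> inv m)" using ab m by (simp only: m_assoc inv_closed m_closed)
      also have "\<dots> = b \<otimes> inv m" using ab m by simp
      finally show ?thesis ..
    qed
    then show ?thesis
      using st m unfolding a_def b_def
      by (simp add: abs_gal_comp gal_point_mult gal_point_closed gal_point_comp minv)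
  qed
  \<comment> \<open>A coboundary is determined by the sign of \<open>d0\<close>, so
    \<open>{d0}\<close> suffices.\<close>
  show "\<exists>T. finite T \<and> (\<forall>\<tau>\<in>abs_gal. (\<forall>x\<in>T. \<tau> x = \<sigma> x) \<longrightarrow>
      (\<lambda>\<sigma>\<in>abs_gal. gal_point \<sigma> m \<otimes> inv m) \<tau> = (\<lambda>\<sigma>\<in>abs_gal. gal_point \<sigma> m \<otimes> inv m) \<sigma>)"
    if "\<sigma> \<in> abs_gal" for \<sigma>
    using that m by (intro exI[of _ "{d0}"]) (simp add: gal_point_eq)
qed

text \<open>The Kummer relation between one cocycle and one element. Working with the relation
  postpones the question whether the map on classes is well defined.\<close>

definition kummer_pair where
  "kummer_pair c \<delta> \<longleftrightarrow> \<delta> \<in> Units (quad_alg Dhat) \<and> (\<exists>\<beta>\<in>Units QQ. \<beta> [^]\<^bsub>QQ\<^esub> (3::nat) = quad_embed \<delta> \<and>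
     (\<forall>\<sigma>\<in>abs_gal. gal_quad \<sigma> \<beta> = \<iota> (c \<sigma>) \<star> \<beta>))"

lemma kummer_class_eq: "kummer_class \<iota> Dhat C = {\<delta>. \<exists>c\<in>C. kummer_pair c \<delta>}"
  unfolding kummer_class_def kummer_pair_def quad_embed_def by blast

lemma kummer_pairE:
  assumes "kummer_pair c \<delta>"
  obtains \<beta> where "\<delta> \<in> Units (quad_alg Dhat)" "\<beta> \<in> Units QQ" "\<beta> [^]\<^bsub>QQ\<^esub> (3::nat) = quad_embed \<delta>"
    "\<And>\<sigma>. \<sigma> \<in> abs_gal \<Longrightarrow> gal_quad \<sigma> \<beta> = \<iota> (c \<sigma>) \<star> \<beta>"
  using assms unfolding kummer_pair_def by blast

text \<open>Hilbert 90 produces \<beta> with a Galois-fixed cube, which over an imperfect field need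
  not be rational. A power of \<beta> with exponent congruent to \<open>1\<close> modulo three has
  the same cocycle, and the exponent can be chosen to make its cube rational.\<close>

lemma kummer_pair_exists:
  assumes c: "c \<in> carrier ZZ"
  shows "\<exists>\<delta>. kummer_pair c \<delta>"
proof -
  note C = cocycleD[OF c]
  have cid: "c id = \<one>"
  proof -
    have "c id = c id \<otimes> gal_point id (c id)" using C(2)[OF abs_gal_id abs_gal_id] by simp
    moreover have "gal_point id (c id) = c id" using C(1)[OF abs_gal_id] by (simp add: gal_point_eq[OF abs_gal_id])
    ultimately show ?thesis using C(1)[OF abs_gal_id] by (metis l_cancel_one)
  qed
  obtain T where T: "finite T" "\<forall>\<tau>\<in>abs_gal. (\<forall>x\<in>T. \<tau> x = id x) \<longrightarrow> c \<tau> = c id" using C(4)[OF abs_gal_id] by blast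
  have "\<exists>\<beta>\<in>Units QQ. \<forall>\<sigma>\<in>abs_gal. gal_quad \<sigma> \<beta> = \<iota> (c \<sigma>) \<star> \<beta>"
  proof (rule hilbert_90[OF _ _ T(1)])
    show "quad_norm (to_ac Dhat) (\<iota> (c \<sigma>)) = 1" if "\<sigma> \<in> abs_gal" for \<sigma> using \<iota>_norm C(1) that by blast
    show "\<iota> (c (\<sigma> \<circ> \<tau>)) = \<iota> (c \<sigma>) \<star> gal_quad \<sigma> (\<iota> (c \<tau>))" if "\<sigma> \<in> abs_gal" "\<tau> \<in> abs_gal" for \<sigma> \<tau>
      using that C(1,2) by (simp add: \<iota>_mult \<iota>_gal gal_point_closed)
    show "\<iota> (c \<sigma>) = \<one>\<^bsub>QQ\<^esub>" if \<sigma>: "\<sigma> \<in> abs_gal" "\<forall>x\<in>T. \<sigma> x = x" for \<sigma>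
    proof -
      have "c \<sigma> = c id" by (rule T(2)[rule_format, OF \<sigma>(1)]) (use \<sigma>(2) in simp)
      then show ?thesis using cid \<iota>_one by simp
    qed
  qed
  then obtain \<beta> where \<beta>: "\<beta> \<in> Units QQ" "\<And>\<sigma>. \<sigma> \<in> abs_gal \<Longrightarrow> gal_quad \<sigma> \<beta> = \<iota> (c \<sigma>) \<star> \<beta>" by blast
  have "gal_quad \<sigma> (\<beta> [^]\<^bsub>QQ\<^esub> (3::nat)) = \<beta> [^]\<^bsub>QQ\<^esub> (3::nat)" if "\<sigma> \<in> abs_gal" for \<sigma>
    using \<beta>(2)[OF that] \<iota>_cube[OF C(1)[OF that]] by (simp add: gal_quad_pow[OF that] quad_pow_mult quad_mult_one)
  then obtain e where e: "(\<beta> [^]\<^bsub>QQ\<^esub> (3::nat)) [^]\<^bsub>QQ\<^esub> (char_exponent TYPE('a) ^ e) \<in> range quad_embed"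
    using quad_fixed_descent[OF char(1) Dhat0] by blast
  define q where "q = char_exponent TYPE('a) ^ e"
  obtain \<delta>0 where \<delta>0: "(\<beta> [^]\<^bsub>QQ\<^esub> (3::nat)) [^]\<^bsub>QQ\<^esub> q = quad_embed \<delta>0" using e unfolding q_def by (elim imageE)
  have cop: "coprime q 3" unfolding q_def by (rule char_exponent_power(2)[OF char(2)])
  have "\<not> 3 dvd q" using coprime_common_divisor[OF cop, of 3] by auto
  then have "q mod 3 = 1 \<or> q mod 3 = 2" by presburger
  \<comment> \<open>\<open>q\<close> itself may be \<open>2\<close> modulo three; its square is
    \<open>1\<close> in either case.\<close>
  then have "(q * q) mod 3 = 1" by (auto simp: mod_mult_eq[of q 3 q, symmetric])
  then obtain k where k: "q * q = 3 * k + 1" by (metis mult_div_mod_eq)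
  \<comment> \<open>One factor \<open>q\<close> makes the cube rational, the other corrects the
    residue modulo three.\<close>
  define \<gamma> where "\<gamma> = \<beta> [^]\<^bsub>QQ\<^esub> (q * q)"
  have "\<gamma> \<in> Units QQ" unfolding \<gamma>_def by (rule quad_units_pow_closed[OF \<beta>(1)])
  moreover have cube: "\<gamma> [^]\<^bsub>QQ\<^esub> (3::nat) = quad_embed (\<delta>0 [^]\<^bsub>quad_alg Dhat\<^esub> q)"
    unfolding quad_embed_pow \<delta>0[symmetric] \<gamma>_def quad_pow_pow by (simp add: mult_ac)
  moreover have "gal_quad \<sigma> \<gamma> = \<iota> (c \<sigma>) \<star> \<gamma>" if "\<sigma> \<in> abs_gal" for \<sigma>
  proof -
    have "\<iota> (c \<sigma>) [^]\<^bsub>QQ\<^esub> (q * q) = (\<iota> (c \<sigma>) [^]\<^bsub>QQ\<^esub> (3::nat)) [^]\<^bsub>QQ\<^esub> k \<star> \<iota> (c \<sigma>) [^]\<^bsub>QQ\<^esub> (1::nat)"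
      unfolding k quad_pow_add quad_pow_pow ..
    also have "\<dots> = \<iota> (c \<sigma>)"
      unfolding \<iota>_cube[OF C(1)[OF that]] quad_one_pow quad_mult_one by (simp add: nat_pow_def quad_mult_one)
    finally show ?thesis
      unfolding \<gamma>_def gal_quad_pow[OF that] \<beta>(2)[OF that] quad_pow_mult by simp
  qed
  moreover have "\<delta>0 [^]\<^bsub>quad_alg Dhat\<^esub> q \<in> Units (quad_alg Dhat)"
    using quad_units_pow_closed[OF \<open>\<gamma> \<in> Units QQ\<close>, of 3] unfolding cube quad_embed_units .
  ultimately show ?thesis unfolding kummer_pair_def by blast
qed

lemma kummer_pair_mult:
  assumes "kummer_pair c \<delta>" "kummer_pair c' \<delta>'" and c: "c \<in> carrier ZZ" "c' \<in> carrier ZZ"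
  shows "kummer_pair (\<lambda>\<sigma>\<in>abs_gal. c \<sigma> \<otimes> c' \<sigma>) (\<delta> \<otimes>\<^bsub>quad_alg Dhat\<^esub> \<delta>')"
proof -
  obtain \<beta> where \<beta>: "\<delta> \<in> Units (quad_alg Dhat)" "\<beta> \<in> Units QQ" "\<beta> [^]\<^bsub>QQ\<^esub> (3::nat) = quad_embed \<delta>"
    "\<And>\<sigma>. \<sigma> \<in> abs_gal \<Longrightarrow> gal_quad \<sigma> \<beta> = \<iota> (c \<sigma>) \<star> \<beta>" using assms(1) by (rule kummer_pairE) (rule that)
  obtain \<beta>' where \<beta>': "\<delta>' \<in> Units (quad_alg Dhat)" "\<beta>' \<in> Units QQ" "\<beta>' [^]\<^bsub>QQ\<^esub> (3::nat) = quad_embed \<delta>'"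
    "\<And>\<sigma>. \<sigma> \<in> abs_gal \<Longrightarrow> gal_quad \<sigma> \<beta>' = \<iota> (c' \<sigma>) \<star> \<beta>'" using assms(2) by (rule kummer_pairE) (rule that)
  show ?thesis unfolding kummer_pair_def
  proof (intro conjI bexI[of _ "\<beta> \<star> \<beta>'"] ballI)
    fix \<sigma> :: "'a alg_closure \<Rightarrow> 'a alg_closure" assume \<sigma>: "\<sigma> \<in> abs_gal"
    show "gal_quad \<sigma> (\<beta> \<star> \<beta>') = \<iota> ((\<lambda>\<sigma>\<in>abs_gal. c \<sigma> \<otimes> c' \<sigma>) \<sigma>) \<star> (\<beta> \<star> \<beta>')"
      using \<sigma> \<iota>_mult[OF cocycleD(1)[OF c(1) \<sigma>] cocycleD(1)[OF c(2) \<sigma>]]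
      by (simp add: gal_quad_mult[OF \<sigma>] \<beta>(4) \<beta>'(4) quad_assoc quad_left_comm)
  qed (use \<beta> \<beta>' in \<open>simp_all add: quad_units_closed quad_pow_mult quad_embed_mult\<close>)
qed

lemma kummer_pair_cube:
  assumes "kummer_pair c \<delta>" and w: "w \<in> Units (quad_alg Dhat)"
  shows "kummer_pair c (\<delta> \<otimes>\<^bsub>quad_alg Dhat\<^esub> w [^]\<^bsub>quad_alg Dhat\<^esub> (3::nat))"
proof -
  obtain \<beta> where \<beta>: "\<delta> \<in> Units (quad_alg Dhat)" "\<beta> \<in> Units QQ" "\<beta> [^]\<^bsub>QQ\<^esub> (3::nat) = quad_embed \<delta>"
    "\<And>\<sigma>. \<sigma> \<in> abs_gal \<Longrightarrow> gal_quad \<sigma> \<beta> = \<iota> (c \<sigma>) \<star> \<beta>" using assms(1) by (rule kummer_pairE) (rule that)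
  show ?thesis unfolding kummer_pair_def
  proof (intro conjI bexI[of _ "\<beta> \<star> quad_embed w"] ballI)
    fix \<sigma> :: "'a alg_closure \<Rightarrow> 'a alg_closure" assume \<sigma>: "\<sigma> \<in> abs_gal"
    show "gal_quad \<sigma> (\<beta> \<star> quad_embed w) = \<iota> (c \<sigma>) \<star> (\<beta> \<star> quad_embed w)"
      using \<sigma> by (simp add: gal_quad_mult[OF \<sigma>] gal_quad_embed[OF \<sigma>] \<beta>(4) quad_assoc)
  qed (use \<beta> w in \<open>simp_all add: quad_units_closed quad_units_pow_closed quad_pow_mult quad_embed_mult quad_embed_pow quad_embed_units\<close>)
qed

text \<open>The cube root \<beta> is replaced by its product with the cube root of unity
  \<open>\<iota> m\<close>, which leaves its cube unchanged.\<close>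

lemma kummer_pair_coboundary:
  assumes "kummer_pair c \<delta>" and c: "c \<in> carrier ZZ" and m: "m \<in> carrier M"
    and c': "\<And>\<sigma>. \<sigma> \<in> abs_gal \<Longrightarrow> c' \<sigma> = c \<sigma> \<otimes> (gal_point \<sigma> m \<otimes> inv m)"
  shows "kummer_pair c' \<delta>"
proof -
  obtain \<beta> where \<beta>: "\<delta> \<in> Units (quad_alg Dhat)" "\<beta> \<in> Units QQ" "\<beta> [^]\<^bsub>QQ\<^esub> (3::nat) = quad_embed \<delta>"
    "\<And>\<sigma>. \<sigma> \<in> abs_gal \<Longrightarrow> gal_quad \<sigma> \<beta> = \<iota> (c \<sigma>) \<star> \<beta>" using assms(1) by (rule kummer_pairE) (rule that)
  have u: "\<iota> m \<in> Units QQ" using \<iota>_norm[OF m] unfolding quad_units_iff by simp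
  show ?thesis unfolding kummer_pair_def
  proof (intro conjI bexI[of _ "\<beta> \<star> \<iota> m"] ballI)
    fix \<sigma> :: "'a alg_closure \<Rightarrow> 'a alg_closure" assume \<sigma>: "\<sigma> \<in> abs_gal"
    note cs = cocycleD(1)[OF c \<sigma>] and gs = gal_point_closed[OF \<sigma> m]
    have "c' \<sigma> \<otimes> m = c \<sigma> \<otimes> gal_point \<sigma> m" unfolding c'[OF \<sigma>] using cs gs m by (simp add: m_assoc)
    moreover have "c' \<sigma> \<in> carrier M" unfolding c'[OF \<sigma>] using cs gs m by simp
    ultimately have "\<iota> (c' \<sigma>) \<star> \<iota> m = \<iota> (c \<sigma>) \<star> gal_quad \<sigma> (\<iota> m)"
      using \<iota>_mult[OF _ m, of "c' \<sigma>"] \<iota>_mult[OF cs gs] \<iota>_gal[OF \<sigma> m] by simp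
    then show "gal_quad \<sigma> (\<beta> \<star> \<iota> m) = \<iota> (c' \<sigma>) \<star> (\<beta> \<star> \<iota> m)"
      unfolding gal_quad_mult[OF \<sigma>] \<beta>(4)[OF \<sigma>] by (metis quad_assoc quad_comm)
  qed (use \<beta> u \<iota>_cube[OF m] in \<open>simp_all add: quad_units_closed quad_pow_mult quad_mult_one\<close>)
qed

text \<open>The quotient of the two cube roots is fixed by Galois and its cube, the quotient of
  \<open>\<delta>'\<close> by \<delta>, is rational; hence the quotient itself is rational.\<close>

lemma kummer_pair_same_cocycle:
  assumes "kummer_pair c \<delta>" "kummer_pair c \<delta>'"
  shows "\<exists>w\<in>Units (quad_alg Dhat). \<delta>' = \<delta> \<otimes>\<^bsub>quad_alg Dhat\<^esub> w [^]\<^bsub>quad_alg Dhat\<^esub> (3::nat)"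
proof -
  obtain \<beta> where \<beta>: "\<delta> \<in> Units (quad_alg Dhat)" "\<beta> \<in> Units QQ" "\<beta> [^]\<^bsub>QQ\<^esub> (3::nat) = quad_embed \<delta>"
    "\<And>\<sigma>. \<sigma> \<in> abs_gal \<Longrightarrow> gal_quad \<sigma> \<beta> = \<iota> (c \<sigma>) \<star> \<beta>" using assms(1) by (rule kummer_pairE) (rule that)
  obtain \<beta>' where \<beta>': "\<delta>' \<in> Units (quad_alg Dhat)" "\<beta>' \<in> Units QQ" "\<beta>' [^]\<^bsub>QQ\<^esub> (3::nat) = quad_embed \<delta>'"
    "\<And>\<sigma>. \<sigma> \<in> abs_gal \<Longrightarrow> gal_quad \<sigma> \<beta>' = \<iota> (c \<sigma>) \<star> \<beta>'" using assms(2) by (rule kummer_pairE) (rule that)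
  obtain \<gamma> where \<gamma>: "\<gamma> \<star> \<beta> = \<beta>'" using quad_divide[OF \<beta>(2)] by blast
  have \<gamma>u: "\<gamma> \<in> Units QQ" using \<beta>'(2) unfolding quad_units_iff \<gamma>[symmetric] quad_norm_mult by simp
  have fixed: "gal_quad \<sigma> \<gamma> = \<gamma>" if \<sigma>: "\<sigma> \<in> abs_gal" for \<sigma>
  proof -
    have "gal_quad \<sigma> \<gamma> \<star> gal_quad \<sigma> \<beta> = \<iota> (c \<sigma>) \<star> (\<gamma> \<star> \<beta>)"
      using \<beta>'(4)[OF \<sigma>] unfolding \<gamma>[symmetric] gal_quad_mult[OF \<sigma>] .
    also have "\<dots> = \<gamma> \<star> gal_quad \<sigma> \<beta>" unfolding \<beta>(4)[OF \<sigma>] by (rule quad_left_comm)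
    finally show ?thesis using quad_cancel[OF gal_quad_units[OF \<sigma> \<beta>(2)]] by blast
  qed
  obtain w0 where w0: "w0 \<otimes>\<^bsub>quad_alg Dhat\<^esub> \<delta> = \<delta>'" using quad_divide[OF \<beta>(1)] by blast
  have du: "quad_embed \<delta> \<in> Units QQ" using \<beta>(1) unfolding quad_embed_units .
  have "\<gamma> [^]\<^bsub>QQ\<^esub> (3::nat) \<star> quad_embed \<delta> = (\<gamma> \<star> \<beta>) [^]\<^bsub>QQ\<^esub> (3::nat)"
    unfolding quad_pow_mult \<beta>(3) ..
  also have "\<dots> = quad_embed (w0 \<otimes>\<^bsub>quad_alg Dhat\<^esub> \<delta>)" unfolding \<gamma> \<beta>'(3) w0 ..
  also have "\<dots> = quad_embed w0 \<star> quad_embed \<delta>" by (rule quad_embed_mult)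
  finally have cube: "\<gamma> [^]\<^bsub>QQ\<^esub> (3::nat) = quad_embed w0" by (rule quad_cancel[OF du])
  have "\<gamma> \<in> quad_embed ` Units (quad_alg Dhat)"
    by (rule quad_fixed_rational[OF char Dhat0 \<gamma>u fixed]) (simp_all add: cube)
  then obtain w where w: "w \<in> Units (quad_alg Dhat)" "\<gamma> = quad_embed w" by blast
  have "w0 = w [^]\<^bsub>quad_alg Dhat\<^esub> (3::nat)"
    using cube unfolding w(2) quad_embed_pow[symmetric] quad_embed_inject by simp
  then show ?thesis using w(1) w0 quad_comm by metis
qed

text \<open>Cocycle values have norm one, so the norm of \<beta> is fixed by Galois; its cube, the
  norm of \<delta>, is rational.\<close>

lemma kummer_pair_norm:
  assumes "kummer_pair c \<delta>" and c: "c \<in> carrier ZZ" and "\<beta> \<in> Units QQ" "\<beta> [^]\<^bsub>QQ\<^esub> (3::nat) = quad_embed \<delta>"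
    "\<And>\<sigma>. \<sigma> \<in> abs_gal \<Longrightarrow> gal_quad \<sigma> \<beta> = \<iota> (c \<sigma>) \<star> \<beta>"
  shows "\<exists>u. u \<noteq> 0 \<and> quad_norm (to_ac Dhat) \<beta> = to_ac u \<and> quad_norm Dhat \<delta> = u ^ 3"
proof -
  let ?N = "quad_norm (to_ac Dhat) \<beta>"
  have cube: "?N ^ 3 = to_ac (quad_norm Dhat \<delta>)"
    unfolding quad_norm_cube[symmetric] assms(4) quad_embed_norm ..
  have "?N \<in> base_field"
  proof (rule fixed_rational)
    fix \<sigma> :: "'a alg_closure \<Rightarrow> 'a alg_closure" assume \<sigma>: "\<sigma> \<in> abs_gal"
    show "\<sigma> ?N = ?N"
      unfolding gal_quad_norm[OF \<sigma>, symmetric] assms(5)[OF \<sigma>] quad_norm_mult \<iota>_norm[OF cocycleD(1)[OF c \<sigma>]] by simp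
  next
    show "?N ^ 3 \<in> base_field" unfolding cube base_field_def by (rule rangeI)
    show "coprime (char_exponent TYPE('a) ^ e) 3" for e by (rule char_exponent_power(2)[OF char(2)])
  qed simp
  then obtain u where u: "?N = to_ac u" unfolding base_field_def by (elim rangeE)
  have "to_ac (quad_norm Dhat \<delta>) = to_ac (u ^ 3)" using cube unfolding u by simp
  moreover have "u \<noteq> 0" using assms(3) unfolding quad_units_iff u by simp
  ultimately show ?thesis using u by (simp only: to_ac_eq_iff) blast
qed

text \<open>The quotient \<open>y\<close> of two cube roots of \<delta> has cube one, but its norm
  may be a rational cube root of unity \<omega>. The scalar \<omega> corrects the norm and, being
  fixed by Galois, does not disturb the coboundary of \<open>y\<close>.\<close>

lemma kummer_pair_same_class:
  assumes "kummer_pair c \<delta>" "kummer_pair c' \<delta>" and c: "c \<in> carrier ZZ" "c' \<in> carrier ZZ"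
  shows "\<exists>m\<in>carrier M. \<forall>\<sigma>\<in>abs_gal. c' \<sigma> = c \<sigma> \<otimes> (gal_point \<sigma> m \<otimes> inv m)"
proof -
  obtain \<beta> where \<beta>: "\<delta> \<in> Units (quad_alg Dhat)" "\<beta> \<in> Units QQ" "\<beta> [^]\<^bsub>QQ\<^esub> (3::nat) = quad_embed \<delta>"
    "\<And>\<sigma>. \<sigma> \<in> abs_gal \<Longrightarrow> gal_quad \<sigma> \<beta> = \<iota> (c \<sigma>) \<star> \<beta>" using assms(1) by (rule kummer_pairE) (rule that)
  obtain \<beta>' where \<beta>': "\<delta> \<in> Units (quad_alg Dhat)" "\<beta>' \<in> Units QQ" "\<beta>' [^]\<^bsub>QQ\<^esub> (3::nat) = quad_embed \<delta>"
    "\<And>\<sigma>. \<sigma> \<in> abs_gal \<Longrightarrow> gal_quad \<sigma> \<beta>' = \<iota> (c' \<sigma>) \<star> \<beta>'" using assms(2) by (rule kummer_pairE) (rule that)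
  obtain u where u: "u \<noteq> 0" "quad_norm (to_ac Dhat) \<beta> = to_ac u" "quad_norm Dhat \<delta> = u ^ 3"
    using kummer_pair_norm[OF assms(1) c(1) \<beta>(2,3,4)] by blast
  obtain u' where u': "u' \<noteq> 0" "quad_norm (to_ac Dhat) \<beta>' = to_ac u'" "quad_norm Dhat \<delta> = u' ^ 3"
    using kummer_pair_norm[OF assms(2) c(2) \<beta>'(2,3,4)] by blast
  define \<omega> where "\<omega> = u' / u"
  have \<omega>: "\<omega> ^ 3 = 1" unfolding \<omega>_def using u u' by (simp add: power_divide)
  obtain y where y: "y \<star> \<beta> = \<beta>'" using quad_divide[OF \<beta>(2)] by blast
  \<comment> \<open>The scalar \<omega> has norm \<open>\<omega>^2\<close>, so \<open>z\<close> has
    norm \<open>\<omega>^3 = 1\<close>.\<close>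
  define z where "z = y \<star> quad_embed (\<omega>, 0)"
  have Ny: "quad_norm (to_ac Dhat) y = to_ac \<omega>"
  proof -
    have "quad_norm (to_ac Dhat) y * to_ac u = to_ac u'" using u(2) u'(2) unfolding y[symmetric] quad_norm_mult by simp
    then show ?thesis unfolding \<omega>_def using u(1) by (simp add: nonzero_eq_divide_eq)
  qed
  have "quad_norm (to_ac Dhat) z = to_ac \<omega> * to_ac (\<omega>\<^sup>2)"
    unfolding z_def quad_norm_mult Ny quad_embed_norm by (simp add: quad_norm_def)
  also have "\<dots> = to_ac (\<omega> ^ 3)" by (simp add: power2_eq_square power3_eq_cube)
  finally have Nz: "quad_norm (to_ac Dhat) z = 1" unfolding \<omega> by simp
  have du: "quad_embed \<delta> \<in> Units QQ" using \<beta>(1) unfolding quad_embed_units .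
  have "y [^]\<^bsub>QQ\<^esub> (3::nat) \<star> quad_embed \<delta> = \<one>\<^bsub>QQ\<^esub> \<star> quad_embed \<delta>"
    unfolding quad_mult_one using \<beta>'(3) unfolding y[symmetric] quad_pow_mult \<beta>(3) .
  then have y3: "y [^]\<^bsub>QQ\<^esub> (3::nat) = \<one>\<^bsub>QQ\<^esub>" by (rule quad_cancel[OF du])
  have "(\<omega>, 0) [^]\<^bsub>quad_alg Dhat\<^esub> (3::nat) = \<one>\<^bsub>quad_alg Dhat\<^esub>" unfolding quad_cube quad_one using \<omega> by simp
  then have "z [^]\<^bsub>QQ\<^esub> (3::nat) = \<one>\<^bsub>QQ\<^esub>"
    unfolding z_def quad_pow_mult y3 quad_embed_pow[symmetric] by (simp add: quad_embed_one quad_mult_one)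
  then obtain m where m: "m \<in> carrier M" "\<iota> m = z" using \<iota>_surj Nz by blast
  have "c' \<sigma> = c \<sigma> \<otimes> (gal_point \<sigma> m \<otimes> inv m)" if \<sigma>: "\<sigma> \<in> abs_gal" for \<sigma>
  proof -
    note cs = cocycleD(1)[OF c(1) \<sigma>] and cs' = cocycleD(1)[OF c(2) \<sigma>] and gs = gal_point_closed[OF \<sigma> m(1)]
    have "gal_quad \<sigma> y \<star> (\<iota> (c \<sigma>) \<star> \<beta>) = \<iota> (c' \<sigma>) \<star> (y \<star> \<beta>)"
      using \<beta>'(4)[OF \<sigma>] unfolding y[symmetric] gal_quad_mult[OF \<sigma>] \<beta>(4)[OF \<sigma>] .
    then have "(gal_quad \<sigma> y \<star> \<iota> (c \<sigma>)) \<star> \<beta> = (\<iota> (c' \<sigma>) \<star> y) \<star> \<beta>" unfolding quad_assoc .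
    then have gy: "gal_quad \<sigma> y \<star> \<iota> (c \<sigma>) = \<iota> (c' \<sigma>) \<star> y" by (rule quad_cancel[OF \<beta>(2)])
    have "\<iota> (c \<sigma> \<otimes> gal_point \<sigma> m) = \<iota> (c \<sigma>) \<star> (gal_quad \<sigma> y \<star> quad_embed (\<omega>, 0))"
      unfolding \<iota>_mult[OF cs gs] \<iota>_gal[OF \<sigma> m(1)] m(2) z_def gal_quad_mult[OF \<sigma>] gal_quad_embed[OF \<sigma>] ..
    also have "\<dots> = (gal_quad \<sigma> y \<star> \<iota> (c \<sigma>)) \<star> quad_embed (\<omega>, 0)" by (metis quad_assoc quad_comm)
    also have "\<dots> = \<iota> (c' \<sigma> \<otimes> m)" unfolding gy \<iota>_mult[OF cs' m(1)] m(2) z_def quad_assoc ..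
    finally have "c \<sigma> \<otimes> gal_point \<sigma> m = c' \<sigma> \<otimes> m" using \<iota>_inject cs cs' gs m(1) by simp
    then have "(c \<sigma> \<otimes> gal_point \<sigma> m) \<otimes> inv m = (c' \<sigma> \<otimes> m) \<otimes> inv m" by simp
    then show ?thesis using cs cs' gs m(1) by (simp add: m_assoc)
  qed
  then show ?thesis using m(1) by blast
qed

text \<open>A cube root \<beta> of \<delta> is chosen with norm exactly \<open>u\<close>. Since
  \<open>u\<close> is rational, the quotients of conjugates of \<beta> by \<beta> have norm one and
  lie in the image of the module.\<close>

lemma kummer_pair_surj:
  assumes \<delta>: "\<delta> \<in> Units (quad_alg Dhat)" and u: "quad_norm Dhat \<delta> = u ^ 3"
  shows "\<exists>c\<in>carrier ZZ. kummer_pair c \<delta>"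
proof -
  have u0: "u \<noteq> 0" using \<delta> u unfolding quad_units_iff by auto
  obtain d where d: "d\<^sup>2 = to_ac Dhat" using sqrt_exists by blast
  have dn: "d \<noteq> 0" using d Dhat0 by auto
  have d': "(- d)\<^sup>2 = to_ac Dhat" using d by simp
  have prod: "split_at d (quad_embed \<delta>) * split_at (- d) (quad_embed \<delta>) = to_ac u ^ 3"
    unfolding split_norm[OF d, symmetric] quad_embed_norm u by simp
  obtain b where b: "b ^ 3 = split_at d (quad_embed \<delta>)" using cube_root_exists by blast
  have b0: "b \<noteq> 0" using prod u0 unfolding b[symmetric] by auto
  \<comment> \<open>A cube root \<open>b\<close> is free in one splitting; in the other it is
    \<open>u / b\<close>, which forces the norm to be \<open>u\<close>.\<close>
  obtain \<beta> where \<beta>: "split_at d \<beta> = b" "split_at (- d) \<beta> = to_ac u / b"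
    using split_surj[OF two' dn] by blast
  have N: "quad_norm (to_ac Dhat) \<beta> = to_ac u" unfolding split_norm[OF d] \<beta> using b0 by simp
  have \<beta>u: "\<beta> \<in> Units QQ" unfolding quad_units_iff N using u0 by simp
  have cube: "\<beta> [^]\<^bsub>QQ\<^esub> (3::nat) = quad_embed \<delta>"
  proof (rule split_eqI[OF two' dn])
    show "split_at d (\<beta> [^]\<^bsub>QQ\<^esub> (3::nat)) = split_at d (quad_embed \<delta>)" unfolding split_pow[OF d] \<beta> b ..
    have "b ^ 3 * split_at (- d) (quad_embed \<delta>) = to_ac u ^ 3" using prod unfolding b .
    then show "split_at (- d) (\<beta> [^]\<^bsub>QQ\<^esub> (3::nat)) = split_at (- d) (quad_embed \<delta>)"
      unfolding split_pow[OF d'] \<beta> power_divide using b0 by (simp add: nonzero_divide_eq_eq mult.commute)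
  qed
  have "\<exists>P\<in>carrier M. gal_quad \<sigma> \<beta> = \<iota> P \<star> \<beta>" if \<sigma>: "\<sigma> \<in> abs_gal" for \<sigma>
  proof -
    obtain z where z: "z \<star> \<beta> = gal_quad \<sigma> \<beta>" using quad_divide[OF \<beta>u] by blast
    have "quad_norm (to_ac Dhat) z * to_ac u = to_ac u"
      using gal_quad_norm[OF \<sigma>, of Dhat \<beta>] unfolding z[symmetric] quad_norm_mult N gal_base[OF \<sigma>] .
    then have "quad_norm (to_ac Dhat) z = 1" using u0 by simp
    moreover have "z [^]\<^bsub>QQ\<^esub> (3::nat) \<star> quad_embed \<delta> = \<one>\<^bsub>QQ\<^esub> \<star> quad_embed \<delta>"
      using gal_quad_pow[OF \<sigma>, where z = \<beta> and D = Dhat and n = 3] unfolding z[symmetric] quad_pow_mult cube gal_quad_embed[OF \<sigma>] quad_mult_one by simp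
    then have "z [^]\<^bsub>QQ\<^esub> (3::nat) = \<one>\<^bsub>QQ\<^esub>" by (rule quad_cancel[rotated]) (use \<delta> quad_embed_units in blast)
    ultimately obtain P where P: "P \<in> carrier M" "\<iota> P = z" using \<iota>_surj by blast
    show ?thesis by (rule bexI[OF _ P(1)]) (simp only: P(2) z)
  qed
  then have "\<forall>\<sigma>\<in>abs_gal. \<exists>P. P \<in> carrier M \<and> gal_quad \<sigma> \<beta> = \<iota> P \<star> \<beta>" by blast
  from bchoice[OF this] obtain c0 where c0: "\<forall>\<sigma>\<in>abs_gal. c0 \<sigma> \<in> carrier M \<and> gal_quad \<sigma> \<beta> = \<iota> (c0 \<sigma>) \<star> \<beta>" by blast
  define c where "c = restrict c0 abs_gal"
  have c: "c \<sigma> \<in> carrier M" "gal_quad \<sigma> \<beta> = \<iota> (c \<sigma>) \<star> \<beta>" if "\<sigma> \<in> abs_gal" for \<sigma>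
    using c0 that unfolding c_def by simp_all
  \<comment> \<open>The value at \<sigma> is determined by the conjugate of \<beta>. This gives the
    cocycle identity for a function obtained by choice.\<close>
  have uniq: "c \<sigma> = P" if "\<sigma> \<in> abs_gal" "P \<in> carrier M" "gal_quad \<sigma> \<beta> = \<iota> P \<star> \<beta>" for \<sigma> P
    by (rule \<iota>_inject[OF c(1)[OF that(1)] that(2)], rule quad_cancel[OF \<beta>u],
        rule trans[OF c(2)[OF that(1), symmetric] that(3)])
  have "c \<in> carrier ZZ"
  proof (rule cocycleI)
    show "c \<in> extensional abs_gal" unfolding c_def by simp
    show "c \<sigma> \<in> carrier M" if "\<sigma> \<in> abs_gal" for \<sigma> using c that by blast
    show "c (\<sigma> \<circ> \<tau>) = c \<sigma> \<otimes> gal_point \<sigma> (c \<tau>)" if st: "\<sigma> \<in> abs_gal" "\<tau> \<in> abs_gal" for \<sigma> \<tau>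
    proof (rule uniq[OF abs_gal_comp[OF st]])
      note gs = gal_point_closed[OF st(1) c(1)[OF st(2)]]
      show "c \<sigma> \<otimes> gal_point \<sigma> (c \<tau>) \<in> carrier M" using c(1)[OF st(1)] gs by simp
      show "gal_quad (\<sigma> \<circ> \<tau>) \<beta> = \<iota> (c \<sigma> \<otimes> gal_point \<sigma> (c \<tau>)) \<star> \<beta>"
        unfolding gal_quad_comp c(2)[OF st(2)] gal_quad_mult[OF st(1)] c(2)[OF st(1)]
          \<iota>_mult[OF c(1)[OF st(1)] gs] \<iota>_gal[OF st(1) c(1)[OF st(2)]] by (metis quad_assoc quad_comm)
    qed
    \<comment> \<open>The value at \<sigma> depends only on the images of the two coordinates of
      \<beta>.\<close>
    show "\<exists>T. finite T \<and> (\<forall>\<tau>\<in>abs_gal. (\<forall>x\<in>T. \<tau> x = \<sigma> x) \<longrightarrow> c \<tau> = c \<sigma>)" if \<sigma>: "\<sigma> \<in> abs_gal" for \<sigma>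
    proof (intro exI[of _ "{fst \<beta>, snd \<beta>}"] conjI ballI impI)
      fix \<tau> assume \<tau>: "\<tau> \<in> abs_gal" "\<forall>x\<in>{fst \<beta>, snd \<beta>}. \<tau> x = \<sigma> x"
      then have g: "gal_quad \<tau> \<beta> = gal_quad \<sigma> \<beta>" unfolding gal_quad_def by simp
      show "c \<tau> = c \<sigma>" by (rule uniq[OF \<tau>(1) c(1)[OF \<sigma>]], rule trans[OF g c(2)[OF \<sigma>]])
    qed simp
  qed
  moreover have "kummer_pair c \<delta>" unfolding kummer_pair_def using \<delta> \<beta>u cube c(2) by blast
  ultimately show ?thesis by blast
qed

end

section \<open>Classes, orbits and stabilizers\<close>

definition cubes :: "'k::field \<Rightarrow> ('k \<times> 'k) set" where
  "cubes D = {z [^]\<^bsub>quad_alg D\<^esub> (3::nat) | z. z \<in> Units (quad_alg D)}"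

lemma cubes_subgroup: "subgroup (cubes D) (units_of (quad_alg D))"
proof -
  interpret U: comm_group "units_of (quad_alg D)" by (rule quad_units_group)
  show ?thesis
  proof (rule U.subgroupI)
    show "cubes D \<subseteq> carrier (units_of (quad_alg D))"
      unfolding cubes_def quad_units_simps using quad_units_pow_closed by blast
    have "\<one>\<^bsub>quad_alg D\<^esub> [^]\<^bsub>quad_alg D\<^esub> (3::nat) \<in> cubes D"
      unfolding cubes_def using U.one_closed unfolding quad_units_simps by blast
    then show "cubes D \<noteq> {}" by blast
  next
    fix a assume "a \<in> cubes D"
    then obtain z where z: "z \<in> Units (quad_alg D)" "a = z [^]\<^bsub>quad_alg D\<^esub> (3::nat)" unfolding cubes_def by blast
    have zc: "z \<in> carrier (units_of (quad_alg D))" unfolding quad_units_simps by (rule z(1))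
    have "inv\<^bsub>units_of (quad_alg D)\<^esub> a = inv\<^bsub>units_of (quad_alg D)\<^esub> z [^]\<^bsub>quad_alg D\<^esub> (3::nat)"
      using U.nat_pow_inv[OF zc, of 3] z(2) by (simp add: quad_units_pow)
    then show "inv\<^bsub>units_of (quad_alg D)\<^esub> a \<in> cubes D"
      using U.inv_closed[OF zc] unfolding cubes_def quad_units_simps by blast
  next
    fix a b assume "a \<in> cubes D" "b \<in> cubes D"
    then obtain z w where z: "z \<in> Units (quad_alg D)" "a = z [^]\<^bsub>quad_alg D\<^esub> (3::nat)"
      "w \<in> Units (quad_alg D)" "b = w [^]\<^bsub>quad_alg D\<^esub> (3::nat)" unfolding cubes_def by blast
    then show "a \<otimes>\<^bsub>units_of (quad_alg D)\<^esub> b \<in> cubes D"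
      unfolding cubes_def quad_units_simps z(2,4) quad_pow_mult[symmetric] using quad_units_closed by blast
  qed
qed

abbreviation cube_class :: "'k::field \<Rightarrow> 'k \<times> 'k \<Rightarrow> ('k \<times> 'k) set" where
  "cube_class D \<delta> \<equiv> cubes D #>\<^bsub>units_of (quad_alg D)\<^esub> \<delta>"

lemma cube_class_mem: "\<delta>' \<in> cube_class D \<delta> \<longleftrightarrow>
    (\<exists>w\<in>Units (quad_alg D). \<delta>' = \<delta> \<otimes>\<^bsub>quad_alg D\<^esub> w [^]\<^bsub>quad_alg D\<^esub> (3::nat))"
  unfolding r_coset_def cubes_def quad_units_simps using quad_comm by blast

lemma cube_class_self: "\<delta> \<in> cube_class D \<delta>"
proof -
  have "\<one>\<^bsub>quad_alg D\<^esub> \<in> Units (quad_alg D)" by (simp add: quad_units_iff quad_one quad_norm_def)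
  then show ?thesis unfolding cube_class_mem
    by (intro bexI[of _ "\<one>\<^bsub>quad_alg D\<^esub>"]) (simp_all add: quad_one_pow quad_mult_one)
qed

text \<open>The norm condition may be tested on one representative, because norms of cubes are
  cubes.\<close>

lemma norm_one_classes_carrier:
  "C \<in> carrier (norm_one_classes D) \<longleftrightarrow>
    (\<exists>\<delta>\<in>Units (quad_alg D). C = cube_class D \<delta> \<and> (\<exists>u. u \<noteq> 0 \<and> quad_norm D \<delta> = u ^ 3))"
proof -
  have car: "carrier (cube_classes D) = (\<lambda>\<delta>. cube_class D \<delta>) ` Units (quad_alg D)"
    unfolding cube_classes_def FactGroup_def RCOSETS_def cubes_def[symmetric] quad_units_simps by auto
  show ?thesis
  proof
    assume "C \<in> carrier (norm_one_classes D)"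
    then have "C \<in> carrier (cube_classes D)" and N: "\<forall>z\<in>C. \<exists>u. u \<noteq> 0 \<and> quad_norm D z = u ^ 3"
      unfolding norm_one_classes_def by simp_all
    then obtain \<delta> where "\<delta> \<in> Units (quad_alg D)" "C = cube_class D \<delta>" unfolding car by blast
    then show "\<exists>\<delta>\<in>Units (quad_alg D). C = cube_class D \<delta> \<and> (\<exists>u. u \<noteq> 0 \<and> quad_norm D \<delta> = u ^ 3)"
      using N cube_class_self by blast
  next
    assume "\<exists>\<delta>\<in>Units (quad_alg D). C = cube_class D \<delta> \<and> (\<exists>u. u \<noteq> 0 \<and> quad_norm D \<delta> = u ^ 3)"
    then obtain \<delta> u where \<delta>: "\<delta> \<in> Units (quad_alg D)" "C = cube_class D \<delta>" "u \<noteq> 0" "quad_norm D \<delta> = u ^ 3" by blast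
    have "\<exists>u. u \<noteq> 0 \<and> quad_norm D z = u ^ 3" if z: "z \<in> C" for z
    proof -
      obtain w where w: "w \<in> Units (quad_alg D)" "z = \<delta> \<otimes>\<^bsub>quad_alg D\<^esub> w [^]\<^bsub>quad_alg D\<^esub> (3::nat)"
        using z unfolding \<delta>(2) cube_class_mem by blast
      have "quad_norm D z = (u * quad_norm D w) ^ 3"
        unfolding w(2) quad_norm_mult quad_norm_cube \<delta>(4) by (simp add: power_mult_distrib)
      moreover have "u * quad_norm D w \<noteq> 0" using \<delta>(3) w(1) unfolding quad_units_iff by simp
      ultimately show ?thesis by blast
    qed
    then show "C \<in> carrier (norm_one_classes D)"
      unfolding norm_one_classes_def using \<delta>(1,2) car by simp
  qed
qed

text \<open>If \<delta> has norm \<open>u^3\<close>, then \<open>w = u / \<delta>\<close> has norm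
  \<open>u^2 / u^3 = 1 / u\<close>, and \<open>\<delta> w^3\<close> has norm one.\<close>

lemma norm_one_representative:
  assumes "C \<in> carrier (norm_one_classes D)"
  shows "\<exists>\<delta>\<in>C. quad_norm D \<delta> = 1"
proof -
  obtain \<delta> u where \<delta>: "\<delta> \<in> Units (quad_alg D)" "C = cube_class D \<delta>" "u \<noteq> 0" "quad_norm D \<delta> = u ^ 3"
    using assms unfolding norm_one_classes_carrier by blast
  obtain w where w: "w \<otimes>\<^bsub>quad_alg D\<^esub> \<delta> = (u, 0)" using quad_divide[OF \<delta>(1)] by blast
  have "quad_norm D w * u ^ 3 = u\<^sup>2" using quad_norm_mult[of D w \<delta>] unfolding w \<delta>(4) by (simp add: quad_norm_def)
  then have "u\<^sup>2 * (quad_norm D w * u) = u\<^sup>2 * 1" by (simp add: power2_eq_square power3_eq_cube mult_ac)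
  then have Nw: "quad_norm D w * u = 1" using \<delta>(3) by (metis mult_cancel_left power_not_zero)
  then have wu: "w \<in> Units (quad_alg D)" unfolding quad_units_iff by auto
  have "quad_norm D (\<delta> \<otimes>\<^bsub>quad_alg D\<^esub> w [^]\<^bsub>quad_alg D\<^esub> (3::nat)) = (quad_norm D w * u) ^ 3"
    unfolding quad_norm_mult quad_norm_cube \<delta>(4) by (simp add: power_mult_distrib mult.commute)
  then have "quad_norm D (\<delta> \<otimes>\<^bsub>quad_alg D\<^esub> w [^]\<^bsub>quad_alg D\<^esub> (3::nat)) = 1" unfolding Nw by simp
  moreover have "\<delta> \<otimes>\<^bsub>quad_alg D\<^esub> w [^]\<^bsub>quad_alg D\<^esub> (3::nat) \<in> C"
    unfolding \<delta>(2) cube_class_mem using wu by blast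
  ultimately show ?thesis by blast
qed

lemma cube_class_eq_iff:
  assumes "\<delta> \<in> Units (quad_alg D)" "\<delta>' \<in> Units (quad_alg D)"
  shows "cube_class D \<delta> = cube_class D \<delta>' \<longleftrightarrow> \<delta>' \<in> cube_class D \<delta>"
proof -
  interpret U: comm_group "units_of (quad_alg D)" by (rule quad_units_group)
  show ?thesis
  proof
    assume eq: "cube_class D \<delta> = cube_class D \<delta>'"
    show "\<delta>' \<in> cube_class D \<delta>" unfolding eq by (rule cube_class_self)
  next
    assume "\<delta>' \<in> cube_class D \<delta>"
    then show "cube_class D \<delta> = cube_class D \<delta>'"
      by (rule U.repr_independence[OF _ _ cubes_subgroup]) (simp only: quad_units_simps assms)
  qed
qed

text \<open>A transporter is multiplication by some \<kappa> of norm one and multiplies \<delta> by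
  \<open>\<kappa>^3\<close>. Conversely, two elements of norm one that differ by \<open>w^3\<close>
  only force the norm of \<open>w\<close> to be a cube root of unity, so \<open>w\<close> must be
  adjusted to norm one.\<close>

lemma norm_form_orbits:
  fixes D :: "'a::field"
  assumes N: "quad_norm D \<delta> = 1" "quad_norm D \<delta>' = 1" and 2: "(2::'a) \<noteq> 0"
  shows "orbit SL2 cubic_act (norm_form D \<delta>) = orbit SL2 cubic_act (norm_form D \<delta>') \<longleftrightarrow> \<delta>' \<in> cube_class D \<delta>"
proof
  assume "orbit SL2 cubic_act (norm_form D \<delta>) = orbit SL2 cubic_act (norm_form D \<delta>')"
  moreover have "norm_form D \<delta>' \<in> orbit SL2 cubic_act (norm_form D \<delta>')"
    unfolding orbit_def using cubic_act_one[of "norm_form D \<delta>'"] SL2_carrier[of "mat 1 :: 'a ^ 2 ^ 2"] by force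
  ultimately have "norm_form D \<delta>' \<in> orbit SL2 cubic_act (norm_form D \<delta>)" by simp
  then obtain g where g: "g \<in> carrier SL2" "cubic_act g (norm_form D \<delta>) = norm_form D \<delta>'"
    unfolding orbit_def by auto
  obtain \<kappa> where \<kappa>: "quad_norm D \<kappa> = 1" "g = quad_mat D \<kappa>" using norm_form_transporter[OF g N 2] by blast
  have "\<delta>' = \<delta> \<otimes>\<^bsub>quad_alg D\<^esub> \<kappa> [^]\<^bsub>quad_alg D\<^esub> (3::nat)"
    using g(2) unfolding \<kappa>(2) quad_mat_act norm_form_inject by simp
  moreover have "\<kappa> \<in> Units (quad_alg D)" unfolding quad_units_iff \<kappa>(1) by simp
  ultimately show "\<delta>' \<in> cube_class D \<delta>" unfolding cube_class_mem by blast
next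
  assume "\<delta>' \<in> cube_class D \<delta>"
  then obtain w where w: "w \<in> Units (quad_alg D)" "\<delta>' = \<delta> \<otimes>\<^bsub>quad_alg D\<^esub> w [^]\<^bsub>quad_alg D\<^esub> (3::nat)"
    unfolding cube_class_mem by blast
  define \<omega> where "\<omega> = quad_norm D w"
  have \<omega>: "\<omega> ^ 3 = 1" using N unfolding w(2) quad_norm_mult quad_norm_cube \<omega>_def by simp
  \<comment> \<open>Multiplying \<open>w\<close> by the scalar \<omega>, its own norm, yields norm
    \<open>\<omega> * \<omega>^2 = 1\<close> and keeps the cube.\<close>
  define \<kappa> where "\<kappa> = w \<otimes>\<^bsub>quad_alg D\<^esub> (\<omega>, 0)"
  have "quad_norm D \<kappa> = \<omega> ^ 3"
    unfolding \<kappa>_def quad_norm_mult \<omega>_def[symmetric] by (simp add: quad_norm_def power2_eq_square power3_eq_cube)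
  then have \<kappa>: "quad_norm D \<kappa> = 1" using \<omega> by simp
  have "(\<omega>, 0) [^]\<^bsub>quad_alg D\<^esub> (3::nat) = \<one>\<^bsub>quad_alg D\<^esub>" unfolding quad_cube quad_one using \<omega> by simp
  then have "\<kappa> [^]\<^bsub>quad_alg D\<^esub> (3::nat) = w [^]\<^bsub>quad_alg D\<^esub> (3::nat)"
    unfolding \<kappa>_def quad_pow_mult by (simp add: quad_mult_one)
  then have "cubic_act (quad_mat D \<kappa>) (norm_form D \<delta>) = norm_form D \<delta>'" unfolding quad_mat_act w(2) by simp
  moreover have "quad_mat D \<kappa> \<in> carrier SL2" unfolding SL2_carrier det_quad_mat by (rule \<kappa>)
  ultimately show "orbit SL2 cubic_act (norm_form D \<delta>) = orbit SL2 cubic_act (norm_form D \<delta>')"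
    using orbit_eqI by blast
qed

section \<open>The Kummer isomorphism on cohomology\<close>

context kummer
begin

abbreviation BB where "BB \<equiv> coboundaries M gal_point"

text \<open>Inverses come for free: the module has exponent three, so the inverse of
  \<open>c\<close> is its square.\<close>

lemma cocycles_group: "comm_group ZZ"
proof (rule comm_groupI)
  fix c assume c: "c \<in> carrier ZZ"
  show "\<one>\<^bsub>ZZ\<^esub> \<otimes>\<^bsub>ZZ\<^esub> c = c"
    unfolding cocycles_simps using cocycleD(1,3)[OF c] by (auto intro!: extensionalityI[of _ abs_gal])
  have "(c \<otimes>\<^bsub>ZZ\<^esub> c) \<otimes>\<^bsub>ZZ\<^esub> c = \<one>\<^bsub>ZZ\<^esub>"
  proof -
    have "P \<otimes> P \<otimes> P = \<one>" if "P \<in> carrier M" for P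
      using pow_order_eq_1[OF that] that card_M by (simp add: order_def numeral_3_eq_3 m_assoc)
    note cube = this
    show ?thesis unfolding cocycles_simps by (intro restrict_ext) (simp add: cube cocycleD(1)[OF c])
  qed
  moreover have "c \<otimes>\<^bsub>ZZ\<^esub> c \<in> carrier ZZ" unfolding cocycles_simps by (rule cocycle_mult[OF c c])
  ultimately show "\<exists>d\<in>carrier ZZ. d \<otimes>\<^bsub>ZZ\<^esub> c = \<one>\<^bsub>ZZ\<^esub>" by blast
next
  have "(\<lambda>\<sigma>\<in>abs_gal. gal_point \<sigma> \<one> \<otimes> inv \<one>) = \<one>\<^bsub>ZZ\<^esub>"
    unfolding cocycles_simps by (intro restrict_ext) (simp add: gal_point_eq)
  then show "\<one>\<^bsub>ZZ\<^esub> \<in> carrier ZZ" using coboundary_cocycle[OF one_closed] by simp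
next
  fix c d assume c: "c \<in> carrier ZZ" "d \<in> carrier ZZ"
  show "c \<otimes>\<^bsub>ZZ\<^esub> d \<in> carrier ZZ" unfolding cocycles_simps by (rule cocycle_mult[OF c])
  show "c \<otimes>\<^bsub>ZZ\<^esub> d = d \<otimes>\<^bsub>ZZ\<^esub> c"
    unfolding cocycles_simps
    by (intro restrict_ext m_comm cocycleD(1)[OF c(1)] cocycleD(1)[OF c(2)])
  fix e assume e: "e \<in> carrier ZZ"
  show "c \<otimes>\<^bsub>ZZ\<^esub> d \<otimes>\<^bsub>ZZ\<^esub> e = c \<otimes>\<^bsub>ZZ\<^esub> (d \<otimes>\<^bsub>ZZ\<^esub> e)"
    unfolding cocycles_simps
    by (intro restrict_ext) (simp add: m_assoc cocycleD(1)[OF c(1)] cocycleD(1)[OF c(2)] cocycleD(1)[OF e])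
qed

definition cobd where "cobd m = (\<lambda>\<sigma>\<in>abs_gal. gal_point \<sigma> m \<otimes> inv m)"

lemma BB_eq: "BB = cobd ` carrier M"
  unfolding coboundaries_def cobd_def by blast

lemma cobd_mult:
  assumes "m \<in> carrier M" "m' \<in> carrier M"
  shows "cobd m \<otimes>\<^bsub>ZZ\<^esub> cobd m' = cobd (m \<otimes> m')"
  unfolding cocycles_simps cobd_def
  by (intro restrict_ext) (simp add: assms gal_point_mult gal_point_closed inv_mult m_ac)

lemma coboundaries_subgroup: "subgroup BB ZZ"
proof -
  interpret Z: comm_group ZZ by (rule cocycles_group)
  have cl: "cobd m \<in> carrier ZZ" if "m \<in> carrier M" for m unfolding cobd_def by (rule coboundary_cocycle[OF that])
  have one: "cobd \<one> = \<one>\<^bsub>ZZ\<^esub>" unfolding cobd_def cocycles_simps by (intro restrict_ext) (simp add: gal_point_eq)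
  show ?thesis
  proof (rule Z.subgroupI)
    show "BB \<subseteq> carrier ZZ" "BB \<noteq> {}" unfolding BB_eq using cl by auto
  next
    fix b assume "b \<in> BB"
    then obtain m where m: "m \<in> carrier M" "b = cobd m" unfolding BB_eq by blast
    have "cobd (inv m) \<otimes>\<^bsub>ZZ\<^esub> b = \<one>\<^bsub>ZZ\<^esub>" using cobd_mult[of "inv m" m] m one by simp
    then have "inv\<^bsub>ZZ\<^esub> b = cobd (inv m)" using cl m by (intro Z.inv_equality) auto
    then show "inv\<^bsub>ZZ\<^esub> b \<in> BB" unfolding BB_eq using m(1) by simp
  next
    fix b b' assume "b \<in> BB" "b' \<in> BB"
    then show "b \<otimes>\<^bsub>ZZ\<^esub> b' \<in> BB" unfolding BB_eq using cobd_mult by auto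
  qed
qed

lemma coset_mem_iff:
  assumes c: "c \<in> carrier ZZ"
  shows "c' \<in> BB #>\<^bsub>ZZ\<^esub> c \<longleftrightarrow> c' \<in> carrier ZZ \<and> (\<exists>m\<in>carrier M. \<forall>\<sigma>\<in>abs_gal. c' \<sigma> = c \<sigma> \<otimes> (gal_point \<sigma> m \<otimes> inv m))"
proof
  assume "c' \<in> BB #>\<^bsub>ZZ\<^esub> c"
  then obtain m where m: "m \<in> carrier M" "c' = cobd m \<otimes>\<^bsub>ZZ\<^esub> c" unfolding r_coset_def BB_eq by blast
  have "c' \<in> carrier ZZ"
    unfolding m(2) cocycles_simps cobd_def by (rule cocycle_mult[OF coboundary_cocycle[OF m(1)] c])
  moreover have "c' \<sigma> = c \<sigma> \<otimes> (gal_point \<sigma> m \<otimes> inv m)" if "\<sigma> \<in> abs_gal" for \<sigma>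
    unfolding m(2) cocycles_simps cobd_def using that cocycleD(1)[OF c that] gal_point_closed[OF that m(1)] m(1)
    by (simp add: m_comm)
  ultimately show "c' \<in> carrier ZZ \<and> (\<exists>m\<in>carrier M. \<forall>\<sigma>\<in>abs_gal. c' \<sigma> = c \<sigma> \<otimes> (gal_point \<sigma> m \<otimes> inv m))"
    using m(1) by blast
next
  assume "c' \<in> carrier ZZ \<and> (\<exists>m\<in>carrier M. \<forall>\<sigma>\<in>abs_gal. c' \<sigma> = c \<sigma> \<otimes> (gal_point \<sigma> m \<otimes> inv m))"
  then obtain m where c': "c' \<in> carrier ZZ" and m: "m \<in> carrier M" "\<forall>\<sigma>\<in>abs_gal. c' \<sigma> = c \<sigma> \<otimes> (gal_point \<sigma> m \<otimes> inv m)" by blast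
  have "c' = cobd m \<otimes>\<^bsub>ZZ\<^esub> c"
  proof (rule extensionalityI[of _ abs_gal])
    show "c' \<in> extensional abs_gal" by (rule cocycleD(3)[OF c'])
    show "cobd m \<otimes>\<^bsub>ZZ\<^esub> c \<in> extensional abs_gal" unfolding cocycles_simps by simp
    fix \<sigma> :: "'a alg_closure \<Rightarrow> 'a alg_closure" assume \<sigma>: "\<sigma> \<in> abs_gal"
    show "c' \<sigma> = (cobd m \<otimes>\<^bsub>ZZ\<^esub> c) \<sigma>"
      unfolding cocycles_simps cobd_def m(2)[rule_format, OF \<sigma>]
      using \<sigma> cocycleD(1)[OF c \<sigma>] gal_point_closed[OF \<sigma> m(1)] m(1) by (simp add: m_comm)
  qed
  then show "c' \<in> BB #>\<^bsub>ZZ\<^esub> c" unfolding r_coset_def BB_eq using m(1) by blast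
qed

lemma H1_carrier: "carrier (H1 M gal_point) = (\<lambda>c. BB #>\<^bsub>ZZ\<^esub> c) ` carrier ZZ"
  unfolding H1_def FactGroup_def RCOSETS_def by auto

text \<open>\<open>kummer_class\<close> collects every admissible \<delta>. The collection is a
  single coset of cubes, so the induced map can be computed on representatives.\<close>

lemma kummer_class_coset:
  assumes c: "c \<in> carrier ZZ" and p: "kummer_pair c \<delta>"
  shows "kummer_class \<iota> Dhat (BB #>\<^bsub>ZZ\<^esub> c) = cube_class Dhat \<delta>"
proof (rule equalityI; rule subsetI)
  fix \<delta>' assume "\<delta>' \<in> kummer_class \<iota> Dhat (BB #>\<^bsub>ZZ\<^esub> c)"
  then obtain c' where c': "c' \<in> BB #>\<^bsub>ZZ\<^esub> c" "kummer_pair c' \<delta>'"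
    unfolding kummer_class_eq by auto
  then have "\<exists>m\<in>carrier M. \<forall>\<sigma>\<in>abs_gal. c' \<sigma> = c \<sigma> \<otimes> (gal_point \<sigma> m \<otimes> inv m)"
    using coset_mem_iff[OF c, of c'] by simp
  then obtain m where m: "m \<in> carrier M" "\<forall>\<sigma>\<in>abs_gal. c' \<sigma> = c \<sigma> \<otimes> (gal_point \<sigma> m \<otimes> inv m)"
    by (elim bexE)
  have "kummer_pair c' \<delta>" by (rule kummer_pair_coboundary[OF p c m(1)]) (rule m(2)[rule_format])
  then show "\<delta>' \<in> cube_class Dhat \<delta>"
    unfolding cube_class_mem by (rule kummer_pair_same_cocycle[OF _ c'(2)])
next
  interpret Z: comm_group ZZ by (rule cocycles_group)
  fix \<delta>' assume "\<delta>' \<in> cube_class Dhat \<delta>"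
  then obtain w where w: "w \<in> Units (quad_alg Dhat)"
    "\<delta>' = \<delta> \<otimes>\<^bsub>quad_alg Dhat\<^esub> w [^]\<^bsub>quad_alg Dhat\<^esub> (3::nat)"
    unfolding cube_class_mem by (elim bexE)
  have "kummer_pair c \<delta>'" unfolding w(2) by (rule kummer_pair_cube[OF p w(1)])
  then show "\<delta>' \<in> kummer_class \<iota> Dhat (BB #>\<^bsub>ZZ\<^esub> c)"
    unfolding kummer_class_eq by (intro CollectI bexI[OF _ Z.rcos_self[OF c coboundaries_subgroup]])
qed

lemma kummer_pair_unit: "kummer_pair c \<delta> \<Longrightarrow> \<delta> \<in> Units (quad_alg Dhat)"
  unfolding kummer_pair_def by blast

text \<open>Hilbert 90 supplies values, \<open>kummer_pair_norm\<close> places them in the kernel of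
  the norm, and the homomorphism property is read off from products of cosets. Injectivity and
  surjectivity are \<open>kummer_pair_same_class\<close> and
  \<open>kummer_pair_surj\<close>.\<close>

theorem kummer_iso: "kummer_class \<iota> Dhat \<in> iso (H1 M gal_point) (norm_one_classes Dhat)"
proof -
  interpret Z: comm_group ZZ by (rule cocycles_group)
  interpret U: comm_group "units_of (quad_alg Dhat)" by (rule quad_units_group)
  let ?f = "kummer_class \<iota> Dhat" and ?H = "H1 M gal_point" and ?K = "norm_one_classes Dhat"
  have nZ: "normal BB ZZ" by (rule Z.subgroup_imp_normal[OF coboundaries_subgroup])
  have nU: "normal (cubes Dhat) (units_of (quad_alg Dhat))" by (rule U.subgroup_imp_normal[OF cubes_subgroup])
  have img: "?f C \<in> carrier ?K" if C: "C \<in> carrier ?H" for C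
  proof -
    obtain c where c: "c \<in> carrier ZZ" "C = BB #>\<^bsub>ZZ\<^esub> c" using C unfolding H1_carrier by blast
    obtain \<delta> where \<delta>: "kummer_pair c \<delta>" using kummer_pair_exists[OF c(1)] by blast
    obtain \<beta> where "\<beta> \<in> Units QQ" "\<beta> [^]\<^bsub>QQ\<^esub> (3::nat) = quad_embed \<delta>"
      "\<And>\<sigma>. \<sigma> \<in> abs_gal \<Longrightarrow> gal_quad \<sigma> \<beta> = \<iota> (c \<sigma>) \<star> \<beta>" using \<delta> by (rule kummer_pairE) (rule that)
    then have "\<exists>u. u \<noteq> 0 \<and> quad_norm Dhat \<delta> = u ^ 3" using kummer_pair_norm[OF \<delta> c(1)] by blast
    then show ?thesis
      unfolding c(2) kummer_class_coset[OF c(1) \<delta>] norm_one_classes_carrier using kummer_pair_unit[OF \<delta>] by blast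
  qed
  have hom: "?f (C \<otimes>\<^bsub>?H\<^esub> C') = ?f C \<otimes>\<^bsub>?K\<^esub> ?f C'" if C: "C \<in> carrier ?H" "C' \<in> carrier ?H" for C C'
  proof -
    obtain c where c: "c \<in> carrier ZZ" "C = BB #>\<^bsub>ZZ\<^esub> c" using C(1) unfolding H1_carrier by blast
    obtain c' where c': "c' \<in> carrier ZZ" "C' = BB #>\<^bsub>ZZ\<^esub> c'" using C(2) unfolding H1_carrier by blast
    obtain \<delta> where \<delta>: "kummer_pair c \<delta>" using kummer_pair_exists[OF c(1)] by blast
    obtain \<delta>' where \<delta>': "kummer_pair c' \<delta>'" using kummer_pair_exists[OF c'(1)] by blast
    have p: "kummer_pair (c \<otimes>\<^bsub>ZZ\<^esub> c') (\<delta> \<otimes>\<^bsub>quad_alg Dhat\<^esub> \<delta>')"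
      unfolding cocycles_simps by (rule kummer_pair_mult[OF \<delta> \<delta>' c(1) c'(1)])
    have "C \<otimes>\<^bsub>?H\<^esub> C' = BB #>\<^bsub>ZZ\<^esub> (c \<otimes>\<^bsub>ZZ\<^esub> c')"
      unfolding c(2) c'(2) H1_def FactGroup_def using normal.rcos_sum[OF nZ c(1) c'(1)] by simp
    then have "?f (C \<otimes>\<^bsub>?H\<^esub> C') = cube_class Dhat (\<delta> \<otimes>\<^bsub>quad_alg Dhat\<^esub> \<delta>')"
      using kummer_class_coset[OF Z.m_closed[OF c(1) c'(1)] p] by simp
    also have "\<dots> = cube_class Dhat \<delta> <#>\<^bsub>units_of (quad_alg Dhat)\<^esub> cube_class Dhat \<delta>'"
      using normal.rcos_sum[OF nU, of \<delta> \<delta>'] kummer_pair_unit[OF \<delta>] kummer_pair_unit[OF \<delta>']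
      by (simp add: quad_units_simps)
    also have "\<dots> = ?f C \<otimes>\<^bsub>?K\<^esub> ?f C'"
      unfolding c(2) c'(2) kummer_class_coset[OF c(1) \<delta>] kummer_class_coset[OF c'(1) \<delta>']
      by (simp add: norm_one_classes_def cube_classes_def FactGroup_def)
    finally show ?thesis .
  qed
  have inj: "inj_on ?f (carrier ?H)"
  proof (rule inj_onI)
    fix C C' assume C: "C \<in> carrier ?H" "C' \<in> carrier ?H" and eq: "?f C = ?f C'"
    obtain c where c: "c \<in> carrier ZZ" "C = BB #>\<^bsub>ZZ\<^esub> c" using C(1) unfolding H1_carrier by blast
    obtain c' where c': "c' \<in> carrier ZZ" "C' = BB #>\<^bsub>ZZ\<^esub> c'" using C(2) unfolding H1_carrier by blast
    obtain \<delta> where \<delta>: "kummer_pair c \<delta>" using kummer_pair_exists[OF c(1)] by blast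
    obtain \<delta>' where \<delta>': "kummer_pair c' \<delta>'" using kummer_pair_exists[OF c'(1)] by blast
    have "\<delta> \<in> cube_class Dhat \<delta>'"
      using eq cube_class_self[of \<delta> Dhat] unfolding c(2) c'(2) kummer_class_coset[OF c(1) \<delta>] kummer_class_coset[OF c'(1) \<delta>'] by simp
    then obtain w where w: "w \<in> Units (quad_alg Dhat)"
      "\<delta> = \<delta>' \<otimes>\<^bsub>quad_alg Dhat\<^esub> w [^]\<^bsub>quad_alg Dhat\<^esub> (3::nat)"
      unfolding cube_class_mem by (elim bexE)
    \<comment> \<open>Moving within the cube class lets both cocycles be paired with the same
      \<delta>.\<close>
    have "kummer_pair c' \<delta>" unfolding w(2) by (rule kummer_pair_cube[OF \<delta>' w(1)])
    from kummer_pair_same_class[OF \<delta> this c(1) c'(1)] have "c' \<in> BB #>\<^bsub>ZZ\<^esub> c"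
      using coset_mem_iff[OF c(1), of c'] c'(1) by simp
    then show "C = C'"
      unfolding c(2) c'(2) by (rule Z.repr_independence[OF _ c(1) coboundaries_subgroup])
  qed
  have surj: "C \<in> ?f ` carrier ?H" if C: "C \<in> carrier ?K" for C
  proof -
    obtain \<delta> u where \<delta>: "\<delta> \<in> Units (quad_alg Dhat)" "C = cube_class Dhat \<delta>" "quad_norm Dhat \<delta> = u ^ 3"
      using C unfolding norm_one_classes_carrier by blast
    obtain c where c: "c \<in> carrier ZZ" "kummer_pair c \<delta>" using kummer_pair_surj[OF \<delta>(1,3)] by blast
    then have "C = ?f (BB #>\<^bsub>ZZ\<^esub> c)" unfolding \<delta>(2) by (simp add: kummer_class_coset)
    then show ?thesis unfolding H1_carrier using c(1) by blast
  qed
  show ?thesis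
    unfolding iso_def hom_def bij_betw_def using img hom inj surj by (simp add: Pi_def) blast
qed

text \<open>Norm-one elements of a class differ by cubes, so all of them have trace forms in one
  orbit, and distinct classes give distinct orbits. Every orbit is reached because each form of
  discriminant \<open>4 * Dhat\<close> reduces to a norm form.\<close>

theorem orbit_bijection:
  "\<exists>\<Phi>. bij_betw \<Phi> (carrier (H1 M gal_point)) (orbits SL2 {f. cubic_disc f = 4 * Dhat} cubic_act) \<and>
     (\<forall>C \<in> carrier (H1 M gal_point). \<forall>\<delta> \<in> kummer_class \<iota> Dhat C.
        quad_norm Dhat \<delta> = 1 \<longrightarrow> \<Phi> C = orbit SL2 cubic_act (trace_form Dhat \<delta>))"
proof -
  let ?f = "kummer_class \<iota> Dhat" and ?H = "carrier (H1 M gal_point)" and ?K = "carrier (norm_one_classes Dhat)"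
  have bij: "bij_betw ?f ?H ?K" using kummer_iso unfolding iso_def by blast
  \<comment> \<open>The norm-one requirement is part of the choice: only then does the trace form
    have discriminant \<open>4 * Dhat\<close>.\<close>
  define rep where "rep C = (SOME \<delta>. \<delta> \<in> ?f C \<and> quad_norm Dhat \<delta> = 1)" for C
  have fK: "?f C \<in> ?K" if "C \<in> ?H" for C using bij that unfolding bij_betw_def by blast
  have rep: "rep C \<in> ?f C" "quad_norm Dhat (rep C) = 1" if "C \<in> ?H" for C
    using someI_ex[of "\<lambda>\<delta>. \<delta> \<in> ?f C \<and> quad_norm Dhat \<delta> = 1"] norm_one_representative[OF fK[OF that]]
    unfolding rep_def by blast+
  have unit: "\<delta> \<in> Units (quad_alg Dhat)" if "quad_norm Dhat \<delta> = 1" for \<delta> unfolding quad_units_iff that by simp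
  have cls: "?f C = cube_class Dhat \<delta>" if C: "C \<in> ?H" and \<delta>: "\<delta> \<in> ?f C" "quad_norm Dhat \<delta> = 1" for C \<delta>
  proof -
    obtain \<delta>0 where d0: "\<delta>0 \<in> Units (quad_alg Dhat)" "?f C = cube_class Dhat \<delta>0"
      using fK[OF C] unfolding norm_one_classes_carrier by blast
    show ?thesis using cube_class_eq_iff[OF d0(1) unit[OF \<delta>(2)]] \<delta>(1) unfolding d0(2) by simp
  qed
  define \<Phi> where "\<Phi> C = orbit SL2 cubic_act (norm_form Dhat (rep C))" for C
  have \<Phi>: "\<Phi> C = orbit SL2 cubic_act (norm_form Dhat \<delta>)"
    if C: "C \<in> ?H" and \<delta>: "\<delta> \<in> ?f C" "quad_norm Dhat \<delta> = 1" for C \<delta>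
    unfolding \<Phi>_def norm_form_orbits[OF rep(2)[OF C] \<delta>(2) two]
    using \<delta>(1) cls[OF C rep(1)[OF C] rep(2)[OF C]] by simp
  have "bij_betw \<Phi> ?H (orbits SL2 {f. cubic_disc f = 4 * Dhat} cubic_act)"
    unfolding bij_betw_def
  proof
    show "inj_on \<Phi> ?H"
    proof (rule inj_onI)
      fix C C' assume C: "C \<in> ?H" "C' \<in> ?H" and eq: "\<Phi> C = \<Phi> C'"
      have "rep C' \<in> cube_class Dhat (rep C)"
        using eq unfolding \<Phi>_def norm_form_orbits[OF rep(2)[OF C(1)] rep(2)[OF C(2)] two] .
      then have "?f C = ?f C'"
        unfolding cls[OF C(1) rep(1)[OF C(1)] rep(2)[OF C(1)]] cls[OF C(2) rep(1)[OF C(2)] rep(2)[OF C(2)]]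
        using cube_class_eq_iff[OF unit[OF rep(2)[OF C(1)]] unit[OF rep(2)[OF C(2)]]] by blast
      then show "C = C'" using bij C unfolding bij_betw_def inj_on_def by blast
    qed
    show "\<Phi> ` ?H = orbits SL2 {f. cubic_disc f = 4 * Dhat} cubic_act"
    proof (rule equalityI; rule subsetI)
      fix O' assume "O' \<in> \<Phi> ` ?H"
      then obtain C where C: "C \<in> ?H" "O' = \<Phi> C" by blast
      then show "O' \<in> orbits SL2 {f. cubic_disc f = 4 * Dhat} cubic_act"
        unfolding orbits_def \<Phi>_def using disc_norm_form[OF rep(2)[OF C(1)]] by blast
    next
      fix O' assume "O' \<in> orbits SL2 {f. cubic_disc f = 4 * Dhat} cubic_act"
      then obtain f where f: "cubic_disc f = 4 * Dhat" "O' = orbit SL2 cubic_act f" unfolding orbits_def by blast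
      obtain g \<delta> where g: "g \<in> carrier SL2" "quad_norm Dhat \<delta> = 1" "cubic_act g f = norm_form Dhat \<delta>"
        using cubic_reduction[OF f(1) Dhat0 two] by blast
      have "cube_class Dhat \<delta> \<in> ?K"
        unfolding norm_one_classes_carrier using unit[OF g(2)] g(2) by (intro bexI[of _ \<delta>]) (auto intro!: exI[of _ 1])
      then obtain C where C: "C \<in> ?H" "?f C = cube_class Dhat \<delta>" using bij unfolding bij_betw_def by (metis imageE)
      have m: "\<delta> \<in> ?f C" unfolding C(2) by (rule cube_class_self)
      have "O' = \<Phi> C"
        unfolding f(2) orbit_eqI[OF g(1,3)] by (rule \<Phi>[OF C(1) m g(2), symmetric])
      then show "O' \<in> \<Phi> ` ?H" using C(1) by blast
    qed
  qed
  then show ?thesis using \<Phi> trace_form_eq[OF two Dhat0] by (intro exI[of _ \<Phi>]) simp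
qed

section \<open>Rational points and stabilizers\<close>

lemma gal_invariants_group: "group (gal_invariants M)"
proof -
  have "subgroup {P \<in> carrier M. \<forall>\<sigma>\<in>abs_gal. gal_point \<sigma> P = P} M"
  proof (rule subgroupI)
    have "\<one> \<in> {P \<in> carrier M. \<forall>\<sigma>\<in>abs_gal. gal_point \<sigma> P = P}" by (simp add: gal_point_eq)
    then show "{P \<in> carrier M. \<forall>\<sigma>\<in>abs_gal. gal_point \<sigma> P = P} \<noteq> {}" by blast
  next
    fix P assume P: "P \<in> {P \<in> carrier M. \<forall>\<sigma>\<in>abs_gal. gal_point \<sigma> P = P}"
    have "gal_point \<sigma> (inv P) = inv (gal_point \<sigma> P)" if "\<sigma> \<in> abs_gal" for \<sigma>
      using P that by (simp add: gal_point_eq)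
    then show "inv P \<in> {P \<in> carrier M. \<forall>\<sigma>\<in>abs_gal. gal_point \<sigma> P = P}" using P by simp
  qed (auto simp: gal_point_mult)
  then show ?thesis unfolding gal_invariants_def by (rule subgroup_imp_group)
qed

text \<open>After conjugation \<open>f\<close> is the norm form of some \<delta>. An element
  stabilizing it is multiplication by \<kappa> of norm one with
  \<open>\<delta> \<kappa>^3 = \<delta>\<close>, that is, by a rational point of mu3; these
  correspond to the fixed points of the module.\<close>

theorem stabilizer_iso:
  assumes disc: "cubic_disc f = 4 * Dhat"
  shows "SL2\<lparr>carrier := stabilizer SL2 cubic_act f\<rparr> \<cong> gal_invariants M"
proof -
  interpret S: group "SL2 :: ('a ^ 2 ^ 2) monoid" by (rule SL2_group)
  obtain g \<delta> where g: "g \<in> carrier SL2" and N: "quad_norm Dhat \<delta> = 1" and gf: "cubic_act g f = norm_form Dhat \<delta>"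
    using cubic_reduction[OF disc Dhat0 two] by blast
  define gi where "gi = inv\<^bsub>SL2\<^esub> g"
  have gi: "gi \<in> carrier SL2" "gi ** g = mat 1" "g ** gi = mat 1"
    using S.inv_closed[OF g] S.l_inv[OF g] S.r_inv[OF g] unfolding gi_def by (simp_all add: SL2_mult SL2_one)
  have f: "f = cubic_act gi (norm_form Dhat \<delta>)"
    unfolding gf[symmetric] cubic_act_mult[symmetric] gi(2) cubic_act_one ..
  let ?T = "carrier (gal_invariants M)"
  have T: "P \<in> ?T \<longleftrightarrow> P \<in> carrier M \<and> (\<forall>\<sigma>\<in>abs_gal. gal_point \<sigma> P = P)" for P
    by (simp add: gal_invariants_def)
  have "\<exists>\<kappa>. quad_embed \<kappa> = \<iota> P" if P: "P \<in> ?T" for P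
  proof -
    have PM: "P \<in> carrier M" and inv: "\<forall>\<sigma>\<in>abs_gal. gal_point \<sigma> P = P" using P T by blast+
    have "\<iota> P \<in> quad_embed ` Units (quad_alg Dhat)"
    proof (rule quad_fixed_rational[OF char Dhat0])
      show "\<iota> P \<in> Units QQ" unfolding quad_units_iff \<iota>_norm[OF PM] by simp
      show "gal_quad \<sigma> (\<iota> P) = \<iota> P" if "\<sigma> \<in> abs_gal" for \<sigma> using \<iota>_gal[OF that PM] inv that by simp
      show "\<iota> P [^]\<^bsub>QQ\<^esub> (3::nat) \<in> range quad_embed"
        unfolding \<iota>_cube[OF PM] quad_embed_one[symmetric] by (rule rangeI)
    qed
    then obtain \<kappa> where "\<iota> P = quad_embed \<kappa>" by (elim imageE)
    then show ?thesis by (intro exI[of _ \<kappa>]) simp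
  qed
  \<comment> \<open>A fixed point of the module has a fixed image of cube one, and such an element
    is rational.\<close>
  then have "\<forall>P\<in>?T. \<exists>\<kappa>. quad_embed \<kappa> = \<iota> P" by blast
  from bchoice[OF this] obtain k where k: "\<And>P. P \<in> ?T \<Longrightarrow> quad_embed (k P) = \<iota> P" by blast
  have kN: "quad_norm Dhat (k P) = 1" and k3: "k P [^]\<^bsub>quad_alg Dhat\<^esub> (3::nat) = \<one>\<^bsub>quad_alg Dhat\<^esub>" if P: "P \<in> ?T" for P
  proof -
    have PM: "P \<in> carrier M" using P T by blast
    have "to_ac (quad_norm Dhat (k P)) = to_ac 1" unfolding quad_embed_norm[symmetric] k[OF P] \<iota>_norm[OF PM] by simp
    then show "quad_norm Dhat (k P) = 1" by (simp only: to_ac_eq_iff)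
    have "quad_embed (k P [^]\<^bsub>quad_alg Dhat\<^esub> (3::nat)) = quad_embed \<one>\<^bsub>quad_alg Dhat\<^esub>"
      unfolding quad_embed_pow k[OF P] \<iota>_cube[OF PM] quad_embed_one ..
    then show "k P [^]\<^bsub>quad_alg Dhat\<^esub> (3::nat) = \<one>\<^bsub>quad_alg Dhat\<^esub>" unfolding quad_embed_inject .
  qed
  \<comment> \<open>Multiplication by \<open>k P\<close>, carried back from the norm form to
    \<open>f\<close>.\<close>
  define \<theta> where "\<theta> P = gi ** quad_mat Dhat (k P) ** g" for P
  let ?S = "stabilizer SL2 cubic_act f"
  have \<theta>S: "\<theta> P \<in> ?S" if P: "P \<in> ?T" for P
  proof -
    have "\<theta> P \<in> carrier SL2"
      using g gi(1) kN[OF P] unfolding \<theta>_def SL2_carrier by (simp add: det_mul det_quad_mat)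
    moreover have "cubic_act (\<theta> P) f = f"
      unfolding \<theta>_def cubic_act_mult gf quad_mat_act k3[OF P] quad_mult_one f[symmetric] ..
    ultimately show ?thesis unfolding stabilizer_def by blast
  qed
  have conj: "g ** \<theta> P ** gi = quad_mat Dhat (k P)" for P
  proof -
    have "g ** \<theta> P ** gi = (g ** gi) ** quad_mat Dhat (k P) ** (g ** gi)"
      unfolding \<theta>_def by (simp only: matrix_mul_assoc)
    then show ?thesis unfolding gi(3) by simp
  qed
  have hom: "\<theta> (P \<otimes> P') = \<theta> P ** \<theta> P'" if P: "P \<in> ?T" "P' \<in> ?T" for P P'
  proof -
    interpret T: group "gal_invariants M" by (rule gal_invariants_group)
    have PP: "P \<otimes> P' \<in> ?T" using T.m_closed[OF P] by (simp add: gal_invariants_def)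
    have "quad_embed (k (P \<otimes> P')) = quad_embed (k P \<otimes>\<^bsub>quad_alg Dhat\<^esub> k P')"
      unfolding quad_embed_mult k[OF P(1)] k[OF P(2)] k[OF PP] using \<iota>_mult P T by simp
    then have kk: "k (P \<otimes> P') = k P \<otimes>\<^bsub>quad_alg Dhat\<^esub> k P'" unfolding quad_embed_inject .
    have "\<theta> P ** \<theta> P' = gi ** quad_mat Dhat (k P) ** (g ** gi) ** quad_mat Dhat (k P') ** g"
      unfolding \<theta>_def by (simp only: matrix_mul_assoc)
    also have "\<dots> = gi ** (quad_mat Dhat (k P) ** quad_mat Dhat (k P')) ** g"
      unfolding gi(3) by (simp only: matrix_mul_rid matrix_mul_assoc)
    finally show ?thesis unfolding \<theta>_def quad_mat_mult kk ..
  qed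
  have inj: "inj_on \<theta> ?T"
  proof (rule inj_onI)
    fix P P' assume P: "P \<in> ?T" "P' \<in> ?T" and eq: "\<theta> P = \<theta> P'"
    have "quad_mat Dhat (k P) = quad_mat Dhat (k P')" using conj[of P] conj[of P'] eq by simp
    then have "\<iota> P = \<iota> P'" unfolding quad_mat_inject using k[OF P(1)] k[OF P(2)] by simp
    then show "P = P'" using \<iota>_inject P T by blast
  qed
  have surj: "h \<in> \<theta> ` ?T" if h: "h \<in> ?S" for h
  proof -
    have hc: "h \<in> carrier SL2" "cubic_act h f = f" using h unfolding stabilizer_def by blast+
    let ?h = "g ** h ** gi"
    have hh: "?h \<in> carrier SL2" using hc(1) g gi(1) by (simp add: SL2_carrier det_mul)
    have act: "cubic_act ?h (norm_form Dhat \<delta>) = norm_form Dhat \<delta>"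
      unfolding cubic_act_mult f[symmetric] hc(2) gf ..
    obtain \<kappa> where \<kappa>: "quad_norm Dhat \<kappa> = 1" "?h = quad_mat Dhat \<kappa>"
      using norm_form_transporter[OF hh act N N two] by blast
    have "\<kappa> [^]\<^bsub>quad_alg Dhat\<^esub> (3::nat) \<otimes>\<^bsub>quad_alg Dhat\<^esub> \<delta> = \<one>\<^bsub>quad_alg Dhat\<^esub> \<otimes>\<^bsub>quad_alg Dhat\<^esub> \<delta>"
      using act unfolding \<kappa>(2) quad_mat_act norm_form_inject quad_mult_one by (simp add: quad_comm)
    then have \<kappa>3: "\<kappa> [^]\<^bsub>quad_alg Dhat\<^esub> (3::nat) = \<one>\<^bsub>quad_alg Dhat\<^esub>"
      by (rule quad_cancel[rotated]) (simp add: quad_units_iff N)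
    have "\<exists>P\<in>carrier M. \<iota> P = quad_embed \<kappa>"
    proof (rule \<iota>_surj)
      show "quad_embed \<kappa> [^]\<^bsub>QQ\<^esub> (3::nat) = \<one>\<^bsub>QQ\<^esub>" unfolding quad_embed_pow[symmetric] \<kappa>3 quad_embed_one ..
      show "quad_norm (to_ac Dhat) (quad_embed \<kappa>) = 1" unfolding quad_embed_norm \<kappa>(1) by simp
    qed
    then obtain P where P: "P \<in> carrier M" "\<iota> P = quad_embed \<kappa>" by blast
    have "gal_point \<sigma> P = P" if \<sigma>: "\<sigma> \<in> abs_gal" for \<sigma>
      by (rule \<iota>_inject[OF gal_point_closed[OF \<sigma> P(1)] P(1)]) (simp add: \<iota>_gal[OF \<sigma> P(1)] P(2) gal_quad_embed[OF \<sigma>])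
    then have PT: "P \<in> ?T" using T P(1) by blast
    have "k P = \<kappa>" using k[OF PT] unfolding P(2) quad_embed_inject .
    then have "\<theta> P = gi ** (g ** h ** gi) ** g" unfolding \<theta>_def \<kappa>(2) by simp
    also have "\<dots> = (gi ** g) ** h ** (gi ** g)" by (simp only: matrix_mul_assoc)
    also have "\<dots> = h" unfolding gi(2) by simp
    finally show ?thesis using PT by blast
  qed
  have "\<theta> \<in> iso (gal_invariants M) (SL2\<lparr>carrier := ?S\<rparr>)"
    unfolding iso_def hom_def bij_betw_def using \<theta>S hom inj surj
    by (auto simp: SL2_mult) (simp_all add: gal_invariants_def SL2_mult)
  then show ?thesis using group.iso_sym[OF gal_invariants_group] unfolding is_iso_def by blast
qed

end

section \<open>Forms and generic properties\<close>

text \<open>Keeps the sums in \<open>forms\<close> meaningful: a sum over an infinite index set is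
  zero by convention.\<close>

lemma finite_exponents: "finite {m :: 'n::finite \<Rightarrow> nat. sum m UNIV = d}"
proof (rule finite_subset)
  show "{m :: 'n \<Rightarrow> nat. sum m UNIV = d} \<subseteq> UNIV \<rightarrow>\<^sub>E {..d}"
    by (auto simp: sum_nonneg_leq_bound member_le_sum)
qed (intro finite_PiE, auto)

lemma forms_mono: "R \<subseteq> R' \<Longrightarrow> forms R d \<subseteq> forms R' d"
  unfolding forms_def by blast

lemma form_monomial:
  fixes m :: "'n::finite \<Rightarrow> nat" and a :: "'k::field"
  shows "(\<lambda>x. a * (\<Prod>i\<in>UNIV. (x $ i) ^ m i)) \<in> forms UNIV (sum m UNIV)"
proof -
  have "(\<Sum>m' | sum m' UNIV = sum m UNIV. (if m' = m then a else 0) * (\<Prod>i\<in>UNIV. (x $ i) ^ m' i)) =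
      a * (\<Prod>i\<in>UNIV. (x $ i) ^ m i)" for x :: "'k ^ 'n"
  proof -
    have "(\<Sum>m' | sum m' UNIV = sum m UNIV. (if m' = m then a else 0) * (\<Prod>i\<in>UNIV. (x $ i) ^ m' i)) =
        (\<Sum>m' | sum m' UNIV = sum m UNIV. if m' = m then a * (\<Prod>i\<in>UNIV. (x $ i) ^ m i) else 0)"
      by (intro sum.cong) auto
    then show ?thesis by (simp add: finite_exponents)
  qed
  then show ?thesis
    unfolding forms_def by (auto intro!: exI[of _ "\<lambda>m'. if m' = m then a else 0"])
qed

lemma form_0: "(\<lambda>x. 0) \<in> forms UNIV d"
  unfolding forms_def by (auto intro!: exI[of _ "\<lambda>_. 0"])

lemma form_add: "f \<in> forms UNIV d \<Longrightarrow> g \<in> forms UNIV d \<Longrightarrow> (\<lambda>x. f x + g x) \<in> forms UNIV d"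
proof -
  assume "f \<in> forms UNIV d" "g \<in> forms UNIV d"
  then obtain c c' where
    "f = (\<lambda>x. \<Sum>m | sum m UNIV = d. c m * (\<Prod>i\<in>UNIV. (x $ i) ^ m i))"
    "g = (\<lambda>x. \<Sum>m | sum m UNIV = d. c' m * (\<Prod>i\<in>UNIV. (x $ i) ^ m i))"
    unfolding forms_def by blast
  then show "(\<lambda>x. f x + g x) \<in> forms UNIV d"
    unfolding forms_def
    by (auto intro!: exI[of _ "\<lambda>m. c m + c' m"] simp: sum.distrib distrib_right)
qed

lemma form_sum: "(\<And>i. i \<in> I \<Longrightarrow> f i \<in> forms UNIV d) \<Longrightarrow> (\<lambda>x. \<Sum>i\<in>I. f i x) \<in> forms UNIV d"
  by (induction I rule: infinite_finite_induct) (auto simp: form_0 form_add)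

lemma form_mult:
  fixes f g :: "'k::field ^ 'n::finite \<Rightarrow> 'k"
  assumes "f \<in> forms UNIV d" "g \<in> forms UNIV e"
  shows "(\<lambda>x. f x * g x) \<in> forms UNIV (d + e)"
proof -
  obtain c c' where fg:
    "f = (\<lambda>x. \<Sum>m | sum m UNIV = d. c m * (\<Prod>i\<in>UNIV. (x $ i) ^ m i))"
    "g = (\<lambda>x. \<Sum>m | sum m UNIV = e. c' m * (\<Prod>i\<in>UNIV. (x $ i) ^ m i))"
    using assms unfolding forms_def by blast
  have "(\<lambda>x. f x * g x) = (\<lambda>x. \<Sum>m | sum m UNIV = d. \<Sum>m' | sum m' UNIV = e.
      (c m * c' m') * (\<Prod>i\<in>UNIV. (x $ i) ^ (m i + m' i)))"
    unfolding fg sum_product by (simp add: power_add prod.distrib mult_ac)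
  moreover have "(\<lambda>x :: 'k ^ 'n. (c m * c' m') * (\<Prod>i\<in>UNIV. (x $ i) ^ (m i + m' i))) \<in> forms UNIV (d + e)"
    if "sum m UNIV = d" "sum m' UNIV = e" for m m'
    using form_monomial[of "c m * c' m'" "\<lambda>i. m i + m' i"] that by (simp add: sum.distrib)
  ultimately show ?thesis by (auto intro!: form_sum)
qed

lemma form_const: "(\<lambda>x :: 'k::field ^ 'n::finite. c) \<in> forms UNIV 0"
  using form_monomial[of c "\<lambda>_ :: 'n. 0"] by simp

lemma form_coord: "(\<lambda>x :: 'k::field ^ 'n::finite. x $ i) \<in> forms UNIV 1"
proof -
  have "(\<Prod>j\<in>UNIV. (x $ j) ^ (if j = i then 1 else 0)) = x $ i" for x :: "'k ^ 'n"
  proof -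
    have "(\<Prod>j\<in>UNIV. (x $ j) ^ (if j = i then 1 else 0)) = (\<Prod>j\<in>UNIV. if j = i then x $ j else 1)"
      by (intro prod.cong) auto
    then show ?thesis by simp
  qed
  then show ?thesis
    using form_monomial[of "1 :: 'k" "\<lambda>j :: 'n. if j = i then 1 else 0"] by simp
qed

lemma form_cmult: "f \<in> forms UNIV d \<Longrightarrow> (\<lambda>x. c * f x) \<in> forms UNIV d"
  using form_mult[OF form_const] by fastforce

lemma form_diff: "f \<in> forms UNIV d \<Longrightarrow> g \<in> forms UNIV d \<Longrightarrow> (\<lambda>x. f x - g x) \<in> forms UNIV d"
  using form_add[of f d "\<lambda>x. - 1 * g x"] form_cmult[of g d "- 1"] by simp

lemma form_power: "f \<in> forms UNIV d \<Longrightarrow> (\<lambda>x. f x ^ n) \<in> forms UNIV (n * d)"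
  by (induction n) (auto simp: form_const intro: form_mult)

lemma form_prod:
  "finite I \<Longrightarrow> (\<And>i. i \<in> I \<Longrightarrow> f i \<in> forms UNIV (e i)) \<Longrightarrow>
    (\<lambda>x. \<Prod>i\<in>I. f i x) \<in> forms UNIV (sum e I)"
  by (induction I rule: finite_induct) (auto simp: form_const intro: form_mult)

lemma form_compose:
  fixes G :: "'m::finite \<Rightarrow> 'k::field ^ 'n::finite \<Rightarrow> 'k"
  assumes "f \<in> forms UNIV d" "\<And>j. G j \<in> forms UNIV e"
  shows "(\<lambda>x. f (\<chi> j. G j x)) \<in> forms UNIV (d * e)"
proof -
  obtain c where f: "f = (\<lambda>x. \<Sum>m | sum m UNIV = d. c m * (\<Prod>i\<in>UNIV. (x $ i) ^ m i))"
    using assms(1) unfolding forms_def by blast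
  have "(\<lambda>x. c m * (\<Prod>i\<in>UNIV. G i x ^ m i)) \<in> forms UNIV (d * e)" if "sum m UNIV = d" for m
    using form_cmult[OF form_prod[of UNIV "\<lambda>i x. G i x ^ m i" "\<lambda>i. m i * e"], of "c m"]
      form_power[OF assms(2)] that
    by (simp add: sum_distrib_right[symmetric])
  then show ?thesis unfolding f by (auto intro!: form_sum)
qed

lemma form_homogeneous: "f \<in> forms UNIV d \<Longrightarrow> f (c *s x) = c ^ d * f x"
proof -
  assume "f \<in> forms UNIV d"
  then obtain a where f: "f = (\<lambda>x. \<Sum>m | sum m UNIV = d. a m * (\<Prod>i\<in>UNIV. (x $ i) ^ m i))"
    unfolding forms_def by blast
  show ?thesis
    unfolding f sum_distrib_left
    by (intro sum.cong) (auto simp: power_mult_distrib prod.distrib simp flip: power_sum)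
qed

lemma proj_eq_iff: "proj x = proj y \<longleftrightarrow> (\<exists>c. c \<noteq> 0 \<and> y = c *s x)"
proof
  assume "proj x = proj y"
  moreover have "y \<in> proj y" unfolding proj_def by (auto intro!: exI[of _ 1])
  ultimately show "\<exists>c. c \<noteq> 0 \<and> y = c *s x" unfolding proj_def by blast
next
  assume "\<exists>c. c \<noteq> 0 \<and> y = c *s x"
  then obtain c where c: "c \<noteq> 0" "y = c *s x" by blast
  show "proj x = proj y"
  proof (rule equalityI; rule subsetI)
    fix z assume "z \<in> proj x"
    then obtain b where "b \<noteq> 0" "z = b *s x" unfolding proj_def by blast
    then show "z \<in> proj y" unfolding proj_def c(2) using c(1)
      by (auto intro!: exI[of _ "b / c"])
  next
    fix z assume "z \<in> proj y"
    then obtain b where "b \<noteq> 0" "z = b *s y" unfolding proj_def by blast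
    then show "z \<in> proj x" unfolding proj_def c(2) using c(1)
      by (auto intro!: exI[of _ "b * c"])
  qed
qed

lemma zariski_closedE:
  assumes "zariski_closed V"
  obtains S where "S \<subseteq> (\<Union>d. forms UNIV d)" "\<And>x. x \<noteq> 0 \<Longrightarrow> proj x \<in> V \<longleftrightarrow> (\<forall>g\<in>S. g x = 0)"
    "\<And>P. P \<in> V \<Longrightarrow> \<exists>x. x \<noteq> 0 \<and> P = proj x"
proof -
  obtain S where S: "S \<subseteq> (\<Union>d. forms UNIV d)" "V = {proj x | x. x \<noteq> 0 \<and> (\<forall>g\<in>S. g x = 0)}"
    using assms unfolding zariski_closed_def by blast
  have "proj x \<in> V \<longleftrightarrow> (\<forall>g\<in>S. g x = 0)" if "x \<noteq> 0" for x
  proof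
    assume "proj x \<in> V"
    then obtain y where y: "proj x = proj y" "\<forall>g\<in>S. g y = 0" unfolding S(2) by blast
    then obtain c where c: "c \<noteq> 0" "y = c *s x" using proj_eq_iff by blast
    show "\<forall>g\<in>S. g x = 0"
    proof
      fix g assume g: "g \<in> S"
      then obtain d where "g \<in> forms UNIV d" using S(1) by blast
      then have "g y = c ^ d * g x" unfolding c(2) by (rule form_homogeneous)
      then show "g x = 0" using y(2) g c(1) by auto
    qed
  qed (use that in \<open>auto simp: S(2)\<close>)
  then show thesis using that[OF S(1)] S(2) by blast
qed

text \<open>A representative vector is chosen, but the value does not depend on it for forms of
  equal degree.\<close>

definition form_ratio :: "('k::field ^ 'n::finite \<Rightarrow> 'k) \<Rightarrow> ('k ^ 'n \<Rightarrow> 'k) \<Rightarrow> ('k, 'n) point \<Rightarrow> 'k" where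
  "form_ratio g h P = (let x = (SOME x. P = proj x) in g x / h x)"

lemma form_ratio_proj:
  assumes "g \<in> forms UNIV d" "h \<in> forms UNIV d"
  shows "form_ratio g h (proj x) = g x / h x"
proof -
  have "proj x = proj (SOME y. proj x = proj y)" by (rule someI) simp
  then obtain c where "c \<noteq> 0" "(SOME y. proj x = proj y) = c *s x"
    using proj_eq_iff by blast
  then show ?thesis
    unfolding form_ratio_def Let_def by (simp add: form_homogeneous[OF assms(1)] form_homogeneous[OF assms(2)])
qed

text \<open>The property holds on the nonempty open set where some form is nonzero. It is a property
  of vectors rather than points, so that forms can be evaluated in it.\<close>

definition generically :: "('k::field, 'n::finite) point set \<Rightarrow> ('k ^ 'n \<Rightarrow> bool) \<Rightarrow> bool" where
  "generically V Q \<longleftrightarrow> (\<exists>d. \<exists>h\<in>forms UNIV d. \<not> vanishes_on h V \<and>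
     (\<forall>x. x \<noteq> 0 \<and> proj x \<in> V \<and> h x \<noteq> 0 \<longrightarrow> Q x))"

lemma generically_mono:
  "generically V Q \<Longrightarrow> (\<And>x. x \<noteq> 0 \<Longrightarrow> proj x \<in> V \<Longrightarrow> Q x \<Longrightarrow> Q' x) \<Longrightarrow> generically V Q'"
  unfolding generically_def by metis

lemma generically_ex: "generically V Q \<Longrightarrow> \<exists>x. x \<noteq> 0 \<and> proj x \<in> V \<and> Q x"
  unfolding generically_def vanishes_on_def by blast

lemma generically_form: "h \<in> forms UNIV d \<Longrightarrow> \<not> vanishes_on h V \<Longrightarrow> generically V (\<lambda>x. h x \<noteq> 0)"
  unfolding generically_def by blast

locale irreducible_variety =
  fixes V :: "('k::field, 'n::finite) point set"
  assumes closed: "zariski_closed V" and irreducible: "zariski_irreducible V"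
begin

lemma point_rep: "P \<in> V \<Longrightarrow> \<exists>x. x \<noteq> 0 \<and> P = proj x"
  using zariski_closedE[OF closed] by metis

lemma zero_set_closed:
  assumes "h \<in> forms UNIV d"
  shows "zariski_closed {proj x | x. x \<noteq> 0 \<and> h x = 0}"
  unfolding zariski_closed_def using assms by (intro exI[of _ "{h}"]) auto

text \<open>The homogeneous ideal of an irreducible variety is prime. Hence two nonempty open sets
  meet, which is what makes \<open>generically\<close> closed under conjunction.\<close>

lemma vanishes_on_mult:
  assumes g: "g \<in> forms UNIV d" and h: "h \<in> forms UNIV e" and "vanishes_on (\<lambda>x. g x * h x) V"
  shows "vanishes_on g V \<or> vanishes_on h V"
proof -
  have Z: "vanishes_on f V" if f: "f \<in> forms UNIV d" "V \<subseteq> {proj x | x. x \<noteq> 0 \<and> f x = 0}" for f d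
    unfolding vanishes_on_def
  proof (intro allI impI)
    fix x assume "x \<noteq> 0 \<and> proj x \<in> V"
    then obtain y where y: "proj y = proj x" "f y = 0" using f(2) by blast
    then obtain c where "x = c *s y" using proj_eq_iff by blast
    then show "f x = 0" using y(2) form_homogeneous[OF f(1)] by simp
  qed
  have "V \<subseteq> {proj x | x. x \<noteq> 0 \<and> g x = 0} \<union> {proj x | x. x \<noteq> 0 \<and> h x = 0}"
  proof
    fix P assume P: "P \<in> V"
    then obtain x where x: "x \<noteq> 0" "P = proj x" using point_rep by blast
    then have "g x = 0 \<or> h x = 0" using assms(3) P unfolding vanishes_on_def by simp
    then show "P \<in> {proj x | x. x \<noteq> 0 \<and> g x = 0} \<union> {proj x | x. x \<noteq> 0 \<and> h x = 0}"
      using x by blast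
  qed
  then have "V \<subseteq> {proj x | x. x \<noteq> 0 \<and> g x = 0} \<or> V \<subseteq> {proj x | x. x \<noteq> 0 \<and> h x = 0}"
    using irreducible zero_set_closed[OF g] zero_set_closed[OF h] by (simp add: zariski_irreducible_def)
  then show ?thesis using Z[OF g] Z[OF h] by blast
qed

lemma generically_conj:
  assumes "generically V Q" "generically V Q'"
  shows "generically V (\<lambda>x. Q x \<and> Q' x)"
proof -
  obtain d h where h: "h \<in> forms UNIV d" "\<not> vanishes_on h V" "\<And>x. x \<noteq> 0 \<Longrightarrow> proj x \<in> V \<Longrightarrow> h x \<noteq> 0 \<Longrightarrow> Q x"
    using assms(1) unfolding generically_def by metis
  obtain e g where g: "g \<in> forms UNIV e" "\<not> vanishes_on g V" "\<And>x. x \<noteq> 0 \<Longrightarrow> proj x \<in> V \<Longrightarrow> g x \<noteq> 0 \<Longrightarrow> Q' x"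
    using assms(2) unfolding generically_def by metis
  have "\<not> vanishes_on (\<lambda>x. h x * g x) V" using vanishes_on_mult[OF h(1) g(1)] h(2) g(2) by blast
  then show ?thesis
    unfolding generically_def using form_mult[OF h(1) g(1)] h(3) g(3)
    by (intro exI[of _ "d + e"] bexI[of _ "\<lambda>x. h x * g x"]) auto
qed

lemma generically_always: "(\<And>x. x \<noteq> 0 \<Longrightarrow> proj x \<in> V \<Longrightarrow> Q x) \<Longrightarrow> generically V Q"
proof -
  assume Q: "\<And>x. x \<noteq> 0 \<Longrightarrow> proj x \<in> V \<Longrightarrow> Q x"
  obtain P where "P \<in> V" using irreducible unfolding zariski_irreducible_def by blast
  then obtain x where "x \<noteq> 0" "proj x \<in> V" using point_rep by blast
  then have "\<not> vanishes_on (\<lambda>x. 1) V" unfolding vanishes_on_def by (metis zero_neq_one)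
  then show ?thesis unfolding generically_def using Q form_const[of 1] by blast
qed

lemma generically_ball:
  assumes "finite I" "\<And>i. i \<in> I \<Longrightarrow> generically V (Q i)"
  shows "generically V (\<lambda>x. \<forall>i\<in>I. Q i x)"
  using assms
proof (induction I rule: finite_induct)
  case empty
  then show ?case by (simp add: generically_always)
next
  case (insert i I)
  then have "generically V (\<lambda>x. Q i x \<and> (\<forall>i\<in>I. Q i x))" by (intro generically_conj) auto
  then show ?case by (rule generically_mono) auto
qed

lemma generically_False: "generically V Q \<Longrightarrow> (\<And>x. x \<noteq> 0 \<Longrightarrow> proj x \<in> V \<Longrightarrow> \<not> Q x) \<Longrightarrow> False"
  using generically_ex by blast

lemma generically_zero_form:
  assumes "h \<in> forms UNIV d" "generically V (\<lambda>x. h x = 0)"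
  shows "vanishes_on h V"
  using generically_conj[OF generically_form[OF assms(1)] assms(2)] generically_ex by fastforce

text \<open>The definition wants the quotient formula wherever the denominator is nonzero.
  Multiplying numerator and denominator by a form \<open>k\<close> shrinks that locus to where the
  formula is known.\<close>

lemma rational_repsI:
  assumes "g \<in> forms UNIV d" "h \<in> forms UNIV d" "\<not> vanishes_on h V"
    and "generically V (\<lambda>x. f (proj x) = g x / h x)"
  shows "f \<in> carrier (rational_representatives V)"
proof -
  obtain e k where k: "k \<in> forms UNIV e" "\<not> vanishes_on k V"
    "\<And>x. x \<noteq> 0 \<Longrightarrow> proj x \<in> V \<Longrightarrow> k x \<noteq> 0 \<Longrightarrow> f (proj x) = g x / h x"
    using assms(4) unfolding generically_def by metis
  have "\<not> vanishes_on (\<lambda>x. h x * k x) V" using vanishes_on_mult[OF assms(2) k(1)] assms(3) k(2) by blast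
  then have "f \<in> {f. \<exists>d. \<exists>g \<in> forms UNIV d. \<exists>h \<in> forms UNIV d. \<not> vanishes_on h V \<and>
        (\<forall>x. x \<noteq> 0 \<and> proj x \<in> V \<and> h x \<noteq> 0 \<longrightarrow> f (proj x) = g x / h x)}"
    using form_mult[OF assms(1) k(1)] form_mult[OF assms(2) k(1)] k(3)
    by (intro CollectI exI[of _ "d + e"] bexI[of _ "\<lambda>x. g x * k x"] bexI[of _ "\<lambda>x. h x * k x"]) auto
  then show ?thesis unfolding rational_representatives_def by simp
qed

lemma rational_repsE:
  assumes "f \<in> carrier (rational_representatives V)"
  obtains d g h where "g \<in> forms UNIV d" "h \<in> forms UNIV d" "\<not> vanishes_on h V"
    "generically V (\<lambda>x. h x \<noteq> 0 \<and> f (proj x) = g x / h x)"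
proof -
  obtain d g h where *: "g \<in> forms UNIV d" "h \<in> forms UNIV d" "\<not> vanishes_on h V"
    "\<forall>x. x \<noteq> 0 \<and> proj x \<in> V \<and> h x \<noteq> 0 \<longrightarrow> f (proj x) = g x / h x"
    using assms unfolding rational_representatives_def by auto
  then have "generically V (\<lambda>x. h x \<noteq> 0 \<and> f (proj x) = g x / h x)"
    unfolding generically_def by blast
  then show thesis using that * by blast
qed

lemma rational_const: "(\<lambda>P. c) \<in> carrier (rational_representatives V)"
proof (rule rational_repsI)
  show "(\<lambda>x. c) \<in> forms UNIV 0" "(\<lambda>x. 1) \<in> forms UNIV 0" by (rule form_const)+
  show "\<not> vanishes_on (\<lambda>x. 1) V"
    using generically_ex[OF generically_always[of "\<lambda>_. True"]] unfolding vanishes_on_def by auto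
  show "generically V (\<lambda>x. c = c / 1)" by (simp add: generically_always)
qed

lemma rational_add_mult:
  assumes "f \<in> carrier (rational_representatives V)" "f' \<in> carrier (rational_representatives V)"
  shows rational_add: "(\<lambda>P. f P + f' P) \<in> carrier (rational_representatives V)"
    and rational_mult: "(\<lambda>P. f P * f' P) \<in> carrier (rational_representatives V)"
proof -
  obtain d g h where h: "g \<in> forms UNIV d" "h \<in> forms UNIV d" "\<not> vanishes_on h V"
    "generically V (\<lambda>x. h x \<noteq> 0 \<and> f (proj x) = g x / h x)"
    using assms(1) by (rule rational_repsE)
  obtain d' g' h' where h': "g' \<in> forms UNIV d'" "h' \<in> forms UNIV d'" "\<not> vanishes_on h' V"
    "generically V (\<lambda>x. h' x \<noteq> 0 \<and> f' (proj x) = g' x / h' x)"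
    using assms(2) by (rule rational_repsE)
  have nv: "\<not> vanishes_on (\<lambda>x. h x * h' x) V" using vanishes_on_mult[OF h(2) h'(2)] h(3) h'(3) by blast
  note c = generically_conj[OF h(4) h'(4)]
  have "(\<lambda>x. g x * h' x + h x * g' x) \<in> forms UNIV (d + d')"
    using h(1,2) h'(1,2) by (intro form_add form_mult)
  then show "(\<lambda>P. f P + f' P) \<in> carrier (rational_representatives V)"
    by (rule rational_repsI[OF _ form_mult[OF h(2) h'(2)] nv])
      (rule generically_mono[OF c], auto simp: field_simps)
  show "(\<lambda>P. f P * f' P) \<in> carrier (rational_representatives V)"
    by (rule rational_repsI[OF form_mult[OF h(1) h'(1)] form_mult[OF h(2) h'(2)] nv])
      (rule generically_mono[OF c], auto simp: field_simps)
qed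

lemma rational_uminus:
  "f \<in> carrier (rational_representatives V) \<Longrightarrow> (\<lambda>P. - f P) \<in> carrier (rational_representatives V)"
  using rational_mult[OF rational_const[of "- 1"], of f] by simp

lemma rational_diff:
  "f \<in> carrier (rational_representatives V) \<Longrightarrow> f' \<in> carrier (rational_representatives V) \<Longrightarrow>
    (\<lambda>P. f P - f' P) \<in> carrier (rational_representatives V)"
  using rational_add[OF _ rational_uminus, of f f'] by simp

text \<open>Either the numerator vanishes on \<open>V\<close>, or it is nonzero on an open set. This
  dichotomy replaces the alternative zero or invertible in the function field.\<close>

lemma rational_zero_or_nonzero:
  assumes "f \<in> carrier (rational_representatives V)"
  shows "generically V (\<lambda>x. f (proj x) = 0) \<or> generically V (\<lambda>x. f (proj x) \<noteq> 0)"
proof -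
  obtain d g h where h: "g \<in> forms UNIV d" "h \<in> forms UNIV d" "\<not> vanishes_on h V"
    "generically V (\<lambda>x. h x \<noteq> 0 \<and> f (proj x) = g x / h x)"
    using assms by (rule rational_repsE)
  show ?thesis
  proof (cases "vanishes_on g V")
    case True
    have "generically V (\<lambda>x. f (proj x) = 0)"
      by (rule generically_mono[OF h(4)]) (use True in \<open>auto simp: vanishes_on_def\<close>)
    then show ?thesis ..
  next
    case False
    have "generically V (\<lambda>x. f (proj x) \<noteq> 0)"
      by (rule generically_mono[OF generically_conj[OF h(4) generically_form[OF h(1) False]]]) auto
    then show ?thesis ..
  qed
qed

text \<open>The convention that the inverse of zero is zero covers the generically vanishing
  functions.\<close>

lemma rational_inverse:
  assumes "f \<in> carrier (rational_representatives V)"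
  shows "(\<lambda>P. inverse (f P)) \<in> carrier (rational_representatives V)"
proof -
  obtain d g h where h: "g \<in> forms UNIV d" "h \<in> forms UNIV d" "\<not> vanishes_on h V"
    "generically V (\<lambda>x. h x \<noteq> 0 \<and> f (proj x) = g x / h x)"
    using assms by (rule rational_repsE)
  show ?thesis
  proof (cases "vanishes_on g V")
    case True
    show ?thesis
      by (rule rational_repsI[OF h(1,2,3)], rule generically_mono[OF h(4)])
        (use True in \<open>auto simp: vanishes_on_def\<close>)
  next
    case False
    show ?thesis
      by (rule rational_repsI[OF h(2,1) False], rule generically_mono[OF h(4)]) auto
  qed
qed

lemma rational_form_ratio:
  assumes "g \<in> forms UNIV d" "h \<in> forms UNIV d" "\<not> vanishes_on h V"
  shows "form_ratio g h \<in> carrier (rational_representatives V)"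
  by (rule rational_repsI[OF assms]) (simp add: form_ratio_proj[OF assms(1,2)] generically_always)

end

section \<open>The function field\<close>

context irreducible_variety
begin

abbreviation rat where "rat \<equiv> carrier (rational_representatives V)"

lemma rational_cring: "cring (rational_representatives V)"
proof (rule cringI)
  let ?R = "rational_representatives V"
  have [simp]: "mult ?R = (\<lambda>f f' P. f P * f' P)" "one ?R = (\<lambda>P. 1)" "zero ?R = (\<lambda>P. 0)"
    "add ?R = (\<lambda>f f' P. f P + f' P)"
    by (simp_all add: rational_representatives_def)
  show "abelian_group ?R"
  proof (rule abelian_groupI)
    fix f assume "f \<in> rat"
    then show "\<exists>g\<in>rat. g \<oplus>\<^bsub>?R\<^esub> f = \<zero>\<^bsub>?R\<^esub>"
      by (intro bexI[of _ "\<lambda>P. - f P"]) (simp_all add: rational_uminus)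
  qed (simp_all add: rational_add rational_const algebra_simps)
  show "comm_monoid ?R"
    by (rule comm_monoidI) (simp_all add: rational_mult rational_const algebra_simps)
qed (simp add: rational_representatives_def algebra_simps)

lemma generically_zero_iff:
  "f \<in> generically_zero V \<longleftrightarrow> f \<in> rat \<and> generically V (\<lambda>x. f (proj x) = 0)"
  unfolding generically_zero_def generically_def by simp

lemma generically_zero_ideal: "ideal (generically_zero V) (rational_representatives V)"
proof (rule idealI)
  let ?R = "rational_representatives V"
  have ops: "mult ?R = (\<lambda>f f' P. f P * f' P)" "one ?R = (\<lambda>P. 1)" "zero ?R = (\<lambda>P. 0)"
    "add ?R = (\<lambda>f f' P. f P + f' P)"
    by (simp_all add: rational_representatives_def)
  interpret cring ?R by (rule rational_cring)
  show "ring ?R" by (rule ring_axioms)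
  have minus: "a_inv ?R f = (\<lambda>P. - f P)" if "f \<in> rat" for f
    using that by (intro minus_equality) (simp_all add: ops rational_uminus)
  show "subgroup (generically_zero V) (add_monoid ?R)"
  proof (rule add.subgroupI)
    show "generically_zero V \<subseteq> rat" by (auto simp: generically_zero_iff)
    have "(\<lambda>P. 0) \<in> generically_zero V"
      by (simp add: generically_zero_iff rational_const generically_always)
    then show "generically_zero V \<noteq> {}" by blast
  next
    fix f assume f: "f \<in> generically_zero V"
    then show "\<ominus>\<^bsub>?R\<^esub> f \<in> generically_zero V"
      by (simp add: generically_zero_iff minus rational_uminus)
  next
    fix f g assume "f \<in> generically_zero V" "g \<in> generically_zero V"
    then show "f \<oplus>\<^bsub>?R\<^esub> g \<in> generically_zero V"
      using generically_conj[of "\<lambda>x. f (proj x) = 0" "\<lambda>x. g (proj x) = 0"]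
      by (auto simp: generically_zero_iff ops rational_add elim: generically_mono)
  qed
  fix f g assume "f \<in> generically_zero V" "g \<in> rat"
  then show "g \<otimes>\<^bsub>?R\<^esub> f \<in> generically_zero V" "f \<otimes>\<^bsub>?R\<^esub> g \<in> generically_zero V"
    by (auto simp: generically_zero_iff ops rational_mult elim: generically_mono)
qed

definition cls :: "(('k, 'n) point \<Rightarrow> 'k) \<Rightarrow> (('k, 'n) point \<Rightarrow> 'k) set" where
  "cls f = generically_zero V +>\<^bsub>rational_representatives V\<^esub> f"

lemma function_field_cring: "cring (function_field V)"
  unfolding function_field_def
  by (rule ideal.quotient_is_cring[OF generically_zero_ideal rational_cring])

lemma function_field_carrier: "carrier (function_field V) = cls ` rat"
  unfolding function_field_def FactRing_def cls_def A_RCOSETS_def RCOSETS_def a_r_coset_def by auto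

text \<open>The bridge from cosets to functions: equations in the function field become equations
  holding generically.\<close>

lemma cls_eq_iff:
  assumes "f \<in> rat" "g \<in> rat"
  shows "cls f = cls g \<longleftrightarrow> generically V (\<lambda>x. f (proj x) = g (proj x))"
proof -
  let ?R = "rational_representatives V"
  interpret R: cring ?R by (rule rational_cring)
  have "a_inv ?R g = (\<lambda>P. - g P)"
    using assms(2) by (intro R.minus_equality)
      (simp_all add: rational_uminus, simp_all add: rational_representatives_def)
  then have "f \<ominus>\<^bsub>?R\<^esub> g = (\<lambda>P. f P - g P)"
    by (simp add: a_minus_def) (simp add: rational_representatives_def)
  then have "cls f = cls g \<longleftrightarrow> (\<lambda>P. f P - g P) \<in> generically_zero V"
    unfolding cls_def using R.quotient_eq_iff_same_a_r_cos[OF generically_zero_ideal assms] by simp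
  then show ?thesis using assms by (simp add: generically_zero_iff rational_diff)
qed

lemma cls_hom:
  assumes "f \<in> rat" "g \<in> rat"
  shows "cls f \<oplus>\<^bsub>function_field V\<^esub> cls g = cls (\<lambda>P. f P + g P)"
    and "cls f \<otimes>\<^bsub>function_field V\<^esub> cls g = cls (\<lambda>P. f P * g P)"
proof -
  note h = ideal.rcos_ring_hom[OF generically_zero_ideal]
  show "cls f \<oplus>\<^bsub>function_field V\<^esub> cls g = cls (\<lambda>P. f P + g P)"
    using ring_hom_add[OF h assms] unfolding cls_def function_field_def
    by (simp add: rational_representatives_def)
  show "cls f \<otimes>\<^bsub>function_field V\<^esub> cls g = cls (\<lambda>P. f P * g P)"
    using ring_hom_mult[OF h assms] unfolding cls_def function_field_def
    by (simp add: rational_representatives_def)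
qed

lemma cls_one: "\<one>\<^bsub>function_field V\<^esub> = cls (\<lambda>P. 1)"
  using ring_hom_one[OF ideal.rcos_ring_hom[OF generically_zero_ideal]]
  unfolding cls_def function_field_def by (simp add: rational_representatives_def)

lemma cls_zero: "\<zero>\<^bsub>function_field V\<^esub> = cls (\<lambda>P. 0)"
proof -
  interpret h: ring_hom_ring "rational_representatives V" "function_field V" cls
    using ideal.rcos_ring_hom_ring[OF generically_zero_ideal]
    unfolding function_field_def cls_def[abs_def] .
  show ?thesis using h.hom_zero by (simp add: rational_representatives_def)
qed

lemma function_field_is_field: "field (function_field V)"
proof (rule cring.cring_fieldI2[OF function_field_cring])
  show "\<zero>\<^bsub>function_field V\<^esub> \<noteq> \<one>\<^bsub>function_field V\<^esub>"
    using generically_False[of "\<lambda>x. (0::'k) = 1"]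
    by (auto simp: cls_zero cls_one cls_eq_iff rational_const)
next
  fix a assume a: "a \<in> carrier (function_field V)" "a \<noteq> \<zero>\<^bsub>function_field V\<^esub>"
  then obtain f where f: "f \<in> rat" "a = cls f" unfolding function_field_carrier by blast
  have "\<not> generically V (\<lambda>x. f (proj x) = 0)"
    using a(2) unfolding f(2) cls_zero cls_eq_iff[OF f(1) rational_const] .
  then have nz: "generically V (\<lambda>x. f (proj x) \<noteq> 0)" using rational_zero_or_nonzero[OF f(1)] by blast
  have "a \<otimes>\<^bsub>function_field V\<^esub> cls (\<lambda>P. inverse (f P)) = \<one>\<^bsub>function_field V\<^esub>"
    unfolding f(2) cls_hom(2)[OF f(1) rational_inverse[OF f(1)]] cls_one
      cls_eq_iff[OF rational_mult[OF f(1) rational_inverse[OF f(1)]] rational_const]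
    using nz by (rule generically_mono) simp
  then show "\<exists>b\<in>carrier (function_field V). a \<otimes>\<^bsub>function_field V\<^esub> b = \<one>\<^bsub>function_field V\<^esub>"
    using rational_inverse[OF f(1)] unfolding function_field_carrier by blast
qed

end

text \<open>Surjectivity ensures that the preimage of a nonempty open set is nonempty, so that
  rational functions can be pulled back.\<close>

locale surjective_morphism = V: irreducible_variety V + W: irreducible_variety W
  for V :: "('k::field, 'n::finite) point set" and W :: "('k, 'm::finite) point set" +
  fixes \<phi> :: "('k, 'n) point \<Rightarrow> ('k, 'm) point" and S :: "'k set"
  assumes morphism: "morphism_over S V W \<phi>" and surj: "\<phi> ` V = W"
begin

lemma local_forms:
  assumes "P \<in> V"
  obtains d G x where "\<And>j. G j \<in> forms UNIV d" "x \<noteq> 0" "proj x = P" "\<exists>j. G j x \<noteq> 0"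
    "\<And>x. x \<noteq> 0 \<Longrightarrow> proj x \<in> V \<Longrightarrow> \<exists>j. G j x \<noteq> 0 \<Longrightarrow> \<phi> (proj x) = proj (\<chi> j. G j x)"
proof -
  obtain d G where "\<forall>j. G j \<in> forms S d" and *: "\<exists>x. x \<noteq> 0 \<and> proj x = P \<and> (\<exists>j. G j x \<noteq> 0)"
    "\<forall>x. x \<noteq> 0 \<and> proj x \<in> V \<and> (\<exists>j. G j x \<noteq> 0) \<longrightarrow> \<phi> (proj x) = proj (\<chi> j. G j x)"
    using morphism assms unfolding morphism_over_def by metis
  then have "\<And>j. G j \<in> forms UNIV d" using forms_mono[of S UNIV d] by blast
  then show thesis using that * by blast
qed

lemma maps_to: "P \<in> V \<Longrightarrow> \<phi> P \<in> W"
  using surj by blast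

text \<open>Near a preimage of a point where \<open>h\<close> is nonzero the morphism is given by
  forms \<open>G\<close>. The form \<open>h(G)\<close> multiplied by a coordinate \<open>G j\<close>
  is nonzero there, and off its zeros the formula for the morphism applies and lands where
  \<open>Q\<close> is known.\<close>

lemma generically_pullback:
  assumes "generically W (\<lambda>y. Q (proj y))"
  shows "generically V (\<lambda>x. Q (\<phi> (proj x)))"
proof -
  obtain e h where h: "h \<in> forms UNIV e" "\<not> vanishes_on h W"
    "\<And>y. y \<noteq> 0 \<Longrightarrow> proj y \<in> W \<Longrightarrow> h y \<noteq> 0 \<Longrightarrow> Q (proj y)"
    using assms unfolding generically_def by metis
  obtain y where y: "y \<noteq> 0" "proj y \<in> W" "h y \<noteq> 0" using h(2) unfolding vanishes_on_def by blast
  then obtain P where P: "P \<in> V" "\<phi> P = proj y" using surj by (metis imageE)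
  obtain d G x where G: "\<And>j. G j \<in> forms UNIV d" "x \<noteq> 0" "proj x = P" "\<exists>j. G j x \<noteq> 0"
    "\<And>x. x \<noteq> 0 \<Longrightarrow> proj x \<in> V \<Longrightarrow> \<exists>j. G j x \<noteq> 0 \<Longrightarrow> \<phi> (proj x) = proj (\<chi> j. G j x)"
    using P(1) by (rule local_forms) (rule that)
  obtain j where j: "G j x \<noteq> 0" using G(4) by blast
  \<comment> \<open>The factor \<open>G j\<close> guarantees that the local presentation is
    valid.\<close>
  define H where "H x = h (\<chi> j. G j x) * G j x" for x
  have H: "H \<in> forms UNIV (e * d + d)"
    unfolding H_def[abs_def] by (intro form_mult form_compose h(1) G(1))
  have "proj y = proj (\<chi> j. G j x)" using G(5)[OF G(2) _ G(4)] G(3) P by metis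
  then obtain c where c: "c \<noteq> 0" "(\<chi> j. G j x) = c *s y" using proj_eq_iff by blast
  then have "h (\<chi> j. G j x) \<noteq> 0" using y(3) form_homogeneous[OF h(1)] by simp
  then have "H x \<noteq> 0" unfolding H_def using j by simp
  then have "\<not> vanishes_on H V" unfolding vanishes_on_def using G(2,3) P(1) by auto
  then have "generically V (\<lambda>x. H x \<noteq> 0)" using generically_form[OF H] by blast
  then show ?thesis
  proof (rule generically_mono)
    fix z assume z: "z \<noteq> 0" "proj z \<in> V" "H z \<noteq> 0"
    then have *: "h (\<chi> j. G j z) \<noteq> 0" "G j z \<noteq> 0" unfolding H_def by auto
    then have "(\<chi> j. G j z) \<noteq> 0" by (metis vec_lambda_beta zero_index)
    moreover have "\<phi> (proj z) = proj (\<chi> j. G j z)" using G(5) z *(2) by blast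
    ultimately show "Q (\<phi> (proj z))" using h(3)[OF _ _ *(1)] maps_to[OF z(2)] by simp
  qed
qed

text \<open>Numerator and denominator are composed with one local presentation of the
  morphism.\<close>

lemma rational_pullback:
  assumes "f \<in> W.rat"
  shows "(\<lambda>P. f (\<phi> P)) \<in> V.rat"
proof -
  obtain d g h where h: "g \<in> forms UNIV d" "h \<in> forms UNIV d" "\<not> vanishes_on h W"
    "generically W (\<lambda>x. h x \<noteq> 0 \<and> f (proj x) = g x / h x)"
    using assms by (rule W.rational_repsE)
  \<comment> \<open>Quantifying over all representatives makes this a property of the point, as
    \<open>generically_pullback\<close> requires.\<close>
  have "generically W (\<lambda>y. \<forall>z. proj z = proj y \<longrightarrow> h z \<noteq> 0 \<and> f (proj z) = g z / h z)"
    using h(4)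
  proof (rule generically_mono)
    fix y assume y: "h y \<noteq> 0 \<and> f (proj y) = g y / h y"
    show "\<forall>z. proj z = proj y \<longrightarrow> h z \<noteq> 0 \<and> f (proj z) = g z / h z"
    proof (intro allI impI)
      fix z assume z: "proj z = proj y"
      then obtain c where "c \<noteq> 0" "z = c *s y" using proj_eq_iff by metis
      then show "h z \<noteq> 0 \<and> f (proj z) = g z / h z"
        using y z form_homogeneous[OF h(1)] form_homogeneous[OF h(2)] by simp
    qed
  qed
  from generically_pullback[OF this]
  have pb: "generically V (\<lambda>x. \<forall>z. proj z = \<phi> (proj x) \<longrightarrow> h z \<noteq> 0 \<and> f (proj z) = g z / h z)" .
  obtain P where P: "P \<in> V" using V.irreducible unfolding zariski_irreducible_def by blast
  obtain e G x where G: "\<And>j. G j \<in> forms UNIV e" "x \<noteq> 0" "proj x = P" "\<exists>j. G j x \<noteq> 0"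
    "\<And>x. x \<noteq> 0 \<Longrightarrow> proj x \<in> V \<Longrightarrow> \<exists>j. G j x \<noteq> 0 \<Longrightarrow> \<phi> (proj x) = proj (\<chi> j. G j x)"
    using P by (rule local_forms) (rule that)
  obtain j where "G j x \<noteq> 0" using G(4) by blast
  then have "\<not> vanishes_on (G j) V" unfolding vanishes_on_def using G(2,3) \<open>P \<in> V\<close> by auto
  then have "generically V (\<lambda>x. G j x \<noteq> 0)" using generically_form[OF G(1)] by blast
  then have gen: "generically V (\<lambda>x. h (\<chi> j. G j x) \<noteq> 0 \<and> f (\<phi> (proj x)) = g (\<chi> j. G j x) / h (\<chi> j. G j x))"
    by (rule generically_mono[OF V.generically_conj[OF pb]]) (use G(5) in metis)
  show ?thesis
  proof (rule V.rational_repsI[OF form_compose[OF h(1) G(1)] form_compose[OF h(2) G(1)]])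
    show "\<not> vanishes_on (\<lambda>x. h (\<chi> j. G j x)) V"
      using generically_ex[OF gen] unfolding vanishes_on_def by blast
    show "generically V (\<lambda>x. f (\<phi> (proj x)) = g (\<chi> j. G j x) / h (\<chi> j. G j x))"
      using gen by (rule generically_mono) simp
  qed
qed

text \<open>Injectivity of the pullback: a function that is not generically zero is generically
  nonzero, and this too pulls back.\<close>

lemma pullback_zero_iff:
  assumes "f \<in> W.rat"
  shows "generically V (\<lambda>x. f (\<phi> (proj x)) = 0) \<longleftrightarrow> generically W (\<lambda>y. f (proj y) = 0)"
proof
  assume v: "generically V (\<lambda>x. f (\<phi> (proj x)) = 0)"
  show "generically W (\<lambda>y. f (proj y) = 0)"
  proof (rule ccontr)
    assume "\<not> generically W (\<lambda>y. f (proj y) = 0)"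
    then have "generically W (\<lambda>y. f (proj y) \<noteq> 0)" using W.rational_zero_or_nonzero[OF assms] by blast
    then have "generically V (\<lambda>x. f (\<phi> (proj x)) \<noteq> 0)" by (rule generically_pullback)
    then show False using V.generically_conj[OF v] V.generically_False by blast
  qed
qed (rule generically_pullback)

lemma pullback_field_eq: "pullback_field V W \<phi> = (\<lambda>f. V.cls (\<lambda>P. f (\<phi> P))) ` W.rat"
  unfolding pullback_field_def V.cls_def by blast

lemma pullback_fieldI: "f \<in> W.rat \<Longrightarrow> V.cls (\<lambda>P. f (\<phi> P)) \<in> pullback_field V W \<phi>"
  unfolding pullback_field_eq by (rule imageI)

lemma pullback_subfield: "subfield (pullback_field V W \<phi>) (function_field V)"
proof -
  interpret F: field "function_field V" by (rule V.function_field_is_field)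
  let ?F = "function_field V" and ?L = "pullback_field V W \<phi>"
  have incl: "?L \<subseteq> carrier ?F"
    unfolding pullback_field_eq V.function_field_carrier using rational_pullback by blast
  show ?thesis
  proof (rule F.subfieldI')
    show "subring ?L ?F"
    proof (rule F.subringI[OF incl])
      show "\<one>\<^bsub>?F\<^esub> \<in> ?L" unfolding V.cls_one using pullback_fieldI[OF W.rational_const[of 1]] .
    next
      fix h assume "h \<in> ?L"
      then obtain f where f: "f \<in> W.rat" "h = V.cls (\<lambda>P. f (\<phi> P))" unfolding pullback_field_eq by blast
      have "\<ominus>\<^bsub>?F\<^esub> h = V.cls (\<lambda>P. - f (\<phi> P))"
      proof (rule F.minus_equality)
        show "V.cls (\<lambda>P. - f (\<phi> P)) \<oplus>\<^bsub>?F\<^esub> h = \<zero>\<^bsub>?F\<^esub>"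
          unfolding f(2) V.cls_zero
          by (subst V.cls_hom(1)) (simp_all add: V.rational_uminus rational_pullback f(1))
      qed (auto simp: V.function_field_carrier f rational_pullback V.rational_uminus)
      then show "\<ominus>\<^bsub>?F\<^esub> h \<in> ?L" using pullback_fieldI[OF W.rational_uminus[OF f(1)]] by simp
    next
      fix h h' assume "h \<in> ?L" "h' \<in> ?L"
      then obtain f f' where f: "f \<in> W.rat" "h = V.cls (\<lambda>P. f (\<phi> P))" "f' \<in> W.rat" "h' = V.cls (\<lambda>P. f' (\<phi> P))"
        unfolding pullback_field_eq by blast
      show "h \<otimes>\<^bsub>?F\<^esub> h' \<in> ?L" "h \<oplus>\<^bsub>?F\<^esub> h' \<in> ?L"
        unfolding f(2,4) V.cls_hom[OF rational_pullback[OF f(1)] rational_pullback[OF f(3)]]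
        using pullback_fieldI[OF W.rational_mult[OF f(1,3)]] pullback_fieldI[OF W.rational_add[OF f(1,3)]] .
    qed
  next
    fix k assume k: "k \<in> ?L - {\<zero>\<^bsub>?F\<^esub>}"
    then obtain f where f: "f \<in> W.rat" "k = V.cls (\<lambda>P. f (\<phi> P))" unfolding pullback_field_eq by blast
    have "\<not> generically V (\<lambda>x. f (\<phi> (proj x)) = 0)"
      using k V.cls_eq_iff[OF rational_pullback[OF f(1)] V.rational_const[of 0]] unfolding f(2) V.cls_zero by simp
    then have nz: "generically V (\<lambda>x. f (\<phi> (proj x)) \<noteq> 0)"
      using V.rational_zero_or_nonzero[OF rational_pullback[OF f(1)]] by simp
    note r = rational_pullback[OF f(1)] rational_pullback[OF W.rational_inverse[OF f(1)]]
    have "k \<otimes>\<^bsub>?F\<^esub> V.cls (\<lambda>P. inverse (f (\<phi> P))) = \<one>\<^bsub>?F\<^esub>"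
      unfolding f(2) V.cls_hom(2)[OF r] V.cls_one V.cls_eq_iff[OF V.rational_mult[OF r] V.rational_const]
      using nz by (rule generically_mono) simp
    then have "inv\<^bsub>?F\<^esub> k = V.cls (\<lambda>P. inverse (f (\<phi> P)))"
      using k incl r by (intro F.comm_inv_char) (auto simp: V.function_field_carrier)
    then show "inv\<^bsub>?F\<^esub> k \<in> ?L" using pullback_fieldI[OF W.rational_inverse[OF f(1)]] by simp
  qed
qed

text \<open>Rewrites the span in the quotient field as generic linear combinations of functions with
  pulled-back coefficients, one vector at a time as in the recursive definition of the span.\<close>

lemma span_mem_iff:
  assumes "set fs \<subseteq> V.rat" "g \<in> V.rat"
  shows "V.cls g \<in> ring.Span (function_field V) (pullback_field V W \<phi>) (map V.cls fs) \<longleftrightarrow>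
    (\<exists>as. length as = length fs \<and> set as \<subseteq> W.rat \<and>
       generically V (\<lambda>x. g (proj x) = (\<Sum>i<length fs. (as ! i) (\<phi> (proj x)) * (fs ! i) (proj x))))"
  using assms
proof (induction fs arbitrary: g)
  case Nil
  interpret F: field "function_field V" by (rule V.function_field_is_field)
  show ?case using Nil V.cls_eq_iff[OF Nil(2) V.rational_const[of 0]] by (simp add: V.cls_zero)
next
  case (Cons f fs)
  interpret F: field "function_field V" by (rule V.function_field_is_field)
  let ?F = "function_field V" and ?L = "pullback_field V W \<phi>"
  have f: "f \<in> V.rat" and fs: "set fs \<subseteq> V.rat" using Cons.prems by auto
  have ce: "V.cls g = V.cls (\<lambda>P. a (\<phi> P)) \<otimes>\<^bsub>?F\<^esub> V.cls f \<oplus>\<^bsub>?F\<^esub> V.cls h \<longleftrightarrow>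
      generically V (\<lambda>x. g (proj x) = a (\<phi> (proj x)) * f (proj x) + h (proj x))"
    if "a \<in> W.rat" "h \<in> V.rat" for a h
    unfolding V.cls_hom(2)[OF rational_pullback[OF that(1)] f]
      V.cls_hom(1)[OF V.rational_mult[OF rational_pullback[OF that(1)] f] that(2)]
    using V.cls_eq_iff[OF Cons.prems(2) V.rational_add[OF V.rational_mult[OF rational_pullback[OF that(1)] f] that(2)]] .
  have sub: "F.Span ?L (map V.cls fs) \<subseteq> V.cls ` V.rat"
    using F.Span_in_carrier[of ?L "map V.cls fs"] fs subfieldE(3)[OF pullback_subfield]
    unfolding V.function_field_carrier by auto
  have "V.cls g \<in> F.Span ?L (map V.cls (f # fs)) \<longleftrightarrow>
      (\<exists>k\<in>?L. \<exists>v\<in>F.Span ?L (map V.cls fs). V.cls g = k \<otimes>\<^bsub>?F\<^esub> V.cls f \<oplus>\<^bsub>?F\<^esub> v)"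
    by (simp add: F.line_extension_mem_iff)
  also have "\<dots> \<longleftrightarrow> (\<exists>a\<in>W.rat. \<exists>h\<in>V.rat. V.cls h \<in> F.Span ?L (map V.cls fs) \<and>
      generically V (\<lambda>x. g (proj x) = a (\<phi> (proj x)) * f (proj x) + h (proj x)))"
    using sub ce unfolding pullback_field_eq[unfolded image_def] by fast
  also have "\<dots> \<longleftrightarrow> (\<exists>a\<in>W.rat. \<exists>h\<in>V.rat. (\<exists>as. length as = length fs \<and> set as \<subseteq> W.rat \<and>
       generically V (\<lambda>x. h (proj x) = (\<Sum>i<length fs. (as ! i) (\<phi> (proj x)) * (fs ! i) (proj x)))) \<and>
      generically V (\<lambda>x. g (proj x) = a (\<phi> (proj x)) * f (proj x) + h (proj x)))"
    using Cons.IH[OF fs] by auto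
  also have "\<dots> \<longleftrightarrow> (\<exists>as. length as = length (f # fs) \<and> set as \<subseteq> W.rat \<and>
       generically V (\<lambda>x. g (proj x) = (\<Sum>i<length (f # fs). (as ! i) (\<phi> (proj x)) * ((f # fs) ! i) (proj x))))"
    (is "?l = ?r")
  proof
    assume ?l
    then obtain a h as where *: "a \<in> W.rat" "h \<in> V.rat" "length as = length fs" "set as \<subseteq> W.rat"
      "generically V (\<lambda>x. h (proj x) = (\<Sum>i<length fs. (as ! i) (\<phi> (proj x)) * (fs ! i) (proj x)))"
      "generically V (\<lambda>x. g (proj x) = a (\<phi> (proj x)) * f (proj x) + h (proj x))" by blast
    have "generically V (\<lambda>x. g (proj x) = (\<Sum>i<length (f # fs). ((a # as) ! i) (\<phi> (proj x)) * ((f # fs) ! i) (proj x)))"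
      by (rule generically_mono[OF V.generically_conj[OF *(5,6)]]) (simp add: sum.lessThan_Suc_shift del: sum.lessThan_Suc)
    then show ?r using * by (intro exI[of _ "a # as"]) auto
  next
    assume ?r
    then obtain bs where bs: "length bs = length (f # fs)" "set bs \<subseteq> W.rat"
      "generically V (\<lambda>x. g (proj x) = (\<Sum>i<length (f # fs). (bs ! i) (\<phi> (proj x)) * ((f # fs) ! i) (proj x)))"
      by blast
    then obtain a as where a: "bs = a # as" "length as = length fs" by (cases bs) auto
    define h where "h P = g P - a (\<phi> P) * f P" for P
    have aW: "a \<in> W.rat" "set as \<subseteq> W.rat" using bs(2) a by auto
    have h: "h \<in> V.rat" unfolding h_def[abs_def]
      by (intro V.rational_diff V.rational_mult rational_pullback f Cons.prems(2) aW)
    have "generically V (\<lambda>x. h (proj x) = (\<Sum>i<length fs. (as ! i) (\<phi> (proj x)) * (fs ! i) (proj x)))"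
      by (rule generically_mono[OF bs(3)]) (simp add: a sum.lessThan_Suc_shift h_def del: sum.lessThan_Suc)
    moreover have "generically V (\<lambda>x. g (proj x) = a (\<phi> (proj x)) * f (proj x) + h (proj x))"
      by (rule V.generically_always) (simp add: h_def)
    ultimately show ?l using h aW a(2) by blast
  qed
  finally show ?case .
qed


text \<open>Either the tail is already dependent, and the head gets coefficient \<open>0\<close>, or
  the head lies in the span of the tail and gets coefficient \<open>- 1\<close>.\<close>

lemma dependentE:
  assumes "set fs \<subseteq> V.rat"
    and "\<not> ring.independent (function_field V) (pullback_field V W \<phi>) (map V.cls fs)"
  shows "\<exists>as. length as = length fs \<and> set as \<subseteq> W.rat \<and>
    generically V (\<lambda>x. (\<Sum>i<length fs. (as ! i) (\<phi> (proj x)) * (fs ! i) (proj x)) = 0) \<and>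
    (\<exists>i<length fs. \<not> generically W (\<lambda>y. (as ! i) (proj y) = 0))"
  using assms
proof (induction fs)
  case Nil
  interpret F: field "function_field V" by (rule V.function_field_is_field)
  show ?case using Nil by simp
next
  case (Cons f fs)
  interpret F: field "function_field V" by (rule V.function_field_is_field)
  have fs: "f \<in> V.rat" "set fs \<subseteq> V.rat" using Cons.prems(1) by auto
  show ?case
  proof (cases "F.independent (pullback_field V W \<phi>) (map V.cls fs)")
    case True
    then have "V.cls f \<in> F.Span (pullback_field V W \<phi>) (map V.cls fs)"
      using Cons.prems(2) F.li_Cons[of "V.cls f"] fs(1) by (auto simp: V.function_field_carrier)
    then obtain as where as: "length as = length fs" "set as \<subseteq> W.rat"
      "generically V (\<lambda>x. f (proj x) = (\<Sum>i<length fs. (as ! i) (\<phi> (proj x)) * (fs ! i) (proj x)))"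
      using span_mem_iff[OF fs(2,1)] by blast
    have "\<not> generically W (\<lambda>y. (- 1 :: 'k) = 0)" using W.generically_False by fastforce
    moreover have "generically V (\<lambda>x. (\<Sum>i<length (f # fs).
        (((\<lambda>_. - 1) # as) ! i) (\<phi> (proj x)) * ((f # fs) ! i) (proj x)) = 0)"
      by (rule generically_mono[OF as(3)]) (simp add: sum.lessThan_Suc_shift del: sum.lessThan_Suc)
    ultimately show ?thesis
      using as(1,2) W.rational_const[of "- 1"]
      by (intro exI[of _ "(\<lambda>_. - 1) # as"]) (auto intro!: exI[of _ 0])
  next
    case False
    then obtain as i where as: "length as = length fs" "set as \<subseteq> W.rat"
      "generically V (\<lambda>x. (\<Sum>i<length fs. (as ! i) (\<phi> (proj x)) * (fs ! i) (proj x)) = 0)"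
      "i < length fs" "\<not> generically W (\<lambda>y. (as ! i) (proj y) = 0)"
      using Cons.IH[OF fs(2)] by blast
    have "generically V (\<lambda>x. (\<Sum>i<length (f # fs).
        (((\<lambda>_. 0) # as) ! i) (\<phi> (proj x)) * ((f # fs) ! i) (proj x)) = 0)"
      by (rule generically_mono[OF as(3)]) (simp add: sum.lessThan_Suc_shift del: sum.lessThan_Suc)
    then show ?thesis
      using as W.rational_const[of 0]
      by (intro exI[of _ "(\<lambda>_. 0) # as"]) (auto intro!: exI[of _ "Suc i"])
  qed
qed

lemma rational_dependent:
  assumes dim: "ring.dimension (function_field V) n (pullback_field V W \<phi>) (carrier (function_field V))"
    and fs: "set fs \<subseteq> V.rat" "n < length fs"
  shows "\<exists>as. length as = length fs \<and> set as \<subseteq> W.rat \<and>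
    generically V (\<lambda>x. (\<Sum>i<length fs. (as ! i) (\<phi> (proj x)) * (fs ! i) (proj x)) = 0) \<and>
    (\<exists>i<length fs. \<not> generically W (\<lambda>y. (as ! i) (proj y) = 0))"
proof (rule dependentE[OF fs(1)])
  interpret F: field "function_field V" by (rule V.function_field_is_field)
  show "\<not> F.independent (pullback_field V W \<phi>) (map V.cls fs)"
    using F.independent_length_le_dimension[OF pullback_subfield dim, of "map V.cls fs"] fs
    by (auto simp: V.function_field_carrier)
qed

lemma rational_not_spanned:
  assumes dim: "ring.dimension (function_field V) n (pullback_field V W \<phi>) (carrier (function_field V))"
    and fs: "ring.independent (function_field V) (pullback_field V W \<phi>) (map V.cls fs)" "length fs < n"
  shows "\<exists>g\<in>V.rat. V.cls g \<notin> ring.Span (function_field V) (pullback_field V W \<phi>) (map V.cls fs)"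
proof (rule ccontr)
  interpret F: field "function_field V" by (rule V.function_field_is_field)
  let ?L = "pullback_field V W \<phi>"
  assume "\<not> ?thesis"
  then have le: "carrier (function_field V) \<subseteq> F.Span ?L (map V.cls fs)"
    unfolding V.function_field_carrier by blast
  obtain Vs where Vs: "set Vs \<subseteq> carrier (function_field V)" "F.independent ?L Vs" "length Vs = n"
    using F.exists_base[OF pullback_subfield dim] by blast
  then have "n \<le> length fs"
    using F.independent_length_le[OF pullback_subfield Vs(2) fs(1)] le by auto
  then show False using fs(2) by simp
qed

text \<open>The constant function \<open>1\<close> spans exactly the pullbacks, and a single vector
  cannot span when the dimension exceeds one.\<close>

lemma exists_not_pullback:
  assumes dim: "ring.dimension (function_field V) n (pullback_field V W \<phi>) (carrier (function_field V))"
    and "1 < n"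
  shows "\<exists>\<theta>\<in>V.rat. \<not> (\<exists>a\<in>W.rat. generically V (\<lambda>x. \<theta> (proj x) = a (\<phi> (proj x))))"
proof -
  interpret F: field "function_field V" by (rule V.function_field_is_field)
  let ?L = "pullback_field V W \<phi>" and ?one = "\<lambda>_. 1"
  have "F.independent ?L (map V.cls [?one])"
    using F.one_not_zero F.one_closed by (auto simp flip: V.cls_one intro!: F.li_Cons)
  then obtain g where g: "g \<in> V.rat" "V.cls g \<notin> F.Span ?L (map V.cls [?one])"
    using rational_not_spanned[OF dim, of "[?one]"] assms(2) by auto
  have "\<not> (\<exists>a\<in>W.rat. generically V (\<lambda>x. g (proj x) = a (\<phi> (proj x))))"
  proof
    assume "\<exists>a\<in>W.rat. generically V (\<lambda>x. g (proj x) = a (\<phi> (proj x)))"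
    then obtain a where "a \<in> W.rat" "generically V (\<lambda>x. g (proj x) = a (\<phi> (proj x)))" by blast
    then have "\<exists>as. length as = length [?one] \<and> set as \<subseteq> W.rat \<and>
       generically V (\<lambda>x. g (proj x) = (\<Sum>i<length [?one]. (as ! i) (\<phi> (proj x)) * ([?one] ! i) (proj x)))"
      by (intro exI[of _ "[a]"]) simp
    then show False using g span_mem_iff[of "[?one]" g] V.rational_const[of 1] by simp
  qed
  then show ?thesis using g(1) by blast
qed

text \<open>The same count with the independent pair of \<open>\<theta>\<close> and the constant
  function \<open>1\<close>.\<close>

lemma exists_not_linear:
  assumes dim: "ring.dimension (function_field V) n (pullback_field V W \<phi>) (carrier (function_field V))"
    and "2 < n" and \<theta>: "\<theta> \<in> V.rat" "\<not> (\<exists>a\<in>W.rat. generically V (\<lambda>x. \<theta> (proj x) = a (\<phi> (proj x))))"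
  shows "\<exists>\<eta>\<in>V.rat. \<not> (\<exists>a\<in>W.rat. \<exists>b\<in>W.rat.
    generically V (\<lambda>x. \<eta> (proj x) = a (\<phi> (proj x)) + b (\<phi> (proj x)) * \<theta> (proj x)))"
proof -
  interpret F: field "function_field V" by (rule V.function_field_is_field)
  let ?L = "pullback_field V W \<phi>" and ?one = "\<lambda>_. 1"
  have one: "F.independent ?L (map V.cls [?one])"
    using F.one_not_zero F.one_closed by (auto simp flip: V.cls_one intro!: F.li_Cons)
  have "V.cls \<theta> \<notin> F.Span ?L (map V.cls [?one])"
  proof
    assume "V.cls \<theta> \<in> F.Span ?L (map V.cls [?one])"
    then obtain as where as: "length as = 1" "set as \<subseteq> W.rat"
      "generically V (\<lambda>x. \<theta> (proj x) = (as ! 0) (\<phi> (proj x)))"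
      using span_mem_iff[of "[?one]" \<theta>] V.rational_const[of 1] \<theta>(1) by auto
    then have "as ! 0 \<in> W.rat" by (metis One_nat_def lessI nth_mem subsetD)
    then show False using as(3) \<theta>(2) by blast
  qed
  then have "F.independent ?L (map V.cls [\<theta>, ?one])"
    using one \<theta>(1) by (auto simp: V.function_field_carrier intro!: F.li_Cons)
  then obtain g where g: "g \<in> V.rat" "V.cls g \<notin> F.Span ?L (map V.cls [\<theta>, ?one])"
    using rational_not_spanned[OF dim, of "[\<theta>, ?one]"] assms(2) by auto
  have "\<not> (\<exists>a\<in>W.rat. \<exists>b\<in>W.rat.
    generically V (\<lambda>x. g (proj x) = a (\<phi> (proj x)) + b (\<phi> (proj x)) * \<theta> (proj x)))"
  proof
    assume "\<exists>a\<in>W.rat. \<exists>b\<in>W.rat.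
      generically V (\<lambda>x. g (proj x) = a (\<phi> (proj x)) + b (\<phi> (proj x)) * \<theta> (proj x))"
    then obtain a b where "a \<in> W.rat" "b \<in> W.rat"
      "generically V (\<lambda>x. g (proj x) = a (\<phi> (proj x)) + b (\<phi> (proj x)) * \<theta> (proj x))" by blast
    then have "\<exists>as. length as = length [\<theta>, ?one] \<and> set as \<subseteq> W.rat \<and>
       generically V (\<lambda>x. g (proj x) = (\<Sum>i<length [\<theta>, ?one]. (as ! i) (\<phi> (proj x)) * ([\<theta>, ?one] ! i) (proj x)))"
      by (intro exI[of _ "[b, a]"]) (simp add: add.commute)
    then show False using g span_mem_iff[of "[\<theta>, ?one]" g] V.rational_const[of 1] \<theta>(1) by simp
  qed
  then show ?thesis using g(1) by blast
qed

end

section \<open>Extensions of function fields of degree three\<close>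

text \<open>The conjugate of \<open>t\<close> is \<open>q - t\<close>, and the product of
  \<open>t\<close> with it is \<open>- p\<close>.\<close>

lemma quadratic_norm:
  fixes t p q a b :: "'k::field"
  assumes "t\<^sup>2 = p + q * t"
  shows "(a + b * t) * (a + b * q - b * t) = a * a + a * b * q - b * b * p"
  using assms by Groebner_Basis.algebra

text \<open>Solves for \<open>h\<close> by multiplying with the conjugate of its
  coefficient.\<close>

lemma quadratic_quotient:
  fixes t p q a b c d h :: "'k::field"
  assumes "a + b * t + (c + d * t) * h = 0" "(c + d * t) * (c + d * q - d * t) = n" "t\<^sup>2 = p + q * t"
  shows "n * h = (b * d * p - a * (c + d * q)) + (a * d - b * c) * t"
  using assms by Groebner_Basis.algebra

text \<open>The usual shift by a third of the quadratic coefficient.\<close>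

lemma depress_cubic:
  fixes t a b e :: "'k::field"
  assumes "t * t * t = a + b * t + 3 * e * t\<^sup>2"
  shows "(t - e) ^ 3 = (b + 3 * e * e) * (t - e) + ((b + 3 * e * e) * e + a - e * e * e)"
  using assms by Groebner_Basis.algebra

text \<open>If \<open>t^3 = p * t + q\<close> has vanishing discriminant, its roots are
  \<open>- s\<close>, \<open>- s\<close> and \<open>2 * s\<close> with
  \<open>s = 3 * q / (2 * p)\<close>; then \<open>p = 3 * s^2\<close> and
  \<open>q = 2 * s^3\<close>.\<close>

lemma repeated_root:
  fixes s p q :: "'k::field"
  assumes "s * (2 * p) = 3 * q"
  shows "4 * p ^ 3 = 27 * q\<^sup>2 \<Longrightarrow> 4 * p\<^sup>2 * (3 * s\<^sup>2 - p) = 0"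
    and "p = 3 * s\<^sup>2 \<Longrightarrow> 3 * (q - 2 * s ^ 3) = 0"
  using assms by Groebner_Basis.algebra+

lemma repeated_root_factor:
  fixes s t :: "'k::field"
  assumes "t ^ 3 = 3 * s\<^sup>2 * t + 2 * s ^ 3"
  shows "(t - 2 * s) * (t + s)\<^sup>2 = 0"
  using assms by Groebner_Basis.algebra

context surjective_morphism
begin

lemma generic_conj3:
  "generically V A \<Longrightarrow> generically V B \<Longrightarrow> generically V C \<Longrightarrow> generically V (\<lambda>x. A x \<and> B x \<and> C x)"
  by (intro V.generically_conj)

lemma pullback_zero:
  "f \<in> W.rat \<Longrightarrow> generically W (\<lambda>y. f (proj y) = 0) \<Longrightarrow> generically V (\<lambda>x. f (\<phi> (proj x)) = 0)"
  using pullback_zero_iff by blast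

lemma pullback_zero_or_nonzero:
  assumes "f \<in> W.rat"
  shows "generically W (\<lambda>y. f (proj y) = 0) \<or> generically V (\<lambda>x. f (\<phi> (proj x)) \<noteq> 0)"
  using V.rational_zero_or_nonzero[OF rational_pullback[OF assms]] pullback_zero_iff[OF assms] by blast

lemmas rat_intros = W.rational_add W.rational_mult W.rational_diff W.rational_uminus W.rational_inverse
  W.rational_const

definition in_pullback :: "(('k, 'n) point \<Rightarrow> 'k) \<Rightarrow> bool" where
  "in_pullback \<theta> \<longleftrightarrow> (\<exists>a\<in>W.rat. generically V (\<lambda>x. \<theta> (proj x) = a (\<phi> (proj x))))"

lemma in_pullbackI:
  "a \<in> W.rat \<Longrightarrow> generically V (\<lambda>x. \<theta> (proj x) = a (\<phi> (proj x))) \<Longrightarrow> in_pullback \<theta>"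
  unfolding in_pullback_def by blast

text \<open>If \<open>b\<close> were generically nonzero, dividing by it would present
  \<open>\<theta>\<close> as a pullback.\<close>

lemma linear_independence:
  assumes \<theta>: "\<not> in_pullback \<theta>" and ab: "a \<in> W.rat" "b \<in> W.rat"
    and z: "generically V (\<lambda>x. a (\<phi> (proj x)) + b (\<phi> (proj x)) * \<theta> (proj x) = 0)"
  shows "generically W (\<lambda>y. a (proj y) = 0)" "generically W (\<lambda>y. b (proj y) = 0)"
proof -
  show b: "generically W (\<lambda>y. b (proj y) = 0)"
  proof (rule ccontr)
    assume "\<not> generically W (\<lambda>y. b (proj y) = 0)"
    then have nz: "generically V (\<lambda>x. b (\<phi> (proj x)) \<noteq> 0)" using pullback_zero_or_nonzero[OF ab(2)] by blast
    have "generically V (\<lambda>x. \<theta> (proj x) = - (a (\<phi> (proj x)) * inverse (b (\<phi> (proj x)))))"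
      by (rule generically_mono[OF V.generically_conj[OF z nz]])
        (auto simp: field_simps eq_neg_iff_add_eq_0)
    moreover have "(\<lambda>Q. - (a Q * inverse (b Q))) \<in> W.rat" by (intro rat_intros ab)
    ultimately show False using \<theta> in_pullbackI[of "\<lambda>Q. - (a Q * inverse (b Q))" \<theta>] by simp
  qed
  have "generically V (\<lambda>x. a (\<phi> (proj x)) = 0)"
    by (rule generically_mono[OF V.generically_conj[OF z pullback_zero[OF ab(2) b]]]) auto
  then show "generically W (\<lambda>y. a (proj y) = 0)" using pullback_zero_iff[OF ab(1)] by blast
qed

end

locale cubic_morphism = surjective_morphism +
  assumes dim: "ring.dimension (function_field V) 3 (pullback_field V W \<phi>) (carrier (function_field V))"
    and char: "(2::'a) \<noteq> 0" "(3::'a) \<noteq> 0"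
begin

text \<open>In substance, two does not divide three. If \<open>\<theta>\<close> were quadratic over
  the pullback field, any \<open>\<eta>\<close> would satisfy a dependence among \<open>1\<close>,
  \<open>\<theta>\<close>, \<open>\<eta>\<close>, \<open>\<theta> * \<eta>\<close>; solving it for
  \<open>\<eta>\<close> and rationalizing the denominator puts every function into the span of
  \<open>1\<close> and \<open>\<theta>\<close>, against dimension three.\<close>

lemma quadratic_independence:
  assumes \<theta>: "\<theta> \<in> V.rat" "\<not> in_pullback \<theta>" and abc: "a \<in> W.rat" "b \<in> W.rat" "c \<in> W.rat"
    and z: "generically V (\<lambda>x. a (\<phi> (proj x)) + b (\<phi> (proj x)) * \<theta> (proj x) + c (\<phi> (proj x)) * (\<theta> (proj x))^2 = 0)"
  shows "generically W (\<lambda>y. a (proj y) = 0)" "generically W (\<lambda>y. b (proj y) = 0)"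
    "generically W (\<lambda>y. c (proj y) = 0)"
proof -
  show c: "generically W (\<lambda>y. c (proj y) = 0)"
  proof (rule ccontr)
    assume "\<not> generically W (\<lambda>y. c (proj y) = 0)"
    then have nz: "generically V (\<lambda>x. c (\<phi> (proj x)) \<noteq> 0)" using pullback_zero_or_nonzero[OF abc(3)] by blast
    define p where "p Q = - (a Q * inverse (c Q))" for Q
    define q where "q Q = - (b Q * inverse (c Q))" for Q
    have pq: "p \<in> W.rat" "q \<in> W.rat" unfolding p_def[abs_def] q_def[abs_def] by (intro rat_intros abc)+
    have sq: "generically V (\<lambda>x. (\<theta> (proj x))^2 = p (\<phi> (proj x)) + q (\<phi> (proj x)) * \<theta> (proj x))"
    proof (rule generically_mono[OF V.generically_conj[OF z nz]])
      fix x assume *: "a (\<phi> (proj x)) + b (\<phi> (proj x)) * \<theta> (proj x) + c (\<phi> (proj x)) * (\<theta> (proj x))^2 = 0 \<and>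
        c (\<phi> (proj x)) \<noteq> 0"
      then have "c (\<phi> (proj x)) * (\<theta> (proj x))^2 = - a (\<phi> (proj x)) - b (\<phi> (proj x)) * \<theta> (proj x)"
        by (simp add: algebra_simps eq_neg_iff_add_eq_0)
      then have "(\<theta> (proj x))^2 = (- a (\<phi> (proj x)) - b (\<phi> (proj x)) * \<theta> (proj x)) / c (\<phi> (proj x))"
        using * by (simp add: nonzero_eq_divide_eq mult.commute)
      then show "(\<theta> (proj x))^2 = p (\<phi> (proj x)) + q (\<phi> (proj x)) * \<theta> (proj x)"
        unfolding p_def q_def by (simp add: divide_inverse algebra_simps)
    qed
    obtain \<eta> where \<eta>: "\<eta> \<in> V.rat" "\<not> (\<exists>a\<in>W.rat. \<exists>b\<in>W.rat.
        generically V (\<lambda>x. \<eta> (proj x) = a (\<phi> (proj x)) + b (\<phi> (proj x)) * \<theta> (proj x)))"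
      using exists_not_linear[OF dim _ \<theta>(1)] \<theta>(2) unfolding in_pullback_def by auto
    \<comment> \<open>Four functions in dimension three. The relation has the shape
      \<open>(a0 + a1 \<theta>) + (a2 + a3 \<theta>) \<eta> = 0\<close>.\<close>
    let ?fs = "[\<lambda>_. 1, \<theta>, \<eta>, \<lambda>P. \<theta> P * \<eta> P]"
    have "set ?fs \<subseteq> V.rat" using \<theta>(1) \<eta>(1) V.rational_const V.rational_mult[OF \<theta>(1) \<eta>(1)] by simp
    then obtain as where as: "length as = length ?fs" "set as \<subseteq> W.rat"
      "generically V (\<lambda>x. (\<Sum>i<length ?fs. (as ! i) (\<phi> (proj x)) * (?fs ! i) (proj x)) = 0)"
      "\<exists>i<length ?fs. \<not> generically W (\<lambda>y. (as ! i) (proj y) = 0)"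
      using rational_dependent[OF dim, of ?fs] by auto
    obtain a0 a1 a2 a3 where as_eq: "as = [a0, a1, a2, a3]"
      using as(1) by (auto simp: length_Suc_conv)
    have a: "a0 \<in> W.rat" "a1 \<in> W.rat" "a2 \<in> W.rat" "a3 \<in> W.rat" using as(2) unfolding as_eq by auto
    have rel: "generically V (\<lambda>x. a0 (\<phi> (proj x)) + a1 (\<phi> (proj x)) * \<theta> (proj x) +
        (a2 (\<phi> (proj x)) + a3 (\<phi> (proj x)) * \<theta> (proj x)) * \<eta> (proj x) = 0)"
      by (rule generically_mono[OF as(3)]) (simp add: as_eq lessThan_Suc numeral_eq_Suc algebra_simps)
    have not23: False if "generically V (\<lambda>x. a2 (\<phi> (proj x)) + a3 (\<phi> (proj x)) * \<theta> (proj x) = 0)"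
    proof -
      have "generically V (\<lambda>x. a0 (\<phi> (proj x)) + a1 (\<phi> (proj x)) * \<theta> (proj x) = 0)"
        by (rule generically_mono[OF V.generically_conj[OF rel that]]) auto
      then have "generically W (\<lambda>y. a0 (proj y) = 0)" "generically W (\<lambda>y. a1 (proj y) = 0)"
        "generically W (\<lambda>y. a2 (proj y) = 0)" "generically W (\<lambda>y. a3 (proj y) = 0)"
        using linear_independence[OF \<theta>(2)] a that by blast+
      then show False using as(4) unfolding as_eq by (auto simp: less_Suc_eq numeral_eq_Suc)
    qed
    \<comment> \<open>The norm of the denominator \<open>a2 + a3 \<theta>\<close>, a pulled-back
      function.\<close>
    define n where "n Q = a2 Q * a2 Q + a2 Q * a3 Q * q Q - a3 Q * a3 Q * p Q" for Q
    have nW: "n \<in> W.rat" unfolding n_def[abs_def] by (intro rat_intros a pq)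
    have norm: "generically V (\<lambda>x. (a2 (\<phi> (proj x)) + a3 (\<phi> (proj x)) * \<theta> (proj x)) *
      (a2 (\<phi> (proj x)) + a3 (\<phi> (proj x)) * q (\<phi> (proj x)) - a3 (\<phi> (proj x)) * \<theta> (proj x)) = n (\<phi> (proj x)))"
    proof (rule generically_mono[OF sq])
      fix x assume *: "(\<theta> (proj x))^2 = p (\<phi> (proj x)) + q (\<phi> (proj x)) * \<theta> (proj x)"
      show "(a2 (\<phi> (proj x)) + a3 (\<phi> (proj x)) * \<theta> (proj x)) *
        (a2 (\<phi> (proj x)) + a3 (\<phi> (proj x)) * q (\<phi> (proj x)) - a3 (\<phi> (proj x)) * \<theta> (proj x)) = n (\<phi> (proj x))"
        using quadratic_norm[OF *] unfolding n_def .
    qed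
    show False
    proof (cases "generically W (\<lambda>y. n (proj y) = 0)")
      \<comment> \<open>The denominator is generically nonzero, so a vanishing norm kills its
        conjugate. Independence of \<open>1\<close> and \<open>\<theta>\<close> then makes
        \<open>a2\<close> and \<open>a3\<close> vanish, against \<open>not23\<close>.\<close>
      case True
      have u: "(\<lambda>P. a2 (\<phi> P) + a3 (\<phi> P) * \<theta> P) \<in> V.rat"
        by (intro V.rational_add V.rational_mult rational_pullback a \<theta>)
      then have "generically V (\<lambda>x. a2 (\<phi> (proj x)) + a3 (\<phi> (proj x)) * \<theta> (proj x) \<noteq> 0)"
        using V.rational_zero_or_nonzero[OF u] not23 by blast
      note g = V.generically_conj[OF V.generically_conj[OF this norm] pullback_zero[OF nW True]]
      have "generically V (\<lambda>x. (a2 (\<phi> (proj x)) + a3 (\<phi> (proj x)) * q (\<phi> (proj x))) + (- a3 (\<phi> (proj x))) * \<theta> (proj x) = 0)"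
        by (rule generically_mono[OF g]) auto
      moreover have "(\<lambda>Q. a2 Q + a3 Q * q Q) \<in> W.rat" "(\<lambda>Q. - a3 Q) \<in> W.rat"
        by (intro rat_intros a pq)+
      ultimately have "generically W (\<lambda>y. - a3 (proj y) = 0)" "generically W (\<lambda>y. a2 (proj y) + a3 (proj y) * q (proj y) = 0)"
        using linear_independence[OF \<theta>(2), of "\<lambda>Q. a2 Q + a3 Q * q Q" "\<lambda>Q. - a3 Q"] by simp_all
      note h = W.generically_conj[OF this]
      have z3: "generically V (\<lambda>x. a3 (\<phi> (proj x)) = 0)"
        by (rule pullback_zero[OF a(4)], rule generically_mono[OF h]) auto
      have z2: "generically V (\<lambda>x. a2 (\<phi> (proj x)) = 0)"
        by (rule pullback_zero[OF a(3)], rule generically_mono[OF h]) auto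
      show False by (rule not23, rule generically_mono[OF V.generically_conj[OF z2 z3]]) auto
    next
      case False
      then have nz: "generically V (\<lambda>x. n (\<phi> (proj x)) \<noteq> 0)" using pullback_zero_or_nonzero[OF nW] by blast
      define b0 where "b0 Q = (a1 Q * a3 Q * p Q - a0 Q * (a2 Q + a3 Q * q Q)) * inverse (n Q)" for Q
      define b1 where "b1 Q = (a0 Q * a3 Q - a1 Q * a2 Q) * inverse (n Q)" for Q
      have b: "b0 \<in> W.rat" "b1 \<in> W.rat"
        unfolding b0_def[abs_def] b1_def[abs_def] by (intro rat_intros a pq nW)+
      have g: "generically V (\<lambda>x. \<eta> (proj x) = b0 (\<phi> (proj x)) + b1 (\<phi> (proj x)) * \<theta> (proj x))"
      proof (rule generically_mono[OF generic_conj3[OF rel V.generically_conj[OF norm sq] nz]])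
        fix x
        let ?Q = "\<phi> (proj x)"
        assume *: "a0 ?Q + a1 ?Q * \<theta> (proj x) + (a2 ?Q + a3 ?Q * \<theta> (proj x)) * \<eta> (proj x) = 0 \<and>
          ((a2 ?Q + a3 ?Q * \<theta> (proj x)) * (a2 ?Q + a3 ?Q * q ?Q - a3 ?Q * \<theta> (proj x)) = n ?Q \<and>
          (\<theta> (proj x))\<^sup>2 = p ?Q + q ?Q * \<theta> (proj x)) \<and> n ?Q \<noteq> 0"
        then have "n ?Q * \<eta> (proj x) = (a1 ?Q * a3 ?Q * p ?Q - a0 ?Q * (a2 ?Q + a3 ?Q * q ?Q)) +
           (a0 ?Q * a3 ?Q - a1 ?Q * a2 ?Q) * \<theta> (proj x)"
          by (intro quadratic_quotient) auto
        then have "\<eta> (proj x) = ((a1 ?Q * a3 ?Q * p ?Q - a0 ?Q * (a2 ?Q + a3 ?Q * q ?Q)) +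
           (a0 ?Q * a3 ?Q - a1 ?Q * a2 ?Q) * \<theta> (proj x)) / n ?Q"
          using * by (simp add: nonzero_eq_divide_eq mult.commute)
        then show "\<eta> (proj x) = b0 ?Q + b1 ?Q * \<theta> (proj x)"
          unfolding b0_def b1_def by (simp add: divide_inverse algebra_simps)
      qed
      show False
        by (rule notE[OF \<eta>(2)], rule bexI[OF _ b(1)], rule bexI[OF _ b(2)], rule g)
    qed
  qed
  have "generically V (\<lambda>x. a (\<phi> (proj x)) + b (\<phi> (proj x)) * \<theta> (proj x) = 0)"
    by (rule generically_mono[OF V.generically_conj[OF z pullback_zero[OF abc(3) c]]]) auto
  then show "generically W (\<lambda>y. a (proj y) = 0)" "generically W (\<lambda>y. b (proj y) = 0)"
    using linear_independence[OF \<theta>(2) abc(1,2)] by blast+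
qed

text \<open>The functions \<open>1\<close>, \<open>\<theta>\<close>, \<open>\<theta>^2\<close>,
  \<open>f\<close> are dependent, and independence of the first three makes the coefficient of
  \<open>f\<close> invertible.\<close>

lemma quadratic_span:
  assumes \<theta>: "\<theta> \<in> V.rat" "\<not> in_pullback \<theta>" and f: "f \<in> V.rat"
  shows "\<exists>a\<in>W.rat. \<exists>b\<in>W.rat. \<exists>c\<in>W.rat. generically V (\<lambda>x. f (proj x) =
    a (\<phi> (proj x)) + b (\<phi> (proj x)) * \<theta> (proj x) + c (\<phi> (proj x)) * (\<theta> (proj x))^2)"
proof -
  let ?fs = "[\<lambda>_. 1, \<theta>, \<lambda>P. \<theta> P * \<theta> P, f]"
  have "set ?fs \<subseteq> V.rat" using \<theta>(1) f V.rational_const V.rational_mult[OF \<theta>(1) \<theta>(1)] by simp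
  then obtain as where as: "length as = length ?fs" "set as \<subseteq> W.rat"
    "generically V (\<lambda>x. (\<Sum>i<length ?fs. (as ! i) (\<phi> (proj x)) * (?fs ! i) (proj x)) = 0)"
    "\<exists>i<length ?fs. \<not> generically W (\<lambda>y. (as ! i) (proj y) = 0)"
    using rational_dependent[OF dim, of ?fs] by auto
  obtain a0 a1 a2 a3 where as_eq: "as = [a0, a1, a2, a3]"
    using as(1) by (auto simp: length_Suc_conv)
  have a: "a0 \<in> W.rat" "a1 \<in> W.rat" "a2 \<in> W.rat" "a3 \<in> W.rat" using as(2) unfolding as_eq by auto
  have rel: "generically V (\<lambda>x. a0 (\<phi> (proj x)) + a1 (\<phi> (proj x)) * \<theta> (proj x) +
      a2 (\<phi> (proj x)) * (\<theta> (proj x))^2 + a3 (\<phi> (proj x)) * f (proj x) = 0)"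
    by (rule generically_mono[OF as(3)])
      (simp add: as_eq lessThan_Suc numeral_eq_Suc algebra_simps)
  have "\<not> generically W (\<lambda>y. a3 (proj y) = 0)"
  proof
    assume z: "generically W (\<lambda>y. a3 (proj y) = 0)"
    have "generically V (\<lambda>x. a0 (\<phi> (proj x)) + a1 (\<phi> (proj x)) * \<theta> (proj x) +
      a2 (\<phi> (proj x)) * (\<theta> (proj x))^2 = 0)"
      by (rule generically_mono[OF V.generically_conj[OF rel pullback_zero[OF a(4) z]]]) auto
    then have "generically W (\<lambda>y. a0 (proj y) = 0)" "generically W (\<lambda>y. a1 (proj y) = 0)"
      "generically W (\<lambda>y. a2 (proj y) = 0)"
      using quadratic_independence[OF \<theta>] a by blast+
    then show False using as(4) z unfolding as_eq by (auto simp: less_Suc_eq numeral_eq_Suc)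
  qed
  then have nz: "generically V (\<lambda>x. a3 (\<phi> (proj x)) \<noteq> 0)" using pullback_zero_or_nonzero[OF a(4)] by blast
  have "generically V (\<lambda>x. f (proj x) = - a0 (\<phi> (proj x)) * inverse (a3 (\<phi> (proj x))) +
      (- a1 (\<phi> (proj x)) * inverse (a3 (\<phi> (proj x)))) * \<theta> (proj x) +
      (- a2 (\<phi> (proj x)) * inverse (a3 (\<phi> (proj x)))) * (\<theta> (proj x))^2)"
  proof (rule generically_mono[OF V.generically_conj[OF rel nz]])
    fix x
    let ?Q = "\<phi> (proj x)"
    assume *: "a0 ?Q + a1 ?Q * \<theta> (proj x) + a2 ?Q * (\<theta> (proj x))^2 + a3 ?Q * f (proj x) = 0 \<and> a3 ?Q \<noteq> 0"
    then have "a3 ?Q * f (proj x) = - a0 ?Q - a1 ?Q * \<theta> (proj x) - a2 ?Q * (\<theta> (proj x))^2"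
      by (auto simp: algebra_simps eq_neg_iff_add_eq_0)
    then have "f (proj x) = (- a0 ?Q - a1 ?Q * \<theta> (proj x) - a2 ?Q * (\<theta> (proj x))^2) / a3 ?Q"
      using * by (simp add: nonzero_eq_divide_eq mult.commute)
    then show "f (proj x) = - a0 ?Q * inverse (a3 ?Q) + (- a1 ?Q * inverse (a3 ?Q)) * \<theta> (proj x) +
      (- a2 ?Q * inverse (a3 ?Q)) * (\<theta> (proj x))^2"
      by (simp add: divide_inverse algebra_simps)
  qed
  moreover have "(\<lambda>Q. - a0 Q * inverse (a3 Q)) \<in> W.rat" "(\<lambda>Q. - a1 Q * inverse (a3 Q)) \<in> W.rat"
    "(\<lambda>Q. - a2 Q * inverse (a3 Q)) \<in> W.rat" by (intro rat_intros a)+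
  ultimately show ?thesis
    by (intro bexI[of _ "\<lambda>Q. - a0 Q * inverse (a3 Q)"] bexI[of _ "\<lambda>Q. - a1 Q * inverse (a3 Q)"]
        bexI[of _ "\<lambda>Q. - a2 Q * inverse (a3 Q)"])
qed

text \<open>Any function outside the pullback field generates; its cubic equation is depressed by a
  pulled-back shift. A vanishing discriminant would give the cubic a repeated root in the pullback
  field, so that all its roots, and with them \<open>\<theta>\<close>, would be pullbacks.
  Characteristics two and three are excluded by the divisions made here.\<close>

lemma cubic_generator:
  obtains \<theta> p q where "\<theta> \<in> V.rat" "\<not> in_pullback \<theta>" "p \<in> W.rat" "q \<in> W.rat"
    "generically V (\<lambda>x. (\<theta> (proj x))^3 = p (\<phi> (proj x)) * \<theta> (proj x) + q (\<phi> (proj x)))"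
    "generically W (\<lambda>y. 4 * (p (proj y))^3 - 27 * (q (proj y))^2 \<noteq> 0)"
proof -
  obtain \<theta>0 where \<theta>0: "\<theta>0 \<in> V.rat" "\<not> in_pullback \<theta>0"
    using exists_not_pullback[OF dim] unfolding in_pullback_def by auto
  obtain a b c where abc: "a \<in> W.rat" "b \<in> W.rat" "c \<in> W.rat"
    "generically V (\<lambda>x. \<theta>0 (proj x) * \<theta>0 (proj x) * \<theta>0 (proj x) =
    a (\<phi> (proj x)) + b (\<phi> (proj x)) * \<theta>0 (proj x) + c (\<phi> (proj x)) * (\<theta>0 (proj x))^2)"
    using quadratic_span[OF \<theta>0, of "\<lambda>P. \<theta>0 P * \<theta>0 P * \<theta>0 P"] V.rational_mult[OF V.rational_mult[OF \<theta>0(1) \<theta>0(1)] \<theta>0(1)] by blast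
  define e where "e Q = c Q * inverse 3" for Q
  have e: "e \<in> W.rat" unfolding e_def[abs_def] by (intro rat_intros abc)
  have ce: "c Q = 3 * e Q" for Q unfolding e_def using char(2) by simp
  define \<theta> where "\<theta> P = \<theta>0 P - e (\<phi> P)" for P
  define p where "p Q = b Q + 3 * e Q * e Q" for Q
  define q where "q Q = (b Q + 3 * e Q * e Q) * e Q + a Q - e Q * e Q * e Q" for Q
  have \<theta>: "\<theta> \<in> V.rat" unfolding \<theta>_def[abs_def] by (intro V.rational_diff \<theta>0 rational_pullback e)
  have pq: "p \<in> W.rat" "q \<in> W.rat" unfolding p_def[abs_def] q_def[abs_def]
    by (intro rat_intros abc e)+
  have n\<theta>: "\<not> in_pullback \<theta>"
  proof
    assume "in_pullback \<theta>"
    then obtain f where f: "f \<in> W.rat" "generically V (\<lambda>x. \<theta> (proj x) = f (\<phi> (proj x)))"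
      unfolding in_pullback_def by blast
    have "generically V (\<lambda>x. \<theta>0 (proj x) = f (\<phi> (proj x)) + e (\<phi> (proj x)))"
      by (rule generically_mono[OF f(2)]) (auto simp: \<theta>_def algebra_simps)
    moreover have "(\<lambda>Q. f Q + e Q) \<in> W.rat" by (intro rat_intros f e)
    ultimately show False using \<theta>0(2) in_pullbackI[of "\<lambda>Q. f Q + e Q" \<theta>0] by simp
  qed
  have cub: "generically V (\<lambda>x. (\<theta> (proj x))^3 = p (\<phi> (proj x)) * \<theta> (proj x) + q (\<phi> (proj x)))"
  proof (rule generically_mono[OF abc(4)])
    fix x
    let ?Q = "\<phi> (proj x)"
    assume "\<theta>0 (proj x) * \<theta>0 (proj x) * \<theta>0 (proj x) = a ?Q + b ?Q * \<theta>0 (proj x) + c ?Q * (\<theta>0 (proj x))^2"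
    then show "(\<theta> (proj x))^3 = p ?Q * \<theta> (proj x) + q ?Q"
      unfolding \<theta>_def p_def q_def ce by (rule depress_cubic)
  qed
  \<comment> \<open>The discriminant of the depressed cubic.\<close>
  define D where "D Q = 4 * (p Q * p Q * p Q) - 27 * (q Q * q Q)" for Q
  have D: "D \<in> W.rat" unfolding D_def[abs_def] by (intro rat_intros pq)
  have "\<not> generically W (\<lambda>y. D (proj y) = 0)"
  proof
    assume "generically W (\<lambda>y. D (proj y) = 0)"
    then have D0: "generically V (\<lambda>x. D (\<phi> (proj x)) = 0)" using pullback_zero D by blast
    show False
    proof (cases "generically W (\<lambda>y. p (proj y) = 0)")
      \<comment> \<open>With \<open>p\<close> zero the discriminant leaves \<open>q\<close> zero as
        well, and \<open>\<theta>\<close> would be generically zero.\<close>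
      case True
      have "generically V (\<lambda>x. \<theta> (proj x) = 0)"
      proof (rule generically_mono[OF generic_conj3[OF cub D0 pullback_zero[OF pq(1) True]]])
        fix x
        assume *: "\<theta> (proj x) ^ 3 = p (\<phi> (proj x)) * \<theta> (proj x) + q (\<phi> (proj x)) \<and>
          D (\<phi> (proj x)) = 0 \<and> p (\<phi> (proj x)) = 0"
        have "(27::'a) = 3 * 3 * 3" by simp
        then have "(27::'a) \<noteq> 0" using char(2) by (metis mult_eq_0_iff)
        moreover have "27 * (q (\<phi> (proj x)) * q (\<phi> (proj x))) = 0"
        proof -
          have "D (\<phi> (proj x)) = 0" "p (\<phi> (proj x)) = 0" using * by simp_all
          then show ?thesis unfolding D_def \<open>p (\<phi> (proj x)) = 0\<close> by simp
        qed
        ultimately have "q (\<phi> (proj x)) = 0" by (metis mult_eq_0_iff)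
        moreover have "\<theta> (proj x) ^ 3 = p (\<phi> (proj x)) * \<theta> (proj x) + q (\<phi> (proj x))"
          "p (\<phi> (proj x)) = 0" using * by simp_all
        ultimately have "\<theta> (proj x) ^ 3 = 0" by (metis add_0 mult_zero_left)
        then show "\<theta> (proj x) = 0" by simp
      qed
      then show False using n\<theta> in_pullbackI[OF W.rational_const[of 0], of \<theta>] by simp
    next
      case False
      then have pnz: "generically V (\<lambda>x. p (\<phi> (proj x)) \<noteq> 0)" using pullback_zero_or_nonzero[OF pq(1)] by blast
      \<comment> \<open>The negative of the double root.\<close>
      define s where "s Q = 3 * q Q * inverse (2 * p Q)" for Q
      have s: "s \<in> W.rat" unfolding s_def[abs_def] by (intro rat_intros pq)
      have fac: "generically V (\<lambda>x. \<theta> (proj x) = 2 * s (\<phi> (proj x)) \<or> \<theta> (proj x) = - s (\<phi> (proj x)))"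
      proof (rule generically_mono[OF generic_conj3[OF cub D0 pnz]])
        fix x
        let ?Q = "\<phi> (proj x)"
        assume *: "\<theta> (proj x) ^ 3 = p ?Q * \<theta> (proj x) + q ?Q \<and> D ?Q = 0 \<and> p ?Q \<noteq> 0"
        have "2 * p ?Q \<noteq> 0" using * char(1) by simp
        then have s1: "s ?Q * (2 * p ?Q) = 3 * q ?Q" unfolding s_def by simp
        have d: "4 * p ?Q ^ 3 = 27 * q ?Q ^ 2" using * unfolding D_def by (simp add: power2_eq_square power3_eq_cube)
        have "4 * p ?Q ^ 2 * (3 * s ?Q ^ 2 - p ?Q) = 0" using repeated_root(1)[OF s1 d] .
        moreover have "4 * p ?Q ^ 2 \<noteq> 0"
        proof -
          have "4 * p ?Q ^ 2 = (2 * p ?Q) ^ 2" by (simp add: power_mult_distrib)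
          then show ?thesis using \<open>2 * p ?Q \<noteq> 0\<close> by (metis power_not_zero)
        qed
        ultimately have ps: "p ?Q = 3 * s ?Q ^ 2" by simp
        have "3 * (q ?Q - 2 * s ?Q ^ 3) = 0" using repeated_root(2)[OF s1 ps] .
        then have "q ?Q - 2 * s ?Q ^ 3 = 0" using char(2) by (metis mult_eq_0_iff)
        then have qs: "q ?Q = 2 * s ?Q ^ 3" by simp
        have "\<theta> (proj x) ^ 3 = p ?Q * \<theta> (proj x) + q ?Q" using * by blast
        then have "(\<theta> (proj x) - 2 * s ?Q) * (\<theta> (proj x) + s ?Q) ^ 2 = 0"
          unfolding ps qs by (rule repeated_root_factor)
        then show "\<theta> (proj x) = 2 * s ?Q \<or> \<theta> (proj x) = - s ?Q" by (auto simp: eq_neg_iff_add_eq_0)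
      qed
      have r: "(\<lambda>P. \<theta> P - 2 * s (\<phi> P)) \<in> V.rat"
        by (intro V.rational_diff V.rational_mult V.rational_const \<theta> rational_pullback s)
      show False
      \<comment> \<open>Pointwise either factor may vanish; the dichotomy for rational functions
        makes one of them vanish generically.\<close>
      proof (cases "generically V (\<lambda>x. \<theta> (proj x) - 2 * s (\<phi> (proj x)) = 0)")
        case True
        then have "generically V (\<lambda>x. \<theta> (proj x) = 2 * s (\<phi> (proj x)))" by (rule generically_mono) simp
        moreover have "(\<lambda>Q. 2 * s Q) \<in> W.rat" by (intro rat_intros s)
        ultimately show False using n\<theta> in_pullbackI[of "\<lambda>Q. 2 * s Q" \<theta>] by simp
      next
        case False
        then have "generically V (\<lambda>x. \<theta> (proj x) - 2 * s (\<phi> (proj x)) \<noteq> 0)"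
          using V.rational_zero_or_nonzero[OF r] by blast
        from V.generically_conj[OF this fac]
        have "generically V (\<lambda>x. \<theta> (proj x) = - s (\<phi> (proj x)))" by (rule generically_mono) auto
        moreover have "(\<lambda>Q. - s Q) \<in> W.rat" by (intro rat_intros s)
        ultimately show False using n\<theta> in_pullbackI[of "\<lambda>Q. - s Q" \<theta>] by simp
      qed
    qed
  qed
  then have "generically W (\<lambda>y. D (proj y) \<noteq> 0)" using W.rational_zero_or_nonzero[OF D] by blast
  then have "generically W (\<lambda>y. 4 * (p (proj y))^3 - 27 * (q (proj y))^2 \<noteq> 0)"
    by (rule generically_mono) (simp add: D_def power2_eq_square power3_eq_cube)
  then show thesis using that \<theta> n\<theta> pq cub by blast
qed

end

section \<open>Specialization of a cubic generator\<close>

text \<open>After one root, a second comes from the quadratic quotient and the third from the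
  vanishing sum of the roots. The discriminant is the squared product of their differences.\<close>

lemma cubic_distinct_roots:
  fixes p q :: "'k::alg_closed_field"
  assumes "4 * p ^ 3 - 27 * q\<^sup>2 \<noteq> 0"
  obtains t1 t2 t3 where "t1 ^ 3 = p * t1 + q" "t2 ^ 3 = p * t2 + q" "t3 ^ 3 = p * t3 + q"
    "t1 \<noteq> t2" "t1 \<noteq> t3" "t2 \<noteq> t3"
proof -
  have "\<exists>t. poly [:- q, - p, 0, 1:] t = 0" by (rule alg_closed_imp_poly_has_root) simp
  then obtain t1 where "poly [:- q, - p, 0, 1:] t1 = 0" by blast
  then have t1: "t1 ^ 3 = p * t1 + q" by (simp add: power3_eq_cube algebra_simps)
  have "\<exists>t. poly [:t1\<^sup>2 - p, t1, 1:] t = 0" by (rule alg_closed_imp_poly_has_root) simp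
  then obtain t2 where "poly [:t1\<^sup>2 - p, t1, 1:] t2 = 0" by blast
  then have t2': "t1\<^sup>2 - p + t1 * t2 + t2\<^sup>2 = 0" by (simp add: power2_eq_square algebra_simps)
  define t3 where "t3 = - t1 - t2"
  have roots: "t2 ^ 3 = p * t2 + q" "t3 ^ 3 = p * t3 + q"
    unfolding t3_def using t1 t2' by Groebner_Basis.algebra+
  have "4 * p ^ 3 - 27 * q\<^sup>2 = ((t1 - t2) * (t1 - t3) * (t2 - t3))\<^sup>2"
    unfolding t3_def using t1 t2' by Groebner_Basis.algebra
  then have "t1 \<noteq> t2" "t1 \<noteq> t3" "t2 \<noteq> t3" using assms by auto
  then show thesis using that t1 roots by blast
qed

lemma mult_mod_cubic:
  fixes t p q :: "'k::field"
  assumes "t ^ 3 = p * t + q"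
  shows "(r0 + r1 * t + r2 * t\<^sup>2) * (s0 + s1 * t + s2 * t\<^sup>2) =
    (r0 * s0 + (r1 * s2 + r2 * s1) * q) +
    (r0 * s1 + r1 * s0 + (r1 * s2 + r2 * s1) * p + r2 * s2 * q) * t +
    (r0 * s2 + r1 * s1 + r2 * s0 + r2 * s2 * p) * t\<^sup>2"
  using assms by Groebner_Basis.algebra

context irreducible_variety
begin

text \<open>Here the quotient formula holds at every point where \<open>D\<close> is nonzero, not
  just generically. A rational function may have arbitrary values on a closed subset, so this is
  what permits evaluation at a chosen point.\<close>

definition regular_off :: "('k ^ 'n \<Rightarrow> 'k) \<Rightarrow> (('k, 'n) point \<Rightarrow> 'k) \<Rightarrow> bool" where
  "regular_off D r \<longleftrightarrow> (\<exists>e. \<exists>E\<in>forms UNIV e. \<exists>H\<in>forms UNIV e.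
     \<forall>y. y \<noteq> 0 \<and> proj y \<in> V \<and> D y \<noteq> 0 \<longrightarrow> H y \<noteq> 0 \<and> r (proj y) = E y / H y)"

lemma regular_offE:
  assumes "regular_off D r"
  obtains e E H where "E \<in> forms UNIV e" "H \<in> forms UNIV e"
    "\<And>y. y \<noteq> 0 \<Longrightarrow> proj y \<in> V \<Longrightarrow> D y \<noteq> 0 \<Longrightarrow> H y \<noteq> 0 \<and> r (proj y) = E y / H y"
  using assms unfolding regular_off_def by metis

lemma regular_offI:
  assumes "E \<in> forms UNIV e" "H \<in> forms UNIV e"
    "\<And>y. y \<noteq> 0 \<Longrightarrow> proj y \<in> V \<Longrightarrow> D y \<noteq> 0 \<Longrightarrow> H y \<noteq> 0 \<and> r (proj y) = E y / H y"
  shows "regular_off D r"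
  using assms unfolding regular_off_def by metis

lemma regular_const: "regular_off D (\<lambda>_. c)"
  by (rule regular_offI[OF form_const form_const[of 1]]) simp

lemma regular_add_mult:
  assumes "regular_off D r" "regular_off D s"
  shows regular_add: "regular_off D (\<lambda>P. r P + s P)" and regular_mult: "regular_off D (\<lambda>P. r P * s P)"
proof -
  obtain e E H where e: "E \<in> forms UNIV e" "H \<in> forms UNIV e"
    "\<And>y. y \<noteq> 0 \<Longrightarrow> proj y \<in> V \<Longrightarrow> D y \<noteq> 0 \<Longrightarrow> H y \<noteq> 0 \<and> r (proj y) = E y / H y"
    using assms(1) by (rule regular_offE) (rule that)
  obtain e' E' H' where e': "E' \<in> forms UNIV e'" "H' \<in> forms UNIV e'"
    "\<And>y. y \<noteq> 0 \<Longrightarrow> proj y \<in> V \<Longrightarrow> D y \<noteq> 0 \<Longrightarrow> H' y \<noteq> 0 \<and> s (proj y) = E' y / H' y"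
    using assms(2) by (rule regular_offE) (rule that)
  have "(\<lambda>y. E y * H' y + H y * E' y) \<in> forms UNIV (e + e')" by (intro form_add form_mult e e')
  then show "regular_off D (\<lambda>P. r P + s P)"
    by (rule regular_offI[OF _ form_mult[OF e(2) e'(2)]]) (use e(3) e'(3) in \<open>auto simp: field_simps\<close>)
  show "regular_off D (\<lambda>P. r P * s P)"
    by (rule regular_offI[OF form_mult[OF e(1) e'(1)] form_mult[OF e(2) e'(2)]])
      (use e(3) e'(3) in \<open>auto simp: field_simps\<close>)
qed

lemma regular_rational:
  assumes "D \<in> forms UNIV d" "\<not> vanishes_on D V" "regular_off D r"
  shows "r \<in> rat"
proof -
  obtain e E H where e: "E \<in> forms UNIV e" "H \<in> forms UNIV e"
    "\<And>y. y \<noteq> 0 \<Longrightarrow> proj y \<in> V \<Longrightarrow> D y \<noteq> 0 \<Longrightarrow> H y \<noteq> 0 \<and> r (proj y) = E y / H y"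
    using assms(3) by (rule regular_offE) (rule that)
  have g: "generically V (\<lambda>y. H y \<noteq> 0 \<and> r (proj y) = E y / H y)"
    by (rule generically_mono[OF generically_form[OF assms(1,2)]]) (use e(3) in blast)
  have "\<not> vanishes_on H V" using generically_ex[OF g] unfolding vanishes_on_def by blast
  then show ?thesis by (rule rational_repsI[OF e(1,2)]) (rule generically_mono[OF g], simp)
qed

text \<open>If the function is generically zero, its numerator vanishes on all of \<open>V\<close>,
  and the quotient formula then gives zero at each point off \<open>D\<close>.\<close>

lemma regular_zero:
  assumes "D \<in> forms UNIV d" "\<not> vanishes_on D V" "regular_off D r" "generically V (\<lambda>x. r (proj x) = 0)"
    and y: "y \<noteq> 0" "proj y \<in> V" "D y \<noteq> 0"
  shows "r (proj y) = 0"
proof -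
  obtain e E H where e: "E \<in> forms UNIV e" "H \<in> forms UNIV e"
    "\<And>y. y \<noteq> 0 \<Longrightarrow> proj y \<in> V \<Longrightarrow> D y \<noteq> 0 \<Longrightarrow> H y \<noteq> 0 \<and> r (proj y) = E y / H y"
    using assms(3) by (rule regular_offE) (rule that)
  have "generically V (\<lambda>y. E y = 0)"
    by (rule generically_mono[OF generically_conj[OF assms(4) generically_form[OF assms(1,2)]]])
      (use e(3) in fastforce)
  then have "vanishes_on E V" by (rule generically_zero_form[OF e(1)])
  then have "E y = 0" using y unfolding vanishes_on_def by blast
  then show ?thesis using e(3)[OF y] by simp
qed

text \<open>The product of the individual denominators works, since it still does not vanish on
  \<open>V\<close>.\<close>

lemma common_denominator:
  assumes "finite Fs" "Fs \<subseteq> rat"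
  shows "\<exists>d. \<exists>D\<in>forms UNIV d. \<not> vanishes_on D V \<and> (\<forall>f\<in>Fs. regular_off D f)"
  using assms
proof (induction Fs rule: finite_induct)
  case empty
  have "\<not> vanishes_on (\<lambda>x. 1) V"
    using generically_ex[OF generically_always[of "\<lambda>_. True"]] unfolding vanishes_on_def by auto
  then show ?case using form_const[of 1] by (intro exI bexI) auto
next
  case (insert f Fs)
  then obtain d D where D: "D \<in> forms UNIV d" "\<not> vanishes_on D V" "\<forall>f\<in>Fs. regular_off D f" by auto
  obtain e g h where h: "g \<in> forms UNIV e" "h \<in> forms UNIV e" "\<not> vanishes_on h V"
    "\<forall>x. x \<noteq> 0 \<and> proj x \<in> V \<and> h x \<noteq> 0 \<longrightarrow> f (proj x) = g x / h x"
    using insert.prems unfolding rational_representatives_def by auto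
  let ?D = "\<lambda>x. D x * h x"
  have "regular_off ?D f" by (rule regular_offI[OF h(1,2)]) (use h(4) in simp)
  moreover have "regular_off ?D f'" if f': "f' \<in> Fs" for f'
  proof -
    obtain e E H where e: "E \<in> forms UNIV e" "H \<in> forms UNIV e"
      "\<And>y. y \<noteq> 0 \<Longrightarrow> proj y \<in> V \<Longrightarrow> D y \<noteq> 0 \<Longrightarrow> H y \<noteq> 0 \<and> f' (proj y) = E y / H y"
      using D(3)[rule_format, OF f'] by (rule regular_offE) (rule that)
    show ?thesis by (rule regular_offI[OF e(1,2)]) (use e(3) in simp)
  qed
  moreover have "\<not> vanishes_on ?D V" using vanishes_on_mult[OF D(1) h(2)] D(2) h(3) by blast
  ultimately show ?case using form_mult[OF D(1) h(2)] by (intro exI bexI) auto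
qed

lemma nonvanishing_coordinate: "\<exists>i. \<not> vanishes_on (\<lambda>x. x $ i) V"
proof -
  obtain x where "x \<noteq> 0" "proj x \<in> V"
    using generically_ex[OF generically_always[of "\<lambda>_. True"]] by blast
  moreover from this obtain i where "x $ i \<noteq> 0" by (auto simp: vec_eq_iff)
  ultimately show ?thesis unfolding vanishes_on_def by blast
qed

end

text \<open>A cubic generator with coefficients regular off \<open>D\<close>: over a point off
  \<open>D\<close> every root of the specialized cubic can take the place of
  \<open>\<theta>\<close>.\<close>

locale cubic_specialization = cubic_morphism V W \<phi> S
  for V :: "('k::alg_closed_field, 'n::finite) point set" and W :: "('k, 'm::finite) point set"
    and \<phi> :: "('k, 'n) point \<Rightarrow> ('k, 'm) point" and S :: "'k set" +
  fixes \<theta> :: "('k, 'n) point \<Rightarrow> 'k" and p q :: "('k, 'm) point \<Rightarrow> 'k" and D :: "'k ^ 'm \<Rightarrow> 'k" and d :: nat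
  assumes \<theta>: "\<theta> \<in> V.rat" "\<not> in_pullback \<theta>"
    and cubic: "generically V (\<lambda>x. (\<theta> (proj x))^3 = p (\<phi> (proj x)) * \<theta> (proj x) + q (\<phi> (proj x)))"
    and D: "D \<in> forms UNIV d" "\<not> vanishes_on D W"
    and regular_pq: "W.regular_off D p" "W.regular_off D q"
begin

text \<open>The root \<open>t\<close> is not assumed to be a value of \<open>\<theta>\<close> at
  some preimage; producing such a preimage is the aim.\<close>

definition good :: "'k ^ 'm \<Rightarrow> 'k \<Rightarrow> bool" where
  "good y t \<longleftrightarrow> y \<noteq> 0 \<and> proj y \<in> W \<and> D y \<noteq> 0 \<and> t ^ 3 = p (proj y) * t + q (proj y)"

text \<open>On good pairs the expression reduces to a polynomial of degree at most two in
  \<open>t\<close> with regular coefficients. The class contains \<open>t\<close> and is closed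
  under ring operations, so all polynomial conditions on coordinates fall under it.\<close>

definition specializable :: "(('k, 'm) point \<Rightarrow> 'k \<Rightarrow> 'k) \<Rightarrow> bool" where
  "specializable s \<longleftrightarrow> (\<exists>r0 r1 r2. W.regular_off D r0 \<and> W.regular_off D r1 \<and> W.regular_off D r2 \<and>
     (\<forall>y t. good y t \<longrightarrow> s (proj y) t = r0 (proj y) + r1 (proj y) * t + r2 (proj y) * t\<^sup>2))"

lemma specializableI:
  assumes "W.regular_off D r0" "W.regular_off D r1" "W.regular_off D r2"
    "\<And>y t. good y t \<Longrightarrow> s (proj y) t = r0 (proj y) + r1 (proj y) * t + r2 (proj y) * t\<^sup>2"
  shows "specializable s"
  using assms unfolding specializable_def by blast

lemma spec_regular: "W.regular_off D r \<Longrightarrow> specializable (\<lambda>Q t. r Q)"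
  by (rule specializableI[of r "\<lambda>_. 0" "\<lambda>_. 0"]) (simp_all add: W.regular_const)

lemma spec_const: "specializable (\<lambda>Q t. c)"
  by (rule spec_regular[OF W.regular_const])

lemma spec_root: "specializable (\<lambda>Q t. t)"
  by (rule specializableI[of "\<lambda>_. 0" "\<lambda>_. 1" "\<lambda>_. 0"]) (simp_all add: W.regular_const)

lemma spec_add:
  assumes "specializable r" "specializable s"
  shows "specializable (\<lambda>Q t. r Q t + s Q t)"
proof -
  obtain r0 r1 r2 where r: "W.regular_off D r0" "W.regular_off D r1" "W.regular_off D r2"
    "\<forall>y t. good y t \<longrightarrow> r (proj y) t = r0 (proj y) + r1 (proj y) * t + r2 (proj y) * t\<^sup>2"
    using assms(1) unfolding specializable_def by blast
  obtain s0 s1 s2 where s: "W.regular_off D s0" "W.regular_off D s1" "W.regular_off D s2"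
    "\<forall>y t. good y t \<longrightarrow> s (proj y) t = s0 (proj y) + s1 (proj y) * t + s2 (proj y) * t\<^sup>2"
    using assms(2) unfolding specializable_def by blast
  show ?thesis
    by (rule specializableI[OF W.regular_add[OF r(1) s(1)] W.regular_add[OF r(2) s(2)] W.regular_add[OF r(3) s(3)]])
      (simp add: r(4) s(4) algebra_simps)
qed

text \<open>The cubic equation for \<open>t\<close> reduces the product to degree two again, with
  regular coefficients since \<open>p\<close> and \<open>q\<close> are regular.\<close>

lemma spec_mult:
  assumes "specializable r" "specializable s"
  shows "specializable (\<lambda>Q t. r Q t * s Q t)"
proof -
  obtain r0 r1 r2 where r: "W.regular_off D r0" "W.regular_off D r1" "W.regular_off D r2"
    "\<forall>y t. good y t \<longrightarrow> r (proj y) t = r0 (proj y) + r1 (proj y) * t + r2 (proj y) * t\<^sup>2"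
    using assms(1) unfolding specializable_def by blast
  obtain s0 s1 s2 where s: "W.regular_off D s0" "W.regular_off D s1" "W.regular_off D s2"
    "\<forall>y t. good y t \<longrightarrow> s (proj y) t = s0 (proj y) + s1 (proj y) * t + s2 (proj y) * t\<^sup>2"
    using assms(2) unfolding specializable_def by blast
  show ?thesis
  proof (rule specializableI)
    fix y t assume g: "good y t"
    then have "t ^ 3 = p (proj y) * t + q (proj y)" unfolding good_def by blast
    from mult_mod_cubic[OF this]
    show "r (proj y) t * s (proj y) t =
      (\<lambda>Q. r0 Q * s0 Q + (r1 Q * s2 Q + r2 Q * s1 Q) * q Q) (proj y) +
      (\<lambda>Q. r0 Q * s1 Q + r1 Q * s0 Q + (r1 Q * s2 Q + r2 Q * s1 Q) * p Q + r2 Q * s2 Q * q Q) (proj y) * t +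
      (\<lambda>Q. r0 Q * s2 Q + r1 Q * s1 Q + r2 Q * s0 Q + r2 Q * s2 Q * p Q) (proj y) * t\<^sup>2"
      using r(4) s(4) g by simp
  qed (intro W.regular_add W.regular_mult r s regular_pq)+
qed

lemma spec_diff:
  assumes "specializable r" "specializable s"
  shows "specializable (\<lambda>Q t. r Q t - s Q t)"
  using spec_add[OF assms(1) spec_mult[OF spec_const[of "- 1"] assms(2)]] by simp

lemma spec_sum: "(\<And>i. i \<in> I \<Longrightarrow> specializable (f i)) \<Longrightarrow> specializable (\<lambda>Q t. \<Sum>i\<in>I. f i Q t)"
  by (induction I rule: infinite_finite_induct) (auto intro: spec_const spec_add)

lemma spec_power: "specializable r \<Longrightarrow> specializable (\<lambda>Q t. r Q t ^ n)"
  by (induction n) (auto intro: spec_const spec_mult)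

lemma spec_prod: "(\<And>i. i \<in> I \<Longrightarrow> specializable (f i)) \<Longrightarrow> specializable (\<lambda>Q t. \<Prod>i\<in>I. f i Q t)"
  by (induction I rule: infinite_finite_induct) (auto intro: spec_const spec_mult)

lemma spec_form:
  assumes "F \<in> forms UNIV e" "\<And>i. specializable (x i)"
  shows "specializable (\<lambda>Q t. F (\<chi> i. x i Q t))"
proof -
  obtain c where F: "F = (\<lambda>x. \<Sum>m | sum m UNIV = e. c m * (\<Prod>i\<in>UNIV. (x $ i) ^ m i))"
    using assms(1) unfolding forms_def by blast
  show ?thesis unfolding F
    by (auto intro!: spec_sum spec_mult spec_const spec_prod spec_power assms(2))
qed

text \<open>The value of \<open>\<theta>\<close> at a generic point forms a good pair with its
  image, so the quadratic expression is available there.\<close>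

lemma generic_good: "generically V (\<lambda>x. \<exists>y. \<phi> (proj x) = proj y \<and> good y (\<theta> (proj x)))"
proof -
  have "generically W (\<lambda>y. \<exists>z. proj y = proj z \<and> z \<noteq> 0 \<and> proj z \<in> W \<and> D z \<noteq> 0)"
    by (rule generically_mono[OF generically_form[OF D]]) blast
  from generically_pullback[OF this]
  have "generically V (\<lambda>x. \<exists>z. \<phi> (proj x) = proj z \<and> z \<noteq> 0 \<and> proj z \<in> W \<and> D z \<noteq> 0)" .
  from V.generically_conj[OF this cubic] show ?thesis
    by (rule generically_mono) (auto simp: good_def)
qed

text \<open>The generic relation is \<open>r0 + r1 \<theta> + r2 \<theta>^2 = 0\<close>.
  Independence makes the three coefficients generically zero, regularity makes them zero at
  \<open>y\<close>, and the expression vanishes for every root \<open>t\<close>.\<close>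

lemma specialization:
  assumes s: "specializable s" and z: "generically V (\<lambda>x. s (\<phi> (proj x)) (\<theta> (proj x)) = 0)" and g: "good y t"
  shows "s (proj y) t = 0"
proof -
  obtain r0 r1 r2 where r: "W.regular_off D r0" "W.regular_off D r1" "W.regular_off D r2"
    and eq: "\<And>y t. good y t \<Longrightarrow> s (proj y) t = r0 (proj y) + r1 (proj y) * t + r2 (proj y) * t\<^sup>2"
    using s unfolding specializable_def by blast
  have "generically V (\<lambda>x. r0 (\<phi> (proj x)) + r1 (\<phi> (proj x)) * \<theta> (proj x) + r2 (\<phi> (proj x)) * (\<theta> (proj x))\<^sup>2 = 0)"
    by (rule generically_mono[OF V.generically_conj[OF generic_good z]]) (auto simp: eq)
  note ind = quadratic_independence[OF \<theta> W.regular_rational[OF D r(1)] W.regular_rational[OF D r(2)]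
      W.regular_rational[OF D r(3)] this]
  have y: "y \<noteq> 0" "proj y \<in> W" "D y \<noteq> 0" using g unfolding good_def by auto
  show ?thesis
    using eq[OF g] W.regular_zero[OF D r(1) ind(1) y] W.regular_zero[OF D r(2) ind(2) y]
      W.regular_zero[OF D r(3) ind(3) y] by simp
qed

end

text \<open>Each property of the specialized point is first written as an identity at the generic
  point: the equations of \<open>V\<close>, proportionality of its image to \<open>y\<close>, and
  the relation between \<open>t\<close> and \<open>\<theta>\<close>. Nonvanishing of a form is
  transported as the existence of an inverse. The value \<open>t\<close> can be recovered from the
  point, which keeps the three points distinct.\<close>

lemma three_points_in_fibre:
  fixes V :: "('k::alg_closed_field, 'n::finite) point set" and W :: "('k, 'm::finite) point set"
  assumes cm: "cubic_morphism V W \<phi> S"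
  shows "\<exists>Q P1 P2 P3. P1 \<in> V \<and> P2 \<in> V \<and> P3 \<in> V \<and> P1 \<noteq> P2 \<and> P1 \<noteq> P3 \<and> P2 \<noteq> P3 \<and>
    \<phi> P1 = Q \<and> \<phi> P2 = Q \<and> \<phi> P3 = Q"
proof -
  interpret cubic_morphism V W \<phi> S by (rule cm)
  obtain \<theta> p q where \<theta>: "\<theta> \<in> V.rat" "\<not> in_pullback \<theta>" and pq: "p \<in> W.rat" "q \<in> W.rat"
    and cubic: "generically V (\<lambda>x. (\<theta> (proj x))^3 = p (\<phi> (proj x)) * \<theta> (proj x) + q (\<phi> (proj x)))"
    and disc: "generically W (\<lambda>y. 4 * (p (proj y))^3 - 27 * (q (proj y))^2 \<noteq> 0)"
    by (rule cubic_generator) (rule that)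
  obtain i0 where i0: "\<not> vanishes_on (\<lambda>x. x $ i0) V" using V.nonvanishing_coordinate by blast
  obtain j0 where j0: "\<not> vanishes_on (\<lambda>x. x $ j0) W" using W.nonvanishing_coordinate by blast
  note gi0 = generically_form[OF form_coord i0]
  obtain P0 where "P0 \<in> V" using V.irreducible unfolding zariski_irreducible_def by blast
  then obtain dG G x0 where G: "\<And>j. G j \<in> forms UNIV dG" "x0 \<noteq> 0" "proj x0 = P0" "\<exists>j. G j x0 \<noteq> 0"
    "\<And>x. x \<noteq> 0 \<Longrightarrow> proj x \<in> V \<Longrightarrow> \<exists>j. G j x \<noteq> 0 \<Longrightarrow> \<phi> (proj x) = proj (\<chi> j. G j x)"
    by (rule local_forms) (rule that)
  then obtain j1 where "G j1 x0 \<noteq> 0" by blast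
  then have Gj1: "\<not> vanishes_on (G j1) V" unfolding vanishes_on_def using G(2,3) \<open>P0 \<in> V\<close> by auto
  obtain dn num den where nd: "num \<in> forms UNIV dn" "den \<in> forms UNIV dn" "\<not> vanishes_on den V"
    "generically V (\<lambda>x. den x \<noteq> 0 \<and> \<theta> (proj x) = num x / den x)"
    using \<theta>(1) by (rule V.rational_repsE) (rule that)
  \<comment> \<open>Collects what must not vanish at the new points: a coordinate of the local
    presentation of the morphism and the denominator of \<open>\<theta>\<close>.\<close>
  define B where "B x = G j1 x * den x" for x
  have B: "B \<in> forms UNIV (dG + dn)" "\<not> vanishes_on B V"
    unfolding B_def[abs_def] using form_mult[OF G(1) nd(2)] V.vanishes_on_mult[OF G(1) nd(2)] Gj1 nd(3) by blast+
  have pw: "(\<lambda>x :: 'k ^ 'n. (x $ i0) ^ e) \<in> forms UNIV e" for e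
    using form_power[OF form_coord[of i0], of e] by simp
  \<comment> \<open>The inverse of \<open>B\<close> in the coordinates normalized by
    \<open>x $ i0\<close>.\<close>
  have pwB: "form_ratio (\<lambda>x. (x $ i0) ^ (dG + dn)) B \<in> V.rat"
    by (rule V.rational_form_ratio[OF pw B])
  have "\<exists>z. fst z \<in> W.rat \<and> fst (snd z) \<in> W.rat \<and> snd (snd z) \<in> W.rat \<and>
      generically V (\<lambda>x. f (proj x) = fst z (\<phi> (proj x)) + fst (snd z) (\<phi> (proj x)) * \<theta> (proj x) +
        snd (snd z) (\<phi> (proj x)) * (\<theta> (proj x))\<^sup>2)" if f: "f \<in> V.rat" for f
  proof -
    obtain a b c where "a \<in> W.rat" "b \<in> W.rat" "c \<in> W.rat" "generically V (\<lambda>x. f (proj x) =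
        a (\<phi> (proj x)) + b (\<phi> (proj x)) * \<theta> (proj x) + c (\<phi> (proj x)) * (\<theta> (proj x))^2)"
      using quadratic_span[OF \<theta> f] by blast
    then show ?thesis by (intro exI[of _ "(a, b, c)"]) simp
  qed
  note span = this
  have "form_ratio (\<lambda>x. x $ i) (\<lambda>x. x $ i0) \<in> V.rat" for i
    by (rule V.rational_form_ratio[OF form_coord form_coord i0])
  then have "\<forall>i. \<exists>z. fst z \<in> W.rat \<and> fst (snd z) \<in> W.rat \<and> snd (snd z) \<in> W.rat \<and>
      generically V (\<lambda>x. form_ratio (\<lambda>x. x $ i) (\<lambda>x. x $ i0) (proj x) = fst z (\<phi> (proj x)) +
        fst (snd z) (\<phi> (proj x)) * \<theta> (proj x) + snd (snd z) (\<phi> (proj x)) * (\<theta> (proj x))\<^sup>2)"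
    using span by blast
  from choice[OF this] obtain z where z: "\<And>i. fst (z i) \<in> W.rat" "\<And>i. fst (snd (z i)) \<in> W.rat"
    "\<And>i. snd (snd (z i)) \<in> W.rat"
    "\<And>i. generically V (\<lambda>x. x $ i / x $ i0 = fst (z i) (\<phi> (proj x)) +
        fst (snd (z i)) (\<phi> (proj x)) * \<theta> (proj x) + snd (snd (z i)) (\<phi> (proj x)) * (\<theta> (proj x))\<^sup>2)"
    unfolding form_ratio_proj[OF form_coord form_coord] by blast
  from span[OF pwB] obtain b where b: "fst b \<in> W.rat" "fst (snd b) \<in> W.rat" "snd (snd b) \<in> W.rat"
    "generically V (\<lambda>x. (x $ i0) ^ (dG + dn) / B x = fst b (\<phi> (proj x)) +
        fst (snd b) (\<phi> (proj x)) * \<theta> (proj x) + snd (snd b) (\<phi> (proj x)) * (\<theta> (proj x))\<^sup>2)"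
    unfolding form_ratio_proj[OF pw B(1)] by blast
  \<comment> \<open>Affine coordinates on the target, as rational functions.\<close>
  define Y where "Y j = form_ratio (\<lambda>y :: 'k ^ 'm. y $ j) (\<lambda>y. y $ j0)" for j
  have Y: "Y j \<in> W.rat" for j unfolding Y_def by (rule W.rational_form_ratio[OF form_coord form_coord j0])
  have Yp: "Y j (proj y) = y $ j / y $ j0" for j y
    unfolding Y_def by (rule form_ratio_proj[OF form_coord form_coord])
  define Fs where "Fs = {p, q, fst b, fst (snd b), snd (snd b)} \<union> range Y \<union> range (\<lambda>i. fst (z i)) \<union>
    range (\<lambda>i. fst (snd (z i))) \<union> range (\<lambda>i. snd (snd (z i)))"
  have "finite Fs" "Fs \<subseteq> W.rat" unfolding Fs_def using pq b(1-3) Y z(1-3) by auto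
  then obtain d0 D0 where D0: "D0 \<in> forms UNIV d0" "\<not> vanishes_on D0 W" "\<forall>f\<in>Fs. W.regular_off D0 f"
    using W.common_denominator by blast
  \<comment> \<open>The extra factor keeps \<open>y $ j0\<close> nonzero at good points, where the
    affine coordinates are used.\<close>
  define D where "D y = D0 y * y $ j0" for y
  have D: "D \<in> forms UNIV (d0 + 1)" "\<not> vanishes_on D W"
    unfolding D_def[abs_def] using form_mult[OF D0(1) form_coord] W.vanishes_on_mult[OF D0(1) form_coord[of j0]] D0(2) j0 by blast+
  have reg: "W.regular_off D f" if f: "f \<in> Fs" for f
  proof -
    obtain e E H where "E \<in> forms UNIV e" "H \<in> forms UNIV e"
      "\<And>y. y \<noteq> 0 \<Longrightarrow> proj y \<in> W \<Longrightarrow> D0 y \<noteq> 0 \<Longrightarrow> H y \<noteq> 0 \<and> f (proj y) = E y / H y"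
      using D0(3)[rule_format, OF f] by (rule W.regular_offE) (rule that)
    then show ?thesis by (intro W.regular_offI[of E e H]) (auto simp: D_def)
  qed
  interpret cubic_specialization V W \<phi> S \<theta> p q D "d0 + 1"
    by unfold_locales (use \<theta> cubic D reg in \<open>auto simp: Fs_def\<close>)
  \<comment> \<open>The \<open>i\<close>-th affine coordinate of a point, expressed through its
    image and \<open>\<theta>\<close>, with \<open>t\<close> substituted for
    \<open>\<theta>\<close>.\<close>
  define xc where "xc i Q t = fst (z i) Q + fst (snd (z i)) Q * t + snd (snd (z i)) Q * t ^ 2" for i Q t
  have xc: "specializable (xc i)" for i
    unfolding xc_def[abs_def]
    by (intro spec_add spec_mult spec_regular spec_power spec_root reg) (auto simp: Fs_def)
  define ib where "ib Q t = fst b Q + fst (snd b) Q * t + snd (snd b) Q * t ^ 2" for Q t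
  have ib: "specializable ib"
    unfolding ib_def[abs_def]
    by (intro spec_add spec_mult spec_regular spec_power spec_root reg) (auto simp: Fs_def)
  \<comment> \<open>At a generic point the substituted coordinates are those of the point itself,
    scaled by the inverse of \<open>x $ i0\<close>.\<close>
  have gX: "generically V (\<lambda>x. x $ i0 \<noteq> 0 \<and> (\<forall>F e. F \<in> forms UNIV e \<longrightarrow>
      F (\<chi> i. xc i (\<phi> (proj x)) (\<theta> (proj x))) = F x / (x $ i0) ^ e))"
  proof -
    have "generically V (\<lambda>x. \<forall>i\<in>UNIV. xc i (\<phi> (proj x)) (\<theta> (proj x)) = x $ i / x $ i0)"
    proof (rule V.generically_ball)
      fix i
      show "generically V (\<lambda>x. xc i (\<phi> (proj x)) (\<theta> (proj x)) = x $ i / x $ i0)"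
        by (rule generically_mono[OF z(4)[of i]]) (simp add: xc_def)
    qed simp
    from V.generically_conj[OF gi0 this] show ?thesis
    proof (rule generically_mono)
      fix x assume *: "x $ i0 \<noteq> 0 \<and> (\<forall>i\<in>UNIV. xc i (\<phi> (proj x)) (\<theta> (proj x)) = x $ i / x $ i0)"
      then have eq: "(\<chi> i. xc i (\<phi> (proj x)) (\<theta> (proj x))) = inverse (x $ i0) *s x"
        by (simp add: vec_eq_iff divide_inverse mult.commute)
      show "x $ i0 \<noteq> 0 \<and> (\<forall>F e. F \<in> forms UNIV e \<longrightarrow>
        F (\<chi> i. xc i (\<phi> (proj x)) (\<theta> (proj x))) = F x / (x $ i0) ^ e)"
        unfolding eq using * by (simp add: form_homogeneous divide_inverse power_inverse mult.commute)
    qed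
  qed
  let ?xc = "\<lambda>y t. \<chi> i. xc i (proj y) t"
  have one: "xc i0 (proj y) t = 1" if "good y t" for y t
  proof -
    have "generically V (\<lambda>x. xc i0 (\<phi> (proj x)) (\<theta> (proj x)) - 1 = 0)"
    proof (rule generically_mono[OF gX])
      fix x assume *: "x $ i0 \<noteq> 0 \<and> (\<forall>F e. F \<in> forms UNIV e \<longrightarrow>
        F (\<chi> i. xc i (\<phi> (proj x)) (\<theta> (proj x))) = F x / (x $ i0) ^ e)"
      then have "(\<chi> i. xc i (\<phi> (proj x)) (\<theta> (proj x))) $ i0 = x $ i0 / (x $ i0) ^ 1"
        using form_coord[of i0] by blast
      then show "xc i0 (\<phi> (proj x)) (\<theta> (proj x)) - 1 = 0" using * by simp
    qed
    from specialization[OF spec_diff[OF xc spec_const] this that] show ?thesis by simp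
  qed
  have inV: "proj (?xc y t) \<in> V" and X0: "?xc y t \<noteq> 0" if g: "good y t" for y t
  proof -
    show nz: "?xc y t \<noteq> 0" using one[OF g] by (metis vec_lambda_beta zero_index zero_neq_one)
    obtain Z where Z: "Z \<subseteq> (\<Union>d. forms UNIV d)" "\<And>x. x \<noteq> 0 \<Longrightarrow> proj x \<in> V \<longleftrightarrow> (\<forall>g\<in>Z. g x = 0)"
      using V.closed by (rule zariski_closedE) (rule that)
    have "F (?xc y t) = 0" if F: "F \<in> Z" for F
    proof -
      obtain e where e: "F \<in> forms UNIV e" using Z(1) F by blast
      have "generically V (\<lambda>x. F (\<chi> i. xc i (\<phi> (proj x)) (\<theta> (proj x))) = 0)"
        by (rule generically_mono[OF gX]) (use e F Z(2) in force)
      from specialization[OF spec_form[OF e xc] this g] show ?thesis .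
    qed
    then show "proj (?xc y t) \<in> V" using Z(2)[OF nz] by blast
  qed
  \<comment> \<open>Specializing \<open>B * ib = 1\<close> shows that \<open>B\<close> is nonzero at
    the new point.\<close>
  have inv: "B (?xc y t) * ib (proj y) t - 1 = 0" if g: "good y t" for y t
  proof (rule specialization[OF spec_diff[OF spec_mult[OF spec_form[OF B(1) xc] ib] spec_const] _ g])
    show "generically V (\<lambda>x. B (\<chi> i. xc i (\<phi> (proj x)) (\<theta> (proj x))) * ib (\<phi> (proj x)) (\<theta> (proj x)) - 1 = 0)"
    proof (rule generically_mono[OF generic_conj3[OF gX b(4) generically_form[OF B]]])
      fix x assume *: "(x $ i0 \<noteq> 0 \<and> (\<forall>F e. F \<in> forms UNIV e \<longrightarrow>
          F (\<chi> i. xc i (\<phi> (proj x)) (\<theta> (proj x))) = F x / (x $ i0) ^ e)) \<and>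
        (x $ i0) ^ (dG + dn) / B x = fst b (\<phi> (proj x)) +
        fst (snd b) (\<phi> (proj x)) * \<theta> (proj x) + snd (snd b) (\<phi> (proj x)) * (\<theta> (proj x))\<^sup>2 \<and> B x \<noteq> 0"
      then have "B (\<chi> i. xc i (\<phi> (proj x)) (\<theta> (proj x))) = B x / (x $ i0) ^ (dG + dn)" using B(1) by blast
      moreover have "ib (\<phi> (proj x)) (\<theta> (proj x)) = (x $ i0) ^ (dG + dn) / B x" unfolding ib_def using * by simp
      moreover have "x $ i0 \<noteq> 0" "B x \<noteq> 0" using * by simp_all
      ultimately show "B (\<chi> i. xc i (\<phi> (proj x)) (\<theta> (proj x))) * ib (\<phi> (proj x)) (\<theta> (proj x)) - 1 = 0"
        by simp
    qed
  qed
  \<comment> \<open>Proportionality to \<open>y\<close> as the vanishing of all two-by-two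
    minors.\<close>
  have par: "G i (?xc y t) * Y j (proj y) - G j (?xc y t) * Y i (proj y) = 0" if g: "good y t" for y t i j
  proof (rule specialization[OF spec_diff[OF spec_mult[OF spec_form[OF G(1) xc] spec_regular]
          spec_mult[OF spec_form[OF G(1) xc] spec_regular]] _ g])
    show "W.regular_off D (Y j)" "W.regular_off D (Y i)" by (auto intro!: reg simp: Fs_def)
    show "generically V (\<lambda>x. G i (\<chi> i. xc i (\<phi> (proj x)) (\<theta> (proj x))) * Y j (\<phi> (proj x)) -
       G j (\<chi> i. xc i (\<phi> (proj x)) (\<theta> (proj x))) * Y i (\<phi> (proj x)) = 0)"
    proof (rule generically_mono[OF V.generically_conj[OF gX generically_form[OF G(1) Gj1]]])
      fix x assume x: "x \<noteq> 0" "proj x \<in> V" and *: "(x $ i0 \<noteq> 0 \<and> (\<forall>F e. F \<in> forms UNIV e \<longrightarrow>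
          F (\<chi> i. xc i (\<phi> (proj x)) (\<theta> (proj x))) = F x / (x $ i0) ^ e)) \<and> G j1 x \<noteq> 0"
      then have GX: "G k (\<chi> i. xc i (\<phi> (proj x)) (\<theta> (proj x))) = G k x / (x $ i0) ^ dG" for k using G(1) by blast
      have "\<phi> (proj x) = proj (\<chi> j. G j x)" using G(5) x * by blast
      then have "Y k (\<phi> (proj x)) = G k x / G j0 x" for k by (simp add: Yp)
      then show "G i (\<chi> i. xc i (\<phi> (proj x)) (\<theta> (proj x))) * Y j (\<phi> (proj x)) -
       G j (\<chi> i. xc i (\<phi> (proj x)) (\<theta> (proj x))) * Y i (\<phi> (proj x)) = 0"
        unfolding GX by simp
    qed
  qed
  have fib: "\<phi> (proj (?xc y t)) = proj y" if g: "good y t" for y t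
  proof -
    have y: "y \<noteq> 0" "y $ j0 \<noteq> 0" using g unfolding good_def D_def by auto
    have G1: "G j1 (?xc y t) \<noteq> 0" using inv[OF g] unfolding B_def by auto
    then have f: "\<phi> (proj (?xc y t)) = proj (\<chi> j. G j (?xc y t))"
      using G(5) X0[OF g] inV[OF g] by blast
    have *: "G i (?xc y t) * y $ j = G j (?xc y t) * y $ i" for i j
      using par[OF g, of i j] y(2) unfolding Yp by (simp add: field_simps)
    define c where "c = y $ j1 / G j1 (?xc y t)"
    have yc: "y = c *s (\<chi> j. G j (?xc y t))"
      unfolding c_def vec_eq_iff using *[of j1] G1 by (simp add: field_simps)
    then have "c \<noteq> 0" using y(1) by auto
    then have "proj (\<chi> j. G j (?xc y t)) = proj y" using yc proj_eq_iff by blast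
    then show ?thesis using f by simp
  qed
  \<comment> \<open>The relation between \<open>\<theta>\<close>, its numerator and its denominator,
    specialized: the point determines \<open>t\<close>.\<close>
  have root: "num (?xc y t) - t * den (?xc y t) = 0" if g: "good y t" for y t
  proof (rule specialization[OF spec_diff[OF spec_form[OF nd(1) xc] spec_mult[OF spec_root spec_form[OF nd(2) xc]]] _ g])
    show "generically V (\<lambda>x. num (\<chi> i. xc i (\<phi> (proj x)) (\<theta> (proj x))) -
      \<theta> (proj x) * den (\<chi> i. xc i (\<phi> (proj x)) (\<theta> (proj x))) = 0)"
    proof (rule generically_mono[OF V.generically_conj[OF gX nd(4)]])
      fix x assume *: "(x $ i0 \<noteq> 0 \<and> (\<forall>F e. F \<in> forms UNIV e \<longrightarrow>
          F (\<chi> i. xc i (\<phi> (proj x)) (\<theta> (proj x))) = F x / (x $ i0) ^ e)) \<and>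
          den x \<noteq> 0 \<and> \<theta> (proj x) = num x / den x"
      then have "num (\<chi> i. xc i (\<phi> (proj x)) (\<theta> (proj x))) = num x / (x $ i0) ^ dn"
        "den (\<chi> i. xc i (\<phi> (proj x)) (\<theta> (proj x))) = den x / (x $ i0) ^ dn" using nd(1,2) by blast+
      then show "num (\<chi> i. xc i (\<phi> (proj x)) (\<theta> (proj x))) -
        \<theta> (proj x) * den (\<chi> i. xc i (\<phi> (proj x)) (\<theta> (proj x))) = 0" using * by simp
    qed
  qed
  have inj: "t = t'" if g: "good y t" "good y t'" and eq: "proj (?xc y t) = proj (?xc y t')" for y t t'
  proof -
    obtain c where c: "?xc y t' = c *s ?xc y t" using eq proj_eq_iff by blast
    then have "xc i0 (proj y) t' = c * xc i0 (proj y) t" by (auto simp: vec_eq_iff)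
    then have "c = 1" using one[OF g(1)] one[OF g(2)] by simp
    then have e: "?xc y t' = ?xc y t" using c by simp
    have "num (?xc y t) = t * den (?xc y t)" using root[OF g(1)] by simp
    moreover have "num (?xc y t') = t' * den (?xc y t')" using root[OF g(2)] by simp
    ultimately have "t' * den (?xc y t) = t * den (?xc y t)" unfolding e by metis
    moreover have "den (?xc y t) \<noteq> 0" using inv[OF g(1)] unfolding B_def by auto
    ultimately show ?thesis by simp
  qed
  obtain y where y: "y \<noteq> 0" "proj y \<in> W" "4 * (p (proj y))^3 - 27 * (q (proj y))^2 \<noteq> 0" "D y \<noteq> 0"
    using generically_ex[OF W.generically_conj[OF disc generically_form[OF D]]] by blast
  obtain t1 t2 t3 where t: "t1 ^ 3 = p (proj y) * t1 + q (proj y)" "t2 ^ 3 = p (proj y) * t2 + q (proj y)"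
    "t3 ^ 3 = p (proj y) * t3 + q (proj y)" "t1 \<noteq> t2" "t1 \<noteq> t3" "t2 \<noteq> t3"
    using y(3) by (rule cubic_distinct_roots) (rule that)
  have g: "good y t1" "good y t2" "good y t3" using y(1,2,4) t(1-3) by (simp_all add: good_def)
  have "proj (?xc y t1) \<noteq> proj (?xc y t2)" "proj (?xc y t1) \<noteq> proj (?xc y t3)" "proj (?xc y t2) \<noteq> proj (?xc y t3)"
    using inj[OF g(1,2)] inj[OF g(1,3)] inj[OF g(2,3)] t(4-6) by blast+
  then show ?thesis
    by (intro exI[of _ "proj y"] exI[of _ "proj (?xc y t1)"] exI[of _ "proj (?xc y t2)"] exI[of _ "proj (?xc y t3)"]
        conjI inV[OF g(1)] inV[OF g(2)] inV[OF g(3)] fib[OF g(1)] fib[OF g(2)] fib[OF g(3)])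
qed

section \<open>The number of deck translations\<close>

text \<open>Otherwise the product of all linear factors plus one would be a nonconstant polynomial
  without a root.\<close>

lemma infinite_alg_closed: "infinite (UNIV :: 'k::alg_closed_field set)"
proof
  assume fin: "finite (UNIV :: 'k set)"
  let ?p = "(\<Prod>a\<in>(UNIV :: 'k set). [:- a, 1:]) + 1"
  have "Polynomial.degree (\<Prod>a\<in>(UNIV :: 'k set). [:- a, 1:]) = card (UNIV :: 'k set)"
    by (subst degree_prod_eq_sum_degree) auto
  moreover have "card (UNIV :: 'k set) > 0" using fin by (simp add: card_gt_0_iff)
  ultimately have "Polynomial.degree ?p > 0" by (subst degree_add_eq_left) auto
  then obtain x where "poly ?p x = 0" using alg_closed_imp_poly_has_root by blast
  moreover have "poly (\<Prod>a\<in>(UNIV :: 'k set). [:- a, 1:]) x = 0"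
    using fin by (auto simp: poly_prod)
  ultimately show False by simp
qed

text \<open>The coefficients are distinct powers of one parameter \<open>s\<close>, so the value of
  the form at \<open>z\<close> is a nonzero polynomial in \<open>s\<close>. Finitely many
  \<open>s\<close> are excluded.\<close>

lemma separating_linear_form:
  fixes Z :: "('k::alg_closed_field ^ 'n::finite) set"
  assumes "finite Z" "0 \<notin> Z"
  shows "\<exists>l\<in>forms UNIV 1. (\<forall>z\<in>Z. l z \<noteq> 0) \<and> (\<forall>a b x y. l (a *s x - b *s y) = a * l x - b * l y)"
proof -
  \<comment> \<open>An injective numbering of the coordinates, so that the monomials in
    \<open>s\<close> do not collide.\<close>
  obtain n :: "'n \<Rightarrow> nat" where n: "inj n" using finite_imp_inj_to_nat_seg[OF finite[of "UNIV :: 'n set"]] by auto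
  define P where "P z = (\<Sum>i\<in>UNIV. Polynomial.monom (z $ i) (n i))" for z :: "'k ^ 'n"
  have Pnz: "P z \<noteq> 0" if z: "z \<noteq> 0" for z
  proof -
    obtain i where i: "z $ i \<noteq> 0" using z by (auto simp: vec_eq_iff)
    have "Polynomial.coeff (P z) (n i) = (\<Sum>j\<in>UNIV. if j = i then z $ i else 0)"
      unfolding P_def Polynomial.coeff_sum by (intro sum.cong) (auto dest: injD[OF n])
    then have "Polynomial.coeff (P z) (n i) = z $ i" by simp
    then show ?thesis using i by auto
  qed
  have "finite (\<Union>z\<in>Z. {s. poly (P z) s = 0})"
    using assms by (intro finite_UN_I poly_roots_finite Pnz) auto
  then obtain s where s: "s \<notin> (\<Union>z\<in>Z. {s. poly (P z) s = 0})"
    using ex_new_if_finite[OF infinite_alg_closed] by blast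
  define l where "l z = (\<Sum>i\<in>UNIV. s ^ n i * z $ i)" for z :: "'k ^ 'n"
  have lP: "l z = poly (P z) s" for z
    unfolding l_def P_def by (simp add: poly_sum poly_monom mult.commute)
  have "l \<in> forms UNIV 1"
    unfolding l_def[abs_def] by (intro form_sum form_cmult form_coord)
  moreover have "\<forall>z\<in>Z. l z \<noteq> 0" using s lP by auto
  moreover have "l (a *s x - b *s y) = a * l x - b * l y" for a b x y
    unfolding l_def by (simp add: sum_distrib_left sum_subtractf algebra_simps)
  ultimately show ?thesis by blast
qed

text \<open>With \<open>m\<close> nonzero on \<open>Z\<close>, a linear form \<open>l\<close> has
  distinct ratios to \<open>m\<close> when it is nonzero on the vectors
  \<open>m y x - m x y\<close>; these are nonzero because the points are distinct.\<close>

lemma separating_ratio: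
  fixes Z :: "('k::alg_closed_field ^ 'n::finite) set"
  assumes "finite Z" "0 \<notin> Z" and indep: "\<And>x y. x \<in> Z \<Longrightarrow> y \<in> Z \<Longrightarrow> x \<noteq> y \<Longrightarrow> proj x \<noteq> proj y"
  shows "\<exists>l\<in>forms UNIV 1. \<exists>m\<in>forms UNIV 1. (\<forall>z\<in>Z. m z \<noteq> 0) \<and>
    (\<forall>x\<in>Z. \<forall>y\<in>Z. x \<noteq> y \<longrightarrow> l x * m y - l y * m x \<noteq> 0)"
proof -
  obtain m where m: "m \<in> forms UNIV 1" "\<forall>z\<in>Z. m z \<noteq> 0"
    using separating_linear_form[OF assms(1,2)] by blast
  define Z' where "Z' = (\<lambda>(x, y). m y *s x - m x *s y) ` {(x, y). x \<in> Z \<and> y \<in> Z \<and> x \<noteq> y}"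
  have "finite {(x, y). x \<in> Z \<and> y \<in> Z \<and> x \<noteq> y}"
    using assms(1) by (intro finite_subset[OF _ finite_cartesian_product[of Z Z]]) auto
  then have "finite Z'" unfolding Z'_def by blast
  moreover have "0 \<notin> Z'"
  proof
    assume "0 \<in> Z'"
    then obtain x y where xy: "x \<in> Z" "y \<in> Z" "x \<noteq> y" "m y *s x = m x *s y"
      unfolding Z'_def by auto
    have "y = (m y / m x) *s x"
      using xy(1,4) m(2) by (simp add: vec_eq_iff field_simps)
    moreover have "m y / m x \<noteq> 0" using xy m(2) by simp
    ultimately have "proj x = proj y" using proj_eq_iff by blast
    then show False using indep xy by blast
  qed
  ultimately have "\<exists>l\<in>forms UNIV 1. (\<forall>z\<in>Z'. l z \<noteq> 0) \<and> (\<forall>a b x y. l (a *s x - b *s y) = a * l x - b * l y)"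
    by (rule separating_linear_form)
  then obtain l where l: "l \<in> forms UNIV 1" "\<forall>z\<in>Z'. l z \<noteq> 0"
    "\<forall>a b x y. l (a *s x - b *s y) = a * l x - b * l y"
    by (elim bexE conjE)
  have "l x * m y - l y * m x \<noteq> 0" if "x \<in> Z" "y \<in> Z" "x \<noteq> y" for x y
  proof -
    have "l (m y *s x - m x *s y) \<noteq> 0" using l(2) that unfolding Z'_def by auto
    then show ?thesis using l(3) by (simp add: mult.commute)
  qed
  then show ?thesis using l(1) m by blast
qed

lemma card_roots_cubic:
  fixes c :: "nat \<Rightarrow> 'k::field"
  assumes "(\<exists>i<4. c i \<noteq> 0)" "finite R" "\<And>s. s \<in> R \<Longrightarrow> (\<Sum>i<4. c i * s ^ i) = 0"
  shows "card R \<le> 3"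
proof -
  define P where "P = (\<Sum>i<4. Polynomial.monom (c i) i)"
  have cf: "Polynomial.coeff P j = (if j < 4 then c j else 0)" for j
    unfolding P_def Polynomial.coeff_sum by simp
  obtain i where "i < 4" "c i \<noteq> 0" using assms(1) by blast
  then have "P \<noteq> 0" using cf[of i] by auto
  have deg: "Polynomial.degree P \<le> 3" by (rule Polynomial.degree_le) (simp add: cf)
  have "R \<subseteq> {s. poly P s = 0}" using assms(3) unfolding P_def by (auto simp: poly_sum poly_monom)
  then have "card R \<le> card {s. poly P s = 0}" using \<open>P \<noteq> 0\<close> by (intro card_mono poly_roots_finite)
  also have "\<dots> \<le> Polynomial.degree P" using \<open>P \<noteq> 0\<close> by (rule card_poly_roots_bound)
  finally show ?thesis using deg by simp
qed

context cubic_morphism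
begin

text \<open>The function \<open>f = l / m\<close> satisfies a nontrivial relation of degree at most
  three over the pullback field, whose coefficients the deck maps preserve. Its values at the
  translates of a generic point are roots of one polynomial, and they are distinct because they are
  distinct at \<open>P0\<close>.\<close>

lemma deck_translations_bound:
  assumes T: "finite T" "\<And>g. g \<in> T \<Longrightarrow> surjective_morphism V V (\<tau> g) UNIV"
    and deck: "\<And>g P. g \<in> T \<Longrightarrow> P \<in> V \<Longrightarrow> \<phi> (\<tau> g P) = \<phi> P"
    and l: "l \<in> forms UNIV 1" "m \<in> forms UNIV 1"
    and P0: "P0 \<in> V"
    and sep: "\<And>g. g \<in> T \<Longrightarrow> \<exists>z. z \<noteq> 0 \<and> \<tau> g P0 = proj z \<and> m z \<noteq> 0"
      "\<And>g h z w. g \<in> T \<Longrightarrow> h \<in> T \<Longrightarrow> g \<noteq> h \<Longrightarrow> \<tau> g P0 = proj z \<Longrightarrow> \<tau> h P0 = proj w \<Longrightarrow> l z * m w - l w * m z \<noteq> 0"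
  shows "card T \<le> 3"
proof (cases "T = {}")
  case False
  then obtain g0 where g0: "g0 \<in> T" by blast
  have \<tau>V: "\<tau> g P \<in> V" if "g \<in> T" "P \<in> V" for g P
    using surjective_morphism.maps_to[OF T(2)[OF that(1)] that(2)] .
  have mV: "\<not> vanishes_on m V"
    using sep(1)[OF g0] \<tau>V[OF g0 P0] unfolding vanishes_on_def by auto
  define f where "f = form_ratio l m"
  have f: "f \<in> V.rat" unfolding f_def by (rule V.rational_form_ratio[OF l mV])
  have fp: "f (proj z) = l z / m z" for z unfolding f_def by (rule form_ratio_proj[OF l])
  let ?fs = "[\<lambda>_. 1, f, \<lambda>P. f P * f P, \<lambda>P. f P * f P * f P]"
  have "set ?fs \<subseteq> V.rat"
    using f V.rational_const V.rational_mult[OF f f] V.rational_mult[OF V.rational_mult[OF f f] f] by simp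
  then obtain as where as: "length as = length ?fs" "set as \<subseteq> W.rat"
    "generically V (\<lambda>x. (\<Sum>i<length ?fs. (as ! i) (\<phi> (proj x)) * (?fs ! i) (proj x)) = 0)"
    "\<exists>i<length ?fs. \<not> generically W (\<lambda>y. (as ! i) (proj y) = 0)"
    using rational_dependent[OF dim, of ?fs] by auto
  \<comment> \<open>One coefficient that is not generically zero suffices for a nonzero polynomial
    at a generic point.\<close>
  then obtain i where i: "i < 4" "\<not> generically W (\<lambda>y. (as ! i) (proj y) = 0)" by (auto simp: eval_nat_numeral)
  have "as ! i \<in> W.rat" using as(1) i(1) by (intro subsetD[OF as(2)] nth_mem) simp
  then have nz: "generically V (\<lambda>x. (as ! i) (\<phi> (proj x)) \<noteq> 0)"
    using pullback_zero_or_nonzero i(2) by blast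
  have rel: "generically V (\<lambda>x. (\<Sum>i<4. (as ! i) (\<phi> (proj x)) * f (proj x) ^ i) = 0)"
    by (rule generically_mono[OF as(3)])
      (simp add: eval_nat_numeral algebra_simps)
  have rel': "generically V (\<lambda>x. \<forall>g\<in>T. (\<Sum>i<4. (as ! i) (\<phi> (\<tau> g (proj x))) * f (\<tau> g (proj x)) ^ i) = 0)"
    using T(1)
  proof (rule V.generically_ball)
    fix g assume "g \<in> T"
    then interpret t: surjective_morphism V V "\<tau> g" UNIV by (rule T(2))
    show "generically V (\<lambda>x. (\<Sum>i<4. (as ! i) (\<phi> (\<tau> g (proj x))) * f (\<tau> g (proj x)) ^ i) = 0)"
      by (rule t.generically_pullback[OF rel])
  qed
  have pair: "generically V (\<lambda>x. f (\<tau> g (proj x)) \<noteq> f (\<tau> h (proj x)))"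
    if gh: "g \<in> T" "h \<in> T" "g \<noteq> h" for g h
  proof -
    interpret tg: surjective_morphism V V "\<tau> g" UNIV by (rule T(2)[OF gh(1)])
    interpret th: surjective_morphism V V "\<tau> h" UNIV by (rule T(2)[OF gh(2)])
    obtain d G x where G: "\<And>j. G j \<in> forms UNIV d" "x \<noteq> 0" "proj x = P0" "\<exists>j. G j x \<noteq> 0"
      "\<And>x. x \<noteq> 0 \<Longrightarrow> proj x \<in> V \<Longrightarrow> \<exists>j. G j x \<noteq> 0 \<Longrightarrow> \<tau> g (proj x) = proj (\<chi> j. G j x)"
      using P0 by (rule tg.local_forms) (rule that)
    obtain e H y where H: "\<And>j. H j \<in> forms UNIV e" "y \<noteq> 0" "proj y = P0" "\<exists>j. H j y \<noteq> 0"
      "\<And>x. x \<noteq> 0 \<Longrightarrow> proj x \<in> V \<Longrightarrow> \<exists>j. H j x \<noteq> 0 \<Longrightarrow> \<tau> h (proj x) = proj (\<chi> j. H j x)"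
      using P0 by (rule th.local_forms) (rule that)
    obtain j where j: "G j x \<noteq> 0" using G(4) by blast
    obtain k where k: "H k y \<noteq> 0" using H(4) by blast
    obtain c where c: "c \<noteq> 0" "x = c *s y" using proj_eq_iff[of y x] G(3) H(3) by blast
    have kx: "H k x \<noteq> 0" unfolding c(2) form_homogeneous[OF H(1)] using c(1) k by simp
    have tg: "\<tau> g P0 = proj (\<chi> j. G j x)" using G(5)[OF G(2)] G(3,4) P0 by blast
    have th: "\<tau> h P0 = proj (\<chi> j. H j x)" using H(5)[OF G(2)] G(3) kx P0 by blast
    \<comment> \<open>The cleared difference of the two values of \<open>f\<close>. It is nonzero at
      \<open>P0\<close>, hence generically nonzero.\<close>
    define K where "K x = l (\<chi> j. G j x) * m (\<chi> j. H j x) - l (\<chi> j. H j x) * m (\<chi> j. G j x)" for x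
    have "K \<in> forms UNIV (1 * d + 1 * e)"
    proof -
      have "(\<lambda>x. l (\<chi> j. G j x) * m (\<chi> j. H j x)) \<in> forms UNIV (1 * d + 1 * e)"
        by (intro form_mult form_compose l G(1) H(1))
      moreover have "(\<lambda>x. l (\<chi> j. H j x) * m (\<chi> j. G j x)) \<in> forms UNIV (1 * e + 1 * d)"
        by (intro form_mult form_compose l G(1) H(1))
      ultimately show ?thesis unfolding K_def[abs_def] by (intro form_diff) (simp_all add: add.commute)
    qed
    moreover have "K x \<noteq> 0" unfolding K_def by (rule sep(2)[OF gh tg th])
    moreover have "x \<noteq> 0" "proj x \<in> V" using G(2,3) P0 by auto
    ultimately have "generically V (\<lambda>x. K x \<noteq> 0)"
      unfolding generically_def vanishes_on_def by blast
    have mz: "m (\<chi> j. G j x) \<noteq> 0"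
    proof -
      obtain z where "\<tau> g P0 = proj z" "m z \<noteq> 0" using sep(1)[OF gh(1)] by blast
      then obtain b where "b \<noteq> 0" "(\<chi> j. G j x) = b *s z" using proj_eq_iff[of z] tg by metis
      then show ?thesis using form_homogeneous[OF l(2)] \<open>m z \<noteq> 0\<close> by simp
    qed
    have mw: "m (\<chi> j. H j x) \<noteq> 0"
    proof -
      obtain z where "\<tau> h P0 = proj z" "m z \<noteq> 0" using sep(1)[OF gh(2)] by blast
      then obtain b where "b \<noteq> 0" "(\<chi> j. H j x) = b *s z" using proj_eq_iff[of z] th by metis
      then show ?thesis using form_homogeneous[OF l(2)] \<open>m z \<noteq> 0\<close> by simp
    qed
    \<comment> \<open>Nonvanishing of \<open>N\<close> makes both local presentations valid and both
      denominators nonzero.\<close>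
    define N where "N x = G j x * H k x * m (\<chi> j. G j x) * m (\<chi> j. H j x)" for x
    have N: "N \<in> forms UNIV (d + e + 1 * d + 1 * e)"
      unfolding N_def[abs_def] by (intro form_mult form_compose l G(1) H(1))
    have "N x \<noteq> 0" unfolding N_def using j kx mz mw by simp
    then have "\<not> vanishes_on N V" unfolding vanishes_on_def using G(2,3) P0 by auto
    from V.generically_conj[OF \<open>generically V (\<lambda>x. K x \<noteq> 0)\<close> generically_form[OF N this]]
    show ?thesis
    proof (rule generically_mono)
      fix x assume x: "x \<noteq> 0" "proj x \<in> V" and KN: "K x \<noteq> 0 \<and> N x \<noteq> 0"
      then have "G j x \<noteq> 0" "H k x \<noteq> 0" and mm: "m (\<chi> j. G j x) \<noteq> 0" "m (\<chi> j. H j x) \<noteq> 0"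
        unfolding N_def by auto
      then have "\<tau> g (proj x) = proj (\<chi> j. G j x)" "\<tau> h (proj x) = proj (\<chi> j. H j x)"
        using G(5) H(5) x by blast+
      then show "f (\<tau> g (proj x)) \<noteq> f (\<tau> h (proj x))"
        using KN mm unfolding K_def by (auto simp: fp field_simps)
    qed
  qed
  have "generically V (\<lambda>x. \<forall>gh\<in>{gh \<in> T \<times> T. fst gh \<noteq> snd gh}. f (\<tau> (fst gh) (proj x)) \<noteq> f (\<tau> (snd gh) (proj x)))"
    using T(1) pair by (intro V.generically_ball) auto
  from generically_ex[OF generic_conj3[OF this rel' nz]] obtain x where x: "x \<noteq> 0" "proj x \<in> V"
    "\<forall>gh\<in>{gh \<in> T \<times> T. fst gh \<noteq> snd gh}. f (\<tau> (fst gh) (proj x)) \<noteq> f (\<tau> (snd gh) (proj x))"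
    "\<forall>g\<in>T. (\<Sum>i<4. (as ! i) (\<phi> (\<tau> g (proj x))) * f (\<tau> g (proj x)) ^ i) = 0"
    "(as ! i) (\<phi> (proj x)) \<noteq> 0" by blast
  define R where "R = (\<lambda>g. f (\<tau> g (proj x))) ` T"
  have "inj_on (\<lambda>g. f (\<tau> g (proj x))) T"
  proof (rule inj_onI, rule ccontr)
    fix g h assume "g \<in> T" "h \<in> T" "f (\<tau> g (proj x)) = f (\<tau> h (proj x))" "g \<noteq> h"
    then show False using x(3)[rule_format, of "(g, h)"] by simp
  qed
  then have "card T = card R" unfolding R_def by (simp add: card_image)
  also have "\<dots> \<le> 3"
  proof (rule card_roots_cubic[of "\<lambda>i. (as ! i) (\<phi> (proj x))"])
    show "\<exists>i<4. (as ! i) (\<phi> (proj x)) \<noteq> 0" using i(1) x(5) by blast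
    show "finite R" unfolding R_def using T(1) by simp
    fix s assume "s \<in> R"
    then obtain g where "g \<in> T" "s = f (\<tau> g (proj x))" unfolding R_def by blast
    then show "(\<Sum>i<4. (as ! i) (\<phi> (proj x)) * s ^ i) = 0"
      using x(4) deck[OF _ x(2)] by simp
  qed
  finally show ?thesis .
qed simp

end

section \<open>Translations and the order of the kernel\<close>

lemma abelian_variety_irreducible: "abelian_variety A \<Longrightarrow> irreducible_variety (carrier A)"
  unfolding abelian_variety_def projective_variety_def by (intro irreducible_variety.intro) auto

text \<open>The group law is restricted to a slice: for a fixed first factor the Segre coordinates
  are linear in the second. Since \<open>g\<close> need not be rational, the resulting forms have
  coefficients in the closure, hence \<open>UNIV\<close>.\<close>

lemma abelian_variety_translation:
  fixes A :: "('a::field alg_closure, 'n::finite) point monoid"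
  assumes A: "abelian_variety A" and g: "g \<in> carrier A"
  shows "surjective_morphism (carrier A) (carrier A) (\<lambda>P. g \<otimes>\<^bsub>A\<^esub> P) UNIV"
proof -
  interpret A: comm_group A using A unfolding abelian_variety_def by blast
  interpret V: irreducible_variety "carrier A" using abelian_variety_irreducible[OF A] .
  obtain \<mu> where mu: "morphism_over base_field (product_variety (carrier A) (carrier A)) (carrier A) \<mu>"
    "\<And>x y. x \<noteq> 0 \<Longrightarrow> y \<noteq> 0 \<Longrightarrow> proj x \<in> carrier A \<Longrightarrow> proj y \<in> carrier A \<Longrightarrow>
      \<mu> (proj (segre x y)) = proj x \<otimes>\<^bsub>A\<^esub> proj y"
    using A unfolding abelian_variety_def by metis
  obtain y0 where y0: "y0 \<noteq> 0" "g = proj y0" using V.point_rep[OF g] by blast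
  show ?thesis
  proof (unfold_locales)
    show "(\<lambda>P. g \<otimes>\<^bsub>A\<^esub> P) ` carrier A = carrier A"
    proof
      show "carrier A \<subseteq> (\<lambda>P. g \<otimes>\<^bsub>A\<^esub> P) ` carrier A"
      proof
        fix P assume P: "P \<in> carrier A"
        have "P = g \<otimes>\<^bsub>A\<^esub> (inv\<^bsub>A\<^esub> g \<otimes>\<^bsub>A\<^esub> P)" using P g by (simp flip: A.m_assoc)
        then show "P \<in> (\<lambda>P. g \<otimes>\<^bsub>A\<^esub> P) ` carrier A" using P g by blast
      qed
    qed (use g in auto)
    show "morphism_over UNIV (carrier A) (carrier A) (\<lambda>P. g \<otimes>\<^bsub>A\<^esub> P)"
      unfolding morphism_over_def
    proof (intro conjI ballI)
      show "(\<lambda>P. g \<otimes>\<^bsub>A\<^esub> P) \<in> carrier A \<rightarrow> carrier A" using g by auto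
      fix P assume P: "P \<in> carrier A"
      obtain x0 where x0: "x0 \<noteq> 0" "P = proj x0" using V.point_rep[OF P] by blast
      have prod: "proj (segre y0 x) \<in> product_variety (carrier A) (carrier A)"
        if "x \<noteq> 0" "proj x \<in> carrier A" for x
        unfolding product_variety_def using y0 g that by blast
      have "proj (segre y0 x0) \<in> product_variety (carrier A) (carrier A)" using prod x0 P by simp
      then have "\<exists>d. \<exists>G. (\<forall>j. G j \<in> forms base_field d) \<and>
        (\<exists>x. x \<noteq> 0 \<and> proj x = proj (segre y0 x0) \<and> (\<exists>j. G j x \<noteq> 0)) \<and>
        (\<forall>x. x \<noteq> 0 \<and> proj x \<in> product_variety (carrier A) (carrier A) \<and> (\<exists>j. G j x \<noteq> 0) \<longrightarrow>
          \<mu> (proj x) = proj (\<chi> j. G j x))"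
        using mu(1) unfolding morphism_over_def by simp
      then obtain d G where G0: "\<forall>j. G j \<in> forms base_field d"
        "\<exists>x. x \<noteq> 0 \<and> proj x = proj (segre y0 x0) \<and> (\<exists>j. G j x \<noteq> 0)"
        and G1: "\<forall>x. x \<noteq> 0 \<and> proj x \<in> product_variety (carrier A) (carrier A) \<and> (\<exists>j. G j x \<noteq> 0) \<longrightarrow>
          \<mu> (proj x) = proj (\<chi> j. G j x)" by blast
      have GU: "G j \<in> forms UNIV d" for j using G0(1) forms_mono[of base_field UNIV d] by auto
      define H where "H j x = G j (\<chi> i. y0 $ fst i * x $ snd i)" for j x
      have Hs: "H j x = G j (segre y0 x)" for j x unfolding H_def segre_def ..
      have H: "H j \<in> forms UNIV (d * 1)" for j
        unfolding H_def[abs_def] by (intro form_compose GU form_cmult form_coord)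
      have sn: "segre y0 x \<noteq> 0" if x: "x \<noteq> 0" for x :: "'a alg_closure ^ 'n"
      proof -
        obtain i j where "y0 $ i \<noteq> 0" "x $ j \<noteq> 0" using x y0(1) by (auto simp: vec_eq_iff)
        then have "segre y0 x $ (i, j) \<noteq> 0" unfolding segre_def by simp
        then show ?thesis by auto
      qed
      show "\<exists>d. \<exists>G :: 'n \<Rightarrow> 'a alg_closure ^ 'n \<Rightarrow> 'a alg_closure. (\<forall>j. G j \<in> forms UNIV d) \<and>
        (\<exists>x. x \<noteq> 0 \<and> proj x = P \<and> (\<exists>j. G j x \<noteq> 0)) \<and>
        (\<forall>x. x \<noteq> 0 \<and> proj x \<in> carrier A \<and> (\<exists>j. G j x \<noteq> 0) \<longrightarrow> g \<otimes>\<^bsub>A\<^esub> proj x = proj (\<chi> j. G j x))"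
      proof (intro exI[of _ "d * 1"] exI[of _ H] conjI)
        show "\<forall>j. H j \<in> forms UNIV (d * 1)" using H by blast
        obtain w j where w: "proj w = proj (segre y0 x0)" "G j w \<noteq> 0" using G0(2) by blast
        then obtain c where "w = c *s segre y0 x0" using proj_eq_iff[of "segre y0 x0" w] by auto
        then have "G j (segre y0 x0) \<noteq> 0" using w(2) form_homogeneous[OF GU] by auto
        then show "\<exists>x. x \<noteq> 0 \<and> proj x = P \<and> (\<exists>j. H j x \<noteq> 0)" using x0 Hs by auto
        show "\<forall>x. x \<noteq> 0 \<and> proj x \<in> carrier A \<and> (\<exists>j. H j x \<noteq> 0) \<longrightarrow> g \<otimes>\<^bsub>A\<^esub> proj x = proj (\<chi> j. H j x)"
        proof (intro allI impI)
          fix x assume x: "x \<noteq> 0 \<and> proj x \<in> carrier A \<and> (\<exists>j. H j x \<noteq> 0)"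
          then have "\<mu> (proj (segre y0 x)) = proj (\<chi> j. G j (segre y0 x))"
            using sn prod unfolding Hs by (intro G1[rule_format]) auto
          then show "g \<otimes>\<^bsub>A\<^esub> proj x = proj (\<chi> j. H j x)"
            using mu(2)[of y0 x] x y0 g unfolding Hs by simp
        qed
      qed
    qed
  qed
qed

text \<open>The three points of a fibre are moved into the kernel by dividing by one of them. For
  the upper bound the deck maps are translations by kernel elements, separated at the neutral
  element, where their values are the kernel elements themselves.\<close>

theorem card_isogeny_kernel:
  fixes A :: "('a::field alg_closure, 'n::finite) point monoid"
    and A' :: "('a alg_closure, 'm::finite) point monoid"
  assumes char: "CHAR('a) \<noteq> 2" "CHAR('a) \<noteq> 3" and iso: "isogeny_of_degree 3 A A' \<phi>"
  shows "card (kernel A A' \<phi>) = 3"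
proof -
  have A: "abelian_variety A" "abelian_variety A'" and mor: "morphism_over base_field (carrier A) (carrier A') \<phi>"
    and hom: "\<phi> \<in> hom A A'" and surj: "\<phi> ` carrier A = carrier A'" and fin: "finite (kernel A A' \<phi>)"
    and dim: "ring.dimension (function_field (carrier A)) 3
       (pullback_field (carrier A) (carrier A') \<phi>) (carrier (function_field (carrier A)))"
    using iso unfolding isogeny_of_degree_def isogeny_def by blast+
  interpret A: comm_group A using A(1) unfolding abelian_variety_def by blast
  interpret A': comm_group A' using A(2) unfolding abelian_variety_def by blast
  interpret h: group_hom A A' \<phi> using hom by unfold_locales
  interpret V: irreducible_variety "carrier A" using abelian_variety_irreducible[OF A(1)] .
  have "cubic_morphism (carrier A) (carrier A') \<phi> base_field"
  proof -
    interpret W: irreducible_variety "carrier A'" using abelian_variety_irreducible[OF A(2)] .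
    show ?thesis
      using mor surj dim of_nat_neq_0_alg_closure[of 2, where ?'a = 'a]
        of_nat_neq_0_alg_closure[of 3, where ?'a = 'a] char
      by unfold_locales auto
  qed
  then interpret cubic_morphism "carrier A" "carrier A'" \<phi> base_field .
  have ker: "P \<in> kernel A A' \<phi> \<longleftrightarrow> P \<in> carrier A \<and> \<phi> P = \<one>\<^bsub>A'\<^esub>" for P by (simp add: kernel_def)
  have "3 \<le> card (kernel A A' \<phi>)"
  proof -
    obtain Q P1 P2 P3 where P: "P1 \<in> carrier A" "P2 \<in> carrier A" "P3 \<in> carrier A"
      "P1 \<noteq> P2" "P1 \<noteq> P3" "P2 \<noteq> P3" "\<phi> P1 = Q" "\<phi> P2 = Q" "\<phi> P3 = Q"
      using three_points_in_fibre[OF cubic_morphism_axioms] by (elim exE conjE)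
    let ?S = "(\<lambda>P. P \<otimes>\<^bsub>A\<^esub> inv\<^bsub>A\<^esub> P1) ` {P1, P2, P3}"
    have "inj_on (\<lambda>P. P \<otimes>\<^bsub>A\<^esub> inv\<^bsub>A\<^esub> P1) {P1, P2, P3}"
    proof (rule inj_onI)
      fix R R' assume "R \<in> {P1, P2, P3}" "R' \<in> {P1, P2, P3}"
      then have "R \<in> carrier A" "R' \<in> carrier A" using P(1-3) by auto
      moreover assume "R \<otimes>\<^bsub>A\<^esub> inv\<^bsub>A\<^esub> P1 = R' \<otimes>\<^bsub>A\<^esub> inv\<^bsub>A\<^esub> P1"
      ultimately show "R = R'" using P(1) A.r_cancel[of "inv\<^bsub>A\<^esub> P1" R R'] by simp
    qed
    then have "card ?S = card {P1, P2, P3}" by (rule card_image)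
    also have "\<dots> = 3" using P(4-6) by simp
    finally have "card ?S = 3" .
    moreover have "?S \<subseteq> kernel A A' \<phi>"
    proof
      fix R assume "R \<in> ?S"
      then obtain P where P': "P \<in> carrier A" "\<phi> P = Q" "R = P \<otimes>\<^bsub>A\<^esub> inv\<^bsub>A\<^esub> P1" using P by blast
      then show "R \<in> kernel A A' \<phi>" unfolding ker using P(1,7) h.hom_closed[OF P(1)] by auto
    qed
    ultimately show ?thesis using card_mono[OF fin] by metis
  qed
  moreover have "card (kernel A A' \<phi>) \<le> 3"
  proof -
    let ?T = "kernel A A' \<phi>"
    have kc: "g \<in> carrier A" if "g \<in> ?T" for g using that ker by blast
    have one: "\<one>\<^bsub>A\<^esub> \<in> carrier A" by simp
    have "\<exists>z. z \<noteq> 0 \<and> P = proj z" if "P \<in> carrier A" for P using V.point_rep[OF that] .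
    then have "\<forall>P\<in>carrier A. \<exists>z. z \<noteq> 0 \<and> P = proj z" by blast
    from bchoice[OF this] obtain rep where rep: "\<forall>P\<in>carrier A. rep P \<noteq> 0 \<and> P = proj (rep P)" by blast
    have "\<exists>l\<in>forms UNIV 1. \<exists>m\<in>forms UNIV 1. (\<forall>z\<in>rep ` ?T. m z \<noteq> 0) \<and>
      (\<forall>x\<in>rep ` ?T. \<forall>y\<in>rep ` ?T. x \<noteq> y \<longrightarrow> l x * m y - l y * m x \<noteq> 0)"
    proof (rule separating_ratio)
      show "finite (rep ` ?T)" using fin by simp
      show "0 \<notin> rep ` ?T" using rep kc by fastforce
      fix x y assume "x \<in> rep ` ?T" "y \<in> rep ` ?T" "x \<noteq> y"
      then show "proj x \<noteq> proj y" using rep kc by fastforce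
    qed
    then obtain l m where lm: "l \<in> forms UNIV 1" "m \<in> forms UNIV 1" "\<forall>z\<in>rep ` ?T. m z \<noteq> 0"
      "\<forall>x\<in>rep ` ?T. \<forall>y\<in>rep ` ?T. x \<noteq> y \<longrightarrow> l x * m y - l y * m x \<noteq> 0" by (elim bexE conjE)
    show ?thesis
    proof (rule deck_translations_bound[OF fin _ _ lm(1,2) one])
      fix g assume g: "g \<in> ?T"
      show "surjective_morphism (carrier A) (carrier A) (\<lambda>P. g \<otimes>\<^bsub>A\<^esub> P) UNIV"
        by (rule abelian_variety_translation[OF A(1) kc[OF g]])
      show "\<phi> (g \<otimes>\<^bsub>A\<^esub> P) = \<phi> P" if "P \<in> carrier A" for P using g that ker by auto
      show "\<exists>z. z \<noteq> 0 \<and> g \<otimes>\<^bsub>A\<^esub> \<one>\<^bsub>A\<^esub> = proj z \<and> m z \<noteq> 0"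
        using rep kc[OF g] lm(3) g by (intro exI[of _ "rep g"]) simp
    next
      fix g h z w assume g: "g \<in> ?T" "h \<in> ?T" "g \<noteq> h"
        and zw: "g \<otimes>\<^bsub>A\<^esub> \<one>\<^bsub>A\<^esub> = proj z" "h \<otimes>\<^bsub>A\<^esub> \<one>\<^bsub>A\<^esub> = proj w"
      have e: "proj (rep g) = proj z" "proj (rep h) = proj w" using zw kc g rep by auto
      then obtain c d where cd: "c \<noteq> 0" "z = c *s rep g" "d \<noteq> 0" "w = d *s rep h"
        using proj_eq_iff by meson
      have ne: "rep g \<noteq> rep h" using rep kc[OF g(1)] kc[OF g(2)] g(3) by metis
      have "l z * m w - l w * m z = c * d * (l (rep g) * m (rep h) - l (rep h) * m (rep g))"
        unfolding cd by (simp add: form_homogeneous[OF lm(1)] form_homogeneous[OF lm(2)] algebra_simps)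
      then show "l z * m w - l w * m z \<noteq> 0" using lm(4) g ne cd(1,3) by auto
    qed
  qed
  ultimately show ?thesis by simp
qed

theorem theorem4p2:
  fixes A :: "('a::field alg_closure, 'n::finite) point monoid"
    and A' :: "('a alg_closure, 'm::finite) point monoid"
    and \<phi> :: "('a alg_closure, 'n) point \<Rightarrow> ('a alg_closure, 'm) point"
    and M :: "('a alg_closure, 'n) point monoid"
    and Dhat :: 'a
  assumes "CHAR('a) \<noteq> 2" and "CHAR('a) \<noteq> 3"
    and "isogeny_of_degree 3 A A' \<phi>"
    and "M = kernel_group A A' \<phi>"
    and "Dhat \<noteq> 0" and "mirror_algebra M Dhat"
  shows "mu3_isos M Dhat \<noteq> {} \<and>
    (\<forall>\<iota> \<in> mu3_isos M Dhat.
      kummer_class \<iota> Dhat \<in> iso (H1 M gal_point) (norm_one_classes Dhat) \<and>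
      (\<forall>C \<in> carrier (norm_one_classes Dhat). \<exists>\<delta>\<in>C. quad_norm Dhat \<delta> = 1) \<and>
      (\<exists>\<Phi>. bij_betw \<Phi> (carrier (H1 M gal_point))
              (orbits SL2 {f. cubic_disc f = 4 * Dhat} cubic_act) \<and>
         (\<forall>C \<in> carrier (H1 M gal_point). \<forall>\<delta> \<in> kummer_class \<iota> Dhat C.
            quad_norm Dhat \<delta> = 1 \<longrightarrow> \<Phi> C = orbit SL2 cubic_act (trace_form Dhat \<delta>)))) \<and>
    (\<forall>f. cubic_disc f = 4 * Dhat \<longrightarrow>
      SL2\<lparr>carrier := stabilizer SL2 cubic_act f\<rparr> \<cong> gal_invariants M)"
proof -
  have A: "abelian_variety A" "abelian_variety A'" and hom: "\<phi> \<in> hom A A'"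
    using assms(3) unfolding isogeny_of_degree_def isogeny_def by simp_all
  interpret A: comm_group A using A(1) unfolding abelian_variety_def by simp
  interpret A': comm_group A' using A(2) unfolding abelian_variety_def by simp
  interpret h: group_hom A A' \<phi> using hom by unfold_locales
  have M: "M = A\<lparr>carrier := kernel A A' \<phi>\<rparr>" using assms(4) unfolding kernel_group_def .
  have "group M" unfolding M by (rule A.subgroup_imp_group[OF h.subgroup_kernel])
  then have "comm_group M"
    by (rule group.group_comm_groupI) (simp add: M kernel_def A.m_comm)
  moreover have "card (carrier M) = 3" unfolding M using card_isogeny_kernel[OF assms(1-3)] by simp
  moreover obtain D s where "quadratic_action_by M D" "s \<noteq> 0" "Dhat = - 3 * D * s\<^sup>2"
    using assms(6) unfolding mirror_algebra_def by blast
  ultimately have mm: "mirror_module M D s Dhat"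
    using assms(1,2) by (simp add: mirror_module_def mirror_module_axioms_def)
  interpret mirror_module M D s Dhat by (rule mm)
  have kummer: "kummer M D s Dhat \<iota>" if "\<iota> \<in> mu3_isos M Dhat" for \<iota>
    using mm that by (simp add: kummer_def kummer_axioms_def)
  \<comment> \<open>The statement on stabilizers does not mention an isomorphism; any one serves to
    prove it.\<close>
  obtain \<iota> where \<iota>: "\<iota> \<in> mu3_isos M Dhat" using mu3_isos_nonempty by blast
  show ?thesis
    using mu3_isos_nonempty kummer.kummer_iso[OF kummer] kummer.orbit_bijection[OF kummer]
      norm_one_representative kummer.stabilizer_iso[OF kummer[OF \<iota>]]
    by (intro conjI ballI allI impI)
qed

end
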